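(* Let $\sigma_v=\overline\sigma(x_v)$. Suppose that the perturbed piecewise smooth system $(x',y')^T=Z_\varepsilon(t,x,y)$ (described in the context) is $2\sigma_v$-periodic in the variable $t$, and assume that there exists $\theta^*\in\mathbb S^1_{\sigma_v}=\mathbb R/(2\sigma_v\mathbb Z)$ such that $M(\theta^*,x_v)=0$ and $\frac{\partial M}{\partial\theta}(\theta^*,x_v)\ne0$. (a) If $G_2^+(\theta^*,p_v)\ne G_2^-(\theta^*,p_v)$ and $$g_{\theta^*}>\frac{2F_2(q_v)}{F_1(p_v)\,\frac{\partial F_2}{\partial x}(p_v)}\max\{G_2^+(\theta^*,p_v),G_2^-(\theta^*,p_v)\},$$ then for every sufficiently small $\varepsilon>0$ there exists a sliding $2\sigma_v$-periodic solution of $(x',y')^T=Z_\varepsilon(t,x,y)$ with initial condition, in $\mathbb S^1_{\sigma_v}\times D$, $\varepsilon$-close to $(t_0,z_0)=(\theta^*,p_v)$. Moreover, this solution slides on $\Sigma^s$ if $G_2^+(\theta^*,p_v)<G_2^-(\theta^*,p_v)$, and on $\Sigma^e$ if $G_2^+(\theta^*,p_v)>G_2^-(\theta^*,p_v)$. (b) If $$g_{\theta^*}<\frac{2F_2(q_v)}{F_1(p_v)\,\frac{\partial F_2}{\partial x}(p_v)}\max\{G_2^+(\theta^*,p_v),G_2^-(\theta^*,p_v)\},$$ then for every sufficiently small $\varepsilon>0$ there exists a crossing $2\sigma_v$-periodic solution of $(x',y')^T=Z_\varepsilon(t,x,y)$ with initial condition, in $\mathbb S^1_{\sigma_v}\times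 D$, $\varepsilon$-close to $(t_0,z_0)=(\theta^*,p_v)$.
   Context: **Unperturbed system.** Let $R(x,y)=(x,-y)$, let $D\subset\mathbb R^2$ be open, bounded and $R$-invariant, and let $F=(F_1,F_2)^T:D\to\mathbb R^2$ be $C^2$. Put $F^-(x,y)=F(x,y)$ and $F^+(x,y)=-RF(R(x,y))$, $\Sigma=\{y=0\}$. The unperturbed ($R$-reversible) system is $Z_0=F^+$ for $y>0$ and $Z_0=F^-$ for $y<0$. Let $\Gamma^\pm(t,z)$ be the solution of $(x',y')^T=F^\pm(x,y)$ with $\Gamma^\pm(0,z)=z$. Write $\Gamma=\Gamma^-=(\Gamma_1,\Gamma_2)^T$ and $Y(t,z)=D_z\Gamma^-(t,z)$ (a $2\times2$ matrix, the fundamental solution of the variational equation with $Y(0,z)=I_2$). **Standing hypotheses.** (h1) There are $x_i<x_v$ such that, with $p_i=(x_i,0)$, $p_v=(x_v,0)\in\Sigma$: $F_2(p_v)=F_2(p_i)=0$, $\frac{\partial F_2}{\partial x}(p_v)F_1(p_v)<0$, $\frac{\partial F_2}{\partial x}(p_i)F_1(p_i)>0$, and $F_2(x,0)\ne0$ for $x_i<x<x_v$. (h2) For each $x_i<x\le x_v$ the solution $\Gamma^-(t,x,0)$ enters $y<0$ and reaches $\Sigma$ transversely for the first positive time at $t=\overline\sigma(x)>0$, i.e. $\Gamma^-_2(\overline\sigma(x),x,0)=0$ and $F_2(\Gamma^-(\overline\sigma(x),x,0))\ne0$. For $0\le t\le\overline\sigma(x)$ put $\gamma(t,x)=\Gamma^-(t,x,0)$,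 and for $-\overline\sigma(x)\le t\le 0$ put $\gamma(t,x)=R\Gamma^-(-t,x,0)$; this is a $2\overline\sigma(x)$-periodic solution of $Z_0$. Put $\sigma_v=\overline\sigma(x_v)$ and $q_v=\Gamma^-(\sigma_v,p_v)\in\Sigma$. **Perturbed system.** $Z_\varepsilon(t,x,y)=X^+_\varepsilon(t,x,y)$ for $y>0$ and $X^-_\varepsilon(t,x,y)$ for $y<0$, where $$X^\pm_\varepsilon(t,x,y)=F^\pm(x,y)+\varepsilon G^\pm(t,x,y)+\varepsilon^2H^\pm(t,x,y;\varepsilon),$$ $G^\pm=(G_1^\pm,G_2^\pm)^T$ and $H^\pm$ are smooth on $\mathbb R\times D$ and $\mathbb R\times D\times(-\varepsilon_0,\varepsilon_0)$ respectively, and are $2\sigma_v$-periodic in $t$. **Melnikov function and the number $g_\theta$.** Put $\{G^-,G^+\}_\theta(t,z)=G^-(t+\theta,z)+RG^+(-t+\theta,Rz)$ and $(a_1,a_2)\wedge(b_1,b_2)=-a_2b_1+a_1b_2$. For $\theta\in\mathbb S^1_{\sigma_v}$, $x\in(x_i,x_v]$ define $$M(\theta,x)=F(\gamma(\overline\sigma(x),x))\wedge\left(Y(\overline\sigma(x),x,0)\int_0^{\overline\sigma(x)}Y(t,x,0)^{-1}\{G^-,G^+\}_\theta(t,\gamma(t,x))\,dt\right),$$ and $$g_\theta=\Big\langle D_z\Gamma_2(\sigma_v,p_v),\int_0^{\sigma_v}Y(t,p_v)^{-1}\Big(G^-(t+\theta,\Gamma(t,p_v))-RG^+(-t+\theta,R\Gamma(t,p_v))\Big)dt\Big\rangle,$$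 where $\langle\cdot,\cdot\rangle$ is the scalar product of the row $D_z\Gamma_2$ (gradient of $\Gamma_2$ in the initial condition) with the column vector. **Terminology.** Solutions are understood in Filippov's sense, in the extended phase space $\mathbb S^1_{\sigma_v}\times D$ with $\theta'=1$, $(x',y')^T=Z_\varepsilon(\theta,x,y)$ and switching manifold $\mathbb S^1_{\sigma_v}\times\Sigma$. Let $X^\pm_{\varepsilon,1},X^\pm_{\varepsilon,2}$ be the components of $X^\pm_\varepsilon$. At a point $(\theta,x,0)$ of the switching manifold: it is a crossing point if $X^+_{\varepsilon,2}X^-_{\varepsilon,2}>0$; it is in the sliding region $\Sigma^s$ if $X^+_{\varepsilon,2}<0<X^-_{\varepsilon,2}$; it is in the escaping region $\Sigma^e$ if $X^-_{\varepsilon,2}<0<X^+_{\varepsilon,2}$. On $\Sigma^s\cup\Sigma^e$ trajectories may follow the sliding vector field $\theta'=1$, $x'=\dfrac{X^-_{\varepsilon,2}X^+_{\varepsilon,1}-X^+_{\varepsilon,2}X^-_{\varepsilon,1}}{X^-_{\varepsilon,2}-X^+_{\varepsilon,2}}$. A crossing periodic solution meets the switching manifold only at crossing points; a sliding periodic solution is a periodic solution (in Filippov's sense) containing a nontrivial arc in $\Sigma^s$ or in $\Sigma^e$ that follows the sliding vector field (it "slides on" that region). "$\varepsilon$-close" means at distance $O(\varepsilon)$ as $\varepsilon\to0^+$. *)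

theory Defs
  imports "HOL-Analysis.Analysis"
begin

text \<open>The plane is \<^typ>\<open>real^2\<close>. The switching manifold is \<open>{z. z $ 2 = 0}\<close>, and its points
  are written \<open>on_axis x\<close>. Time is a real number; the circle \<open>\<real> / (2 \<sigma>\<^sub>v \<int>)\<close> is rendered by
  representatives, every time-dependent datum being \<open>2 \<sigma>\<^sub>v\<close>-periodic.\<close>

definition on_axis :: "real \<Rightarrow> real^2" where
  "on_axis x = vector [x, 0]"

definition reflect :: "real^2 \<Rightarrow> real^2" where
  "reflect z = vector [z $ 1, - (z $ 2)]"

definition wedge :: "real^2 \<Rightarrow> real^2 \<Rightarrow> real" where
  "wedge a b = - (a $ 2) * (b $ 1) + (a $ 1) * (b $ 2)"


text \<open>On an open set \<open>S\<close>, being \<open>C\<^sup>k\<close> is expressed by iterated directional derivatives: \<open>f\<close> is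
  \<open>C\<^sup>k\<^sup>+\<^sup>1\<close> iff it is differentiable and all its directional derivatives are \<open>C\<^sup>k\<close>. For maps
  between Euclidean spaces this is the usual notion.\<close>

primrec Ck_on :: "nat \<Rightarrow> 'a::euclidean_space set \<Rightarrow> ('a \<Rightarrow> 'b::euclidean_space) \<Rightarrow> bool" where
  "Ck_on 0 S f \<longleftrightarrow> continuous_on S f"
| "Ck_on (Suc k) S f \<longleftrightarrow> (\<forall>z\<in>S. f differentiable (at z)) \<and>
     (\<forall>v. Ck_on k S (\<lambda>z. frechet_derivative f (at z) v))"

definition smooth_on :: "'a::euclidean_space set \<Rightarrow> ('a \<Rightarrow> 'b::euclidean_space) \<Rightarrow> bool" where
  "smooth_on S f \<longleftrightarrow> (\<forall>k. Ck_on k S f)"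


definition ode_solution ::
  "(real^2 \<Rightarrow> real^2) \<Rightarrow> (real^2) set \<Rightarrow> real set \<Rightarrow> (real \<Rightarrow> real^2) \<Rightarrow> bool" where
  "ode_solution F D T u \<longleftrightarrow>
     (\<forall>t\<in>T. u t \<in> D \<and> (u has_vector_derivative F (u t)) (at t within T))"

definition flow_exists :: "(real^2 \<Rightarrow> real^2) \<Rightarrow> (real^2) set \<Rightarrow> real \<Rightarrow> real^2 \<Rightarrow> bool" where
  "flow_exists F D t z \<longleftrightarrow> (\<exists>u. ode_solution F D (closed_segment 0 t) u \<and> u 0 = z)"

text \<open>The solution \<open>\<Gamma>(t, z)\<close> of \<open>z' = F z\<close> in \<open>D\<close> with \<open>\<Gamma>(0, z) = z\<close>. For \<open>F\<close> of class \<open>C\<^sup>2\<close> on the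
  open set \<open>D\<close> the solution is unique, so the description is proper as soon as
  \<open>flow_exists F D t z\<close> holds.\<close>

definition flow :: "(real^2 \<Rightarrow> real^2) \<Rightarrow> (real^2) set \<Rightarrow> real \<Rightarrow> real^2 \<Rightarrow> real^2" where
  "flow F D t z = (THE w. \<exists>u. ode_solution F D (closed_segment 0 t) u \<and> u 0 = z \<and> u t = w)"

definition flow_deriv :: "(real^2 \<Rightarrow> real^2) \<Rightarrow> (real^2) set \<Rightarrow> real \<Rightarrow> real^2 \<Rightarrow> real^2^2" where
  "flow_deriv F D t z = matrix (frechet_derivative (\<lambda>w. flow F D t w) (at z))"


text \<open>The vector field given is the lower one, \<open>F\<^sup>- = F\<close>; the upper one is its reversed image.\<close>

definition upper_field :: "(real^2 \<Rightarrow> real^2) \<Rightarrow> real^2 \<Rightarrow> real^2" where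
  "upper_field F z = - reflect (F (reflect z))"

definition dF2_dx :: "(real^2 \<Rightarrow> real^2) \<Rightarrow> real^2 \<Rightarrow> real" where
  "dF2_dx F p = deriv (\<lambda>s. F (vector [s, p $ 2]) $ 2) (p $ 1)"

text \<open>For the lower field, the tangency at \<open>x\<^sub>v\<close> is visible and the one at \<open>x\<^sub>i\<close> is invisible.
  Membership in \<open>D\<close>, the domain of \<open>F\<close>, is made explicit because \<open>F\<close> is a total function here.\<close>

definition fold_hyp :: "(real^2 \<Rightarrow> real^2) \<Rightarrow> (real^2) set \<Rightarrow> real \<Rightarrow> real \<Rightarrow> bool" where
  "fold_hyp F D xi xv \<longleftrightarrow>
     xi < xv \<and>
     (\<forall>x\<in>{xi..xv}. on_axis x \<in> D) \<and>
     F (on_axis xv) $ 2 = 0 \<and> F (on_axis xi) $ 2 = 0 \<and>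
     dF2_dx F (on_axis xv) * F (on_axis xv) $ 1 < 0 \<and>
     dF2_dx F (on_axis xi) * F (on_axis xi) $ 1 > 0 \<and>
     (\<forall>x\<in>{xi<..<xv}. F (on_axis x) $ 2 \<noteq> 0)"

text \<open>\<open>\<sigma> x\<close> is the first positive time at which the orbit of \<open>(x, 0)\<close> meets the switching manifold;
  on \<open>{xi<..xv}\<close> this determines the function \<open>\<sigma>\<close>.\<close>

definition return_hyp ::
  "(real^2 \<Rightarrow> real^2) \<Rightarrow> (real^2) set \<Rightarrow> real \<Rightarrow> real \<Rightarrow> (real \<Rightarrow> real) \<Rightarrow> bool" where
  "return_hyp F D xi xv \<sigma> \<longleftrightarrow>
     (\<forall>x\<in>{xi<..xv}.
        \<sigma> x > 0 \<and>
        flow_exists F D (\<sigma> x) (on_axis x) \<and>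
        (\<forall>t\<in>{0<..<\<sigma> x}. flow F D t (on_axis x) $ 2 < 0) \<and>
        flow F D (\<sigma> x) (on_axis x) $ 2 = 0 \<and>
        F (flow F D (\<sigma> x) (on_axis x)) $ 2 \<noteq> 0)"

definition periodic_orbit :: "(real^2 \<Rightarrow> real^2) \<Rightarrow> (real^2) set \<Rightarrow> real \<Rightarrow> real \<Rightarrow> real^2" where
  "periodic_orbit F D t x =
     (if 0 \<le> t then flow F D t (on_axis x) else reflect (flow F D (- t) (on_axis x)))"


definition perturbed_field ::
  "(real^2 \<Rightarrow> real^2) \<Rightarrow> (real \<Rightarrow> real^2 \<Rightarrow> real^2) \<Rightarrow> (real \<Rightarrow> real^2 \<Rightarrow> real \<Rightarrow> real^2) \<Rightarrow>
     real \<Rightarrow> real \<Rightarrow> real^2 \<Rightarrow> real^2" where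
  "perturbed_field F G H \<epsilon> t z = F z + \<epsilon> *\<^sub>R G t z + \<epsilon>\<^sup>2 *\<^sub>R H t z \<epsilon>"

definition bracket ::
  "(real \<Rightarrow> real^2 \<Rightarrow> real^2) \<Rightarrow> (real \<Rightarrow> real^2 \<Rightarrow> real^2) \<Rightarrow> real \<Rightarrow> real \<Rightarrow> real^2 \<Rightarrow> real^2" where
  "bracket Gm Gp \<theta> t z = Gm (t + \<theta>) z + reflect (Gp (- t + \<theta>) (reflect z))"

definition melnikov ::
  "(real^2 \<Rightarrow> real^2) \<Rightarrow> (real^2) set \<Rightarrow> (real \<Rightarrow> real) \<Rightarrow>
     (real \<Rightarrow> real^2 \<Rightarrow> real^2) \<Rightarrow> (real \<Rightarrow> real^2 \<Rightarrow> real^2) \<Rightarrow> real \<Rightarrow> real \<Rightarrow> real" where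
  "melnikov F D \<sigma> Gm Gp \<theta> x =
     wedge (F (periodic_orbit F D (\<sigma> x) x))
       (flow_deriv F D (\<sigma> x) (on_axis x) *v
          integral {0..\<sigma> x}
            (\<lambda>t. matrix_inv (flow_deriv F D t (on_axis x)) *v
                   bracket Gm Gp \<theta> t (periodic_orbit F D t x)))"

text \<open>The gradient of \<open>\<Gamma>\<^sub>2(\<sigma>\<^sub>v, \<cdot>)\<close> at \<open>p\<^sub>v\<close> is the second row of the derivative matrix of
  \<open>\<Gamma>(\<sigma>\<^sub>v, \<cdot>)\<close>.\<close>

definition g_number ::
  "(real^2 \<Rightarrow> real^2) \<Rightarrow> (real^2) set \<Rightarrow> (real \<Rightarrow> real) \<Rightarrow> real \<Rightarrow>
     (real \<Rightarrow> real^2 \<Rightarrow> real^2) \<Rightarrow> (real \<Rightarrow> real^2 \<Rightarrow> real^2) \<Rightarrow> real \<Rightarrow> real" where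
  "g_number F D \<sigma> xv Gm Gp \<theta> =
     row 2 (flow_deriv F D (\<sigma> xv) (on_axis xv)) \<bullet>
       integral {0..\<sigma> xv}
         (\<lambda>t. matrix_inv (flow_deriv F D t (on_axis xv)) *v
                (Gm (t + \<theta>) (flow F D t (on_axis xv))
                 - reflect (Gp (- t + \<theta>) (reflect (flow F D t (on_axis xv))))))"


text \<open>In what follows \<open>Xp\<close> and \<open>Xm\<close> are the time-dependent fields in \<open>y > 0\<close> and \<open>y < 0\<close>. Both are
  continuous up to the switching manifold, so Filippov's convexification at a switching
  point is the segment between the two one-sided values.\<close>

definition filippov_set ::
  "(real \<Rightarrow> real^2 \<Rightarrow> real^2) \<Rightarrow> (real \<Rightarrow> real^2 \<Rightarrow> real^2) \<Rightarrow> real \<Rightarrow> real^2 \<Rightarrow> (real^2) set" where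
  "filippov_set Xp Xm t z =
     (if z $ 2 > 0 then {Xp t z}
      else if z $ 2 < 0 then {Xm t z}
      else closed_segment (Xm t z) (Xp t z))"

text \<open>A Filippov solution is a locally absolutely continuous curve whose derivative lies almost
  everywhere in the Filippov set. Absolute continuity is expressed by \<open>u\<close> being an
  indefinite integral of a locally absolutely integrable \<open>v\<close>, which is then \<open>u'\<close> almost
  everywhere. The extended-phase-space solution with \<open>\<theta>' = 1\<close> is \<open>t \<mapsto> (t, u t)\<close>.\<close>

definition filippov_solution ::
  "(real^2) set \<Rightarrow> (real \<Rightarrow> real^2 \<Rightarrow> real^2) \<Rightarrow> (real \<Rightarrow> real^2 \<Rightarrow> real^2) \<Rightarrow> (real \<Rightarrow> real^2) \<Rightarrow> bool" where
  "filippov_solution D Xp Xm u \<longleftrightarrow>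
     (\<forall>t. u t \<in> D) \<and>
     (\<exists>v. (\<forall>a b. a \<le> b \<longrightarrow>
              v absolutely_integrable_on {a..b} \<and> (v has_integral (u b - u a)) {a..b}) \<and>
          (AE t in lebesgue. v t \<in> filippov_set Xp Xm t (u t)))"

definition crossing_point ::
  "(real \<Rightarrow> real^2 \<Rightarrow> real^2) \<Rightarrow> (real \<Rightarrow> real^2 \<Rightarrow> real^2) \<Rightarrow> real \<Rightarrow> real^2 \<Rightarrow> bool" where
  "crossing_point Xp Xm t z \<longleftrightarrow> z $ 2 = 0 \<and> Xp t z $ 2 * Xm t z $ 2 > 0"

definition sliding_region ::
  "(real \<Rightarrow> real^2 \<Rightarrow> real^2) \<Rightarrow> (real \<Rightarrow> real^2 \<Rightarrow> real^2) \<Rightarrow> (real \<times> (real^2)) set" where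
  "sliding_region Xp Xm = {(t, z). z $ 2 = 0 \<and> Xp t z $ 2 < 0 \<and> 0 < Xm t z $ 2}"

definition escaping_region ::
  "(real \<Rightarrow> real^2 \<Rightarrow> real^2) \<Rightarrow> (real \<Rightarrow> real^2 \<Rightarrow> real^2) \<Rightarrow> (real \<times> (real^2)) set" where
  "escaping_region Xp Xm = {(t, z). z $ 2 = 0 \<and> Xm t z $ 2 < 0 \<and> 0 < Xp t z $ 2}"

definition sliding_field ::
  "(real \<Rightarrow> real^2 \<Rightarrow> real^2) \<Rightarrow> (real \<Rightarrow> real^2 \<Rightarrow> real^2) \<Rightarrow> real \<Rightarrow> real^2 \<Rightarrow> real^2" where
  "sliding_field Xp Xm t z =
     on_axis ((Xm t z $ 2 * Xp t z $ 1 - Xp t z $ 2 * Xm t z $ 1) / (Xm t z $ 2 - Xp t z $ 2))"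

definition slides_on ::
  "(real \<Rightarrow> real^2 \<Rightarrow> real^2) \<Rightarrow> (real \<Rightarrow> real^2 \<Rightarrow> real^2) \<Rightarrow> (real \<times> (real^2)) set \<Rightarrow>
     (real \<Rightarrow> real^2) \<Rightarrow> bool" where
  "slides_on Xp Xm S u \<longleftrightarrow>
     (\<exists>a b. a < b \<and>
        (\<forall>t\<in>{a..b}. (t, u t) \<in> S \<and>
           (u has_vector_derivative sliding_field Xp Xm t (u t)) (at t within {a..b})))"

definition periodic_solution ::
  "(real^2) set \<Rightarrow> (real \<Rightarrow> real^2 \<Rightarrow> real^2) \<Rightarrow> (real \<Rightarrow> real^2 \<Rightarrow> real^2) \<Rightarrow> real \<Rightarrow>
     (real \<Rightarrow> real^2) \<Rightarrow> bool" where
  "periodic_solution D Xp Xm T u \<longleftrightarrow>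
     filippov_solution D Xp Xm u \<and> (\<forall>t. u (t + T) = u t)"

definition sliding_periodic_solution ::
  "(real^2) set \<Rightarrow> (real \<Rightarrow> real^2 \<Rightarrow> real^2) \<Rightarrow> (real \<Rightarrow> real^2 \<Rightarrow> real^2) \<Rightarrow> real \<Rightarrow>
     (real \<Rightarrow> real^2) \<Rightarrow> bool" where
  "sliding_periodic_solution D Xp Xm T u \<longleftrightarrow>
     periodic_solution D Xp Xm T u \<and>
     (slides_on Xp Xm (sliding_region Xp Xm) u \<or> slides_on Xp Xm (escaping_region Xp Xm) u)"

text \<open>The first condition on the zeros of \<open>u t $ 2\<close> excludes orbits that stay in one half-plane.\<close>

definition crossing_periodic_solution ::
  "(real^2) set \<Rightarrow> (real \<Rightarrow> real^2 \<Rightarrow> real^2) \<Rightarrow> (real \<Rightarrow> real^2 \<Rightarrow> real^2) \<Rightarrow> real \<Rightarrow>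
     (real \<Rightarrow> real^2) \<Rightarrow> bool" where
  "crossing_periodic_solution D Xp Xm T u \<longleftrightarrow>
     periodic_solution D Xp Xm T u \<and>
     (\<exists>t. u t $ 2 = 0) \<and>
     (\<forall>t. u t $ 2 = 0 \<longrightarrow> crossing_point Xp Xm t (u t))"

end

theory Submission
  imports Defs
begin

text \<open>
  Reflecting the upper half-plane and reversing time there turns the problem into one about two perturbations
  of the same lower field \<open>F\<close>, both with orbits leaving the switching manifold near the visible
  fold \<open>p\<^sub>v\<close>: one departs into the lower half-plane at a time \<open>t\<close>, the other
  is the arrival from the upper half-plane at time \<open>t - \<epsilon> r\<close>, followed backwards. A
  periodic orbit is obtained when the two meet on the switching manifold near \<open>q\<^sub>v\<close>. To
  first order in \<open>\<epsilon>\<close>, with start points \<open>x\<^sub>v + \<epsilon>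
  \<xi>\<^sub>0\<close>, \<open>x\<^sub>v + \<epsilon> \<xi>\<^sub>1\<close> and a stay of length
  \<open>\<epsilon> r\<close> on the switching manifold, variation of constants reduces meeting to two scalar
  equations: \<open>M(t, x\<^sub>v) = O(\<epsilon>)\<close> and \<open>g\<^sub>\<theta> = (\<beta> / \<alpha>)
  (\<xi>\<^sub>0 + \<xi>\<^sub>1) + \<beta> r\<close>, where \<open>\<alpha> = - F\<^sub>1(p\<^sub>v)\<close>
  and \<open>\<beta> = F\<^sub>2(q\<^sub>v)\<close>. The fold of the lower (upper) perturbed field lies at
  \<open>\<xi> = - G\<^sub>2\<^sup>- / b\<close> (at \<open>- G\<^sub>2\<^sup>+ / b\<close>), \<open>b =
  \<partial>F\<^sub>2/\<partial>x (p\<^sub>v)\<close>.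

  A crossing orbit has \<open>\<xi>\<^sub>0 = \<xi>\<^sub>1\<close> and \<open>r = 0\<close>; both fields
  point downwards there iff \<open>\<xi>\<^sub>0\<close> lies to the left of both folds, which is the
  inequality of (b). A sliding orbit departs from the fold of the lower field, and
  \<open>\<xi>\<^sub>1\<close> is found by following the sliding field backwards for the scaled time
  \<open>r\<close>. The second equation then crosses zero for some \<open>r > 0\<close> under the inequality
  of (a). In each case the unknowns are the start time and one real parameter, and the Poincare-Miranda
  theorem solves the equations. The escaping case is the sliding case for the time-reversed system.
\<close>

section \<open>Ordinary differential equations\<close>

text \<open>The tangency at the fold decouples the equations. There \<open>F\<close> is horizontal,
  and \<open>F\<close> along \<open>\<gamma>\<close> solves the variational equation, so shifting
  the start along the axis moves the arrival to first order by a multiple of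
  \<open>F (\<gamma> \<sigma>)\<close>; changing the arrival time does the same. Hence
  \<open>wedge\<close> with \<open>F (\<gamma> \<sigma>)\<close> removes the offsets, the meeting
  time and the length of the slide, and leaves a function of the start time alone. The second
  components supply the rest: their difference fixes the meeting time \<open>\<tau>\<close>, a third
  unknown, and their sum is the equation with \<open>g_\<theta>\<close>.

  The obstacle is the slide. The two folds are only O(\<epsilon>) apart, numerator and denominator
  of the sliding field are both of order \<epsilon>, and the backward slide starts on the boundary
  of the sliding region. The arc is therefore never expanded in \<epsilon>: its continuity in the
  data and one-sided bounds on its position are enough for sign changes on the faces of a box. This
  is why an intermediate value argument stands where an implicit function theorem might be
  expected.\<close>

lemma gronwall:
  fixes e :: "real \<Rightarrow> 'a::euclidean_space"
  assumes T: "0 \<le> T" and L: "0 \<le> L" and c: "0 \<le> c"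
    and der: "\<And>t. t \<in> {0..T} \<Longrightarrow> (e has_vector_derivative e' t) (at t within {0..T})"
    and bnd: "\<And>t. t \<in> {0..T} \<Longrightarrow> norm (e' t) \<le> L * norm (e t) + c"
    and t: "t \<in> {0..T}"
  shows "norm (e t) \<le> (norm (e 0) + c * T) * exp (L * T)"
proof -
  have cont: "continuous_on {0..T} e"
    by (rule continuous_on_vector_derivative) (rule der)
  define m where "m s = L * norm (e s) + c" for s
  have contm: "continuous_on {0..T} m"
    unfolding m_def by (intro continuous_intros cont)
  \<comment> \<open>\<open>norm (e s)\<close> need not be differentiable where \<open>e\<close>
    vanishes; the argument runs on this differentiable majorant instead.\<close>
  define Q where "Q s = norm (e 0) + integral {0..s} m" for s
  have Q': "(Q has_vector_derivative m s) (at s within {0..T})" if "s \<in> {0..T}" for s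
    unfolding Q_def
    using integral_has_vector_derivative[OF contm that] by (auto intro!: derivative_eq_intros)
  have eQ: "norm (e s) \<le> Q s" if s: "s \<in> {0..T}" for s
  proof -
    have "(e' has_integral (e s - e 0)) {0..s}"
      using s by (intro fundamental_theorem_of_calculus)
        (auto intro: has_vector_derivative_within_subset[OF der])
    moreover have "m integrable_on {0..s}"
      using s by (intro integrable_continuous_real continuous_on_subset[OF contm]) auto
    ultimately have "norm (e s - e 0) \<le> integral {0..s} m"
      using integral_norm_bound_integral[of e' "{0..s}" m] bnd s
      by (auto simp: has_integral_iff m_def)
    then show ?thesis unfolding Q_def using norm_triangle_sub[of "e s" "e 0"] by linarith
  qed
  \<comment> \<open>The term \<open>- c * s\<close> absorbs the inhomogeneity:
    \<open>exp (- L * s) * c\<close> is at most \<open>c\<close>, so \<open>R\<close> is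
    nonincreasing.\<close>
  define R where "R s = exp (- L * s) * Q s - c * s" for s
  have R': "(R has_real_derivative (exp (- L * s) * m s - L * exp (- L * s) * Q s - c))
      (at s within {0..T})" if "s \<in> {0..T}" for s
  proof -
    have "(Q has_real_derivative m s) (at s within {0..T})"
      using Q'[OF that] by (simp add: has_real_derivative_iff_has_vector_derivative)
    then show ?thesis unfolding R_def by (auto intro!: derivative_eq_intros)
  qed
  have "R t \<le> R 0"
  proof (rule DERIV_nonpos_imp_decreasing_open[of 0 t R])
    show "0 \<le> t" using t by simp
    show "continuous_on {0..t} R"
      by (rule continuous_on_subset[of "{0..T}"], rule continuous_on_vector_derivative)
        (use R' t in \<open>auto simp: has_real_derivative_iff_has_vector_derivative\<close>)
    fix s assume s: "0 < s" "s < t"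
    have "(R has_real_derivative (exp (- L * s) * m s - L * exp (- L * s) * Q s - c)) (at s)"
      using R'[of s] s t by (simp add: at_within_Icc_at)
    moreover have "exp (- L * s) * m s - L * exp (- L * s) * Q s - c
        = exp (- L * s) * L * (norm (e s) - Q s) + c * (exp (- L * s) - 1)"
      by (simp add: m_def algebra_simps)
    moreover have "exp (- L * s) * L * (norm (e s) - Q s) \<le> 0"
      using eQ[of s] s t L by (intro mult_nonneg_nonpos) auto
    moreover have "c * (exp (- L * s) - 1) \<le> 0"
      using c L s by (intro mult_nonneg_nonpos) auto
    ultimately show "\<exists>y. (R has_real_derivative y) (at s) \<and> y \<le> 0" by fastforce
  qed
  then have "exp (- L * t) * Q t \<le> norm (e 0) + c * t" by (simp add: R_def Q_def)
  then have "exp (L * t) * (exp (- L * t) * Q t) \<le> exp (L * t) * (norm (e 0) + c * t)"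
    by (intro mult_left_mono) auto
  then have "Q t \<le> exp (L * t) * (norm (e 0) + c * t)"
    by (simp add: mult.assoc[symmetric] exp_minus_inverse exp_minus)
  also have "\<dots> \<le> exp (L * T) * (norm (e 0) + c * T)"
    using t L c by (intro mult_mono add_mono mult_left_mono) (auto intro!: add_nonneg_nonneg mult_left_mono)
  finally show ?thesis using eQ[OF t] by (simp add: mult.commute)
qed

text \<open>The weight \<open>exp (- 2 L t)\<close> makes the Picard operator a contraction on the whole interval,
  so no gluing of local solutions is needed.\<close>

lemma global_lipschitz_ode_exists:
  fixes f :: "real \<Rightarrow> 'a::euclidean_space \<Rightarrow> 'a"
  assumes T: "0 \<le> T"
    and cont: "continuous_on ({0..T} \<times> UNIV) (\<lambda>(t, x). f t x)"
    and lip: "\<And>t x y. t \<in> {0..T} \<Longrightarrow> norm (f t x - f t y) \<le> L * norm (x - y)"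
  shows "\<exists>u. u 0 = z \<and> (\<forall>t\<in>{0..T}. (u has_vector_derivative f t (u t)) (at t within {0..T}))"
proof -
  define M where "M = max 1 \<bar>L\<bar>"
  have M: "M > 0" and LM: "L \<le> M" by (auto simp: M_def)
  \<comment> \<open>Bounded continuous functions live on the whole line; composing with the clamp
    extends functions on \<open>{0..T}\<close> to it without enlarging their range.\<close>
  define cl where "cl t = max 0 (min T t)" for t
  have cl: "cl t \<in> {0..T}" and clid: "t \<in> {0..T} \<Longrightarrow> cl t = t" for t
    using T by (auto simp: cl_def)
  have ccl: "continuous_on UNIV cl" unfolding cl_def by (intro continuous_intros)
  have contf: "continuous_on {0..T} (\<lambda>s. f s (g s))" if "continuous_on {0..T} g" for g
    by (rule continuous_on_compose2[OF cont, of "{0..T}" "\<lambda>s. (s, g s)", simplified])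
      (use that in \<open>auto intro!: continuous_intros\<close>)
  \<comment> \<open>The unknown is the weighted curve
    \<open>exp (- 2 * M * t) *\<^sub>R u t\<close>: moving the weight into the function lets the
    plain sup metric do the work of the weighted norm.\<close>
  define I where "I v s = f s (exp (2 * M * s) *\<^sub>R apply_bcontfun v s)" for v :: "real \<Rightarrow>\<^sub>C 'a" and s
  have Icont: "continuous_on {0..T} (I v)" for v
    unfolding I_def by (intro contf continuous_intros continuous_on_apply_bcontfun)
  define P where "P v t = exp (- 2 * M * cl t) *\<^sub>R (z + integral {0..cl t} (I v))" for v t
  have PB: "P v \<in> bcontfun" for v
  proof -
    define h where "h t = exp (- 2 * M * t) *\<^sub>R (z + integral {0..t} (I v))" for t
    have h: "continuous_on {0..T} h"
      unfolding h_def
      by (intro continuous_intros indefinite_integral_continuous_1 integrable_continuous_real Icont)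
    have eq: "P v = h \<circ> cl" by (auto simp: P_def h_def)
    have "continuous_on UNIV (P v)"
      unfolding eq by (rule continuous_on_compose[OF ccl]) (rule continuous_on_subset[OF h], use cl in auto)
    moreover have "bounded (range (P v))"
      by (rule bounded_subset[of "h ` {0..T}"])
        (use cl eq compact_continuous_image[OF h] in \<open>auto intro: compact_imp_bounded\<close>)
    ultimately show ?thesis by (simp add: bcontfun_def)
  qed
  define \<Phi> where "\<Phi> v = Bcontfun (P v)" for v
  have \<Phi>: "apply_bcontfun (\<Phi> v) = P v" for v
    unfolding \<Phi>_def using Bcontfun_inverse[OF PB] .
  have contr: "dist (\<Phi> v) (\<Phi> w) \<le> (1/2) * dist v w" for v w
  proof (rule dist_bound)
    fix t
    define s where "s = cl t"
    have s: "s \<in> {0..T}" unfolding s_def by (rule cl)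
    have intI: "I v integrable_on {0..s}" for v
      by (rule integrable_continuous_real, rule continuous_on_subset[OF Icont]) (use s in auto)
    have bI: "norm (I v r - I w r) \<le> dist v w * (M * exp (2 * M * r))" if r: "r \<in> {0..s}" for r
    proof -
      have "norm (I v r - I w r) \<le> L * norm (exp (2 * M * r) *\<^sub>R v r - exp (2 * M * r) *\<^sub>R w r)"
        unfolding I_def by (rule lip) (use r s in auto)
      also have "\<dots> = L * (exp (2 * M * r) * dist (v r) (w r))"
        by (simp add: scaleR_diff_right[symmetric] dist_norm)
      also have "\<dots> \<le> M * (exp (2 * M * r) * dist v w)"
        using LM M dist_bounded[of v r w] by (intro mult_mono) auto
      finally show ?thesis by (simp add: algebra_simps)
    qed
    \<comment> \<open>The exponent \<open>2 * M\<close> against the Lipschitz constant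
      \<open>M\<close> produces the contraction factor one half.\<close>
    have ie: "((\<lambda>r. M * exp (2 * M * r)) has_integral (exp (2 * M * s) / 2 - exp (2 * M * 0) / 2)) {0..s}"
      by (rule fundamental_theorem_of_calculus)
        (use s in \<open>auto intro!: derivative_eq_intros simp: has_real_derivative_iff_has_vector_derivative[symmetric]\<close>)
    have "norm (integral {0..s} (I v) - integral {0..s} (I w)) = norm (integral {0..s} (\<lambda>r. I v r - I w r))"
      by (simp add: integral_diff[OF intI intI])
    also have "\<dots> \<le> integral {0..s} (\<lambda>r. dist v w * (M * exp (2 * M * r)))"
      by (rule integral_norm_bound_integral)
        (use bI intI in \<open>auto intro!: integrable_diff integrable_continuous_real[of _ _ "\<lambda>r. dist v w * _ r"] continuous_intros\<close>)
    also have "\<dots> = dist v w * (exp (2 * M * s) / 2 - 1 / 2)"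
      using integral_unique[OF ie] by simp
    also have "\<dots> \<le> dist v w * (exp (2 * M * s) / 2)"
      by (intro mult_left_mono) auto
    finally have A: "norm (integral {0..s} (I v) - integral {0..s} (I w)) \<le> dist v w * (exp (2 * M * s) / 2)" .
    have "dist (\<Phi> v t) (\<Phi> w t) = exp (- 2 * M * s) * norm (integral {0..s} (I v) - integral {0..s} (I w))"
      unfolding \<Phi> P_def s_def[symmetric] dist_norm
      by (simp add: scaleR_diff_right[symmetric])
    also have "\<dots> \<le> exp (- 2 * M * s) * (dist v w * (exp (2 * M * s) / 2))"
      by (intro mult_left_mono A) auto
    also have "\<dots> = (1/2) * dist v w" by (simp add: exp_minus field_simps)
    finally show "dist (\<Phi> v t) (\<Phi> w t) \<le> (1/2) * dist v w" .
  qed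
  have "\<exists>!v. \<Phi> v = v"
    using banach_fix_type[of "1/2" \<Phi>] contr by auto
  then obtain v where v: "\<Phi> v = v" by auto
  define u where "u t = z + integral {0..t} (I v)" for t
  have uv: "exp (2 * M * t) *\<^sub>R apply_bcontfun v t = u t" if "t \<in> {0..T}" for t
  proof -
    have "apply_bcontfun v t = exp (- 2 * M * t) *\<^sub>R u t"
      using \<Phi>[of v] unfolding v by (simp add: P_def u_def clid[OF that])
    then show ?thesis by (simp add: exp_minus)
  qed
  have "(u has_vector_derivative f t (u t)) (at t within {0..T})" if t: "t \<in> {0..T}" for t
  proof -
    have "(u has_vector_derivative I v t) (at t within {0..T})"
      unfolding u_def using integral_has_vector_derivative[OF Icont t]
      by (auto intro!: derivative_eq_intros)
    then show ?thesis using uv[OF t] by (simp add: I_def)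
  qed
  moreover have "u 0 = z" by (simp add: u_def)
  ultimately show ?thesis by blast
qed

section \<open>Continuously differentiable maps\<close>

text \<open>A C^1 map on an open set that is not convex has Lipschitz bounds only on compact
  subsets; the quantitative estimates draw on these.\<close>

definition compactly_lipschitz :: "'a::metric_space set \<Rightarrow> ('a \<Rightarrow> 'b::metric_space) \<Rightarrow> bool" where
  "compactly_lipschitz S f \<longleftrightarrow> (\<forall>K. compact K \<and> K \<subseteq> S \<longrightarrow> (\<exists>L. L-lipschitz_on K f))"

text \<open>The union of the balls is the Minkowski sum of \<open>K\<close> and a closed ball, and a
  sum of compact sets is compact.\<close>

lemma compact_cball_neighbourhood:
  fixes K :: "'a::euclidean_space set"
  assumes "compact K" "open S" "K \<subseteq> S"
  obtains r where "0 < r" "compact (\<Union>x\<in>K. cball x r)" "(\<Union>x\<in>K. cball x r) \<subseteq> S"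
proof -
  obtain r where r: "0 < r" "(\<Union>x\<in>K. cball x r) \<subseteq> S"
    using compact_subset_open_imp_cball_epsilon_subset[OF assms] by blast
  have "(\<Union>x\<in>K. cball x r) = (\<Union>x\<in>K. \<Union>y\<in>cball 0 r. {x + y})"
  proof safe
    fix x y assume "x \<in> K" "y \<in> cball x r"
    then show "y \<in> (\<Union>x\<in>K. \<Union>y\<in>cball 0 r. {x + y})"
      by (intro UN_I[of x K] UN_I[of "y - x" "cball 0 r"]) (auto simp: dist_norm norm_minus_commute)
  next
    fix x y :: 'a assume "x \<in> K" "y \<in> cball 0 r"
    then show "x + y \<in> (\<Union>x\<in>K. cball x r)"
      by (intro UN_I[of x K]) (auto simp: dist_norm)
  qed
  then have "compact (\<Union>x\<in>K. cball x r)"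
    using compact_sums'[OF assms(1), of "cball 0 r"] by simp
  then show ?thesis using r that by blast
qed

text \<open>Since \<open>K\<close> need not be convex, pairs at distance at most \<open>r\<close>
  are joined inside a ball that lies in \<open>S\<close>, where the mean value inequality applies;
  pairs further apart are handled by the bound \<open>A\<close> of \<open>f\<close> on
  \<open>K\<close>, which costs the constant \<open>2 * A / r\<close>.\<close>

lemma Ck_on_Suc_0_compactly_lipschitz:
  fixes f :: "'a::euclidean_space \<Rightarrow> 'b::euclidean_space"
  assumes S: "open S" and f: "Ck_on (Suc 0) S f"
  shows "compactly_lipschitz S f"
  unfolding compactly_lipschitz_def
proof (intro allI impI, elim conjE)
  fix K assume K: "compact K" "K \<subseteq> S"
  let ?D = "\<lambda>z. frechet_derivative f (at z)"
  have der: "(f has_derivative ?D z) (at z)" if "z \<in> S" for z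
    using f that frechet_derivative_works by auto
  have contD: "continuous_on S (\<lambda>z. ?D z v)" for v using f by auto
  have contf: "continuous_on S f"
    using der by (meson has_derivative_continuous_on has_derivative_at_withinI)
  obtain r where r: "0 < r" and Nc: "compact (\<Union>x\<in>K. cball x r)" and NS: "(\<Union>x\<in>K. cball x r) \<subseteq> S"
    using compact_cball_neighbourhood[OF K(1) S K(2)] .
  let ?N = "\<Union>x\<in>K. cball x r"
  have "\<exists>B. \<forall>z\<in>?N. norm (?D z i) \<le> B" for i
    using compact_imp_bounded[OF compact_continuous_image[OF continuous_on_subset[OF contD NS] Nc], of i]
    by (auto simp: bounded_iff)
  then obtain B where B: "\<And>i z. z \<in> ?N \<Longrightarrow> norm (?D z i) \<le> B i" by metis
  define C where "C = (\<Sum>i\<in>Basis. B i)"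
  \<comment> \<open>\<open>Ck_on\<close> gives continuity of each directional derivative only;
    summing the bounds over \<open>Basis\<close> turns them into a bound of the operator
    norm.\<close>
  have onorm: "onorm (?D z) \<le> C" if z: "z \<in> ?N" for z
  proof (rule onorm_le)
    fix h
    have lin: "linear (?D z)" using der z NS has_derivative_linear by blast
    have "?D z h = (\<Sum>i\<in>Basis. (h \<bullet> i) *\<^sub>R ?D z i)"
      by (rule trans[OF arg_cong[OF euclidean_representation[symmetric]]])
        (simp add: linear_sum[OF lin] linear_scale[OF lin])
    also have "norm \<dots> \<le> (\<Sum>i\<in>Basis. B i * norm h)"
    proof (rule sum_norm_le)
      fix i :: 'a assume i: "i \<in> Basis"
      show "norm ((h \<bullet> i) *\<^sub>R ?D z i) \<le> B i * norm h"
        unfolding norm_scaleR mult.commute[of "B i"]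
        by (rule mult_mono[OF Basis_le_norm[OF i] B[OF z]]) auto
    qed
    finally show "norm (?D z h) \<le> C * norm h"
      by (simp only: C_def sum_distrib_right[symmetric])
  qed
  obtain A where A: "\<And>x. x \<in> K \<Longrightarrow> norm (f x) \<le> A"
    using compact_imp_bounded[OF compact_continuous_image[OF continuous_on_subset[OF contf K(2)] K(1)]]
    by (auto simp: bounded_iff)
  define L where "L = max 0 (max C (2 * A / r))"
  have "L-lipschitz_on K f"
  proof (rule lipschitz_onI)
    show "0 \<le> L" by (simp add: L_def)
    fix x y assume x: "x \<in> K" and y: "y \<in> K"
    show "dist (f x) (f y) \<le> L * dist x y"
    proof (cases "dist x y \<le> r")
      case True
      have "norm (f y - f x) \<le> C * norm (y - x)"
      proof (rule differentiable_bound[of "cball x r" f ?D])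
        show "(f has_derivative ?D z) (at z within cball x r)" if "z \<in> cball x r" for z
          by (rule has_derivative_at_withinI[OF der]) (use that x NS in blast)
        show "onorm (?D z) \<le> C" if "z \<in> cball x r" for z
          by (rule onorm) (use that x in blast)
      qed (use True r in \<open>simp_all add: less_imp_le\<close>)
      also have "\<dots> \<le> L * norm (y - x)" by (intro mult_right_mono) (auto simp: L_def)
      finally show ?thesis by (simp add: dist_norm norm_minus_commute)
    next
      case False
      have "dist (f x) (f y) \<le> 2 * A"
        using A[OF x] A[OF y] norm_triangle_ineq4[of "f x" "f y"] by (simp add: dist_norm)
      also have "\<dots> = (2 * A / r) * r" using r by simp
      also have "\<dots> \<le> L * dist x y" using False r by (intro mult_mono) (auto simp: L_def)
      finally show ?thesis .
    qed
  qed
  then show "\<exists>L. L-lipschitz_on K f" ..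
qed

section \<open>A three-dimensional intermediate value theorem\<close>

text \<open>The map that sends \<open>p\<close> to \<open>p - f p\<close>, clamped to the box
  coordinate by coordinate, has a Brouwer fixed point. A coordinate that was really clamped would
  sit on a face, where the sign condition moves the point inward; hence nothing was clamped and all
  three functions vanish.\<close>

lemma poincare_miranda:
  fixes f1 f2 f3 :: "real \<times> real \<times> real \<Rightarrow> real"
    and a1 b1 a2 b2 a3 b3 :: real
  defines "Q \<equiv> {a1..b1} \<times> {a2..b2} \<times> {a3..b3}"
  assumes le: "a1 \<le> b1" "a2 \<le> b2" "a3 \<le> b3"
    and cont: "continuous_on Q f1" "continuous_on Q f2" "continuous_on Q f3"
    and f1: "\<And>y z. (a1, y, z) \<in> Q \<Longrightarrow> f1 (a1, y, z) < 0" "\<And>y z. (b1, y, z) \<in> Q \<Longrightarrow> f1 (b1, y, z) > 0"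
    and f2: "\<And>x z. (x, a2, z) \<in> Q \<Longrightarrow> f2 (x, a2, z) < 0" "\<And>x z. (x, b2, z) \<in> Q \<Longrightarrow> f2 (x, b2, z) > 0"
    and f3: "\<And>x y. (x, y, a3) \<in> Q \<Longrightarrow> f3 (x, y, a3) < 0" "\<And>x y. (x, y, b3) \<in> Q \<Longrightarrow> f3 (x, y, b3) > 0"
  obtains x y z where "(x, y, z) \<in> Q" "f1 (x, y, z) = 0" "f2 (x, y, z) = 0" "f3 (x, y, z) = 0"
proof -
  define cl where "cl a b t = max a (min b t)" for a b t :: real
  have cl_in: "a \<le> b \<Longrightarrow> cl a b t \<in> {a..b}" for a b t by (auto simp: cl_def)
  have fixed: "d = 0" if "t \<in> {a..b}" "cl a b (t - d) = t" "t = a \<Longrightarrow> d < 0" "t = b \<Longrightarrow> d > 0" for a b t d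
    using that unfolding cl_def by (auto simp: max_def min_def split: if_splits)
  define H where "H p = (cl a1 b1 (fst p - f1 p), cl a2 b2 (fst (snd p) - f2 p),
      cl a3 b3 (snd (snd p) - f3 p))" for p
  have "compact Q" "convex Q" unfolding Q_def by (auto intro!: compact_Times convex_Times)
  moreover have "Q \<noteq> {}" using le by (auto simp: Q_def)
  moreover have "continuous_on Q H" unfolding H_def cl_def by (intro continuous_intros cont)
  moreover have "H \<in> Q \<rightarrow> Q"
    using cl_in[OF le(1)] cl_in[OF le(2)] cl_in[OF le(3)] unfolding H_def Q_def by (intro Pi_I SigmaI)
  ultimately obtain p where p: "p \<in> Q" "H p = p" by (rule brouwer)
  obtain x y z where xyz: "p = (x, y, z)" by (cases p) auto
  have e: "cl a1 b1 (x - f1 p) = x" "cl a2 b2 (y - f2 p) = y" "cl a3 b3 (z - f3 p) = z"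
    using p(2) by (auto simp: H_def xyz)
  show ?thesis
  proof (rule that[of x y z])
    show "(x, y, z) \<in> Q" using p xyz by simp
    show "f1 (x, y, z) = 0" using fixed[OF _ e(1)] f1 p xyz by (auto simp: Q_def)
    show "f2 (x, y, z) = 0" using fixed[OF _ e(2)] f2 p xyz by (auto simp: Q_def)
    show "f3 (x, y, z) = 0" using fixed[OF _ e(3)] f3 p xyz by (auto simp: Q_def)
  qed
qed

section \<open>Plane vectors\<close>

lemma on_axis_nth [simp]: "on_axis x $ 1 = x" "on_axis x $ 2 = 0"
  by (simp_all add: on_axis_def)

lemma reflect_nth [simp]: "reflect z $ 1 = z $ 1" "reflect z $ 2 = - (z $ 2)"
  by (simp_all add: reflect_def)

lemma vec2_eq_iff: "(u::real^2) = v \<longleftrightarrow> u $ 1 = v $ 1 \<and> u $ 2 = v $ 2"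
  by (simp add: vec_eq_iff forall_2)

lemma on_axis_add: "on_axis (x + y) = on_axis x + on_axis y"
  and on_axis_diff: "on_axis (x - y) = on_axis x - on_axis y"
  and on_axis_mult: "on_axis (c * x) = c *\<^sub>R on_axis x"
  by (simp_all add: vec2_eq_iff)

lemma norm_on_axis [simp]: "norm (on_axis x) = \<bar>x\<bar>"
  by (simp add: norm_vec_def L2_set_def sum_2)

lemma bounded_linear_on_axis: "bounded_linear on_axis"
  by (rule bounded_linear_intro[of _ 1]) (simp_all add: on_axis_add on_axis_mult[symmetric])

lemma norm_reflect [simp]: "norm (reflect z) = norm z"
  by (simp add: norm_vec_def L2_set_def sum_2)

lemma reflect_reflect [simp]: "reflect (reflect z) = z"
  by (simp add: vec2_eq_iff)

lemma bounded_linear_reflect: "bounded_linear reflect"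
  by (rule bounded_linear_intro[of _ 1]) (simp_all add: vec2_eq_iff)

lemma reflect_on_axis [simp]: "reflect (on_axis x) = on_axis x"
  by (simp add: vec2_eq_iff)

lemmas reflect_linear = bounded_linear.linear[OF bounded_linear_reflect]
lemmas reflect_simps = linear_add[OF reflect_linear] linear_diff[OF reflect_linear]
  linear_neg[OF reflect_linear] linear_scale[OF reflect_linear]

lemma inner_vec2: "(u::real^2) \<bullet> v = u $ 1 * v $ 1 + u $ 2 * v $ 2"
  by (simp add: inner_vec_def sum_2)

lemma vec2_expand: "(v::real^2) = v $ 1 *\<^sub>R axis 1 1 + v $ 2 *\<^sub>R axis 2 1"
  by (simp add: vec2_eq_iff axis_def)

section \<open>The unperturbed orbit\<close>

text \<open>The signs of \<open>\<alpha>\<close>, \<open>b\<close> and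
  \<open>F (\<gamma> \<sigma>) $ 2\<close> are not extra assumptions:
  \<open>fold_orbit_exists\<close> obtains them from the fold and return hypotheses. The curve
  \<open>\<gamma>\<close> stands for the flow, which is a definite description and awkward to
  differentiate.\<close>

locale fold_orbit =
  fixes F :: "real^2 \<Rightarrow> real^2" and D :: "(real^2) set" and \<gamma> :: "real \<Rightarrow> real^2"
    and \<sigma> xv \<alpha> b :: real
  assumes open_D: "open D" and C2: "Ck_on 2 D F" and \<sigma>_pos: "0 < \<sigma>"
    and \<gamma>_in_D: "\<And>t. t \<in> {0..\<sigma>} \<Longrightarrow> \<gamma> t \<in> D"
    and \<gamma>_deriv: "\<And>t. t \<in> {0..\<sigma>} \<Longrightarrow> (\<gamma> has_vector_derivative F (\<gamma> t)) (at t within {0..\<sigma>})"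
    and \<gamma>_0: "\<gamma> 0 = on_axis xv"
    and \<gamma>_neg: "\<And>t. t \<in> {0<..<\<sigma>} \<Longrightarrow> \<gamma> t $ 2 < 0"
    and \<gamma>_end: "\<gamma> \<sigma> $ 2 = 0" and F_end: "F (\<gamma> \<sigma>) $ 2 > 0"
    and F_start: "F (on_axis xv) = on_axis (- \<alpha>)" and \<alpha>_pos: "\<alpha> > 0"
    and fold: "frechet_derivative F (at (on_axis xv)) (on_axis 1) $ 2 = b" and b_pos: "b > 0"
begin

abbreviation "DF z \<equiv> frechet_derivative F (at z)"

definition tube :: "real \<Rightarrow> (real^2) set" where
  "tube \<delta> = (\<Union>t\<in>{0..\<sigma>}. cball (\<gamma> t) \<delta>)"

lemma C2': "\<And>z. z \<in> D \<Longrightarrow> (F has_derivative DF z) (at z)" "\<And>v. Ck_on (Suc 0) D (\<lambda>z. DF z v)"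
  using C2 by (auto simp: numeral_2_eq_2 frechet_derivative_works)

lemma DF_continuous: "continuous_on D (\<lambda>z. DF z (v :: real^2))"
  using C2'(2)[of v] by (auto intro!: differentiable_imp_continuous_on differentiable_at_imp_differentiable_on)

lemma DF_linear: "z \<in> D \<Longrightarrow> linear (DF z)"
  using C2'(1) has_derivative_linear by blast

lemma F_continuous: "continuous_on D F"
  using C2'(1) by (meson has_derivative_continuous_on has_derivative_at_withinI)

lemma \<gamma>_continuous: "continuous_on {0..\<sigma>} \<gamma>"
  by (rule continuous_on_vector_derivative) (rule \<gamma>_deriv)

text \<open>A single constant serves every bound, so that it can later be enlarged to control the
  perturbations too. The Lipschitz bound on \<open>DF\<close> is what two derivatives of
  \<open>F\<close> are for.\<close>

lemma tube_constants_exist: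
  "\<exists>\<delta> L. 0 < \<delta> \<and> 0 \<le> L \<and> compact (tube \<delta>) \<and> tube \<delta> \<subseteq> D
    \<and> (\<forall>x\<in>tube \<delta>. \<forall>y\<in>tube \<delta>. norm (F x - F y) \<le> L * norm (x - y))
    \<and> (\<forall>x\<in>tube \<delta>. norm (F x) \<le> L)
    \<and> (\<forall>x\<in>tube \<delta>. \<forall>v. norm (DF x v) \<le> L * norm v)
    \<and> (\<forall>x\<in>tube \<delta>. \<forall>y\<in>tube \<delta>. \<forall>v. norm (DF x v - DF y v) \<le> L * norm (x - y) * norm v)"
proof -
  have "compact (\<gamma> ` {0..\<sigma>})" by (intro compact_continuous_image \<gamma>_continuous) auto
  moreover have "\<gamma> ` {0..\<sigma>} \<subseteq> D" using \<gamma>_in_D by auto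
  ultimately obtain \<delta> where \<delta>: "0 < \<delta>" "compact (tube \<delta>)" "tube \<delta> \<subseteq> D"
    using compact_cball_neighbourhood[OF _ open_D, of "\<gamma> ` {0..\<sigma>}"] unfolding tube_def by force
  have "Ck_on (Suc 0) D F"
    using C2' DF_continuous by (auto simp: differentiable_def)
  then obtain L1 where L1: "L1-lipschitz_on (tube \<delta>) F"
    using Ck_on_Suc_0_compactly_lipschitz[OF open_D] \<delta> unfolding compactly_lipschitz_def by blast
  obtain L2 where L2: "\<And>x. x \<in> tube \<delta> \<Longrightarrow> norm (F x) \<le> L2"
    using compact_imp_bounded[OF compact_continuous_image[OF continuous_on_subset[OF F_continuous \<delta>(3)] \<delta>(2)]]
    by (auto simp: bounded_iff)
  have "\<exists>M. \<forall>x\<in>tube \<delta>. norm (DF x v) \<le> M" for v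
    using compact_imp_bounded[OF compact_continuous_image[OF continuous_on_subset[OF DF_continuous \<delta>(3)] \<delta>(2)]]
    by (auto simp: bounded_iff)
  then obtain M where M: "\<And>v x. x \<in> tube \<delta> \<Longrightarrow> norm (DF x v) \<le> M v" by metis
  have "\<exists>M. M-lipschitz_on (tube \<delta>) (\<lambda>z. DF z v)" for v
    using Ck_on_Suc_0_compactly_lipschitz[OF open_D C2'(2)] \<delta> unfolding compactly_lipschitz_def by blast
  then obtain K where K: "\<And>v. (K v)-lipschitz_on (tube \<delta>) (\<lambda>z. DF z v)" by metis
  let ?i = "axis 1 1 :: real^2" and ?j = "axis 2 1 :: real^2"
  \<comment> \<open>Continuity and Lipschitz bounds are available for \<open>DF x v\<close> with
    \<open>v\<close> fixed; expanding \<open>v\<close> in the two axes makes them uniform in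
    \<open>v\<close>.\<close>
  have split: "DF x v = v $ 1 *\<^sub>R DF x ?i + v $ 2 *\<^sub>R DF x ?j" if "x \<in> tube \<delta>" for x v
  proof -
    have "linear (DF x)" using that \<delta> DF_linear by auto
    then show ?thesis
      using arg_cong[where f = "DF x", OF vec2_expand[of v]] by (simp add: linear_add linear_scale)
  qed
  have comp: "\<bar>v $ 1\<bar> \<le> norm v" "\<bar>v $ 2\<bar> \<le> norm v" for v :: "real^2"
    by (simp_all add: component_le_norm_cart)
  have D1: "norm (DF x v) \<le> (M ?i + M ?j) * norm v" if x: "x \<in> tube \<delta>" for x v
  proof -
    have "norm (DF x v) \<le> \<bar>v $ 1\<bar> * norm (DF x ?i) + \<bar>v $ 2\<bar> * norm (DF x ?j)"
      unfolding split[OF x, of v] by (rule order_trans[OF norm_triangle_ineq]) simp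
    also have "\<dots> \<le> norm v * M ?i + norm v * M ?j"
      by (intro add_mono mult_mono comp M x) auto
    finally show ?thesis by (simp add: algebra_simps)
  qed
  have D2: "norm (DF x v - DF y v) \<le> (K ?i + K ?j) * norm (x - y) * norm v"
    if x: "x \<in> tube \<delta>" and y: "y \<in> tube \<delta>" for x y v
  proof -
    have k: "norm (DF x w - DF y w) \<le> K w * norm (x - y)" for w
      using lipschitz_onD[OF K x y] by (simp add: dist_norm)
    have "DF x v - DF y v = v $ 1 *\<^sub>R (DF x ?i - DF y ?i) + v $ 2 *\<^sub>R (DF x ?j - DF y ?j)"
      unfolding split[OF x, of v] split[OF y, of v] by (simp add: algebra_simps)
    then have "norm (DF x v - DF y v) \<le> \<bar>v $ 1\<bar> * norm (DF x ?i - DF y ?i) + \<bar>v $ 2\<bar> * norm (DF x ?j - DF y ?j)"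
      by (metis norm_scaleR norm_triangle_ineq)
    also have "\<dots> \<le> norm v * (K ?i * norm (x - y)) + norm v * (K ?j * norm (x - y))"
      by (intro add_mono mult_mono comp k) auto
    finally show ?thesis by (simp add: algebra_simps)
  qed
  define L where "L = max (max 0 L1) (max L2 (max (M ?i + M ?j) (K ?i + K ?j)))"
  have L: "0 \<le> L" "L1 \<le> L" "L2 \<le> L" "M ?i + M ?j \<le> L" "K ?i + K ?j \<le> L" by (auto simp: L_def)
  show ?thesis
  proof (rule exI[of _ \<delta>], rule exI[of _ L], intro conjI ballI allI)
    show "norm (F x - F y) \<le> L * norm (x - y)" if "x \<in> tube \<delta>" "y \<in> tube \<delta>" for x y
      using lipschitz_onD[OF L1 that] mult_right_mono[OF L(2), of "norm (x - y)"] by (simp add: dist_norm)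
    show "norm (F x) \<le> L" if "x \<in> tube \<delta>" for x using L2[OF that] L by simp
    show "norm (DF x v) \<le> L * norm v" if "x \<in> tube \<delta>" for x v
      using D1[OF that, of v] mult_right_mono[OF L(4), of "norm v"] by simp
    show "norm (DF x v - DF y v) \<le> L * norm (x - y) * norm v" if "x \<in> tube \<delta>" "y \<in> tube \<delta>" for x y v
      using D2[OF that, of v] mult_right_mono[OF L(5), of "norm (x - y) * norm v"]
      by (simp add: mult.assoc)
  qed (use \<delta> L in auto)
qed

end

text \<open>\<open>L\<close> is a parameter rather than a chosen constant, so that the two perturbed
  systems can share it; the hypotheses persist when \<open>L\<close> grows.\<close>

locale fold_tube = fold_orbit +
  fixes \<delta> L :: real
  assumes \<delta>_pos: "0 < \<delta>" and L_nonneg: "0 \<le> L" and tube_compact: "compact (tube \<delta>)" and tube_D: "tube \<delta> \<subseteq> D"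
    and F_lip: "\<And>x y. x \<in> tube \<delta> \<Longrightarrow> y \<in> tube \<delta> \<Longrightarrow> norm (F x - F y) \<le> L * norm (x - y)"
    and F_bound: "\<And>x. x \<in> tube \<delta> \<Longrightarrow> norm (F x) \<le> L"
    and DF_bound: "\<And>x v. x \<in> tube \<delta> \<Longrightarrow> norm (DF x v) \<le> L * norm v"
    and DF_lip: "\<And>x y v. x \<in> tube \<delta> \<Longrightarrow> y \<in> tube \<delta> \<Longrightarrow> norm (DF x v - DF y v) \<le> L * norm (x - y) * norm v"
begin

lemma tubeI: "t \<in> {0..\<sigma>} \<Longrightarrow> norm (x - \<gamma> t) \<le> \<delta> \<Longrightarrow> x \<in> tube \<delta>"
  by (auto simp: tube_def dist_norm norm_minus_commute)

lemma \<gamma>_tube: "t \<in> {0..\<sigma>} \<Longrightarrow> \<gamma> t \<in> tube \<delta>"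
  using \<delta>_pos by (intro tubeI[of t]) auto

text \<open>The Lipschitz bound on \<open>DF\<close> bounds the derivative of the remainder by
  \<open>L * norm v\<close> on the ball of radius \<open>norm v\<close>, and the mean value
  inequality makes the remainder quadratic.\<close>

lemma F_taylor:
  assumes t: "t \<in> {0..\<sigma>}" and v: "norm v \<le> \<delta>"
  shows "norm (F (\<gamma> t + v) - F (\<gamma> t) - DF (\<gamma> t) v) \<le> L * (norm v)\<^sup>2"
proof -
  have "norm (F (\<gamma> t + v) - F (\<gamma> t) - DF (\<gamma> t) (\<gamma> t + v - \<gamma> t)) \<le> norm (\<gamma> t + v - \<gamma> t) * (L * norm v)"
  proof (rule differentiable_bound_linearization[where S = "cball (\<gamma> t) (norm v)" and f' = DF])
    have sub: "cball (\<gamma> t) (norm v) \<subseteq> tube \<delta>" using t v by (force simp: tube_def)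
    show "\<gamma> t + s *\<^sub>R (\<gamma> t + v - \<gamma> t) \<in> cball (\<gamma> t) (norm v)" if "s \<in> {0..1}" for s
      using that by (auto simp: dist_norm intro!: mult_left_le_one_le)
    show "(F has_derivative DF z) (at z within cball (\<gamma> t) (norm v))" if "z \<in> cball (\<gamma> t) (norm v)" for z
      by (rule has_derivative_at_withinI[OF C2'(1)]) (use that sub tube_D in blast)
    show "onorm (DF z - DF (\<gamma> t)) \<le> L * norm v" if "z \<in> cball (\<gamma> t) (norm v)" for z
    proof (rule onorm_le)
      fix h
      have "norm (DF z h - DF (\<gamma> t) h) \<le> L * norm (z - \<gamma> t) * norm h"
        by (rule DF_lip[OF _ \<gamma>_tube[OF t]]) (use that sub in blast)
      also have "\<dots> \<le> L * norm v * norm h"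
        using that L_nonneg by (intro mult_right_mono mult_left_mono) (auto simp: dist_norm norm_minus_commute)
      finally show "norm ((DF z - DF (\<gamma> t)) h) \<le> L * norm v * norm h" by simp
    qed
    show "\<gamma> t \<in> cball (\<gamma> t) (norm v)" by simp
  qed
  then show ?thesis by (simp add: power2_eq_square mult_ac)
qed

lemma DF_split: "z \<in> D \<Longrightarrow> DF z v = v $ 1 *\<^sub>R DF z (axis 1 1) + v $ 2 *\<^sub>R DF z (axis 2 1)"
  using arg_cong[where f = "DF z", OF vec2_expand[of v]]
  by (simp add: linear_add[OF DF_linear] linear_scale[OF DF_linear])

lemma DF_\<gamma>_continuous: "continuous_on {0..\<sigma>} (\<lambda>s. DF (\<gamma> s) v)"
  by (rule continuous_on_compose2[OF DF_continuous \<gamma>_continuous]) (use \<gamma>_in_D in auto)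

text \<open>The equation is solved in the form given by \<open>DF_split\<close>, because joint
  continuity in time and vector is read off from the two columns of \<open>DF\<close>.\<close>

lemma variational_exists:
  assumes "continuous_on {0..\<sigma>} g"
  shows "\<exists>w. w 0 = w0 \<and> (\<forall>s\<in>{0..\<sigma>}. (w has_vector_derivative DF (\<gamma> s) (w s) + g s) (at s within {0..\<sigma>}))"
proof -
  let ?f = "\<lambda>s v. (v $ 1 *\<^sub>R DF (\<gamma> s) (axis 1 1) + v $ 2 *\<^sub>R DF (\<gamma> s) (axis 2 1)) + g s"
  have eq: "DF (\<gamma> s) v + g s = ?f s v" if "s \<in> {0..\<sigma>}" for s v
    by (rule arg_cong[where f = "\<lambda>x. x + g s", OF DF_split[OF \<gamma>_in_D[OF that]]])
  have "\<exists>w. w 0 = w0 \<and> (\<forall>s\<in>{0..\<sigma>}. (w has_vector_derivative ?f s (w s)) (at s within {0..\<sigma>}))"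
  proof (rule global_lipschitz_ode_exists[where f = ?f and L = L])
    show "continuous_on ({0..\<sigma>} \<times> UNIV) (\<lambda>(s, v). ?f s v)"
      unfolding case_prod_beta
      by (intro continuous_intros continuous_on_compose2[OF DF_\<gamma>_continuous]
          continuous_on_compose2[OF assms]) auto
    fix s x y assume s: "s \<in> {0..\<sigma>}"
    have "?f s x - ?f s y = DF (\<gamma> s) (x - y)"
      using eq[OF s, of x] eq[OF s, of y] linear_diff[OF DF_linear[OF \<gamma>_in_D[OF s]], of x y]
      by (metis add_diff_cancel_right)
    then show "norm (?f s x - ?f s y) \<le> L * norm (x - y)"
      using DF_bound[OF \<gamma>_tube[OF s]] by simp
  qed (use \<sigma>_pos in simp)
  then obtain w where w: "w 0 = w0"
      "\<And>s. s \<in> {0..\<sigma>} \<Longrightarrow> (w has_vector_derivative ?f s (w s)) (at s within {0..\<sigma>})"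
    by blast
  have "(w has_vector_derivative DF (\<gamma> s) (w s) + g s) (at s within {0..\<sigma>})" if "s \<in> {0..\<sigma>}" for s
    using w(2)[OF that] by (subst eq[OF that])
  with w(1) show ?thesis by blast
qed

section \<open>The adjoint variational equation and the inverse of the fundamental matrix\<close>

definition adjDF :: "real^2 \<Rightarrow> real^2 \<Rightarrow> real^2" where
  "adjDF x v = vector [DF x (axis 1 1) \<bullet> v, DF x (axis 2 1) \<bullet> v]"

lemma adjDF: "x \<in> D \<Longrightarrow> adjDF x v \<bullet> w = v \<bullet> DF x w"
  unfolding adjDF_def inner_vec2[of "vector _"]
  by (subst DF_split, assumption) (simp add: inner_add_right inner_commute[of v] mult.commute)

lemma adjDF_diff: "adjDF x (u - v) = adjDF x u - adjDF x v"
  by (simp add: adjDF_def vec2_eq_iff inner_diff_right)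

lemma adjoint_exists:
  "\<exists>z. z 0 = z0 \<and> (\<forall>s\<in>{0..\<sigma>}. (z has_vector_derivative - adjDF (\<gamma> s) (z s)) (at s within {0..\<sigma>}))"
proof (rule global_lipschitz_ode_exists[where f = "\<lambda>s v. - adjDF (\<gamma> s) v" and L = L])
  have eq: "- adjDF x v = (- (DF x (axis 1 1) \<bullet> v)) *\<^sub>R axis 1 1 + (- (DF x (axis 2 1) \<bullet> v)) *\<^sub>R axis 2 1" for x v
    by (simp add: adjDF_def vec2_eq_iff axis_def)
  show "continuous_on ({0..\<sigma>} \<times> UNIV) (\<lambda>(s, v). - adjDF (\<gamma> s) v)"
    unfolding case_prod_beta eq
    by (intro continuous_intros continuous_on_compose2[OF DF_\<gamma>_continuous]) auto
  fix s x y assume s: "s \<in> {0..\<sigma>}"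
  have "norm (- adjDF (\<gamma> s) x - - adjDF (\<gamma> s) y) \<le> norm (adjDF (\<gamma> s) (x - y))"
    by (simp add: adjDF_diff norm_minus_commute)
  also have "\<dots> \<le> L * norm (x - y)"
  proof -
    \<comment> \<open>A transposed map has the same norm: the square of \<open>norm a\<close> equals
      \<open>(x - y) \<bullet> DF (\<gamma> s) a\<close>, and one factor \<open>norm a\<close>
      cancels.\<close>
    define a where "a = adjDF (\<gamma> s) (x - y)"
    have "norm a * norm a = (x - y) \<bullet> DF (\<gamma> s) a"
      using adjDF[OF \<gamma>_in_D[OF s], of "x - y" a]
      by (simp only: a_def[symmetric] dot_square_norm power2_eq_square)
    also have "\<dots> \<le> norm (x - y) * norm (DF (\<gamma> s) a)" by (rule norm_cauchy_schwarz)
    also have "\<dots> \<le> norm (x - y) * (L * norm a)"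
      by (intro mult_left_mono DF_bound \<gamma>_tube s) auto
    finally have "norm a * norm a \<le> (L * norm (x - y)) * norm a" by (simp only: mult_ac)
    moreover have "0 \<le> L * norm (x - y)" using L_nonneg by simp
    ultimately show ?thesis unfolding a_def[symmetric]
      by (cases "norm a = 0") (simp, metis mult_right_le_imp_le norm_ge_zero order_le_less)
  qed
  finally show "norm (- adjDF (\<gamma> s) x - - adjDF (\<gamma> s) y) \<le> L * norm (x - y)" .
qed (use \<sigma>_pos in simp)

definition is_fund :: "real^2 \<Rightarrow> (real \<Rightarrow> real^2) \<Rightarrow> bool" where
  "is_fund h w \<longleftrightarrow> w 0 = h \<and>
    (\<forall>s\<in>{0..\<sigma>}. (w has_vector_derivative DF (\<gamma> s) (w s)) (at s within {0..\<sigma>}))"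

definition is_adj :: "real^2 \<Rightarrow> (real \<Rightarrow> real^2) \<Rightarrow> bool" where
  "is_adj h z \<longleftrightarrow> z 0 = h \<and>
    (\<forall>s\<in>{0..\<sigma>}. (z has_vector_derivative - adjDF (\<gamma> s) (z s)) (at s within {0..\<sigma>}))"

definition "fund h = (SOME w. is_fund h w)"
definition "adj h = (SOME z. is_adj h z)"

lemma is_fund: "is_fund h (fund h)"
  unfolding fund_def
  using variational_exists[of "\<lambda>_. 0" h] by (intro someI_ex[of "is_fund h"]) (simp add: is_fund_def)

lemma is_adj: "is_adj h (adj h)"
  unfolding adj_def
  using adjoint_exists[of h] by (intro someI_ex[of "is_adj h"]) (simp add: is_adj_def)

lemmas fund = is_fund[unfolded is_fund_def, THEN conjunct1]
  is_fund[unfolded is_fund_def, THEN conjunct2, rule_format]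
lemmas adj = is_adj[unfolded is_adj_def, THEN conjunct1]
  is_adj[unfolded is_adj_def, THEN conjunct2, rule_format]

definition Y :: "real \<Rightarrow> real^2 \<Rightarrow> real^2" where
  "Y s v = v $ 1 *\<^sub>R fund (axis 1 1) s + v $ 2 *\<^sub>R fund (axis 2 1) s"
text \<open>The rows of \<open>Z s\<close> are adjoint solutions starting from the unit vectors,
  which makes \<open>Z s\<close> the inverse of \<open>Y s\<close> without differentiating an
  inverse matrix.\<close>

definition Z :: "real \<Rightarrow> real^2 \<Rightarrow> real^2" where
  "Z s v = vector [adj (axis 1 1) s \<bullet> v, adj (axis 2 1) s \<bullet> v]"

lemma linear_Y: "linear (Y s)"
  by (rule linearI) (simp_all add: Y_def algebra_simps)

lemma linear_Z: "linear (Z s)"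
  by (rule linearI) (simp_all add: Z_def vec2_eq_iff inner_add_right)

lemma Y_0: "Y 0 v = v"
  using vec2_expand[of v] by (simp add: Y_def fund)

lemma Y_deriv:
  assumes s: "s \<in> {0..\<sigma>}"
  shows "((\<lambda>s. Y s v) has_vector_derivative DF (\<gamma> s) (Y s v)) (at s within {0..\<sigma>})"
  unfolding Y_def linear_add[OF DF_linear[OF \<gamma>_in_D[OF s]]] linear_scale[OF DF_linear[OF \<gamma>_in_D[OF s]]]
  by (intro has_vector_derivative_add fund(2)[OF s]
      bounded_linear.has_vector_derivative[OF bounded_linear_scaleR_right])

lemma adj_continuous: "continuous_on {0..\<sigma>} (adj h)"
  by (rule continuous_on_vector_derivative) (rule adj)

lemma Z_eq: "Z s v = (adj (axis 1 1) s \<bullet> v) *\<^sub>R axis 1 1 + (adj (axis 2 1) s \<bullet> v) *\<^sub>R axis 2 1"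
  by (simp add: Z_def vec2_eq_iff axis_def)

lemma Z_continuous: "continuous_on {0..\<sigma>} g \<Longrightarrow> continuous_on {0..\<sigma>} (\<lambda>s. Z s (g s))"
  unfolding Z_eq by (intro continuous_intros adj_continuous)

text \<open>Pairing an adjoint solution with \<open>w\<close> cancels the two terms with
  \<open>DF\<close>, so \<open>Z s (w s)\<close> has derivative \<open>Z s (g s)\<close>.\<close>

lemma Z_variation:
  assumes w: "\<And>s. s \<in> {0..\<sigma>} \<Longrightarrow> (w has_vector_derivative DF (\<gamma> s) (w s) + g s) (at s within {0..\<sigma>})"
    and s: "s \<in> {0..\<sigma>}"
  shows "((\<lambda>r. Z r (g r)) has_integral (Z s (w s) - w 0)) {0..s}"
proof -
  have der: "((\<lambda>r. adj h r \<bullet> w r) has_vector_derivative adj h r \<bullet> g r) (at r within {0..\<sigma>})"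
    if r: "r \<in> {0..\<sigma>}" for h r
  proof -
    have "((\<lambda>r. adj h r \<bullet> w r) has_vector_derivative
      (adj h r \<bullet> (DF (\<gamma> r) (w r) + g r) + (- adjDF (\<gamma> r) (adj h r)) \<bullet> w r)) (at r within {0..\<sigma>})"
      by (rule bounded_bilinear.has_vector_derivative[OF bounded_bilinear_inner adj(2)[OF r] w[OF r]])
    then show ?thesis
      by (simp add: inner_add_right adjDF[OF \<gamma>_in_D[OF r]])
  qed
  have "((\<lambda>r. Z r (w r)) has_vector_derivative Z r (g r)) (at r within {0..\<sigma>})" if "r \<in> {0..\<sigma>}" for r
    unfolding Z_eq
    by (intro has_vector_derivative_add
        bounded_linear.has_vector_derivative[OF bounded_linear_scaleR_left] der[OF that])
  then have "((\<lambda>r. Z r (g r)) has_integral (Z s (w s) - Z 0 (w 0))) {0..s}"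
    using s by (intro fundamental_theorem_of_calculus)
      (simp, rule has_vector_derivative_within_subset[of _ _ _ "{0..\<sigma>}"], auto)
  moreover have "Z 0 (w 0) = w 0"
    by (simp add: Z_def adj vec2_eq_iff inner_axis')
  ultimately show ?thesis by simp
qed

lemma Z_Y:
  assumes s: "s \<in> {0..\<sigma>}" shows "Z s (Y s v) = v"
proof -
  have "((\<lambda>r. Z r 0) has_integral (Z s (Y s v) - Y 0 v)) {0..s}"
    by (rule Z_variation[of "\<lambda>s. Y s v" "\<lambda>_. 0"]) (use Y_deriv s in auto)
  then show ?thesis
    using has_integral_unique[of "\<lambda>r. Z r 0"] has_integral_0 by (fastforce simp: linear_0[OF linear_Z] Y_0)
qed

text \<open>\<open>Z s\<close> is a left inverse by the homogeneous case of the variation formula;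
  in finite dimension it is then also a right inverse.\<close>

lemma Y_Z: assumes s: "s \<in> {0..\<sigma>}" shows "Y s (Z s v) = v"
proof -
  have "inj (Y s)" using Z_Y[OF s] by (rule inj_on_inverseI)
  then have "surj (Y s)" by (rule linear_inj_imp_surj[OF linear_Y])
  then obtain u where "v = Y s u" by (rule surjE)
  then show ?thesis by (simp only: Z_Y[OF s])
qed

lemma variation_of_constants:
  assumes w: "\<And>s. s \<in> {0..\<sigma>} \<Longrightarrow> (w has_vector_derivative DF (\<gamma> s) (w s) + g s) (at s within {0..\<sigma>})"
    and s: "s \<in> {0..\<sigma>}"
  shows "w s = Y s (w 0 + integral {0..s} (\<lambda>r. Z r (g r)))"
proof -
  have "integral {0..s} (\<lambda>r. Z r (g r)) = Z s (w s) - w 0"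
    by (rule integral_unique[OF Z_variation[OF w s]])
  then show ?thesis by (simp add: Y_Z[OF s])
qed

text \<open>\<open>F \<circ> \<gamma>\<close> solves the variational equation.\<close>

lemma Y_on_axis: "Y \<sigma> (on_axis x) = (- x / \<alpha>) *\<^sub>R F (\<gamma> \<sigma>)"
proof -
  have "((\<lambda>s. F (\<gamma> s)) has_vector_derivative DF (\<gamma> s) (F (\<gamma> s)) + 0) (at s within {0..\<sigma>})"
    if s: "s \<in> {0..\<sigma>}" for s
    using vector_derivative_diff_chain_within[OF \<gamma>_deriv[OF s]
      has_derivative_at_withinI[OF C2'(1)[OF \<gamma>_in_D[OF s]]]] by (simp add: o_def)
  from variation_of_constants[OF this, of \<sigma>] have "F (\<gamma> \<sigma>) = Y \<sigma> (on_axis (- \<alpha>))"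
    using \<sigma>_pos by (simp add: linear_0[OF linear_Z] \<gamma>_0 F_start)
  \<comment> \<open>At the fold \<open>F\<close> is horizontal, so every offset on the axis is a
    multiple of \<open>F (\<gamma> 0)\<close>; this is why the axis is mapped into the line of
    \<open>F (\<gamma> \<sigma>)\<close>.\<close>
  moreover have "on_axis x = (- x / \<alpha>) *\<^sub>R on_axis (- \<alpha>)"
    using \<alpha>_pos by (simp add: vec2_eq_iff)
  ultimately show ?thesis by (simp only: linear_scale[OF linear_Y])
qed

end

section \<open>Solutions of the perturbed lower system\<close>

context fold_tube
begin

text \<open>Frozen after \<open>\<sigma>\<close>, so that solutions arriving later than the
  unperturbed orbit still have a reference point.\<close>

definition center :: "real \<Rightarrow> real^2" where "center s = \<gamma> (min s \<sigma>)"

text \<open>Replacing \<open>u\<close> by its projection to a ball around the unperturbed orbit makes the field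
  globally Lipschitz without changing it near the orbit.\<close>

definition proj :: "real \<Rightarrow> real^2 \<Rightarrow> real^2" where
  "proj s u = center s + closest_point (cball 0 \<delta>) (u - center s)"

lemma center_tube: "0 \<le> s \<Longrightarrow> norm (u - center s) \<le> \<delta> \<Longrightarrow> u \<in> tube \<delta>"
  unfolding center_def using \<sigma>_pos by (intro tubeI[of "min s \<sigma>"]) auto

lemma proj_tube: assumes "0 \<le> s" shows "proj s u \<in> tube \<delta>"
proof (rule center_tube[OF assms])
  have "closest_point (cball 0 \<delta>) (u - center s) \<in> cball 0 \<delta>"
    using \<delta>_pos by (intro closest_point_in_set) auto
  then show "norm (proj s u - center s) \<le> \<delta>" by (simp add: proj_def)
qed

lemma proj_id: "norm (u - center s) \<le> \<delta> \<Longrightarrow> proj s u = u"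
  by (simp add: proj_def closest_point_self)

lemma proj_lip: "norm (proj s u - proj s u') \<le> norm (u - u')"
proof -
  have "dist (closest_point (cball 0 \<delta>) (u - center s)) (closest_point (cball 0 \<delta>) (u' - center s))
      \<le> dist (u - center s) (u' - center s)"
    using \<delta>_pos by (intro closest_point_lipschitz) auto
  then show ?thesis by (simp add: proj_def dist_norm)
qed

lemma center_continuous: "continuous_on {0..} center"
  unfolding center_def
  by (rule continuous_on_compose2[OF \<gamma>_continuous]) (use \<sigma>_pos in \<open>auto intro!: continuous_intros\<close>)

lemma proj_continuous: "continuous_on ({0..T} \<times> UNIV) (\<lambda>(s, u). proj s u)"
  unfolding proj_def case_prod_beta
  by (intro continuous_intros continuous_on_compose2[OF center_continuous]
      continuous_on_compose2[OF continuous_on_closest_point[of "cball 0 \<delta>" UNIV]])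
    (use \<delta>_pos in auto)

lemma center_eq: "s \<in> {0..\<sigma>} \<Longrightarrow> center s = \<gamma> s"
  by (simp add: center_def min_def)

end

text \<open>\<open>k e\<close> is the perturbation divided by \<open>e\<close>, with
  \<open>g\<close> as its limit; \<open>k_g\<close> carries the term of second order in \<epsilon>.
  Start times stay within distance 1 of \<open>\<theta>\<close> and solutions run for at most
  \<open>\<sigma> + 1\<close>; the time window contains all of this.\<close>

locale half = fold_tube +
  fixes g :: "real \<Rightarrow> real^2 \<Rightarrow> real^2" and k :: "real \<Rightarrow> real \<Rightarrow> real^2 \<Rightarrow> real^2" and \<theta> e0 :: real
  assumes e0_le: "e0 \<le> 1"
    and k_lip: "\<And>e t t' z z'. \<lbrakk>0 < e; e < e0; t \<in> {\<theta>-2..\<theta>+\<sigma>+3}; t' \<in> {\<theta>-2..\<theta>+\<sigma>+3}; z \<in> tube \<delta>; z' \<in> tube \<delta>\<rbrakk>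
        \<Longrightarrow> norm (k e t z - k e t' z') \<le> L * (\<bar>t - t'\<bar> + norm (z - z'))"
    and k_bound: "\<And>e t z. \<lbrakk>0 < e; e < e0; t \<in> {\<theta>-2..\<theta>+\<sigma>+3}; z \<in> tube \<delta>\<rbrakk> \<Longrightarrow> norm (k e t z) \<le> L"
    and k_g: "\<And>e t z. \<lbrakk>0 < e; e < e0; t \<in> {\<theta>-2..\<theta>+\<sigma>+3}; z \<in> tube \<delta>\<rbrakk> \<Longrightarrow> norm (k e t z - g t z) \<le> L * e"
    and g_lip: "\<And>t t' z z'. \<lbrakk>t \<in> {\<theta>-2..\<theta>+\<sigma>+3}; t' \<in> {\<theta>-2..\<theta>+\<sigma>+3}; z \<in> tube \<delta>; z' \<in> tube \<delta>\<rbrakk>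
        \<Longrightarrow> norm (g t z - g t' z') \<le> L * (\<bar>t - t'\<bar> + norm (z - z'))"
    and g_bound: "\<And>t z. \<lbrakk>t \<in> {\<theta>-2..\<theta>+\<sigma>+3}; z \<in> tube \<delta>\<rbrakk> \<Longrightarrow> norm (g t z) \<le> L"
begin

definition X :: "real \<Rightarrow> real \<Rightarrow> real^2 \<Rightarrow> real^2" where
  "X e t z = F z + e *\<^sub>R k e t z"

lemma X_F:
  assumes "0 < e" "e < e0" "t \<in> {\<theta>-2..\<theta>+\<sigma>+3}" "z \<in> tube \<delta>"
  shows "norm (X e t z - F z) \<le> L * e"
  using k_bound[OF assms] assms(1) by (simp add: X_def)

lemma X_bound:
  assumes "0 < e" "e < e0" "t \<in> {\<theta>-2..\<theta>+\<sigma>+3}" "z \<in> tube \<delta>"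
  shows "norm (X e t z) \<le> 2 * L"
proof -
  have "L * e \<le> L * 1" using assms e0_le L_nonneg by (intro mult_left_mono) auto
  then show ?thesis
    using X_F[OF assms] F_bound[OF assms(4)] norm_triangle_sub[of "X e t z" "F z"] by linarith
qed

lemma X_lip:
  assumes "0 < e" "e < e0" "t \<in> {\<theta>-2..\<theta>+\<sigma>+3}" "t' \<in> {\<theta>-2..\<theta>+\<sigma>+3}" "z \<in> tube \<delta>" "z' \<in> tube \<delta>"
  shows "norm (X e t z - X e t' z') \<le> 2 * L * norm (z - z') + L * e * \<bar>t - t'\<bar>"
proof -
  have "X e t z - X e t' z' = (F z - F z') + e *\<^sub>R (k e t z - k e t' z')"
    by (simp add: X_def algebra_simps)
  then have "norm (X e t z - X e t' z') \<le> norm (F z - F z') + e * norm (k e t z - k e t' z')"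
    using norm_triangle_ineq[of "F z - F z'" "e *\<^sub>R (k e t z - k e t' z')"] assms(1) by simp
  also have "\<dots> \<le> L * norm (z - z') + e * (L * (\<bar>t - t'\<bar> + norm (z - z')))"
    using assms by (intro add_mono F_lip mult_left_mono k_lip) auto
  also have "\<dots> = L * norm (z - z') + e * (L * norm (z - z')) + L * e * \<bar>t - t'\<bar>"
    by (simp add: algebra_simps)
  also have "\<dots> \<le> L * norm (z - z') + 1 * (L * norm (z - z')) + L * e * \<bar>t - t'\<bar>"
    using assms e0_le L_nonneg by (intro add_mono mult_right_mono) auto
  finally show ?thesis by (simp add: algebra_simps)
qed

lemma X_continuous:
  assumes e: "0 < e" "e < e0" and t0: "t0 \<in> {\<theta>-1..\<theta>+1}"
  shows "continuous_on ({0..\<sigma>+1} \<times> UNIV) (\<lambda>(s, u). X e (t0 + s) (proj s u))"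
proof -
  have tm: "t0 + s \<in> {\<theta>-2..\<theta>+\<sigma>+3}" if "s \<in> {0..\<sigma>+1}" for s using that t0 by auto
  have "(L * e + 2 * L)-lipschitz_on ({\<theta>-2..\<theta>+\<sigma>+3} \<times> tube \<delta>) (\<lambda>(t, z). X e t z)"
  proof (rule lipschitz_onI; clarify?)
    fix t z t' z' assume H: "t \<in> {\<theta>-2..\<theta>+\<sigma>+3}" "z \<in> tube \<delta>" "t' \<in> {\<theta>-2..\<theta>+\<sigma>+3}" "z' \<in> tube \<delta>"
    have "norm (X e t z - X e t' z') \<le> 2 * L * norm (z - z') + L * e * \<bar>t - t'\<bar>"
      by (rule X_lip[OF e H(1,3,2,4)])
    also have "\<dots> \<le> 2 * L * dist (t, z) (t', z') + L * e * dist (t, z) (t', z')"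
      using e L_nonneg dist_fst_le[of "(t, z)" "(t', z')"] dist_snd_le[of "(t, z)" "(t', z')"]
      by (intro add_mono mult_left_mono) (auto simp: dist_norm)
    finally show "dist (X e t z) (X e t' z') \<le> (L * e + 2 * L) * dist (t, z) (t', z')"
      by (simp add: dist_norm algebra_simps)
  qed (use L_nonneg e in auto)
  then have "continuous_on ({\<theta>-2..\<theta>+\<sigma>+3} \<times> tube \<delta>) (\<lambda>(t, z). X e t z)"
    by (rule lipschitz_on_continuous_on)
  then have "continuous_on ({0..\<sigma>+1} \<times> UNIV) (\<lambda>p. (\<lambda>(t, z). X e t z) (t0 + fst p, proj (fst p) (snd p)))"
  proof (rule continuous_on_compose2)
    show "continuous_on ({0..\<sigma>+1} \<times> UNIV) (\<lambda>p. (t0 + fst p, proj (fst p) (snd p)))"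
      using proj_continuous[of "\<sigma>+1"] by (intro continuous_intros) (simp_all add: case_prod_beta)
    show "(\<lambda>p. (t0 + fst p, proj (fst p) (snd p))) ` ({0..\<sigma>+1} \<times> UNIV) \<subseteq> {\<theta>-2..\<theta>+\<sigma>+3} \<times> tube \<delta>"
      using tm proj_tube by force
  qed
  then show ?thesis by (simp add: case_prod_beta)
qed

definition is_sol :: "real \<Rightarrow> real \<Rightarrow> real \<Rightarrow> (real \<Rightarrow> real^2) \<Rightarrow> bool" where
  "is_sol e t0 x u \<longleftrightarrow> u 0 = on_axis x \<and>
    (\<forall>s\<in>{0..\<sigma>+1}. (u has_vector_derivative X e (t0 + s) (proj s (u s))) (at s within {0..\<sigma>+1}))"

text \<open>Solving the truncated field, \<open>sol\<close> exists up to time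
  \<open>\<sigma> + 1\<close> from every point of the axis, so it can be evaluated and is continuous
  in its data before anything is known about its position. It solves the true system while it stays
  in the tube, see \<open>sol_solves\<close>.\<close>

definition "sol e t0 x = (SOME u. is_sol e t0 x u)"

lemma sol:
  assumes e: "0 < e" "e < e0" and t0: "t0 \<in> {\<theta>-1..\<theta>+1}"
  shows "sol e t0 x 0 = on_axis x"
    and "\<And>s. s \<in> {0..\<sigma>+1} \<Longrightarrow>
      (sol e t0 x has_vector_derivative X e (t0 + s) (proj s (sol e t0 x s))) (at s within {0..\<sigma>+1})"
proof -
  have "\<exists>u. u 0 = on_axis x \<and> (\<forall>s\<in>{0..\<sigma>+1}. (u has_vector_derivative X e (t0 + s) (proj s (u s))) (at s within {0..\<sigma>+1}))"
  proof (rule global_lipschitz_ode_exists[where f = "\<lambda>s u. X e (t0 + s) (proj s u)" and L = "2 * L"])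
    fix s x y assume s: "s \<in> {0..\<sigma>+1}"
    have "norm (X e (t0 + s) (proj s x) - X e (t0 + s) (proj s y))
        \<le> 2 * L * norm (proj s x - proj s y) + L * e * \<bar>(t0 + s) - (t0 + s)\<bar>"
      using s t0 by (intro X_lip e proj_tube) auto
    also have "\<dots> \<le> 2 * L * norm (x - y)"
      using mult_left_mono[OF proj_lip[of s x y], of "2 * L"] L_nonneg by simp
    finally show "norm (X e (t0 + s) (proj s x) - X e (t0 + s) (proj s y)) \<le> 2 * L * norm (x - y)" .
  qed (use \<sigma>_pos X_continuous[OF e t0] in auto)
  then have "\<exists>u. is_sol e t0 x u" by (simp add: is_sol_def)
  then have "is_sol e t0 x (sol e t0 x)" unfolding sol_def by (rule someI_ex)
  then show "sol e t0 x 0 = on_axis x"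
    and "\<And>s. s \<in> {0..\<sigma>+1} \<Longrightarrow>
      (sol e t0 x has_vector_derivative X e (t0 + s) (proj s (sol e t0 x s))) (at s within {0..\<sigma>+1})"
    unfolding is_sol_def by blast+
qed

lemma sol_speed:
  assumes e: "0 < e" "e < e0" and t0: "t0 \<in> {\<theta>-1..\<theta>+1}" and s: "s \<in> {0..\<sigma>+1}" and s': "s' \<in> {0..\<sigma>+1}"
  shows "norm (sol e t0 x s - sol e t0 x s') \<le> 2 * L * \<bar>s - s'\<bar>"
proof -
  have "norm (sol e t0 x s - sol e t0 x s') \<le> 2 * L * norm (s - s')"
  proof (rule differentiable_bound[of "{0..\<sigma>+1}" "sol e t0 x" "\<lambda>r h. h *\<^sub>R X e (t0 + r) (proj r (sol e t0 x r))"])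
    show "(sol e t0 x has_derivative (\<lambda>h. h *\<^sub>R X e (t0 + r) (proj r (sol e t0 x r)))) (at r within {0..\<sigma>+1})"
      if "r \<in> {0..\<sigma>+1}" for r
      using sol(2)[OF e t0 that] by (simp add: has_vector_derivative_def)
    show "onorm (\<lambda>h. h *\<^sub>R X e (t0 + r) (proj r (sol e t0 x r))) \<le> 2 * L" if "r \<in> {0..\<sigma>+1}" for r
    proof (rule onorm_le)
      fix h :: real
      have "norm (X e (t0 + r) (proj r (sol e t0 x r))) \<le> 2 * L"
        using that t0 by (intro X_bound e proj_tube) auto
      then show "norm (h *\<^sub>R X e (t0 + r) (proj r (sol e t0 x r))) \<le> 2 * L * norm h"
        by (simp add: mult.commute mult_left_mono)
    qed
  qed (use s s' in auto)
  then show ?thesis by simp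
qed

text \<open>The Gronwall constant for an initial error \<open>B * e\<close> and a field error
  \<open>L * e\<close>.\<close>

definition C1 :: "real \<Rightarrow> real" where "C1 B = (B + L * \<sigma>) * exp (L * \<sigma>)"

lemma C1_nonneg: "0 \<le> B \<Longrightarrow> 0 \<le> C1 B"
  using L_nonneg \<sigma>_pos by (simp add: C1_def)

lemma sol_near:
  assumes e: "0 < e" "e < e0" and t0: "t0 \<in> {\<theta>-1..\<theta>+1}" and \<xi>: "\<bar>\<xi>\<bar> \<le> B" and s: "s \<in> {0..\<sigma>}"
  shows "norm (sol e t0 (xv + e * \<xi>) s - \<gamma> s) \<le> C1 B * e"
proof -
  let ?u = "sol e t0 (xv + e * \<xi>)"
  have B: "0 \<le> B" using \<xi> by linarith
  have "norm (?u s - \<gamma> s) \<le> (norm (?u 0 - \<gamma> 0) + (L * e) * \<sigma>) * exp (L * \<sigma>)"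
  proof (rule gronwall[where e' = "\<lambda>s. X e (t0 + s) (proj s (?u s)) - F (\<gamma> s)"])
    fix r assume r: "r \<in> {0..\<sigma>}"
    have "(?u has_vector_derivative X e (t0 + r) (proj r (?u r))) (at r within {0..\<sigma>})"
      by (rule has_vector_derivative_within_subset[OF sol(2)[OF e t0]]) (use r in auto)
    then show "((\<lambda>s. ?u s - \<gamma> s) has_vector_derivative X e (t0 + r) (proj r (?u r)) - F (\<gamma> r)) (at r within {0..\<sigma>})"
      by (intro has_vector_derivative_diff \<gamma>_deriv r)
    have r0: "0 \<le> r" using r by simp
    have "norm (F (proj r (?u r)) - F (\<gamma> r)) \<le> L * norm (proj r (?u r) - \<gamma> r)"
      by (intro F_lip proj_tube \<gamma>_tube r r0)
    \<comment> \<open>\<open>proj\<close> is nonexpansive and fixes \<open>\<gamma> r\<close>, so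
      the comparison closes before the solution is known to stay in the tube.\<close>
    also have "proj r (\<gamma> r) = \<gamma> r" using center_eq[OF r] \<delta>_pos by (intro proj_id) simp
    then have "norm (proj r (?u r) - \<gamma> r) \<le> norm (?u r - \<gamma> r)" using proj_lip[of r "?u r" "\<gamma> r"] by simp
    then have "L * norm (proj r (?u r) - \<gamma> r) \<le> L * norm (?u r - \<gamma> r)" using L_nonneg by (rule mult_left_mono)
    finally have a: "norm (F (proj r (?u r)) - F (\<gamma> r)) \<le> L * norm (?u r - \<gamma> r)" .
    have b: "norm (X e (t0 + r) (proj r (?u r)) - F (proj r (?u r))) \<le> L * e"
      using r t0 by (intro X_F e proj_tube) auto
    show "norm (X e (t0 + r) (proj r (?u r)) - F (\<gamma> r)) \<le> L * norm (?u r - \<gamma> r) + L * e"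
      using norm_triangle_ineq[of "F (proj r (?u r)) - F (\<gamma> r)" "X e (t0 + r) (proj r (?u r)) - F (proj r (?u r))"] a b
      by simp
  qed (use \<sigma>_pos L_nonneg e s in auto)
  also have "norm (?u 0 - \<gamma> 0) = e * \<bar>\<xi>\<bar>"
    using e by (simp add: sol(1)[OF e t0] \<gamma>_0 on_axis_diff[symmetric] abs_mult)
  also have "(e * \<bar>\<xi>\<bar> + (L * e) * \<sigma>) * exp (L * \<sigma>) \<le> (e * B + (L * e) * \<sigma>) * exp (L * \<sigma>)"
    using e \<xi> by (intro mult_right_mono[of _ _ "exp _"] add_right_mono mult_left_mono) auto
  also have "\<dots> = C1 B * e" by (simp add: C1_def algebra_simps)
  finally show ?thesis .
qed

text \<open>Speeds are at most \<open>2 * L\<close>, so within \<open>overtime\<close> a solution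
  drifts by at most \<open>\<delta> / 2\<close>; the other half of \<open>\<delta>\<close> is left
  for the deviation from \<open>\<gamma>\<close> at time \<open>\<sigma>\<close>.\<close>

definition overtime :: real where "overtime = min 1 (\<delta> / (4 * L + 1))"

lemma overtime: "0 < overtime" "overtime \<le> 1" "2 * L * overtime \<le> \<delta> / 2"
proof -
  show "0 < overtime" "overtime \<le> 1" using \<delta>_pos L_nonneg by (auto simp: overtime_def)
  have "2 * L * overtime \<le> 2 * L * (\<delta> / (4 * L + 1))"
    using L_nonneg by (intro mult_left_mono) (auto simp: overtime_def)
  also have "\<dots> \<le> \<delta> / 2" using L_nonneg \<delta>_pos by (simp add: field_simps)
  finally show "2 * L * overtime \<le> \<delta> / 2" .
qed

lemma sol_center:
  assumes e: "0 < e" "e < e0" and t0: "t0 \<in> {\<theta>-1..\<theta>+1}" and \<xi>: "\<bar>\<xi>\<bar> \<le> B" and small: "C1 B * e \<le> \<delta> / 2"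
    and s: "s \<in> {0..\<sigma> + overtime}"
  shows "norm (sol e t0 (xv + e * \<xi>) s - center s) \<le> \<delta>"
proof (cases "s \<le> \<sigma>")
  case True
  then have "s \<in> {0..\<sigma>}" using s by simp
  then show ?thesis using sol_near[OF e t0 \<xi>, of s] small \<delta>_pos center_eq[of s] by auto
next
  case False
  let ?u = "sol e t0 (xv + e * \<xi>)"
  have "norm (?u s - ?u \<sigma>) \<le> 2 * L * \<bar>s - \<sigma>\<bar>"
    using s False \<sigma>_pos overtime by (intro sol_speed e t0) auto
  also have "\<dots> \<le> 2 * L * overtime" using False s L_nonneg by (intro mult_left_mono) auto
  finally have "norm (?u s - ?u \<sigma>) \<le> \<delta> / 2" using overtime by simp
  moreover have "norm (?u \<sigma> - \<gamma> \<sigma>) \<le> \<delta> / 2" using sol_near[OF e t0 \<xi>, of \<sigma>] small \<sigma>_pos by auto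
  moreover have "center s = \<gamma> \<sigma>" using False by (simp add: center_def)
  ultimately show ?thesis using norm_triangle_ineq[of "?u s - ?u \<sigma>" "?u \<sigma> - \<gamma> \<sigma>"] by simp
qed

lemma sol_solves:
  assumes e: "0 < e" "e < e0" and t0: "t0 \<in> {\<theta>-1..\<theta>+1}" and \<xi>: "\<bar>\<xi>\<bar> \<le> B" and small: "C1 B * e \<le> \<delta> / 2"
    and s: "s \<in> {0..\<sigma> + overtime}"
  shows "sol e t0 (xv + e * \<xi>) s \<in> tube \<delta>"
    and "(sol e t0 (xv + e * \<xi>) has_vector_derivative X e (t0 + s) (sol e t0 (xv + e * \<xi>) s)) (at s within {0..\<sigma> + overtime})"
proof -
  let ?u = "sol e t0 (xv + e * \<xi>)"
  have c: "norm (?u s - center s) \<le> \<delta>" by (rule sol_center[OF assms])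
  then show "?u s \<in> tube \<delta>" using s by (intro center_tube) auto
  have "(?u has_vector_derivative X e (t0 + s) (proj s (?u s))) (at s within {0..\<sigma> + overtime})"
    by (rule has_vector_derivative_within_subset[OF sol(2)[OF e t0]]) (use s overtime in auto)
  then show "(?u has_vector_derivative X e (t0 + s) (?u s)) (at s within {0..\<sigma> + overtime})"
    using proj_id[OF c] by simp
qed

text \<open>\<open>Y \<sigma> (J t)\<close> is the displacement of the arrival caused to first order
  by the perturbation. The difference of the two such integrals gives the Melnikov function, their
  sum gives \<open>g_number\<close>.\<close>

definition J :: "real \<Rightarrow> real^2" where
  "J t = integral {0..\<sigma>} (\<lambda>s. Z s (g (t + s) (\<gamma> s)))"

definition \<omega> :: "real \<Rightarrow> real \<Rightarrow> real^2" where
  "\<omega> t \<xi> = Y \<sigma> (on_axis \<xi> + J t)"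

section \<open>First-order expansion of the perturbed orbits at arrival\<close>

lemma g_\<gamma>_continuous:
  assumes t0: "t0 \<in> {\<theta>-1..\<theta>+1}"
  shows "continuous_on {0..\<sigma>} (\<lambda>s. g (t0 + s) (\<gamma> s))"
proof -
  have "(L + L)-lipschitz_on ({\<theta>-2..\<theta>+\<sigma>+3} \<times> tube \<delta>) (\<lambda>(t, z). g t z)"
  proof (rule lipschitz_onI; clarify?)
    fix t z t' z' assume H: "t \<in> {\<theta>-2..\<theta>+\<sigma>+3}" "z \<in> tube \<delta>" "t' \<in> {\<theta>-2..\<theta>+\<sigma>+3}" "z' \<in> tube \<delta>"
    have "norm (g t z - g t' z') \<le> L * (\<bar>t - t'\<bar> + norm (z - z'))"
      by (rule g_lip[OF H(1,3,2,4)])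
    also have "\<dots> \<le> L * (dist (t, z) (t', z') + dist (t, z) (t', z'))"
      using L_nonneg dist_fst_le[of "(t, z)" "(t', z')"] dist_snd_le[of "(t, z)" "(t', z')"]
      by (intro add_mono mult_left_mono) (auto simp: dist_norm)
    finally show "dist (g t z) (g t' z') \<le> (L + L) * dist (t, z) (t', z')"
      by (simp add: dist_norm algebra_simps)
  qed (use L_nonneg in auto)
  then have "continuous_on ({\<theta>-2..\<theta>+\<sigma>+3} \<times> tube \<delta>) (\<lambda>(t, z). g t z)"
    by (rule lipschitz_on_continuous_on)
  then have "continuous_on {0..\<sigma>} (\<lambda>s. (\<lambda>(t, z). g t z) (t0 + s, \<gamma> s))"
    by (rule continuous_on_compose2) (use t0 \<gamma>_tube in \<open>auto intro!: continuous_intros \<gamma>_continuous\<close>)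
  then show ?thesis by simp
qed

text \<open>Gronwall is applied to the deviation of \<open>sol\<close> from
  \<open>\<gamma> s + e *\<^sub>R w s\<close>, with \<open>w\<close> the inhomogeneous variational
  solution. The deviation is zero at the start and its defect is quadratic in
  \<open>e\<close>.\<close>

lemma sol_first_order_exists:
  assumes B: "0 \<le> B"
  shows "\<exists>C\<ge>0. \<forall>e t0 \<xi>. 0 < e \<and> e < e0 \<and> t0 \<in> {\<theta>-1..\<theta>+1} \<and> \<bar>\<xi>\<bar> \<le> B \<and> C1 B * e \<le> \<delta> / 2 \<longrightarrow>
    norm (sol e t0 (xv + e * \<xi>) \<sigma> - \<gamma> \<sigma> - e *\<^sub>R \<omega> t0 \<xi>) \<le> C * e\<^sup>2"
proof -
  define C where "C = (L * (C1 B)\<^sup>2 + L * C1 B + L) * \<sigma> * exp (L * \<sigma>)"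
  have C: "0 \<le> C" unfolding C_def using L_nonneg C1_nonneg[OF B] \<sigma>_pos by (intro mult_nonneg_nonneg add_nonneg_nonneg) auto
  have "norm (sol e t0 (xv + e * \<xi>) \<sigma> - \<gamma> \<sigma> - e *\<^sub>R \<omega> t0 \<xi>) \<le> C * e\<^sup>2"
    if e: "0 < e" "e < e0" and t0: "t0 \<in> {\<theta>-1..\<theta>+1}" and \<xi>: "\<bar>\<xi>\<bar> \<le> B" and small: "C1 B * e \<le> \<delta> / 2" for e t0 \<xi>
  proof -
    let ?u = "sol e t0 (xv + e * \<xi>)"
    obtain w where w: "w 0 = on_axis \<xi>"
      "\<And>s. s \<in> {0..\<sigma>} \<Longrightarrow> (w has_vector_derivative DF (\<gamma> s) (w s) + g (t0 + s) (\<gamma> s)) (at s within {0..\<sigma>})"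
      using variational_exists[OF g_\<gamma>_continuous[OF t0], of "on_axis \<xi>"] by blast
    have w\<sigma>: "w \<sigma> = \<omega> t0 \<xi>"
      using variation_of_constants[OF w(2), of \<sigma>] \<sigma>_pos w(1) by (simp add: \<omega>_def J_def)
    have "norm (?u \<sigma> - \<gamma> \<sigma> - e *\<^sub>R w \<sigma>) \<le>
      (norm (?u 0 - \<gamma> 0 - e *\<^sub>R w 0) + ((L * (C1 B)\<^sup>2 + L * C1 B + L) * e\<^sup>2) * \<sigma>) * exp (L * \<sigma>)"
    proof (rule gronwall[where e' = "\<lambda>s. X e (t0 + s) (?u s) - F (\<gamma> s) - e *\<^sub>R (DF (\<gamma> s) (w s) + g (t0 + s) (\<gamma> s))"])
      fix r assume r: "r \<in> {0..\<sigma>}"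
      have ro: "r \<in> {0..\<sigma> + overtime}" using r overtime by auto
      have "(?u has_vector_derivative X e (t0 + r) (?u r)) (at r within {0..\<sigma>})"
        by (rule has_vector_derivative_within_subset[OF sol_solves(2)[OF e t0 \<xi> small ro]])
          (use overtime in auto)
      then show "((\<lambda>s. ?u s - \<gamma> s - e *\<^sub>R w s) has_vector_derivative
        X e (t0 + r) (?u r) - F (\<gamma> r) - e *\<^sub>R (DF (\<gamma> r) (w r) + g (t0 + r) (\<gamma> r))) (at r within {0..\<sigma>})"
        by (intro has_vector_derivative_diff \<gamma>_deriv r w(2)
            bounded_linear.has_vector_derivative[OF bounded_linear_scaleR_right])
      define v where "v = ?u r - \<gamma> r"
      have v: "norm v \<le> C1 B * e" unfolding v_def by (rule sol_near[OF e t0 \<xi> r])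
      have ur: "?u r = \<gamma> r + v" by (simp add: v_def)
      have tm: "t0 + r \<in> {\<theta>-2..\<theta>+\<sigma>+3}" using t0 r by auto
      have utube: "\<gamma> r + v \<in> tube \<delta>" using sol_solves(1)[OF e t0 \<xi> small ro] by (simp add: ur)
      have t1: "norm (F (\<gamma> r + v) - F (\<gamma> r) - DF (\<gamma> r) v) \<le> L * (C1 B * e)\<^sup>2"
      proof (rule order_trans[OF F_taylor[OF r]])
        show "norm v \<le> \<delta>" using v small \<delta>_pos by linarith
        show "L * (norm v)\<^sup>2 \<le> L * (C1 B * e)\<^sup>2"
          using v L_nonneg by (intro mult_left_mono power_mono) auto
      qed
      have t2: "norm (DF (\<gamma> r) (v - e *\<^sub>R w r)) \<le> L * norm (v - e *\<^sub>R w r)"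
        by (intro DF_bound \<gamma>_tube r)
      have t3: "norm (e *\<^sub>R (k e (t0 + r) (\<gamma> r + v) - k e (t0 + r) (\<gamma> r))) \<le> e * (L * (C1 B * e))"
      proof -
        have "norm (k e (t0 + r) (\<gamma> r + v) - k e (t0 + r) (\<gamma> r)) \<le> L * (\<bar>(t0 + r) - (t0 + r)\<bar> + norm ((\<gamma> r + v) - \<gamma> r))"
          by (intro k_lip e tm utube \<gamma>_tube r)
        also have "\<dots> \<le> L * (C1 B * e)" using v L_nonneg by (intro mult_left_mono) auto
        finally show ?thesis using e by simp
      qed
      have t4: "norm (e *\<^sub>R (k e (t0 + r) (\<gamma> r) - g (t0 + r) (\<gamma> r))) \<le> e * (L * e)"
        using k_g[OF e tm \<gamma>_tube[OF r]] e by simp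
      have lin: "DF (\<gamma> r) (v - e *\<^sub>R w r) = DF (\<gamma> r) v - e *\<^sub>R DF (\<gamma> r) (w r)"
        using DF_linear[OF \<gamma>_in_D[OF r]] by (simp add: linear_diff linear_scale)
      \<comment> \<open>Four contributions: the Taylor remainder of \<open>F\<close>, the linear
        term that Gronwall absorbs, the displaced argument of \<open>k\<close>, and the replacement
        of \<open>k\<close> by \<open>g\<close>.\<close>
      have split: "X e (t0 + r) (?u r) - F (\<gamma> r) - e *\<^sub>R (DF (\<gamma> r) (w r) + g (t0 + r) (\<gamma> r))
        = (F (\<gamma> r + v) - F (\<gamma> r) - DF (\<gamma> r) v) + DF (\<gamma> r) (v - e *\<^sub>R w r)
          + (e *\<^sub>R (k e (t0 + r) (\<gamma> r + v) - k e (t0 + r) (\<gamma> r)) + e *\<^sub>R (k e (t0 + r) (\<gamma> r) - g (t0 + r) (\<gamma> r)))"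
        unfolding lin ur X_def by (simp add: algebra_simps)
      have "norm (X e (t0 + r) (?u r) - F (\<gamma> r) - e *\<^sub>R (DF (\<gamma> r) (w r) + g (t0 + r) (\<gamma> r)))
        \<le> (L * (C1 B * e)\<^sup>2 + L * norm (v - e *\<^sub>R w r)) + (e * (L * (C1 B * e)) + e * (L * e))"
        unfolding split
        by (intro order_trans[OF norm_triangle_ineq] add_mono t1 t2 t3 t4)
      then show "norm (X e (t0 + r) (?u r) - F (\<gamma> r) - e *\<^sub>R (DF (\<gamma> r) (w r) + g (t0 + r) (\<gamma> r)))
        \<le> L * norm (?u r - \<gamma> r - e *\<^sub>R w r) + (L * (C1 B)\<^sup>2 + L * C1 B + L) * e\<^sup>2"
        unfolding v_def[symmetric] by (simp add: algebra_simps power2_eq_square)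
    qed (use \<sigma>_pos L_nonneg e C1_nonneg[OF B] in auto)
    moreover have "?u 0 - \<gamma> 0 - e *\<^sub>R w 0 = 0"
      by (simp add: sol(1)[OF e t0] \<gamma>_0 w(1) on_axis_add on_axis_mult)
    ultimately show ?thesis by (simp add: w\<sigma> C_def mult_ac)
  qed
  then show ?thesis using C by blast
qed

text \<open>Near time \<open>\<sigma>\<close> the velocity differs from
  \<open>F (\<gamma> \<sigma>)\<close> by O(e), over a time of length O(e); so shifting the arrival
  by \<open>e * \<tau>\<close> adds \<open>e * \<tau>\<close> times that vector up to a quadratic
  error.\<close>

lemma sol_expansion:
  assumes B: "0 \<le> B"
  shows "\<exists>C\<ge>0. \<forall>e t0 \<xi> \<tau>. 0 < e \<and> e < e0 \<and> t0 \<in> {\<theta>-1..\<theta>+1} \<and> \<bar>\<xi>\<bar> \<le> B \<and> \<bar>\<tau>\<bar> \<le> B \<and> C1 B * e \<le> \<delta> / 2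
      \<and> e * B \<le> overtime \<and> e * B \<le> \<sigma> \<longrightarrow>
    norm (sol e t0 (xv + e * \<xi>) (\<sigma> + e * \<tau>) - (\<gamma> \<sigma> + e *\<^sub>R (\<omega> t0 \<xi> + \<tau> *\<^sub>R F (\<gamma> \<sigma>)))) \<le> C * e\<^sup>2"
proof -
  obtain C where C: "0 \<le> C" "\<And>e t0 \<xi>. 0 < e \<Longrightarrow> e < e0 \<Longrightarrow> t0 \<in> {\<theta>-1..\<theta>+1} \<Longrightarrow> \<bar>\<xi>\<bar> \<le> B \<Longrightarrow> C1 B * e \<le> \<delta> / 2 \<Longrightarrow>
    norm (sol e t0 (xv + e * \<xi>) \<sigma> - \<gamma> \<sigma> - e *\<^sub>R \<omega> t0 \<xi>) \<le> C * e\<^sup>2"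
    using sol_first_order_exists[OF B] by blast
  define K where "K = L + L * (2 * L * B + C1 B)"
  have K: "0 \<le> K" unfolding K_def using L_nonneg B C1_nonneg[OF B] by simp
  have "norm (sol e t0 (xv + e * \<xi>) (\<sigma> + e * \<tau>) - (\<gamma> \<sigma> + e *\<^sub>R (\<omega> t0 \<xi> + \<tau> *\<^sub>R F (\<gamma> \<sigma>)))) \<le> (C + B * K) * e\<^sup>2"
    if e: "0 < e" "e < e0" and t0: "t0 \<in> {\<theta>-1..\<theta>+1}" and \<xi>: "\<bar>\<xi>\<bar> \<le> B" and \<tau>: "\<bar>\<tau>\<bar> \<le> B"
      and small: "C1 B * e \<le> \<delta> / 2" and e1: "e * B \<le> overtime" and e2: "e * B \<le> \<sigma>" for e t0 \<xi> \<tau>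
  proof -
    let ?u = "sol e t0 (xv + e * \<xi>)"
    let ?S = "{\<sigma> - e * B..\<sigma> + e * B}"
    let ?q = "F (\<gamma> \<sigma>)"
    have eB: "0 \<le> e * B" using e B by simp
    have e\<tau>: "\<bar>e * \<tau>\<bar> \<le> e * B" using \<tau> e by (simp add: abs_mult)
    \<comment> \<open>Subtracting the uniform motion \<open>s *\<^sub>R ?q\<close> leaves the mean
      value inequality with nothing but the deviation of the velocity.\<close>
    have "norm ((?u (\<sigma> + e * \<tau>) - (\<sigma> + e * \<tau>) *\<^sub>R ?q) - (?u \<sigma> - \<sigma> *\<^sub>R ?q)) \<le> (K * e) * norm ((\<sigma> + e * \<tau>) - \<sigma>)"
    proof (rule differentiable_bound[of ?S "\<lambda>s. ?u s - s *\<^sub>R ?q" "\<lambda>s h. h *\<^sub>R (X e (t0 + s) (?u s) - ?q)"])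
      fix s assume s: "s \<in> ?S"
      have so: "s \<in> {0..\<sigma> + overtime}" and s1: "s \<in> {0..\<sigma>+1}" using s e1 e2 overtime by auto
      have "(?u has_vector_derivative X e (t0 + s) (?u s)) (at s within ?S)"
        by (rule has_vector_derivative_within_subset[OF sol_solves(2)[OF e t0 \<xi> small so]])
          (use e1 e2 in auto)
      then have "((\<lambda>s. ?u s - s *\<^sub>R ?q) has_vector_derivative X e (t0 + s) (?u s) - 1 *\<^sub>R ?q) (at s within ?S)"
        by (intro has_vector_derivative_diff bounded_linear.has_vector_derivative[OF bounded_linear_scaleR_left] has_vector_derivative_id)
      then show "((\<lambda>s. ?u s - s *\<^sub>R ?q) has_derivative (\<lambda>h. h *\<^sub>R (X e (t0 + s) (?u s) - ?q))) (at s within ?S)"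
        by (simp add: has_vector_derivative_def)
      have ut: "?u s \<in> tube \<delta>" by (rule sol_solves(1)[OF e t0 \<xi> small so])
      have a: "norm (X e (t0 + s) (?u s) - F (?u s)) \<le> L * e"
        using t0 s1 by (intro X_F e ut) auto
      have "norm (?u s - \<gamma> \<sigma>) \<le> norm (?u s - ?u \<sigma>) + norm (?u \<sigma> - \<gamma> \<sigma>)"
        using norm_triangle_ineq[of "?u s - ?u \<sigma>" "?u \<sigma> - \<gamma> \<sigma>"] by simp
      also have "\<dots> \<le> 2 * L * \<bar>s - \<sigma>\<bar> + C1 B * e"
        using \<sigma>_pos s1 by (intro add_mono sol_speed sol_near e t0 \<xi>) auto
      also have "\<dots> \<le> 2 * L * (e * B) + C1 B * e"
        using s L_nonneg by (intro add_right_mono mult_left_mono) auto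
      finally have b: "norm (?u s - \<gamma> \<sigma>) \<le> (2 * L * B + C1 B) * e" by (simp add: algebra_simps)
      have "norm (F (?u s) - ?q) \<le> L * norm (?u s - \<gamma> \<sigma>)" using \<sigma>_pos by (intro F_lip ut \<gamma>_tube) auto
      also have "\<dots> \<le> L * ((2 * L * B + C1 B) * e)" by (intro mult_left_mono b L_nonneg)
      finally have "norm (X e (t0 + s) (?u s) - ?q) \<le> K * e"
        using a norm_triangle_ineq[of "X e (t0 + s) (?u s) - F (?u s)" "F (?u s) - ?q"]
        by (simp add: K_def algebra_simps)
      then show "onorm (\<lambda>h. h *\<^sub>R (X e (t0 + s) (?u s) - ?q)) \<le> K * e"
        by (intro onorm_le) (simp add: mult.commute mult_left_mono)
    qed (use e\<tau> eB in auto)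
    also have "(K * e) * norm ((\<sigma> + e * \<tau>) - \<sigma>) \<le> (K * e) * (e * B)"
      using e\<tau> K e by (intro mult_left_mono) auto
    finally have 1: "norm ((?u (\<sigma> + e * \<tau>) - (\<sigma> + e * \<tau>) *\<^sub>R ?q) - (?u \<sigma> - \<sigma> *\<^sub>R ?q)) \<le> B * K * e\<^sup>2"
      by (simp add: power2_eq_square mult_ac)
    have eq: "?u (\<sigma> + e * \<tau>) - (\<gamma> \<sigma> + e *\<^sub>R (\<omega> t0 \<xi> + \<tau> *\<^sub>R ?q))
      = ((?u (\<sigma> + e * \<tau>) - (\<sigma> + e * \<tau>) *\<^sub>R ?q) - (?u \<sigma> - \<sigma> *\<^sub>R ?q)) + (?u \<sigma> - \<gamma> \<sigma> - e *\<^sub>R \<omega> t0 \<xi>)"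
      by (simp add: algebra_simps)
    have "norm (?u (\<sigma> + e * \<tau>) - (\<gamma> \<sigma> + e *\<^sub>R (\<omega> t0 \<xi> + \<tau> *\<^sub>R ?q))) \<le> B * K * e\<^sup>2 + C * e\<^sup>2"
      unfolding eq by (intro order_trans[OF norm_triangle_ineq] add_mono 1 C(2) e t0 \<xi> small)
    then show ?thesis by (simp add: algebra_simps)
  qed
  moreover have "0 \<le> C + B * K" using C B K by simp
  ultimately show ?thesis by blast
qed

text \<open>The constant may depend on \<open>e\<close>: what is wanted is continuity in the data at
  fixed \<open>e\<close>, for the fixed point argument.\<close>

lemma sol_lipschitz:
  assumes e: "0 < e" "e < e0"
  shows "\<exists>M\<ge>0. \<forall>t\<in>{\<theta>-1..\<theta>+1}. \<forall>t'\<in>{\<theta>-1..\<theta>+1}. \<forall>s\<in>{0..\<sigma>+1}. \<forall>s'\<in>{0..\<sigma>+1}. \<forall>x x'.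
    norm (sol e t x s - sol e t' x' s') \<le> M * (\<bar>t - t'\<bar> + \<bar>x - x'\<bar> + \<bar>s - s'\<bar>)"
proof -
  have Le: "0 \<le> L * e" using L_nonneg e by simp
  define E where "E = exp (2 * L * (\<sigma>+1))"
  define M where "M = max (L * e * (\<sigma>+1) * E) (max E (2 * L))"
  have M: "L * e * (\<sigma>+1) * E \<le> M" "E \<le> M" "2 * L \<le> M" by (auto simp: M_def)
  have M0: "0 \<le> M" using M(3) L_nonneg by linarith
  have "norm (sol e t x s - sol e t' x' s') \<le> M * (\<bar>t - t'\<bar> + \<bar>x - x'\<bar> + \<bar>s - s'\<bar>)"
    if t: "t \<in> {\<theta>-1..\<theta>+1}" and t': "t' \<in> {\<theta>-1..\<theta>+1}" and s: "s \<in> {0..\<sigma>+1}" and s': "s' \<in> {0..\<sigma>+1}" for t t' s s' x x'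
  proof -
    have "norm (sol e t x s - sol e t' x' s) \<le> (norm (sol e t x 0 - sol e t' x' 0) + (L * e * \<bar>t - t'\<bar>) * (\<sigma>+1)) * exp (2 * L * (\<sigma>+1))"
    proof (rule gronwall[where e' = "\<lambda>r. X e (t + r) (proj r (sol e t x r)) - X e (t' + r) (proj r (sol e t' x' r))"])
      fix r assume r: "r \<in> {0..\<sigma>+1}"
      show "((\<lambda>r. sol e t x r - sol e t' x' r) has_vector_derivative
        X e (t + r) (proj r (sol e t x r)) - X e (t' + r) (proj r (sol e t' x' r))) (at r within {0..\<sigma>+1})"
        by (intro has_vector_derivative_diff sol e t t' r)
      have "norm (X e (t + r) (proj r (sol e t x r)) - X e (t' + r) (proj r (sol e t' x' r)))
        \<le> 2 * L * norm (proj r (sol e t x r) - proj r (sol e t' x' r)) + L * e * \<bar>(t + r) - (t' + r)\<bar>"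
        using r t t' by (intro X_lip e proj_tube) auto
      also have "\<dots> \<le> 2 * L * norm (sol e t x r - sol e t' x' r) + L * e * \<bar>t - t'\<bar>"
        using L_nonneg Le by (intro add_mono mult_left_mono proj_lip) auto
      finally show "norm (X e (t + r) (proj r (sol e t x r)) - X e (t' + r) (proj r (sol e t' x' r)))
        \<le> 2 * L * norm (sol e t x r - sol e t' x' r) + L * e * \<bar>t - t'\<bar>" .
    qed (use s L_nonneg Le \<sigma>_pos in \<open>auto intro!: mult_nonneg_nonneg\<close>)
    also have "norm (sol e t x 0 - sol e t' x' 0) = \<bar>x - x'\<bar>"
      by (simp add: sol(1)[OF e t] sol(1)[OF e t'] on_axis_diff[symmetric])
    also have "(\<bar>x - x'\<bar> + (L * e * \<bar>t - t'\<bar>) * (\<sigma>+1)) * exp (2 * L * (\<sigma>+1))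
        = E * \<bar>x - x'\<bar> + (L * e * (\<sigma>+1) * E) * \<bar>t - t'\<bar>"
      by (simp add: E_def algebra_simps)
    also have "\<dots> \<le> M * \<bar>x - x'\<bar> + M * \<bar>t - t'\<bar>"
      by (intro add_mono mult_right_mono M) auto
    finally have 1: "norm (sol e t x s - sol e t' x' s) \<le> M * \<bar>x - x'\<bar> + M * \<bar>t - t'\<bar>" .
    have "norm (sol e t' x' s - sol e t' x' s') \<le> 2 * L * \<bar>s - s'\<bar>" by (intro sol_speed e t' s s')
    also have "\<dots> \<le> M * \<bar>s - s'\<bar>" by (intro mult_right_mono M) auto
    finally show ?thesis
      using 1 norm_triangle_ineq[of "sol e t x s - sol e t' x' s" "sol e t' x' s - sol e t' x' s'"]
      by (simp add: algebra_simps)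
  qed
  then show ?thesis using M0 by blast
qed

lemma sol_continuous:
  assumes e: "0 < e" "e < e0"
  shows "continuous_on ({\<theta>-1..\<theta>+1} \<times> UNIV \<times> {0..\<sigma>+1}) (\<lambda>(t, x, s). sol e t x s)"
proof -
  obtain M where M: "0 \<le> M" "\<And>t t' s s' x x'. t \<in> {\<theta>-1..\<theta>+1} \<Longrightarrow> t' \<in> {\<theta>-1..\<theta>+1} \<Longrightarrow> s \<in> {0..\<sigma>+1} \<Longrightarrow> s' \<in> {0..\<sigma>+1}
    \<Longrightarrow> norm (sol e t x s - sol e t' x' s') \<le> M * (\<bar>t - t'\<bar> + \<bar>x - x'\<bar> + \<bar>s - s'\<bar>)"
    using sol_lipschitz[OF e] by blast
  have "(3 * M)-lipschitz_on ({\<theta>-1..\<theta>+1} \<times> UNIV \<times> {0..\<sigma>+1}) (\<lambda>(t, x, s). sol e t x s)"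
  proof (rule lipschitz_onI; clarify?)
    fix t x s t' x' s' :: real assume H: "t \<in> {\<theta>-1..\<theta>+1}" "s \<in> {0..\<sigma>+1}" "t' \<in> {\<theta>-1..\<theta>+1}" "s' \<in> {0..\<sigma>+1}"
    let ?p = "(t, x, s)" and ?p' = "(t', x', s')"
    have d: "\<bar>t - t'\<bar> \<le> dist ?p ?p'" "\<bar>x - x'\<bar> \<le> dist ?p ?p'" "\<bar>s - s'\<bar> \<le> dist ?p ?p'"
      using dist_fst_le[of ?p ?p'] dist_snd_le[of ?p ?p'] dist_fst_le[of "(x, s)" "(x', s')"] dist_snd_le[of "(x, s)" "(x', s')"]
      by (auto simp: dist_real_def)
    have "norm (sol e t x s - sol e t' x' s') \<le> M * (\<bar>t - t'\<bar> + \<bar>x - x'\<bar> + \<bar>s - s'\<bar>)"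
      by (rule M(2)[OF H(1,3,2,4)])
    also have "\<dots> \<le> M * (3 * dist ?p ?p')" using d M(1) by (intro mult_left_mono) auto
    finally show "dist (sol e t x s) (sol e t' x' s') \<le> 3 * M * dist ?p ?p'" by (simp add: dist_norm)
  qed (use M in auto)
  then show ?thesis by (rule lipschitz_on_continuous_on)
qed

lemma Z_bound: "\<exists>B\<ge>0. \<forall>s\<in>{0..\<sigma>}. \<forall>v. norm (Z s v) \<le> B * norm v"
proof -
  have "\<exists>B. \<forall>s\<in>{0..\<sigma>}. norm (adj h s) \<le> B" for h
    using compact_imp_bounded[OF compact_continuous_image[OF adj_continuous[of h]]] by (auto simp: bounded_iff)
  then obtain B where B: "\<And>h s. s \<in> {0..\<sigma>} \<Longrightarrow> norm (adj h s) \<le> B h" by metis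
  have B0: "0 \<le> B h" for h by (rule order_trans[OF norm_ge_zero B[of 0]]) (use \<sigma>_pos in simp)
  have "norm (Z s v) \<le> (B (axis 1 1) + B (axis 2 1)) * norm v" if s: "s \<in> {0..\<sigma>}" for s v
  proof -
    have "norm (Z s v) \<le> \<bar>adj (axis 1 1) s \<bullet> v\<bar> + \<bar>adj (axis 2 1) s \<bullet> v\<bar>"
      unfolding Z_eq by (rule order_trans[OF norm_triangle_ineq]) simp
    also have "\<dots> \<le> norm (adj (axis 1 1) s) * norm v + norm (adj (axis 2 1) s) * norm v"
      by (intro add_mono Cauchy_Schwarz_ineq2)
    also have "\<dots> \<le> B (axis 1 1) * norm v + B (axis 2 1) * norm v"
      by (intro add_mono mult_right_mono B s) auto
    finally show ?thesis by (simp add: algebra_simps)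
  qed
  moreover have "0 \<le> B (axis 1 1) + B (axis 2 1)" using B0 by simp
  ultimately show ?thesis by blast
qed

lemma J_lip: "\<exists>M\<ge>0. \<forall>t\<in>{\<theta>-1..\<theta>+1}. \<forall>t'\<in>{\<theta>-1..\<theta>+1}. norm (J t - J t') \<le> M * \<bar>t - t'\<bar>"
proof -
  obtain B where B: "0 \<le> B" "\<And>s v. s \<in> {0..\<sigma>} \<Longrightarrow> norm (Z s v) \<le> B * norm v" using Z_bound by blast
  have "norm (J t - J t') \<le> (B * L * \<sigma>) * \<bar>t - t'\<bar>" if t: "t \<in> {\<theta>-1..\<theta>+1}" and t': "t' \<in> {\<theta>-1..\<theta>+1}" for t t'
  proof -
    have int: "(\<lambda>s. Z s (g (r + s) (\<gamma> s))) integrable_on {0..\<sigma>}" if "r \<in> {\<theta>-1..\<theta>+1}" for r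
      by (intro integrable_continuous_real Z_continuous g_\<gamma>_continuous that)
    have "J t - J t' = integral {0..\<sigma>} (\<lambda>s. Z s (g (t + s) (\<gamma> s)) - Z s (g (t' + s) (\<gamma> s)))"
      unfolding J_def by (rule integral_diff[symmetric]) (intro int t t')+
    also have "norm \<dots> \<le> integral {0..\<sigma>} (\<lambda>s. B * L * \<bar>t - t'\<bar>)"
    proof (rule integral_norm_bound_integral)
      fix s assume s: "s \<in> {0..\<sigma>}"
      have "norm (Z s (g (t + s) (\<gamma> s)) - Z s (g (t' + s) (\<gamma> s))) \<le> B * norm (g (t + s) (\<gamma> s) - g (t' + s) (\<gamma> s))"
        unfolding linear_diff[OF linear_Z, symmetric] by (rule B(2)[OF s])
      also have "\<dots> \<le> B * (L * (\<bar>(t + s) - (t' + s)\<bar> + norm (\<gamma> s - \<gamma> s)))"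
        using t t' s by (intro mult_left_mono g_lip \<gamma>_tube B) auto
      finally show "norm (Z s (g (t + s) (\<gamma> s)) - Z s (g (t' + s) (\<gamma> s))) \<le> B * L * \<bar>t - t'\<bar>" by simp
    qed (intro integrable_diff int t t' integrable_const_ivl)+
    finally show ?thesis using \<sigma>_pos by (simp add: mult_ac)
  qed
  moreover have "0 \<le> B * L * \<sigma>" using B L_nonneg \<sigma>_pos by simp
  ultimately show ?thesis by blast
qed

end

section \<open>The sign of the second component along a perturbed orbit\<close>

lemma increment_le_of_derivative_le:
  fixes h :: "real \<Rightarrow> real"
  assumes ab: "a \<le> b"
    and der: "\<And>s. s \<in> {a..b} \<Longrightarrow> (h has_real_derivative h' s) (at s within {a..b})"
    and le: "\<And>s. s \<in> {a<..<b} \<Longrightarrow> h' s \<le> c"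
  shows "h b - h a \<le> c * (b - a)"
proof -
  have "h b - c * b \<le> h a - c * a"
  proof (rule DERIV_nonpos_imp_decreasing_open[OF ab, where f = "\<lambda>s. h s - c * s"])
    fix s assume s: "a < s" "s < b"
    have "((\<lambda>s. h s - c * s) has_real_derivative h' s - c) (at s)"
      using der[of s] s by (auto intro!: derivative_eq_intros simp: at_within_Icc_at)
    then show "\<exists>y. ((\<lambda>s. h s - c * s) has_real_derivative y) (at s) \<and> y \<le> 0"
      using le[of s] s by (intro exI[of _ "h' s - c"]) auto
  next
    have "continuous_on {a..b} h" by (rule DERIV_continuous_on) (rule der)
    then show "continuous_on {a..b} (\<lambda>s. h s - c * s)" by (intro continuous_intros)
  qed
  then show ?thesis by (simp add: algebra_simps)
qed

lemma has_vector_derivative_nth: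
  "(u has_vector_derivative (u' :: real^2)) (at s within S) \<Longrightarrow> ((\<lambda>s. u s $ i) has_real_derivative u' $ i) (at s within S)"
  using bounded_linear.has_vector_derivative[OF bounded_linear_vec_nth]
  by (simp add: has_real_derivative_iff_has_vector_derivative)

lemma abs_nth_le: "\<bar>(v::real^2) $ i\<bar> \<le> norm v"
  by (rule component_le_norm_cart)

context half
begin

text \<open>At the fold \<open>DF\<close> applied to \<open>F\<close> has second component
  \<open>- \<alpha> * b\<close>, so along every orbit starting nearby the vertical speed falls at a
  rate that does not shrink with \<open>e\<close>. A start with vertical speed zero is thus still
  pushed into the lower half-plane.\<close>

lemma X_lower_decreasing:
  shows "\<exists>r>0. \<exists>e1>0. \<forall>e t0 \<xi> s. 0 < e \<and> e < e1 \<and> e < e0 \<and> t0 \<in> {\<theta>-1..\<theta>+1} \<and> \<bar>\<xi>\<bar> \<le> B \<and> C1 B * e \<le> \<delta> / 2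
     \<and> s \<in> {0..r} \<longrightarrow>
    r \<le> \<sigma> \<and> X e (t0 + s) (sol e t0 (xv + e * \<xi>) s) $ 2 \<le> X e t0 (on_axis (xv + e * \<xi>)) $ 2 - (\<alpha> * b / 8) * s"
proof -
  let ?p = "on_axis xv"
  define \<kappa> where "\<kappa> = \<alpha> * b"
  have \<kappa>: "0 < \<kappa>" using \<alpha>_pos b_pos by (simp add: \<kappa>_def)
  have pt: "?p \<in> tube \<delta>" using \<gamma>_tube[of 0] \<sigma>_pos \<gamma>_0 by simp
  have pD: "?p \<in> D" using pt tube_D by blast
  have "DF ?p (F ?p) = (- \<alpha>) *\<^sub>R DF ?p (on_axis 1)"
    unfolding F_start linear_scale[OF DF_linear[OF pD], symmetric] by (simp add: on_axis_mult[symmetric])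
  then have DFp: "DF ?p (F ?p) $ 2 = - \<kappa>" using fold by (simp add: \<kappa>_def)
  \<comment> \<open>Within \<open>r0\<close> of the fold the variation of \<open>DF z (F z)\<close>,
    at most \<open>2 * L\<^sup>2 * r0\<close>, takes no more than a quarter of the rate
    \<open>\<kappa>\<close>.\<close>
  define r0 where "r0 = \<kappa> / (8 * L\<^sup>2 + 1)"
  have r0: "0 < r0" "2 * L\<^sup>2 * r0 \<le> \<kappa> / 4"
    using \<kappa> by (auto simp: r0_def field_simps add_pos_nonneg)
  have near: "DF z (F z) $ 2 \<le> - \<kappa> * 3 / 4" if z: "z \<in> tube \<delta>" and zp: "norm (z - ?p) \<le> r0" for z
  proof -
    have "DF z (F z) - DF ?p (F ?p) = (DF z (F z) - DF ?p (F z)) + DF ?p (F z - F ?p)"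
      using linear_diff[OF DF_linear[OF pD]] by simp
    also have "norm \<dots> \<le> L * norm (z - ?p) * norm (F z) + L * norm (F z - F ?p)"
      by (intro order_trans[OF norm_triangle_ineq] add_mono DF_lip DF_bound z pt)
    also have "\<dots> \<le> L * r0 * L + L * (L * r0)"
      using L_nonneg r0 F_bound[OF z] zp order_trans[OF F_lip[OF z pt] mult_left_mono[OF zp L_nonneg]]
      by (intro add_mono mult_mono mult_left_mono) auto
    finally have "norm (DF z (F z) - DF ?p (F ?p)) \<le> \<kappa> / 4" using r0 by (simp add: power2_eq_square)
    then show ?thesis
      using abs_nth_le[of "DF z (F z) - DF ?p (F ?p)" 2] DFp by simp
  qed
  define r where "r = min \<sigma> (r0 / (4 * L + 1))"
  have r: "0 < r" "r \<le> \<sigma>" "2 * L * r \<le> r0 / 2"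
  proof -
    show "0 < r" "r \<le> \<sigma>" using r0 L_nonneg \<sigma>_pos by (auto simp: r_def)
    have "2 * L * r \<le> 2 * L * (r0 / (4 * L + 1))"
      using L_nonneg by (intro mult_left_mono) (auto simp: r_def)
    also have "\<dots> \<le> r0 / 2" using L_nonneg r0 by (simp add: field_simps)
    finally show "2 * L * r \<le> r0 / 2" .
  qed
  \<comment> \<open>The first bound keeps the start within \<open>r0 / 2\<close> of the fold, the
    second keeps the contribution of the perturbation below \<open>\<kappa> / 8\<close>.\<close>
  define e1 where "e1 = min (r0 / (2 * \<bar>B\<bar> + 1)) (\<kappa> / (8 * (L * (1 + 2 * L) + L\<^sup>2) + 1))"
  have den: "0 < 8 * (L * (1 + 2 * L) + L\<^sup>2) + 1" using L_nonneg by (simp add: add_nonneg_pos)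
  have e1: "0 < e1" using r0 \<kappa> den by (simp add: e1_def add_nonneg_pos)
  have "X e (t0 + s) (sol e t0 (xv + e * \<xi>) s) $ 2 \<le> X e t0 (on_axis (xv + e * \<xi>)) $ 2 - (\<kappa> / 8) * s"
    if e: "0 < e" "e < e1" "e < e0" and t0: "t0 \<in> {\<theta>-1..\<theta>+1}" and \<xi>: "\<bar>\<xi>\<bar> \<le> B" and small: "C1 B * e \<le> \<delta> / 2"
      and s: "s \<in> {0..r}" for e t0 \<xi> s
  proof -
    let ?u = "sol e t0 (xv + e * \<xi>)"
    have eB: "e * B \<le> r0 / 2"
    proof -
      have "e * B \<le> e * \<bar>B\<bar>" using e by (intro mult_left_mono) auto
      also have "\<dots> \<le> (r0 / (2 * \<bar>B\<bar> + 1)) * \<bar>B\<bar>" using e by (intro mult_right_mono) (auto simp: e1_def)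
      also have "\<dots> \<le> r0 / 2" using r0 by (simp add: field_simps)
      finally show ?thesis .
    qed
    have e\<kappa>: "e * (L * (1 + 2 * L)) + L * (L * e) \<le> \<kappa> / 8"
    proof -
      have "e * (8 * (L * (1 + 2 * L) + L\<^sup>2) + 1) \<le> \<kappa>"
        using e den by (simp add: e1_def pos_less_divide_eq less_imp_le)
      then show ?thesis using e by (simp add: algebra_simps power2_eq_square)
    qed
    have in_o: "x \<in> {0..\<sigma> + overtime}" "x \<in> {0..\<sigma>+1}" if "x \<in> {0..s}" for x using that s r overtime by auto
    have tm: "t0 + x \<in> {\<theta>-2..\<theta>+\<sigma>+3}" if "x \<in> {0..s}" for x using that s r t0 by auto
    have u0: "?u 0 = on_axis (xv + e * \<xi>)" by (rule sol(1)[OF e(1,3) t0])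
    have ut: "?u x \<in> tube \<delta>" if "x \<in> {0..s}" for x
      by (rule sol_solves(1)[OF e(1,3) t0 \<xi> small in_o(1)[OF that]])
    have spd: "norm (?u x - ?u 0) \<le> 2 * L * x" if "x \<in> {0..s}" for x
      using sol_speed[OF e(1,3) t0 in_o(2)[OF that], of 0 "xv + e * \<xi>"] \<sigma>_pos that by simp
    have up: "norm (?u x - ?p) \<le> r0" if x: "x \<in> {0..s}" for x
    proof -
      have "norm (?u 0 - ?p) = e * \<bar>\<xi>\<bar>" using e by (simp add: u0 on_axis_diff[symmetric] abs_mult)
      also have "\<dots> \<le> e * B" using e \<xi> by (intro mult_left_mono) auto
      finally have "norm (?u 0 - ?p) \<le> r0 / 2" using eB by simp
      moreover have "2 * L * x \<le> 2 * L * r" using x s L_nonneg by (intro mult_left_mono) auto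
      ultimately show ?thesis
        using spd[OF x] r norm_triangle_ineq[of "?u x - ?u 0" "?u 0 - ?p"] by simp
    qed
    have "F (?u s) $ 2 - F (?u 0) $ 2 \<le> (- \<kappa> * 3 / 4 + L * (L * e)) * (s - 0)"
    proof (rule increment_le_of_derivative_le[where h' = "\<lambda>x. DF (?u x) (X e (t0 + x) (?u x)) $ 2"])
      show "0 \<le> s" using s by simp
      fix x assume x: "x \<in> {0..s}"
      have "(?u has_vector_derivative X e (t0 + x) (?u x)) (at x within {0..s})"
        by (rule has_vector_derivative_within_subset[OF sol_solves(2)[OF e(1,3) t0 \<xi> small in_o(1)[OF x]]])
          (use in_o in blast)
      from vector_derivative_diff_chain_within[OF this has_derivative_at_withinI[OF C2'(1)]]
      have "((F \<circ> ?u) has_vector_derivative DF (?u x) (X e (t0 + x) (?u x))) (at x within {0..s})"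
        using ut[OF x] tube_D by blast
      then show "((\<lambda>x. F (?u x) $ 2) has_real_derivative DF (?u x) (X e (t0 + x) (?u x)) $ 2) (at x within {0..s})"
        using has_vector_derivative_nth[of "F \<circ> ?u"] by simp
    next
      fix x assume "x \<in> {0<..<s}"
      then have x: "x \<in> {0..s}" by simp
      have uD: "?u x \<in> D" using ut[OF x] tube_D by blast
      have "norm (DF (?u x) (X e (t0 + x) (?u x) - F (?u x))) \<le> L * (L * e)"
        by (rule order_trans[OF DF_bound[OF ut[OF x]]])
          (intro mult_left_mono X_F e tm[OF x] ut[OF x] L_nonneg)
      then have "DF (?u x) (X e (t0 + x) (?u x)) $ 2 \<le> DF (?u x) (F (?u x)) $ 2 + L * (L * e)"
        using abs_nth_le[of "DF (?u x) (X e (t0 + x) (?u x) - F (?u x))" 2]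
        by (simp add: linear_diff[OF DF_linear[OF uD]])
      then show "DF (?u x) (X e (t0 + x) (?u x)) $ 2 \<le> - \<kappa> * 3 / 4 + L * (L * e)"
        using near[OF ut[OF x] up[OF x]] by linarith
    qed
    then have a: "F (?u s) $ 2 - F (?u 0) $ 2 \<le> - \<kappa> * 3 / 4 * s + L * (L * e) * s" by (simp add: algebra_simps)
    have s0: "0 \<in> {0..s}" "s \<in> {0..s}" using s by auto
    have "norm (k e (t0 + s) (?u s) - k e (t0 + 0) (?u 0)) \<le> L * (\<bar>(t0 + s) - (t0 + 0)\<bar> + norm (?u s - ?u 0))"
      by (intro k_lip e tm s0 ut)
    also have "\<dots> \<le> L * (s + 2 * L * s)"
      using spd[OF s0(2)] s L_nonneg by (intro mult_left_mono) auto
    finally have "e * norm (k e (t0 + s) (?u s) - k e t0 (?u 0)) \<le> e * (L * (s + 2 * L * s))"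
      using e by (intro mult_left_mono) auto
    moreover have "e * (k e (t0 + s) (?u s) $ 2 - k e t0 (?u 0) $ 2) \<le> e * norm (k e (t0 + s) (?u s) - k e t0 (?u 0))"
      using e abs_nth_le[of "k e (t0 + s) (?u s) - k e t0 (?u 0)" 2] by (intro mult_left_mono) auto
    ultimately have b: "e * (k e (t0 + s) (?u s) $ 2 - k e t0 (?u 0) $ 2) \<le> e * (L * (1 + 2 * L)) * s"
      by (simp add: algebra_simps)
    have "(e * (L * (1 + 2 * L)) + L * (L * e)) * s \<le> (\<kappa> / 8) * s" using s e\<kappa> by (intro mult_right_mono) auto
    moreover have "- \<kappa> * 3 / 4 * s \<le> - \<kappa> / 4 * s" using \<kappa> s by (intro mult_right_mono) auto
    ultimately show ?thesis using a b unfolding u0[symmetric] X_def by (simp add: algebra_simps)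
  qed
  then show ?thesis using r(1,2) e1 unfolding \<kappa>_def by blast
qed

text \<open>Three regimes: just after the start the falling vertical speed puts the orbit under a
  parabola; in the middle it is close to \<open>\<gamma>\<close>, which is bounded away from the
  axis; near \<open>\<sigma>\<close> the vertical speed is positive, so the orbit is below the axis
  until it returns to it.\<close>

lemma sol_below:
  assumes B: "0 \<le> B"
  shows "\<exists>e1>0. \<forall>e t0 \<xi> \<tau>. 0 < e \<and> e < e1 \<and> e < e0 \<and> t0 \<in> {\<theta>-1..\<theta>+1} \<and> \<bar>\<xi>\<bar> \<le> B \<and> \<bar>\<tau>\<bar> \<le> B
     \<and> X e t0 (on_axis (xv + e * \<xi>)) $ 2 \<le> 0 \<and> sol e t0 (xv + e * \<xi>) (\<sigma> + e * \<tau>) $ 2 = 0 \<longrightarrow>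
    (\<forall>s\<in>{0<..<\<sigma> + e * \<tau>}. sol e t0 (xv + e * \<xi>) s $ 2 < 0)
    \<and> X e (t0 + (\<sigma> + e * \<tau>)) (sol e t0 (xv + e * \<xi>) (\<sigma> + e * \<tau>)) $ 2 > 0
    \<and> 0 < \<sigma> + e * \<tau> \<and> \<sigma> + e * \<tau> \<le> \<sigma> + overtime \<and> C1 B * e \<le> \<delta> / 2"
proof -
  obtain r e1 where r: "0 < r" and e1: "0 < e1" and dec: "\<And>e t0 \<xi> s. 0 < e \<Longrightarrow> e < e1 \<Longrightarrow> e < e0 \<Longrightarrow>
     t0 \<in> {\<theta>-1..\<theta>+1} \<Longrightarrow> \<bar>\<xi>\<bar> \<le> B \<Longrightarrow> C1 B * e \<le> \<delta> / 2 \<Longrightarrow> s \<in> {0..r} \<Longrightarrow>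
    r \<le> \<sigma> \<and> X e (t0 + s) (sol e t0 (xv + e * \<xi>) s) $ 2 \<le> X e t0 (on_axis (xv + e * \<xi>)) $ 2 - (\<alpha> * b / 8) * s"
    using X_lower_decreasing[of B] by blast
  define \<beta> where "\<beta> = F (\<gamma> \<sigma>) $ 2"
  have \<beta>: "0 < \<beta>" using F_end by (simp add: \<beta>_def)
  \<comment> \<open>Moving for a time \<open>c\<close> at speed \<open>2 * L\<close> changes
    \<open>F\<close> by at most \<open>\<beta> / 4\<close>.\<close>
  define c where "c = min (\<sigma> / 2) (\<beta> / (8 * L\<^sup>2 + 1))"
  have c: "0 < c" "c \<le> \<sigma> / 2" "2 * L\<^sup>2 * c \<le> \<beta> / 4"
  proof -
    have d: "0 < 8 * L\<^sup>2 + 1" by (simp add: add_nonneg_pos)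
    show "0 < c" using \<beta> \<sigma>_pos d by (simp add: c_def)
    show "c \<le> \<sigma> / 2" unfolding c_def by (rule min.cobounded1)
    have "2 * L\<^sup>2 * c \<le> 2 * L\<^sup>2 * (\<beta> / (8 * L\<^sup>2 + 1))" by (intro mult_left_mono) (auto simp: c_def)
    also have "\<dots> \<le> \<beta> / 4" using \<beta> d by (simp add: field_simps)
    finally show "2 * L\<^sup>2 * c \<le> \<beta> / 4" .
  qed
  have "\<exists>m>0. \<forall>s\<in>{r..\<sigma> - c}. \<gamma> s $ 2 \<le> - m"
  proof (cases "{r..\<sigma> - c} = {}")
    case True then show ?thesis by (intro exI[of _ 1]) auto
  next
    case False
    have "continuous_on {r..\<sigma> - c} (\<lambda>s. \<gamma> s $ 2)"
      using r c by (intro continuous_intros continuous_on_subset[OF \<gamma>_continuous]) auto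
    then obtain x where x: "x \<in> {r..\<sigma> - c}" "\<And>y. y \<in> {r..\<sigma> - c} \<Longrightarrow> \<gamma> y $ 2 \<le> \<gamma> x $ 2"
      using continuous_attains_sup[of "{r..\<sigma> - c}" "\<lambda>s. \<gamma> s $ 2"] False by auto
    have "\<gamma> x $ 2 < 0" using x r c by (intro \<gamma>_neg) auto
    then show ?thesis using x by (intro exI[of _ "- \<gamma> x $ 2"]) auto
  qed
  then obtain m where m: "0 < m" "\<And>s. s \<in> {r..\<sigma> - c} \<Longrightarrow> \<gamma> s $ 2 \<le> - m" by blast
  \<comment> \<open>Dominates every constant that multiplies \<open>e\<close> below; one smallness
    condition on \<open>e * A\<close> then serves all estimates.\<close>
  define A where "A = C1 B + B + L * C1 B + L + 1"
  have C1B: "0 \<le> C1 B" by (rule C1_nonneg[OF B])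
  have LC: "0 \<le> L * C1 B" using L_nonneg C1B by simp
  have A: "C1 B \<le> A" "B \<le> A" "L * C1 B + L \<le> A" "0 < A"
    using B C1B L_nonneg LC unfolding A_def by linarith+
  define e2 where "e2 = min e1 (min (min (\<delta> / 2) (m / 2)) (min (c / 2) (min overtime (\<beta> / 4))) / A)"
  have mp: "0 < min (min (\<delta> / 2) (m / 2)) (min (c / 2) (min overtime (\<beta> / 4)))"
    using \<delta>_pos m c overtime \<beta> by simp
  have e2: "0 < e2" unfolding e2_def using A(4) mp e1 by simp
  have "(\<forall>s\<in>{0<..<\<sigma> + e * \<tau>}. sol e t0 (xv + e * \<xi>) s $ 2 < 0)
    \<and> X e (t0 + (\<sigma> + e * \<tau>)) (sol e t0 (xv + e * \<xi>) (\<sigma> + e * \<tau>)) $ 2 > 0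
    \<and> 0 < \<sigma> + e * \<tau> \<and> \<sigma> + e * \<tau> \<le> \<sigma> + overtime \<and> C1 B * e \<le> \<delta> / 2"
    if e: "0 < e" "e < e2" "e < e0" and t0: "t0 \<in> {\<theta>-1..\<theta>+1}" and \<xi>: "\<bar>\<xi>\<bar> \<le> B" and \<tau>: "\<bar>\<tau>\<bar> \<le> B"
     and X0: "X e t0 (on_axis (xv + e * \<xi>)) $ 2 \<le> 0" and end0: "sol e t0 (xv + e * \<xi>) (\<sigma> + e * \<tau>) $ 2 = 0"
    for e t0 \<xi> \<tau>
  proof -
    let ?u = "sol e t0 (xv + e * \<xi>)" and ?end = "\<sigma> + e * \<tau>"
    have "e * A \<le> min (min (\<delta> / 2) (m / 2)) (min (c / 2) (min overtime (\<beta> / 4)))"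
      using e(2) A(4) unfolding e2_def by (simp only: min_less_iff_conj pos_less_divide_eq less_imp_le)
    then have eA: "e * A \<le> \<delta> / 2" "e * A \<le> m / 2" "e * A \<le> c / 2" "e * A \<le> overtime" "e * A \<le> \<beta> / 4"
      by auto
    have eC: "C1 B * e \<le> e * A" "e * B \<le> e * A" "L * (C1 B * e) + L * e \<le> e * A"
      using mult_left_mono[OF A(1), of e] mult_left_mono[OF A(2), of e] mult_left_mono[OF A(3), of e] e
      by (auto simp: algebra_simps)
    have small: "C1 B * e \<le> \<delta> / 2" using eA eC by linarith
    have e1: "e < e1" using e by (simp add: e2_def)
    have e\<tau>: "\<bar>e * \<tau>\<bar> \<le> e * B" using \<tau> e by (simp add: abs_mult)
    have endp: "0 < ?end" "?end \<le> \<sigma> + overtime" "\<bar>?end - \<sigma>\<bar> \<le> c / 2" using e\<tau> eA eC c by auto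
    have u0: "?u 0 $ 2 = 0" by (simp add: sol(1)[OF e(1,3) t0])
    have uder: "((\<lambda>s. ?u s $ 2) has_real_derivative X e (t0 + s) (?u s) $ 2) (at s within S)"
      if "s \<in> S" "S \<subseteq> {0..\<sigma> + overtime}" for s S
      by (rule has_vector_derivative_nth, rule has_vector_derivative_within_subset[OF sol_solves(2)[OF e(1,3) t0 \<xi> small]])
        (use that in blast)+
    have start: "?u s $ 2 < 0" if s: "s \<in> {0<..r}" for s
    proof -
      have rs: "r \<le> \<sigma>" using dec[OF e(1) e1 e(3) t0 \<xi> small, of s] s by auto
      \<comment> \<open>The quadratic term integrates the rate \<open>\<alpha> * b / 8\<close> of
        \<open>dec\<close>.\<close>
      have "(?u s $ 2 + \<alpha> * b / 16 * s\<^sup>2) - (?u 0 $ 2 + \<alpha> * b / 16 * 0\<^sup>2) \<le> 0 * (s - 0)"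
      proof (rule increment_le_of_derivative_le[where h = "\<lambda>s. ?u s $ 2 + \<alpha> * b / 16 * s\<^sup>2" and
            h' = "\<lambda>s. X e (t0 + s) (?u s) $ 2 + \<alpha> * b / 8 * s"])
        show "0 \<le> s" using s by simp
        show "((\<lambda>s. ?u s $ 2 + \<alpha> * b / 16 * s\<^sup>2) has_real_derivative X e (t0 + x) (?u x) $ 2 + \<alpha> * b / 8 * x) (at x within {0..s})"
          if x: "x \<in> {0..s}" for x
          using uder[OF x] s rs overtime by (auto intro!: derivative_eq_intros)
        show "X e (t0 + x) (?u x) $ 2 + \<alpha> * b / 8 * x \<le> 0" if "x \<in> {0<..<s}" for x
          using dec[OF e(1) e1 e(3) t0 \<xi> small, of x] that s X0 by auto
      qed
      moreover have "0 < \<alpha> * b / 16 * s\<^sup>2" using \<alpha>_pos b_pos s by simp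
      ultimately show ?thesis using u0 by simp
    qed
    have fin: "X e (t0 + s) (?u s) $ 2 \<ge> \<beta> / 4" if s: "s \<in> {\<sigma> - c..\<sigma> + c / 2}" "s \<le> \<sigma> + overtime" for s
    proof -
      have so: "s \<in> {0..\<sigma> + overtime}" and s1: "s \<in> {0..\<sigma>+1}" using s c overtime by auto
      have ut: "?u s \<in> tube \<delta>" by (rule sol_solves(1)[OF e(1,3) t0 \<xi> small so])
      have "norm (?u s - \<gamma> \<sigma>) \<le> norm (?u s - ?u \<sigma>) + norm (?u \<sigma> - \<gamma> \<sigma>)"
        using norm_triangle_ineq[of "?u s - ?u \<sigma>" "?u \<sigma> - \<gamma> \<sigma>"] by simp
      also have "\<dots> \<le> 2 * L * \<bar>s - \<sigma>\<bar> + C1 B * e"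
        using \<sigma>_pos s1 by (intro add_mono sol_speed sol_near e t0 \<xi>) auto
      also have "\<dots> \<le> 2 * L * c + C1 B * e"
        using s c L_nonneg by (intro add_right_mono mult_left_mono) auto
      finally have "L * norm (?u s - \<gamma> \<sigma>) \<le> L * (2 * L * c + C1 B * e)" using L_nonneg by (rule mult_left_mono)
      then have "norm (F (?u s) - F (\<gamma> \<sigma>)) \<le> L * (2 * L * c + C1 B * e)"
        using F_lip[OF ut \<gamma>_tube[of \<sigma>]] \<sigma>_pos by simp
      moreover have "norm (X e (t0 + s) (?u s) - F (?u s)) \<le> L * e"
        using t0 s1 by (intro X_F e ut) auto
      ultimately have "norm (X e (t0 + s) (?u s) - F (\<gamma> \<sigma>)) \<le> 2 * L\<^sup>2 * c + (L * (C1 B * e) + L * e)"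
        using norm_triangle_ineq[of "X e (t0 + s) (?u s) - F (?u s)" "F (?u s) - F (\<gamma> \<sigma>)"]
        by (simp add: algebra_simps power2_eq_square)
      also have "\<dots> \<le> \<beta> / 2" using c eC eA by linarith
      finally show ?thesis
        using abs_nth_le[of "X e (t0 + s) (?u s) - F (\<gamma> \<sigma>)" 2] \<beta> by (simp add: \<beta>_def)
    qed
    have neg: "?u s $ 2 < 0" if s: "s \<in> {0<..<?end}" for s
    proof -
      consider "s \<le> r" | "s \<in> {r..\<sigma> - c}" | "\<sigma> - c < s" by force
      then show ?thesis
      proof cases
        case 1 then show ?thesis using start s by auto
      next
        case 2
        then have "s \<in> {0..\<sigma>}" using r c by auto
        then have "norm (?u s - \<gamma> s) \<le> C1 B * e" by (rule sol_near[OF e(1,3) t0 \<xi>])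
        then show ?thesis using abs_nth_le[of "?u s - \<gamma> s" 2] m(2)[OF 2] eC(1) eA(2) m(1) by simp
      next
        case 3
        \<comment> \<open>Integrated backwards from the zero at the end, through times at which the
          vertical speed is at least \<open>\<beta> / 4\<close>.\<close>
        have "- ?u ?end $ 2 - - ?u s $ 2 \<le> (- (\<beta> / 4)) * (?end - s)"
        proof (rule increment_le_of_derivative_le[where h = "\<lambda>s. - ?u s $ 2" and
              h' = "\<lambda>s. - X e (t0 + s) (?u s) $ 2"])
          show "s \<le> ?end" using s by simp
          show "((\<lambda>s. - ?u s $ 2) has_real_derivative - X e (t0 + x) (?u x) $ 2) (at x within {s..?end})"
            if x: "x \<in> {s..?end}" for x
            using uder[OF x] s endp by (auto intro!: derivative_eq_intros)
          show "- X e (t0 + x) (?u x) $ 2 \<le> - (\<beta> / 4)" if "x \<in> {s<..<?end}" for x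
            using fin[of x] that 3 endp by auto
        qed
        then have "?u s $ 2 \<le> (- (\<beta> / 4)) * (?end - s)" using end0 by simp
        also have "\<dots> < 0" using \<beta> s by (simp add: mult_neg_pos)
        finally show ?thesis .
      qed
    qed
    have "?end \<in> {\<sigma> - c..\<sigma> + c / 2}" using endp(3) c(1) by (auto simp: abs_le_iff)
    then have "X e (t0 + ?end) (?u ?end) $ 2 > 0" using fin[of ?end] endp \<beta> by linarith
    then show ?thesis using neg endp small by blast
  qed
  then show ?thesis using e2 by blast
qed

end

section \<open>Matching the two half orbits\<close>

lemma wedge_simps: "wedge a (u + v) = wedge a u + wedge a v" "wedge a (u - v) = wedge a u - wedge a v"
    "wedge a (c *\<^sub>R v) = c * wedge a v" "wedge a a = 0"
  by (simp_all add: wedge_def algebra_simps)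

lemma wedge_le: "\<bar>wedge a v\<bar> \<le> 2 * norm a * norm v"
proof -
  have "\<bar>wedge a v\<bar> \<le> \<bar>a $ 2\<bar> * \<bar>v $ 1\<bar> + \<bar>a $ 1\<bar> * \<bar>v $ 2\<bar>"
    unfolding wedge_def abs_mult[symmetric] by linarith
  also have "\<dots> \<le> norm a * norm v + norm a * norm v"
    by (intro add_mono mult_mono abs_nth_le) auto
  finally show ?thesis by simp
qed

text \<open>System 1 is the lower one; system 2 is the upper one, reflected and run backwards.\<close>

locale two_halves = h1: half F D \<gamma> \<sigma> xv \<alpha> b \<delta> L g1 k1 \<theta> e0 + h2: half F D \<gamma> \<sigma> xv \<alpha> b \<delta> L g2 k2 "- \<theta>" e0
  for F D \<gamma> \<sigma> xv \<alpha> b \<delta> L g1 k1 g2 k2 \<theta> e0 +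
  fixes M' :: real
  assumes e0_pos: "0 < e0"
    and M_zero: "wedge (F (\<gamma> \<sigma>)) (h1.Y \<sigma> (h1.J \<theta> - h2.J (- \<theta>))) = 0"
    and M_deriv: "((\<lambda>t. wedge (F (\<gamma> \<sigma>)) (h1.Y \<sigma> (h1.J t - h2.J (- t)))) has_real_derivative M') (at \<theta>)"
    and M'_nonzero: "M' \<noteq> 0"
begin

text \<open>In the application \<open>M\<close> is, near \<open>\<theta>\<close>, the Melnikov
  function at \<open>xv\<close>, and \<open>G\<close> is the number \<open>g_\<theta>\<close>.
  System 2 runs in reversed time, hence the argument \<open>- t\<close>.\<close>

definition M :: "real \<Rightarrow> real" where "M t = wedge (F (\<gamma> \<sigma>)) (h1.Y \<sigma> (h1.J t - h2.J (- t)))"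
definition G :: real where "G = h1.Y \<sigma> (h1.J \<theta> + h2.J (- \<theta>)) $ 2"
definition \<beta> :: real where "\<beta> = F (\<gamma> \<sigma>) $ 2"

lemma \<beta>_pos: "0 < \<beta>" using h1.F_end by (simp add: \<beta>_def)

text \<open>A nonzero derivative at the single point \<open>\<theta>\<close> already forces a linear
  sign change with half the slope.\<close>

lemma M_sign: "\<exists>d>0. \<forall>h. 0 < h \<and> h < d \<longrightarrow>
    sgn M' * M (\<theta> + h) \<ge> \<bar>M'\<bar> / 2 * h \<and> sgn M' * M (\<theta> - h) \<le> - (\<bar>M'\<bar> / 2 * h)"
proof -
  have "(M has_derivative (\<lambda>h. M' * h)) (at \<theta>)"
    using M_deriv unfolding M_def[symmetric] has_field_derivative_def by simp
  then have "\<forall>e>0. \<exists>d>0. \<forall>y. norm (y - \<theta>) < d \<longrightarrow> norm (M y - M \<theta> - M' * (y - \<theta>)) \<le> e * norm (y - \<theta>)"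
    unfolding has_derivative_at_alt by blast
  moreover have "0 < \<bar>M'\<bar> / 2" using M'_nonzero by simp
  ultimately obtain d where d: "0 < d" and
    *: "\<And>y. norm (y - \<theta>) < d \<Longrightarrow> norm (M y - M \<theta> - M' * (y - \<theta>)) \<le> \<bar>M'\<bar> / 2 * norm (y - \<theta>)"
    by blast
  have M\<theta>: "M \<theta> = 0" using M_zero by (simp add: M_def)
  have s: "\<bar>sgn M'\<bar> = 1" "sgn M' * M' = \<bar>M'\<bar>" using M'_nonzero by (auto simp: sgn_if)
  have "sgn M' * M (\<theta> + h) \<ge> \<bar>M'\<bar> / 2 * h \<and> sgn M' * M (\<theta> - h) \<le> - (\<bar>M'\<bar> / 2 * h)"
    if h: "0 < h" "h < d" for h
  proof -
    have a: "\<bar>M (\<theta> + h) - M' * h\<bar> \<le> \<bar>M'\<bar> / 2 * h" using *[of "\<theta> + h"] h M\<theta> by simp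
    have b: "\<bar>M (\<theta> - h) + M' * h\<bar> \<le> \<bar>M'\<bar> / 2 * h" using *[of "\<theta> - h"] h M\<theta> by simp
    have "\<bar>sgn M' * (M (\<theta> + h) - M' * h)\<bar> \<le> \<bar>M'\<bar> / 2 * h" using a s by (simp add: abs_mult)
    moreover have "\<bar>sgn M' * (M (\<theta> - h) + M' * h)\<bar> \<le> \<bar>M'\<bar> / 2 * h" using b s by (simp add: abs_mult)
    moreover have "sgn M' * (M (\<theta> + h) - M' * h) = sgn M' * M (\<theta> + h) - \<bar>M'\<bar> * h"
      "sgn M' * (M (\<theta> - h) + M' * h) = sgn M' * M (\<theta> - h) + \<bar>M'\<bar> * h"
      unfolding s(2)[symmetric] by (simp_all add: algebra_simps)
    ultimately have "\<bar>sgn M' * M (\<theta> + h) - \<bar>M'\<bar> * h\<bar> \<le> \<bar>M'\<bar> * h / 2"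
      "\<bar>sgn M' * M (\<theta> - h) + \<bar>M'\<bar> * h\<bar> \<le> \<bar>M'\<bar> * h / 2" by simp_all
    then show ?thesis by (intro conjI) (unfold times_divide_eq_left, linarith+)
  qed
  then show ?thesis using d by blast
qed

text \<open>Both systems perturb the same orbit, so they share the fundamental matrix, and offsets
  contribute along \<open>F (\<gamma> \<sigma>)\<close> only.\<close>

lemma \<omega>_1: "h1.\<omega> t \<xi> = (- \<xi> / \<alpha>) *\<^sub>R F (\<gamma> \<sigma>) + h1.Y \<sigma> (h1.J t)"
  and \<omega>_2: "h2.\<omega> t \<xi> = (- \<xi> / \<alpha>) *\<^sub>R F (\<gamma> \<sigma>) + h1.Y \<sigma> (h2.J t)"
  by (simp_all only: h1.\<omega>_def h2.\<omega>_def linear_add[OF h1.linear_Y] h1.Y_on_axis)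

text \<open>The two half orbits, started near the fold with offsets \<open>\<xi>\<^sub>0\<close> and \<open>\<xi>\<^sub>1\<close> and met at scaled
  time \<open>\<tau>\<close> after \<open>\<sigma>\<close>; \<open>r\<close> is the scaled duration of the sliding arc.\<close>

definition U :: "real \<Rightarrow> real \<Rightarrow> real \<Rightarrow> real \<Rightarrow> real^2" where
  "U e t \<xi> \<tau> = h1.sol e t (xv + e * \<xi>) (\<sigma> + e * \<tau>)"
text \<open>The slide, the lower arc and the upper arc last \<open>e * r\<close>,
  \<open>\<sigma> + e * \<tau>\<close> and \<open>\<sigma> - e * (r + \<tau>)\<close>; these add up
  to \<open>2 * \<sigma>\<close>, so closing up gives the exact period.\<close>

definition W :: "real \<Rightarrow> real \<Rightarrow> real \<Rightarrow> real \<Rightarrow> real \<Rightarrow> real^2" where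
  "W e t \<xi> r \<tau> = h2.sol e (- (t - e * r)) (xv + e * \<xi>) (\<sigma> - e * (r + \<tau>))"

text \<open>Sum, difference and wedge of the two arrivals each depend to first order on different
  unknowns. \<open>A\<close> is fixed before \<open>T\<close>, because \<open>T\<close> has to be
  chosen large compared with \<open>A\<close> afterwards. The error
  \<open>C * e * \<bar>t - \<theta>\<bar>\<close> comes from evaluating \<open>G\<close> at
  \<open>\<theta>\<close>.\<close>

lemma matching_expansion:
  assumes B: "0 \<le> B"
  shows "\<exists>A\<ge>0. \<forall>T\<ge>0. \<exists>C\<ge>0. \<exists>e1>0. \<forall>e t \<xi>0 \<xi>1 r \<tau>. 0 < e \<and> e < e1 \<and> \<bar>t - \<theta>\<bar> \<le> 1/2 \<and> \<bar>\<xi>0\<bar> \<le> B \<and> \<bar>\<xi>1\<bar> \<le> B \<and> 0 \<le> r \<and> r \<le> B \<and> \<bar>\<tau>\<bar> \<le> T \<longrightarrow>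
    \<bar>(U e t \<xi>0 \<tau> + W e t \<xi>1 r \<tau>) $ 2 - e * (G - (\<beta> / \<alpha>) * (\<xi>0 + \<xi>1) - r * \<beta>)\<bar> \<le> C * e\<^sup>2 + C * e * \<bar>t - \<theta>\<bar>
    \<and> \<bar>(U e t \<xi>0 \<tau> - W e t \<xi>1 r \<tau>) $ 2 - e * (2 * \<tau> + r) * \<beta>\<bar> \<le> A * e + C * e\<^sup>2
    \<and> \<bar>wedge (F (\<gamma> \<sigma>)) (U e t \<xi>0 \<tau> - W e t \<xi>1 r \<tau>) - e * M t\<bar> \<le> C * e\<^sup>2"
proof -
  let ?q = "F (\<gamma> \<sigma>)"
  obtain BY where BY: "\<And>v. norm (h1.Y \<sigma> v) \<le> BY * norm v" "0 < BY"
    using linear_bounded_pos[OF h1.linear_Y] by metis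
  obtain M1 where M1: "0 \<le> M1" "\<And>t t'. t \<in> {\<theta>-1..\<theta>+1} \<Longrightarrow> t' \<in> {\<theta>-1..\<theta>+1} \<Longrightarrow> norm (h1.J t - h1.J t') \<le> M1 * \<bar>t - t'\<bar>"
    using h1.J_lip by blast
  obtain M2 where M2: "0 \<le> M2" "\<And>t t'. t \<in> {-\<theta>-1..-\<theta>+1} \<Longrightarrow> t' \<in> {-\<theta>-1..-\<theta>+1} \<Longrightarrow> norm (h2.J t - h2.J t') \<le> M2 * \<bar>t - t'\<bar>"
    using h2.J_lip by blast
  define NJ where "NJ = norm (h1.J \<theta>) + M1 + (norm (h2.J (-\<theta>)) + M2)"
  \<comment> \<open>Bounds the contribution of the offsets and of the two integrals to the
    difference, uniformly in the meeting time.\<close>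
  define A where "A = 2 * (B * \<beta> / \<alpha>) + BY * NJ"
  have NJ: "0 \<le> NJ" using M1 M2 by (simp add: NJ_def)
  have A: "0 \<le> A" using B \<beta>_pos h1.\<alpha>_pos BY NJ by (simp add: A_def)
  have "\<exists>C\<ge>0. \<exists>e1>0. \<forall>e t \<xi>0 \<xi>1 r \<tau>. 0 < e \<and> e < e1 \<and> \<bar>t - \<theta>\<bar> \<le> 1/2 \<and> \<bar>\<xi>0\<bar> \<le> B \<and> \<bar>\<xi>1\<bar> \<le> B \<and> 0 \<le> r \<and> r \<le> B \<and> \<bar>\<tau>\<bar> \<le> T \<longrightarrow>
    \<bar>(U e t \<xi>0 \<tau> + W e t \<xi>1 r \<tau>) $ 2 - e * (G - (\<beta> / \<alpha>) * (\<xi>0 + \<xi>1) - r * \<beta>)\<bar> \<le> C * e\<^sup>2 + C * e * \<bar>t - \<theta>\<bar>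
    \<and> \<bar>(U e t \<xi>0 \<tau> - W e t \<xi>1 r \<tau>) $ 2 - e * (2 * \<tau> + r) * \<beta>\<bar> \<le> A * e + C * e\<^sup>2
    \<and> \<bar>wedge ?q (U e t \<xi>0 \<tau> - W e t \<xi>1 r \<tau>) - e * M t\<bar> \<le> C * e\<^sup>2" if T: "0 \<le> T" for T
  proof -
    define P where "P = B + T"
    have P: "0 \<le> P" "B \<le> P" "T \<le> P" using B T by (auto simp: P_def)
    obtain Ca where Ca: "0 \<le> Ca" "\<And>e t0 \<xi> \<tau>. 0 < e \<Longrightarrow> e < e0 \<Longrightarrow> t0 \<in> {\<theta>-1..\<theta>+1} \<Longrightarrow> \<bar>\<xi>\<bar> \<le> P \<Longrightarrow> \<bar>\<tau>\<bar> \<le> P \<Longrightarrow> h1.C1 P * e \<le> \<delta> / 2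
        \<Longrightarrow> e * P \<le> h1.overtime \<Longrightarrow> e * P \<le> \<sigma> \<Longrightarrow>
      norm (h1.sol e t0 (xv + e * \<xi>) (\<sigma> + e * \<tau>) - (\<gamma> \<sigma> + e *\<^sub>R (h1.\<omega> t0 \<xi> + \<tau> *\<^sub>R ?q))) \<le> Ca * e\<^sup>2"
      using h1.sol_expansion[OF P(1)] by blast
    obtain Cb where Cb: "0 \<le> Cb" "\<And>e t0 \<xi> \<tau>. 0 < e \<Longrightarrow> e < e0 \<Longrightarrow> t0 \<in> {-\<theta>-1..-\<theta>+1} \<Longrightarrow> \<bar>\<xi>\<bar> \<le> P \<Longrightarrow> \<bar>\<tau>\<bar> \<le> P \<Longrightarrow> h2.C1 P * e \<le> \<delta> / 2
        \<Longrightarrow> e * P \<le> h2.overtime \<Longrightarrow> e * P \<le> \<sigma> \<Longrightarrow>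
      norm (h2.sol e t0 (xv + e * \<xi>) (\<sigma> + e * \<tau>) - (\<gamma> \<sigma> + e *\<^sub>R (h2.\<omega> t0 \<xi> + \<tau> *\<^sub>R ?q))) \<le> Cb * e\<^sup>2"
      using h2.sol_expansion[OF P(1)] by blast
    define C where "C = (Ca + Cb) + BY * (M1 + M2) + BY * M2 * B + 2 * norm ?q * ((Ca + Cb) + BY * M2 * B)"
    have nn: "0 \<le> BY * (M1 + M2)" "0 \<le> BY * M2 * B" "0 \<le> norm ?q * ((Ca + Cb) + BY * M2 * B)" "0 \<le> norm ?q * (Ca + Cb)"
      using BY M1 M2 B Ca Cb by (auto intro!: mult_nonneg_nonneg add_nonneg_nonneg)
    have C: "0 \<le> C" "Ca + Cb + BY * M2 * B \<le> C" "BY * (M1 + M2) \<le> C" "Ca + Cb \<le> C" "2 * norm ?q * ((Ca + Cb) + BY * M2 * B) \<le> C"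
      using nn Ca Cb unfolding C_def by linarith+
    define m where "m = min (min e0 (\<delta> / 2)) (min (min h1.overtime h2.overtime) (min \<sigma> (1/2)))"
    have m: "0 < m" using e0_pos h1.\<delta>_pos h1.overtime h2.overtime h1.\<sigma>_pos by (simp add: m_def)
    define S where "S = 1 + P + h1.C1 P + h2.C1 P"
    have S: "1 \<le> S" "P \<le> S" "h1.C1 P \<le> S" "h2.C1 P \<le> S"
      using P h1.C1_nonneg[OF P(1)] h2.C1_nonneg[OF P(1)] unfolding S_def by linarith+
    have e1: "0 < m / S" using m S by simp
    have "\<bar>(U e t \<xi>0 \<tau> + W e t \<xi>1 r \<tau>) $ 2 - e * (G - (\<beta> / \<alpha>) * (\<xi>0 + \<xi>1) - r * \<beta>)\<bar> \<le> C * e\<^sup>2 + C * e * \<bar>t - \<theta>\<bar>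
      \<and> \<bar>(U e t \<xi>0 \<tau> - W e t \<xi>1 r \<tau>) $ 2 - e * (2 * \<tau> + r) * \<beta>\<bar> \<le> A * e + C * e\<^sup>2
      \<and> \<bar>wedge ?q (U e t \<xi>0 \<tau> - W e t \<xi>1 r \<tau>) - e * M t\<bar> \<le> C * e\<^sup>2"
      if e: "0 < e" "e < m / S" and t: "\<bar>t - \<theta>\<bar> \<le> 1/2" and \<xi>0: "\<bar>\<xi>0\<bar> \<le> B" and \<xi>1: "\<bar>\<xi>1\<bar> \<le> B" and r: "0 \<le> r" "r \<le> B" and \<tau>: "\<bar>\<tau>\<bar> \<le> T"
      for e t \<xi>0 \<xi>1 r \<tau>
    proof -
      have eS: "e * S \<le> m" using e S by (simp add: pos_less_divide_eq less_imp_le)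
      have "e * 1 \<le> m" "e * P \<le> m" "e * h1.C1 P \<le> m" "e * h2.C1 P \<le> m"
        using e(1) by (intro order_trans[OF mult_left_mono eS] S; simp)+
      then have sm: "e < e0 \<or> e = e0" "h1.C1 P * e \<le> \<delta> / 2" "h2.C1 P * e \<le> \<delta> / 2" "e * P \<le> h1.overtime" "e * P \<le> h2.overtime" "e * P \<le> \<sigma>" "e * P \<le> 1/2"
        by (auto simp: m_def mult.commute)
      have ee0: "e < e0"
      proof -
        have "e * 1 \<le> e * S" using e S by (intro mult_left_mono) auto
        moreover have "e * S < m" using e S by (simp add: pos_less_divide_eq)
        ultimately show ?thesis by (simp add: m_def)
      qed
      have er: "0 \<le> e * r" "e * r \<le> e * B" "e * B \<le> 1/2"
      proof -
        show "0 \<le> e * r" using e r by simp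
        show "e * r \<le> e * B" using e r by (intro mult_left_mono) auto
        have "e * B \<le> e * P" using e P by (intro mult_left_mono) auto
        then show "e * B \<le> 1/2" using sm(7) by linarith
      qed
      have tr: "t \<in> {\<theta>-1..\<theta>+1}" "- (t - e * r) \<in> {-\<theta>-1..-\<theta>+1}" "- t \<in> {-\<theta>-1..-\<theta>+1}"
        "\<theta> \<in> {\<theta>-1..\<theta>+1}" "-\<theta> \<in> {-\<theta>-1..-\<theta>+1}"
        unfolding atLeastAtMost_iff using t er by linarith+
      define a where "a = h1.Y \<sigma> (h1.J t)"
      define c where "c = h1.Y \<sigma> (h2.J (- (t - e * r)))"
      \<comment> \<open>\<open>u\<close> and \<open>w\<close> are the remainders of the two
        expansions, each quadratic in \<open>e\<close>; everything else is explicit.\<close>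
      define u where "u = U e t \<xi>0 \<tau> - (\<gamma> \<sigma> + e *\<^sub>R (((- \<xi>0 / \<alpha>) *\<^sub>R ?q + a) + \<tau> *\<^sub>R ?q))"
      define w where "w = W e t \<xi>1 r \<tau> - (\<gamma> \<sigma> + e *\<^sub>R (((- \<xi>1 / \<alpha>) *\<^sub>R ?q + c) + (- (r + \<tau>)) *\<^sub>R ?q))"
      have nu: "norm u \<le> Ca * e\<^sup>2"
        unfolding u_def U_def a_def \<omega>_1[symmetric]
        using \<xi>0 \<tau> P by (intro Ca(2) e ee0 tr sm) auto
      have nw: "norm w \<le> Cb * e\<^sup>2"
      proof -
        have "norm (h2.sol e (- (t - e * r)) (xv + e * \<xi>1) (\<sigma> + e * (- (r + \<tau>))) - (\<gamma> \<sigma> + e *\<^sub>R (h2.\<omega> (- (t - e * r)) \<xi>1 + (- (r + \<tau>)) *\<^sub>R ?q))) \<le> Cb * e\<^sup>2"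
          using \<xi>1 \<tau> r P by (intro Cb(2) e ee0 tr sm) (auto simp: P_def)
        moreover have "\<sigma> - e * (r + \<tau>) = \<sigma> + e * (- (r + \<tau>))" by (simp add: algebra_simps)
        ultimately show ?thesis unfolding w_def W_def c_def \<omega>_2[symmetric] by (simp only:)
      qed
      have Ueq: "U e t \<xi>0 \<tau> = u + (\<gamma> \<sigma> + e *\<^sub>R (((- \<xi>0 / \<alpha>) *\<^sub>R ?q + a) + \<tau> *\<^sub>R ?q))" by (simp add: u_def)
      have Weq: "W e t \<xi>1 r \<tau> = w + (\<gamma> \<sigma> + e *\<^sub>R (((- \<xi>1 / \<alpha>) *\<^sub>R ?q + c) + (- (r + \<tau>)) *\<^sub>R ?q))" by (simp add: w_def)
      have q2: "\<gamma> \<sigma> $ 2 = 0" by (rule h1.\<gamma>_end)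
      have NJ1: "norm (h1.J t) \<le> norm (h1.J \<theta>) + M1"
      proof -
        have "norm (h1.J t - h1.J \<theta>) \<le> M1 * \<bar>t - \<theta>\<bar>" by (intro M1 tr)
        also have "\<dots> \<le> M1 * 1" using t M1 by (intro mult_left_mono) auto
        finally show ?thesis using norm_triangle_sub[of "h1.J t" "h1.J \<theta>"] by simp
      qed
      have NJ2: "norm (h2.J (- (t - e * r))) \<le> norm (h2.J (-\<theta>)) + M2"
      proof -
        have "norm (h2.J (- (t - e * r)) - h2.J (-\<theta>)) \<le> M2 * \<bar>- (t - e * r) - -\<theta>\<bar>" by (intro M2 tr)
        also have "\<dots> \<le> M2 * 1" using t er M2 by (intro mult_left_mono; linarith)
        finally show ?thesis using norm_triangle_sub[of "h2.J (- (t - e * r))" "h2.J (-\<theta>)"] by simp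
      qed
      \<comment> \<open>The start of system 2 is displaced by \<open>e * r\<close>. This moves its
        integral by O(e), which the prefactor \<open>e\<close> makes a term of second order.\<close>
      have J2s: "norm (h2.J (- (t - e * r)) - h2.J (- t)) \<le> M2 * (e * B)"
      proof -
        have "norm (h2.J (- (t - e * r)) - h2.J (- t)) \<le> M2 * \<bar>- (t - e * r) - - t\<bar>" by (intro M2 tr)
        also have "\<dots> \<le> M2 * (e * B)" using er M2 by (intro mult_left_mono) auto
        finally show ?thesis .
      qed
      have uw: "norm u + norm w \<le> (Ca + Cb) * e\<^sup>2" using nu nw by (simp add: algebra_simps)
      have one: "\<bar>(U e t \<xi>0 \<tau> + W e t \<xi>1 r \<tau>) $ 2 - e * (G - (\<beta> / \<alpha>) * (\<xi>0 + \<xi>1) - r * \<beta>)\<bar> \<le> C * e\<^sup>2 + C * e * \<bar>t - \<theta>\<bar>"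
      proof -
        define z where "z = (h1.J t - h1.J \<theta>) + ((h2.J (- (t - e * r)) - h2.J (- t)) + (h2.J (- t) - h2.J (- \<theta>)))"
        have ac: "a $ 2 + c $ 2 - G = h1.Y \<sigma> z $ 2"
          unfolding a_def c_def G_def z_def by (simp add: linear_add[OF h1.linear_Y] linear_diff[OF h1.linear_Y])
        have "norm z \<le> M1 * \<bar>t - \<theta>\<bar> + (M2 * (e * B) + M2 * \<bar>- t - - \<theta>\<bar>)"
          unfolding z_def by (intro order_trans[OF norm_triangle_ineq] add_mono M1(2) M2(2) J2s tr)
        also have "\<dots> = (M1 + M2) * \<bar>t - \<theta>\<bar> + M2 * B * e" by (simp add: algebra_simps abs_minus_commute)
        finally have "norm (h1.Y \<sigma> z) \<le> BY * ((M1 + M2) * \<bar>t - \<theta>\<bar> + M2 * B * e)"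
          using BY by (meson mult_left_mono order_trans less_imp_le)
        then have "\<bar>a $ 2 + c $ 2 - G\<bar> \<le> BY * (M1 + M2) * \<bar>t - \<theta>\<bar> + BY * M2 * B * e"
          unfolding ac using abs_nth_le[of "h1.Y \<sigma> z" 2] by (simp add: algebra_simps)
        then have "e * \<bar>a $ 2 + c $ 2 - G\<bar> \<le> e * (BY * (M1 + M2) * \<bar>t - \<theta>\<bar> + BY * M2 * B * e)"
          using e by (intro mult_left_mono) auto
        moreover have "\<bar>e * (a $ 2 + c $ 2 - G)\<bar> = e * \<bar>a $ 2 + c $ 2 - G\<bar>" using e by (simp add: abs_mult)
        ultimately have 1: "\<bar>e * (a $ 2 + c $ 2 - G)\<bar> \<le> BY * (M1 + M2) * (e * \<bar>t - \<theta>\<bar>) + BY * M2 * B * e\<^sup>2"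
          by (simp only: distrib_left mult_ac power2_eq_square)
        have eq: "(U e t \<xi>0 \<tau> + W e t \<xi>1 r \<tau>) $ 2 - e * (G - (\<beta> / \<alpha>) * (\<xi>0 + \<xi>1) - r * \<beta>)
          = (u $ 2 + w $ 2) + e * (a $ 2 + c $ 2 - G)"
          unfolding Ueq Weq using q2 h1.\<alpha>_pos by (simp add: \<beta>_def field_simps)
        have "\<bar>u $ 2 + w $ 2\<bar> \<le> (Ca + Cb) * e\<^sup>2"
          using abs_nth_le[of u 2] abs_nth_le[of w 2] uw by linarith
        then have "\<bar>(U e t \<xi>0 \<tau> + W e t \<xi>1 r \<tau>) $ 2 - e * (G - (\<beta> / \<alpha>) * (\<xi>0 + \<xi>1) - r * \<beta>)\<bar>
          \<le> (Ca + Cb + BY * M2 * B) * e\<^sup>2 + BY * (M1 + M2) * (e * \<bar>t - \<theta>\<bar>)"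
          unfolding eq using 1 by (simp add: algebra_simps)
        also have "\<dots> \<le> C * e\<^sup>2 + C * (e * \<bar>t - \<theta>\<bar>)"
          using e by (intro add_mono mult_right_mono C) auto
        finally show ?thesis by (simp add: mult.assoc)
      qed
      have two: "\<bar>(U e t \<xi>0 \<tau> - W e t \<xi>1 r \<tau>) $ 2 - e * (2 * \<tau> + r) * \<beta>\<bar> \<le> A * e + C * e\<^sup>2"
      proof -
        have eq: "(U e t \<xi>0 \<tau> - W e t \<xi>1 r \<tau>) $ 2 - e * (2 * \<tau> + r) * \<beta>
          = (u $ 2 - w $ 2) + e * ((\<xi>1 - \<xi>0) * \<beta> / \<alpha> + (a $ 2 - c $ 2))"
          unfolding Ueq Weq using h1.\<alpha>_pos by (simp add: \<beta>_def field_simps)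
        have "\<bar>a $ 2\<bar> \<le> BY * norm (h1.J t)" "\<bar>c $ 2\<bar> \<le> BY * norm (h2.J (- (t - e * r)))"
          unfolding a_def c_def by (rule order_trans[OF abs_nth_le BY(1)])+
        moreover have "BY * (norm (h1.J t) + norm (h2.J (- (t - e * r)))) \<le> BY * NJ"
          using NJ1 NJ2 BY unfolding NJ_def by (intro mult_left_mono) auto
        ultimately have ac: "\<bar>a $ 2 - c $ 2\<bar> \<le> BY * NJ" by (simp add: algebra_simps)
        have "\<bar>(\<xi>1 - \<xi>0) * \<beta> / \<alpha>\<bar> = \<bar>\<xi>1 - \<xi>0\<bar> * (\<beta> / \<alpha>)"
          using \<beta>_pos h1.\<alpha>_pos by (simp add: abs_mult)
        also have "\<dots> \<le> (2 * B) * (\<beta> / \<alpha>)"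
          using \<xi>0 \<xi>1 \<beta>_pos h1.\<alpha>_pos by (intro mult_right_mono) auto
        finally have "\<bar>(\<xi>1 - \<xi>0) * \<beta> / \<alpha> + (a $ 2 - c $ 2)\<bar> \<le> (2 * B) * (\<beta> / \<alpha>) + BY * NJ"
          using ac by linarith
        also have "\<dots> = A" by (simp add: A_def)
        finally have "\<bar>(\<xi>1 - \<xi>0) * \<beta> / \<alpha> + (a $ 2 - c $ 2)\<bar> \<le> A" .
        then have "\<bar>e * ((\<xi>1 - \<xi>0) * \<beta> / \<alpha> + (a $ 2 - c $ 2))\<bar> \<le> A * e"
          using e by (simp add: abs_mult mult.commute[of e])
        moreover have "\<bar>u $ 2 - w $ 2\<bar> \<le> (Ca + Cb) * e\<^sup>2"
          using abs_nth_le[of u 2] abs_nth_le[of w 2] uw by linarith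
        moreover have "(Ca + Cb) * e\<^sup>2 \<le> C * e\<^sup>2" by (intro mult_right_mono C) auto
        ultimately show ?thesis unfolding eq by linarith
      qed
      have three: "\<bar>wedge ?q (U e t \<xi>0 \<tau> - W e t \<xi>1 r \<tau>) - e * M t\<bar> \<le> C * e\<^sup>2"
      proof -
        have "h1.Y \<sigma> (h2.J (- (t - e * r)) - h2.J (- t)) = c - h1.Y \<sigma> (h2.J (- t))"
          by (simp add: c_def linear_diff[OF h1.linear_Y])
        then have eq: "wedge ?q (U e t \<xi>0 \<tau> - W e t \<xi>1 r \<tau>) - e * M t
          = wedge ?q ((u - w) - e *\<^sub>R h1.Y \<sigma> (h2.J (- (t - e * r)) - h2.J (- t)))"
          unfolding Ueq Weq M_def a_def linear_diff[OF h1.linear_Y] wedge_simps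
          by (simp add: c_def algebra_simps)
        have "norm (e *\<^sub>R h1.Y \<sigma> (h2.J (- (t - e * r)) - h2.J (- t))) \<le> e * (BY * (M2 * (e * B)))"
          using e BY J2s by (auto intro!: mult_left_mono order_trans[OF BY(1)])
        moreover have "norm (u - w) \<le> (Ca + Cb) * e\<^sup>2" using uw norm_triangle_ineq4[of u w] by linarith
        ultimately have "norm ((u - w) - e *\<^sub>R h1.Y \<sigma> (h2.J (- (t - e * r)) - h2.J (- t))) \<le> (Ca + Cb) * e\<^sup>2 + e * (BY * (M2 * (e * B)))"
          using norm_triangle_ineq4[of "u - w" "e *\<^sub>R h1.Y \<sigma> (h2.J (- (t - e * r)) - h2.J (- t))"] by linarith
        also have "\<dots> = ((Ca + Cb) + BY * M2 * B) * e\<^sup>2" by (simp add: algebra_simps power2_eq_square)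
        finally have "2 * norm ?q * norm ((u - w) - e *\<^sub>R h1.Y \<sigma> (h2.J (- (t - e * r)) - h2.J (- t))) \<le> 2 * norm ?q * (((Ca + Cb) + BY * M2 * B) * e\<^sup>2)"
          by (intro mult_left_mono) auto
        moreover have "(2 * norm ?q * ((Ca + Cb) + BY * M2 * B)) * e\<^sup>2 \<le> C * e\<^sup>2" by (intro mult_right_mono C) auto
        ultimately show ?thesis unfolding eq using wedge_le[of ?q "(u - w) - e *\<^sub>R h1.Y \<sigma> (h2.J (- (t - e * r)) - h2.J (- t))"]
          by (simp only: mult.assoc)
      qed
      from one two three show ?thesis by blast
    qed
    then show ?thesis using C(1) e1 by blast
  qed
  then show ?thesis using A by blast
qed

text \<open>\<open>matches\<close> packages the matching statement for all families \<open>\<xi>0\<close>, \<open>\<xi>1\<close>, \<open>r\<close> of start data indexed by the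
  start time and one further parameter ranging over \<open>{l0..l1}\<close>.\<close>

definition matches :: "real \<Rightarrow> real \<Rightarrow> real \<Rightarrow> real \<Rightarrow> real \<Rightarrow> bool" where
  "matches B \<eta> K T e1 \<longleftrightarrow> (\<forall>e (\<xi>0 :: real \<times> real \<Rightarrow> real) \<xi>1 r l0 l1. 0 < e \<and> e < e1 \<and> l0 < l1
    \<and> continuous_on ({\<theta> - K * e..\<theta> + K * e} \<times> {l0..l1}) \<xi>0
    \<and> continuous_on ({\<theta> - K * e..\<theta> + K * e} \<times> {l0..l1}) \<xi>1
    \<and> continuous_on ({\<theta> - K * e..\<theta> + K * e} \<times> {l0..l1}) r
    \<and> (\<forall>p\<in>{\<theta> - K * e..\<theta> + K * e} \<times> {l0..l1}. \<bar>\<xi>0 p\<bar> \<le> B \<and> \<bar>\<xi>1 p\<bar> \<le> B \<and> 0 \<le> r p \<and> r p \<le> B)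
    \<and> (\<forall>t\<in>{\<theta> - K * e..\<theta> + K * e}. G - (\<beta> / \<alpha>) * (\<xi>0 (t, l0) + \<xi>1 (t, l0)) - r (t, l0) * \<beta> \<ge> \<eta>)
    \<and> (\<forall>t\<in>{\<theta> - K * e..\<theta> + K * e}. G - (\<beta> / \<alpha>) * (\<xi>0 (t, l1) + \<xi>1 (t, l1)) - r (t, l1) * \<beta> \<le> - \<eta>)
    \<longrightarrow> (\<exists>t \<nu> \<tau>. t \<in> {\<theta> - K * e..\<theta> + K * e} \<and> \<nu> \<in> {l0<..<l1} \<and> \<bar>\<tau>\<bar> \<le> T
        \<and> U e t (\<xi>0 (t, \<nu>)) \<tau> = W e t (\<xi>1 (t, \<nu>)) (r (t, \<nu>)) \<tau> \<and> U e t (\<xi>0 (t, \<nu>)) \<tau> $ 2 = 0))"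

lemma matchesD:
  fixes \<xi>0 \<xi>1 r :: "real \<times> real \<Rightarrow> real"
  assumes m: "matches B \<eta> K T e1" and e: "0 < e" "e < e1" "l0 < l1"
    and cont: "continuous_on ({\<theta> - K * e..\<theta> + K * e} \<times> {l0..l1}) \<xi>0"
      "continuous_on ({\<theta> - K * e..\<theta> + K * e} \<times> {l0..l1}) \<xi>1"
      "continuous_on ({\<theta> - K * e..\<theta> + K * e} \<times> {l0..l1}) r"
    and bd: "\<And>p. p\<in>{\<theta> - K * e..\<theta> + K * e} \<times> {l0..l1} \<Longrightarrow> \<bar>\<xi>0 p\<bar> \<le> B \<and> \<bar>\<xi>1 p\<bar> \<le> B \<and> 0 \<le> r p \<and> r p \<le> B"
    and left: "\<And>t. t\<in>{\<theta> - K * e..\<theta> + K * e} \<Longrightarrow> G - (\<beta> / \<alpha>) * (\<xi>0 (t, l0) + \<xi>1 (t, l0)) - r (t, l0) * \<beta> \<ge> \<eta>"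
    and right: "\<And>t. t\<in>{\<theta> - K * e..\<theta> + K * e} \<Longrightarrow> G - (\<beta> / \<alpha>) * (\<xi>0 (t, l1) + \<xi>1 (t, l1)) - r (t, l1) * \<beta> \<le> - \<eta>"
  obtains t \<nu> \<tau> where "t \<in> {\<theta> - K * e..\<theta> + K * e}" "\<nu> \<in> {l0<..<l1}" "\<bar>\<tau>\<bar> \<le> T"
    "U e t (\<xi>0 (t, \<nu>)) \<tau> = W e t (\<xi>1 (t, \<nu>)) (r (t, \<nu>)) \<tau>" "U e t (\<xi>0 (t, \<nu>)) \<tau> $ 2 = 0"
proof -
  note * = m[unfolded matches_def, THEN spec[of _ e], THEN spec[of _ \<xi>0], THEN spec[of _ \<xi>1], THEN spec[of _ r], THEN spec[of _ l0], THEN spec[of _ l1]]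
  have "\<exists>t \<nu> \<tau>. t \<in> {\<theta> - K * e..\<theta> + K * e} \<and> \<nu> \<in> {l0<..<l1} \<and> \<bar>\<tau>\<bar> \<le> T
        \<and> U e t (\<xi>0 (t, \<nu>)) \<tau> = W e t (\<xi>1 (t, \<nu>)) (r (t, \<nu>)) \<tau> \<and> U e t (\<xi>0 (t, \<nu>)) \<tau> $ 2 = 0"
    by (rule *[THEN mp]) (intro conjI ballI e cont bd left right)
  then show ?thesis using that by (elim exE conjE)
qed

text \<open>On the box in start time, parameter and meeting time the three combinations of
  \<open>matching_expansion\<close> change sign between opposite faces. At a common zero both
  arrivals lie on the axis and, since \<open>F (\<gamma> \<sigma>)\<close> is transversal to the
  axis, coincide.\<close>

lemma matching:
  assumes B: "0 \<le> B" and \<eta>: "0 < \<eta>"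
  shows "\<exists>K>0. \<exists>T\<ge>0. \<exists>e1>0. matches B \<eta> K T e1"
proof -
  let ?q = "F (\<gamma> \<sigma>)"
  obtain A where A: "0 \<le> A" and Aexp: "\<forall>T\<ge>0. \<exists>C\<ge>0. \<exists>e1>0. \<forall>e t \<xi>0 \<xi>1 r \<tau>. 0 < e \<and> e < e1 \<and> \<bar>t - \<theta>\<bar> \<le> 1/2 \<and> \<bar>\<xi>0\<bar> \<le> B \<and> \<bar>\<xi>1\<bar> \<le> B \<and> 0 \<le> r \<and> r \<le> B \<and> \<bar>\<tau>\<bar> \<le> T \<longrightarrow>
    \<bar>(U e t \<xi>0 \<tau> + W e t \<xi>1 r \<tau>) $ 2 - e * (G - (\<beta> / \<alpha>) * (\<xi>0 + \<xi>1) - r * \<beta>)\<bar> \<le> C * e\<^sup>2 + C * e * \<bar>t - \<theta>\<bar>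
    \<and> \<bar>(U e t \<xi>0 \<tau> - W e t \<xi>1 r \<tau>) $ 2 - e * (2 * \<tau> + r) * \<beta>\<bar> \<le> A * e + C * e\<^sup>2
    \<and> \<bar>wedge ?q (U e t \<xi>0 \<tau> - W e t \<xi>1 r \<tau>) - e * M t\<bar> \<le> C * e\<^sup>2"
    using matching_expansion[OF B] by blast
  \<comment> \<open>On the faces where \<open>\<tau>\<close> is \<open>T\<close> or
    \<open>- T\<close>, the term with \<open>\<tau>\<close> must outweigh \<open>A\<close>, the
    slide term \<open>B * \<beta>\<close> and a margin 1.\<close>
  define T where "T = (A + B * \<beta> + 1) / \<beta>"
  have T: "0 \<le> T" "T * \<beta> = A + B * \<beta> + 1" using A B \<beta>_pos by (auto simp: T_def)
  obtain C ea where C: "0 \<le> C" and ea: "0 < ea" and exp: "\<And>e t \<xi>0 \<xi>1 r \<tau>. 0 < e \<Longrightarrow> e < ea \<Longrightarrow> \<bar>t - \<theta>\<bar> \<le> 1/2 \<Longrightarrow> \<bar>\<xi>0\<bar> \<le> B \<Longrightarrow> \<bar>\<xi>1\<bar> \<le> B \<Longrightarrow> 0 \<le> r \<Longrightarrow> r \<le> B \<Longrightarrow> \<bar>\<tau>\<bar> \<le> T \<Longrightarrow>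
    \<bar>(U e t \<xi>0 \<tau> + W e t \<xi>1 r \<tau>) $ 2 - e * (G - (\<beta> / \<alpha>) * (\<xi>0 + \<xi>1) - r * \<beta>)\<bar> \<le> C * e\<^sup>2 + C * e * \<bar>t - \<theta>\<bar>
    \<and> \<bar>(U e t \<xi>0 \<tau> - W e t \<xi>1 r \<tau>) $ 2 - e * (2 * \<tau> + r) * \<beta>\<bar> \<le> A * e + C * e\<^sup>2
    \<and> \<bar>wedge ?q (U e t \<xi>0 \<tau> - W e t \<xi>1 r \<tau>) - e * M t\<bar> \<le> C * e\<^sup>2"
    using Aexp[rule_format, OF T(1)] by blast
  obtain d where d: "0 < d" and Msgn: "\<And>h. 0 < h \<Longrightarrow> h < d \<Longrightarrow>
    sgn M' * M (\<theta> + h) \<ge> \<bar>M'\<bar> / 2 * h \<and> sgn M' * M (\<theta> - h) \<le> - (\<bar>M'\<bar> / 2 * h)"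
    using M_sign by blast
  \<comment> \<open>With half the slope of \<open>M\<close>, this makes \<open>e * M\<close> exceed
    the error \<open>C * e\<^sup>2\<close> by \<open>e\<^sup>2\<close> at distance
    \<open>K * e\<close> from \<open>\<theta>\<close>.\<close>
  define K where "K = 2 * (C + 1) / \<bar>M'\<bar>"
  have K: "0 < K" "\<bar>M'\<bar> / 2 * K = C + 1" using M'_nonzero C by (auto simp: K_def)
  define m where "m = min (min ea e0) (min (min d (1/2)) (min (\<eta> / 2) (min \<sigma> 1)))"
  have m: "0 < m" using ea e0_pos d \<eta> h1.\<sigma>_pos by (simp add: m_def)
  define S where "S = 2 + K + C + C * K + B + T"
  have CK: "0 \<le> C * K" using C K by simp
  have S: "1 < S" "K \<le> S" "C + C * K \<le> S" "K + B \<le> S" "T + B \<le> S" "C \<le> S"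
    using K C T B CK unfolding S_def by linarith+
  have s1: "\<bar>sgn M'\<bar> = 1" using M'_nonzero by (auto simp: sgn_if)
  have main: "\<exists>t \<nu> \<tau>. t \<in> {\<theta> - K * e..\<theta> + K * e} \<and> \<nu> \<in> {l0<..<l1} \<and> \<bar>\<tau>\<bar> \<le> T
        \<and> U e t (\<xi>0 (t, \<nu>)) \<tau> = W e t (\<xi>1 (t, \<nu>)) (r (t, \<nu>)) \<tau> \<and> U e t (\<xi>0 (t, \<nu>)) \<tau> $ 2 = 0"
    if e: "0 < e" "e < m / S" and l: "l0 < l1"
      and cont: "continuous_on ({\<theta> - K * e..\<theta> + K * e} \<times> {l0..l1}) \<xi>0"
        "continuous_on ({\<theta> - K * e..\<theta> + K * e} \<times> {l0..l1}) \<xi>1"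
        "continuous_on ({\<theta> - K * e..\<theta> + K * e} \<times> {l0..l1}) r"
      and bd: "\<And>p. p\<in>{\<theta> - K * e..\<theta> + K * e} \<times> {l0..l1} \<Longrightarrow> \<bar>\<xi>0 p\<bar> \<le> B \<and> \<bar>\<xi>1 p\<bar> \<le> B \<and> 0 \<le> r p \<and> r p \<le> B"
      and left: "\<And>t. t\<in>{\<theta> - K * e..\<theta> + K * e} \<Longrightarrow> G - (\<beta> / \<alpha>) * (\<xi>0 (t, l0) + \<xi>1 (t, l0)) - r (t, l0) * \<beta> \<ge> \<eta>"
      and right: "\<And>t. t\<in>{\<theta> - K * e..\<theta> + K * e} \<Longrightarrow> G - (\<beta> / \<alpha>) * (\<xi>0 (t, l1) + \<xi>1 (t, l1)) - r (t, l1) * \<beta> \<le> - \<eta>"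
    for e l0 l1 :: real and \<xi>0 \<xi>1 r :: "real \<times> real \<Rightarrow> real"
  proof -
    have eSm: "e * S < m" using e S by (simp add: pos_less_divide_eq)
    have "e * 1 < m" "e * K < m" "e * (C + C * K) < m" "e * (K + B) < m" "e * (T + B) < m" "e * C < m"
      using e(1) by (intro le_less_trans[OF mult_left_mono eSm] less_imp_le[OF S(1)] S; simp)+
    then have sm: "e < ea" "e < e0" "e * K < d" "e * K \<le> 1/2" "e * (C + C * K) < \<eta>" "e * (K + B) \<le> 1/2"
      "e * (T + B) \<le> \<sigma>" "e * (T + B) \<le> 1" "e * C < 1"
      using \<eta> by (auto simp: m_def)
    let ?I = "{\<theta> - K * e..\<theta> + K * e}"
    let ?Q = "?I \<times> {l0..l1} \<times> {- T..T}"
    define u where "u p = U e (fst p) (\<xi>0 (fst p, fst (snd p))) (snd (snd p))" for p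
    define w where "w p = W e (fst p) (\<xi>1 (fst p, fst (snd p))) (r (fst p, fst (snd p))) (snd (snd p))" for p
    have Ke: "0 < K * e" "K * e \<le> 1/2" "K * e < d" using K e sm by (auto simp: mult.commute)
    have proj_Q: "(fst p, fst (snd p)) \<in> ?I \<times> {l0..l1}" if "p \<in> ?Q" for p using that by auto
    have c3: "continuous_on ?Q (\<lambda>p. f (fst p, fst (snd p)))" if "continuous_on (?I \<times> {l0..l1}) f" for f :: "real \<times> real \<Rightarrow> real"
      by (rule continuous_on_compose2[OF that]) (auto intro!: continuous_intros)
    have e\<tau>: "\<bar>e * \<tau>\<bar> \<le> e * T" if "\<bar>\<tau>\<bar> \<le> T" for \<tau> using that e by (simp add: abs_mult)
    have erB: "0 \<le> e * r p \<and> e * r p \<le> e * B" if "p \<in> ?I \<times> {l0..l1}" for p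
      using bd[OF that] e by (simp add: mult_left_mono)
    have eTB: "e * T + e * B \<le> \<sigma>" "e * T + e * B \<le> 1" "e * K + e * B \<le> 1/2" "0 \<le> e * B" "0 \<le> e * T"
      using sm e B T by (auto simp: algebra_simps)
    have contU: "continuous_on ?Q u"
    proof -
      have "continuous_on ?Q (\<lambda>p. (\<lambda>(t, x, s). h1.sol e t x s) (fst p, xv + e * \<xi>0 (fst p, fst (snd p)), \<sigma> + e * snd (snd p)))"
      proof (rule continuous_on_compose2[OF h1.sol_continuous[OF e(1) sm(2)]])
        show "continuous_on ?Q (\<lambda>p. (fst p, xv + e * \<xi>0 (fst p, fst (snd p)), \<sigma> + e * snd (snd p)))"
          by (intro continuous_intros c3 cont)
        show "(\<lambda>p. (fst p, xv + e * \<xi>0 (fst p, fst (snd p)), \<sigma> + e * snd (snd p))) ` ?Q \<subseteq> {\<theta>-1..\<theta>+1} \<times> UNIV \<times> {0..\<sigma>+1}"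
        proof (rule image_subsetI)
          fix p assume p: "p \<in> ?Q"
          have "\<bar>e * snd (snd p)\<bar> \<le> e * T" by (rule e\<tau>) (use p in auto)
          then have "\<sigma> + e * snd (snd p) \<in> {0..\<sigma>+1}" unfolding atLeastAtMost_iff using eTB by linarith
          moreover have "fst p \<in> ?I" using p by auto
          then have "fst p \<in> {\<theta>-1..\<theta>+1}" unfolding atLeastAtMost_iff using Ke by linarith
          ultimately show "(fst p, xv + e * \<xi>0 (fst p, fst (snd p)), \<sigma> + e * snd (snd p)) \<in> {\<theta>-1..\<theta>+1} \<times> UNIV \<times> {0..\<sigma>+1}"
            by simp
        qed
      qed
      then show ?thesis unfolding u_def U_def by simp
    qed
    have contW: "continuous_on ?Q w"
    proof -
      let ?f = "\<lambda>p. (- (fst p - e * r (fst p, fst (snd p))), xv + e * \<xi>1 (fst p, fst (snd p)), \<sigma> - e * (r (fst p, fst (snd p)) + snd (snd p)))"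
      have "continuous_on ?Q (\<lambda>p. (\<lambda>(t, x, s). h2.sol e t x s) (?f p))"
      proof (rule continuous_on_compose2[OF h2.sol_continuous[OF e(1) sm(2)]])
        show "continuous_on ?Q ?f" by (intro continuous_intros c3 cont)
        show "?f ` ?Q \<subseteq> {-\<theta>-1..-\<theta>+1} \<times> UNIV \<times> {0..\<sigma>+1}"
        proof (rule image_subsetI)
          fix p assume p: "p \<in> ?Q"
          have a: "\<bar>e * snd (snd p)\<bar> \<le> e * T" by (rule e\<tau>) (use p in auto)
          note b = erB[OF proj_Q[OF p]]
          have "\<sigma> - (e * r (fst p, fst (snd p)) + e * snd (snd p)) \<in> {0..\<sigma>+1}"
            unfolding atLeastAtMost_iff using eTB a b by linarith
          moreover have "fst p \<in> ?I" using p by auto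
          then have "- (fst p - e * r (fst p, fst (snd p))) \<in> {-\<theta>-1..-\<theta>+1}"
            unfolding atLeastAtMost_iff using Ke eTB b by (auto simp: mult.commute[of e K])
          ultimately show "?f p \<in> {-\<theta>-1..-\<theta>+1} \<times> UNIV \<times> {0..\<sigma>+1}"
            by (simp add: distrib_left)
        qed
      qed
      then show ?thesis unfolding w_def W_def by simp
    qed
    have ex: "\<bar>(u (t, \<nu>, \<tau>) + w (t, \<nu>, \<tau>)) $ 2 - e * (G - (\<beta> / \<alpha>) * (\<xi>0 (t, \<nu>) + \<xi>1 (t, \<nu>)) - r (t, \<nu>) * \<beta>)\<bar> \<le> C * e\<^sup>2 + C * e * (K * e)
      \<and> \<bar>(u (t, \<nu>, \<tau>) - w (t, \<nu>, \<tau>)) $ 2 - e * (2 * \<tau> + r (t, \<nu>)) * \<beta>\<bar> \<le> A * e + C * e\<^sup>2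
      \<and> \<bar>wedge ?q (u (t, \<nu>, \<tau>) - w (t, \<nu>, \<tau>)) - e * M t\<bar> \<le> C * e\<^sup>2" if p: "(t, \<nu>, \<tau>) \<in> ?Q" for t \<nu> \<tau>
    proof -
      have tK: "\<bar>t - \<theta>\<bar> \<le> K * e" using p by (auto simp: abs_le_iff)
      have "C * e * \<bar>t - \<theta>\<bar> \<le> C * e * (K * e)" using tK C e by (intro mult_left_mono) auto
      moreover have "\<bar>t - \<theta>\<bar> \<le> 1/2" using tK Ke by linarith
      moreover have "\<bar>\<tau>\<bar> \<le> T" using p by (auto simp: abs_le_iff)
      moreover note bd[OF proj_Q[OF p, simplified fst_conv snd_conv]]
      ultimately show ?thesis
        using exp[OF e(1) sm(1), of t "\<xi>0 (t, \<nu>)" "\<xi>1 (t, \<nu>)" "r (t, \<nu>)" \<tau>] unfolding u_def w_def fst_conv snd_conv by linarith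
    qed
    have Ce: "C * e\<^sup>2 + C * e * (K * e) < e * \<eta>"
    proof -
      have "C * e\<^sup>2 + C * e * (K * e) = e * (e * (C + C * K))" by (simp add: algebra_simps power2_eq_square)
      also have "\<dots> < e * \<eta>" using sm e by (intro mult_strict_left_mono) auto
      finally show ?thesis .
    qed
    \<comment> \<open>\<open>sgn M'\<close> and the minus sign orient the three functions as the
      sign conditions demand.\<close>
    obtain t \<nu> \<tau> where sol: "(t, \<nu>, \<tau>) \<in> ?Q" "sgn M' * wedge ?q (u (t, \<nu>, \<tau>) - w (t, \<nu>, \<tau>)) = 0"
      "- (u (t, \<nu>, \<tau>) + w (t, \<nu>, \<tau>)) $ 2 = 0" "(u (t, \<nu>, \<tau>) - w (t, \<nu>, \<tau>)) $ 2 = 0"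
    proof (rule poincare_miranda[of "\<theta> - K * e" "\<theta> + K * e" l0 l1 "- T" T "\<lambda>p. sgn M' * wedge ?q (u p - w p)"
          "\<lambda>p. - (u p + w p) $ 2" "\<lambda>p. (u p - w p) $ 2"])
      show "\<theta> - K * e \<le> \<theta> + K * e" "l0 \<le> l1" "- T \<le> T" using Ke l T by auto
      show "continuous_on ?Q (\<lambda>p. sgn M' * wedge ?q (u p - w p))"
        unfolding wedge_def by (intro continuous_intros contU contW)
      show "continuous_on ?Q (\<lambda>p. - (u p + w p) $ 2)" "continuous_on ?Q (\<lambda>p. (u p - w p) $ 2)"
        by (intro continuous_intros contU contW)+
      have wM: "\<bar>sgn M' * wedge ?q (u (t, \<nu>, \<tau>) - w (t, \<nu>, \<tau>)) - e * (sgn M' * M t)\<bar> \<le> C * e\<^sup>2" if p: "(t, \<nu>, \<tau>) \<in> ?Q" for t \<nu> \<tau>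
      proof -
        have "sgn M' * wedge ?q (u (t, \<nu>, \<tau>) - w (t, \<nu>, \<tau>)) - e * (sgn M' * M t)
          = sgn M' * (wedge ?q (u (t, \<nu>, \<tau>) - w (t, \<nu>, \<tau>)) - e * M t)" by (simp add: algebra_simps)
        then show ?thesis using ex[OF p] s1 by (simp add: abs_mult)
      qed
      have eM: "e * (\<bar>M'\<bar> / 2 * (K * e)) = (C + 1) * e\<^sup>2"
        unfolding K(2)[symmetric] by (simp add: power2_eq_square)
      have e2: "0 < e\<^sup>2" using e by simp
      show "sgn M' * wedge ?q (u (\<theta> - K * e, y, z) - w (\<theta> - K * e, y, z)) < 0" if "(\<theta> - K * e, y, z) \<in> ?Q" for y z
      proof -
        have "e * (sgn M' * M (\<theta> - K * e)) \<le> e * (- (\<bar>M'\<bar> / 2 * (K * e)))"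
          using Msgn[OF Ke(1,3)] e by (intro mult_left_mono) auto
        then have "e * (sgn M' * M (\<theta> - K * e)) \<le> - ((C + 1) * e\<^sup>2)" using eM by simp
        then show ?thesis using wM[OF that] e2 unfolding distrib_right abs_le_iff mult_1 by linarith
      qed
      show "sgn M' * wedge ?q (u (\<theta> + K * e, y, z) - w (\<theta> + K * e, y, z)) > 0" if "(\<theta> + K * e, y, z) \<in> ?Q" for y z
      proof -
        have "e * (\<bar>M'\<bar> / 2 * (K * e)) \<le> e * (sgn M' * M (\<theta> + K * e))"
          using Msgn[OF Ke(1,3)] e by (intro mult_left_mono) auto
        then have "(C + 1) * e\<^sup>2 \<le> e * (sgn M' * M (\<theta> + K * e))" using eM by simp
        then show ?thesis using wM[OF that] e2 unfolding distrib_right abs_le_iff mult_1 by linarith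
      qed
      show "- (u (x, l0, z) + w (x, l0, z)) $ 2 < 0" if p: "(x, l0, z) \<in> ?Q" for x z
      proof -
        have "e * \<eta> \<le> e * (G - (\<beta> / \<alpha>) * (\<xi>0 (x, l0) + \<xi>1 (x, l0)) - r (x, l0) * \<beta>)"
          using left[of x] p e by (intro mult_left_mono) auto
        then show ?thesis using ex[OF p, THEN conjunct1] Ce unfolding vector_uminus_component by linarith
      qed
      show "- (u (x, l1, z) + w (x, l1, z)) $ 2 > 0" if p: "(x, l1, z) \<in> ?Q" for x z
      proof -
        have "e * (G - (\<beta> / \<alpha>) * (\<xi>0 (x, l1) + \<xi>1 (x, l1)) - r (x, l1) * \<beta>) \<le> e * (- \<eta>)"
          using right[of x] p e by (intro mult_left_mono) auto
        then show ?thesis using ex[OF p, THEN conjunct1] Ce unfolding vector_uminus_component by simp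
      qed
      have Ce1: "A * e + C * e\<^sup>2 < e * (A + 1)"
        using sm(9) e mult_strict_left_mono[of "e * C" 1 e] by (simp add: algebra_simps power2_eq_square)
      have r\<beta>: "e * (r (x, y) * \<beta>) \<le> e * (B * \<beta>) \<and> 0 \<le> e * (r (x, y) * \<beta>)" if "(x, y) \<in> ?I \<times> {l0..l1}" for x y
        using bd[OF that] e \<beta>_pos by (auto intro!: mult_left_mono mult_right_mono)
      have T2: "e * (T * \<beta>) = e * (A + 1) + e * (B * \<beta>)" unfolding T(2) by (simp add: algebra_simps)
      have eT: "0 \<le> e * (T * \<beta>)" "0 \<le> e * (B * \<beta>)" using e T(1) \<beta>_pos B by simp_all
      show "(u (x, y, - T) - w (x, y, - T)) $ 2 < 0" if p: "(x, y, - T) \<in> ?Q" for x y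
      proof -
        have "e * (2 * (- T) + r (x, y)) * \<beta> = e * (r (x, y) * \<beta>) - 2 * (e * (T * \<beta>))" by (simp add: algebra_simps)
        moreover have "(x, y) \<in> ?I \<times> {l0..l1}" using p by auto
        ultimately show ?thesis using ex[OF p] Ce1 r\<beta>[of x y] T2 eT by linarith
      qed
      show "(u (x, y, T) - w (x, y, T)) $ 2 > 0" if p: "(x, y, T) \<in> ?Q" for x y
      proof -
        have "e * (2 * T + r (x, y)) * \<beta> = e * (r (x, y) * \<beta>) + 2 * (e * (T * \<beta>))" by (simp add: algebra_simps)
        moreover have "(x, y) \<in> ?I \<times> {l0..l1}" using p by auto
        ultimately show ?thesis using ex[OF p] Ce1 r\<beta>[of x y] T2 eT by linarith
      qed
    qed
    have u2: "u (t, \<nu>, \<tau>) $ 2 = 0" "w (t, \<nu>, \<tau>) $ 2 = 0" using sol(3,4) by auto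
    have "wedge ?q (u (t, \<nu>, \<tau>) - w (t, \<nu>, \<tau>)) = 0" using sol(2) M'_nonzero by (simp add: sgn_zero_iff)
    then have "\<beta> * (u (t, \<nu>, \<tau>) $ 1 - w (t, \<nu>, \<tau>) $ 1) = 0" using u2 by (simp add: wedge_def \<beta>_def)
    then have uw: "u (t, \<nu>, \<tau>) = w (t, \<nu>, \<tau>)" using \<beta>_pos u2 by (simp add: vec2_eq_iff)
    have tI: "t \<in> ?I" using sol(1) by auto
    \<comment> \<open>The margin \<open>\<eta>\<close> beats the error at both ends, so the
      endpoints are excluded; for the slide this gives a positive duration.\<close>
    have "\<nu> \<noteq> l0"
    proof
      assume eq: "\<nu> = l0"
      have "e * \<eta> \<le> e * (G - (\<beta> / \<alpha>) * (\<xi>0 (t, \<nu>) + \<xi>1 (t, \<nu>)) - r (t, \<nu>) * \<beta>)"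
        unfolding eq using left[OF tI] e by (intro mult_left_mono) auto
      then show False using ex[OF sol(1), THEN conjunct1] Ce sol(3) by simp
    qed
    moreover have "\<nu> \<noteq> l1"
    proof
      assume eq: "\<nu> = l1"
      have "e * (G - (\<beta> / \<alpha>) * (\<xi>0 (t, \<nu>) + \<xi>1 (t, \<nu>)) - r (t, \<nu>) * \<beta>) \<le> e * (- \<eta>)"
        unfolding eq using right[OF tI] e by (intro mult_left_mono) auto
      then show False using ex[OF sol(1), THEN conjunct1] Ce sol(3) by simp
    qed
    ultimately have "\<nu> \<in> {l0<..<l1}" using sol(1) by auto
    moreover have "\<bar>\<tau>\<bar> \<le> T" using sol(1) by (auto simp: abs_le_iff)
    ultimately show ?thesis using tI uw u2 unfolding u_def w_def fst_conv snd_conv by blast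
  qed
  have mS: "0 < m / S" using m S by simp
  show ?thesis
    by (rule exI[of _ K], rule conjI, rule K(1), rule exI[of _ T], rule conjI, rule T(1),
        rule exI[of _ "m / S"], rule conjI, rule mS, unfold matches_def, intro allI impI, elim conjE, rule main; blast)
qed

end

section \<open>Sliding along the switching manifold\<close>

text \<open>Growth is known only while \<open>\<phi>\<close> is at most \<open>\<kappa>\<close>. If
  \<open>\<phi>\<close> were not positive at \<open>r\<close>, then after the last time with
  \<open>\<phi> \<ge> \<kappa>\<close>, or from 0 on if there is none, it could only have grown.
  This keeps the slide inside the sliding region although a vertical component vanishes at its
  start.\<close>

lemma positive_by_growth:
  fixes \<phi> :: "real \<Rightarrow> real"
  assumes cont: "continuous_on {0..S} \<phi>" and start: "0 \<le> \<phi> 0" and c: "0 < c" and \<kappa>: "0 < \<kappa>"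
    and growth: "\<And>r r'. 0 \<le> r \<Longrightarrow> r \<le> r' \<Longrightarrow> r' \<le> S \<Longrightarrow> (\<And>s. s \<in> {r<..<r'} \<Longrightarrow> \<phi> s \<le> \<kappa>) \<Longrightarrow> c * (r' - r) \<le> \<phi> r' - \<phi> r"
    and r: "r \<in> {0<..S}"
  shows "0 < \<phi> r"
proof (rule ccontr)
  assume neg: "\<not> 0 < \<phi> r"
  define A where "A = {0..r} \<inter> \<phi> -` {\<kappa>..}"
  show False
  proof (cases "A = {}")
    case True
    have "\<phi> s \<le> \<kappa>" if "s \<in> {0<..<r}" for s
    proof -
      have "s \<notin> A" using True by simp
      then show ?thesis using that by (simp add: A_def)
    qed
    then have "c * (r - 0) \<le> \<phi> r - \<phi> 0" using r by (intro growth) auto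
    moreover have "0 < c * (r - 0)" using c r by simp
    ultimately show False using start neg by linarith
  next
    case False
    have "closed A"
      unfolding A_def using r by (intro continuous_closed_preimage continuous_on_subset[OF cont]) auto
    moreover have "bounded A" unfolding A_def by (rule bounded_subset[of "{0..r}"]) auto
    ultimately have "compact A" using compact_eq_bounded_closed by blast
    then obtain m where m: "m \<in> A" "\<And>s. s \<in> A \<Longrightarrow> s \<le> m"
      using compact_attains_sup[of A] False by blast
    have mr: "0 \<le> m" "m \<le> r" "\<kappa> \<le> \<phi> m" using m by (auto simp: A_def)
    have "c * (r - m) \<le> \<phi> r - \<phi> m"
    proof (rule growth)
      fix s assume s: "s \<in> {m<..<r}"
      show "\<phi> s \<le> \<kappa>"
      proof (rule ccontr)
        assume "\<not> \<phi> s \<le> \<kappa>"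
        then have "s \<in> A" using s mr by (auto simp: A_def)
        then show False using m(2)[of s] s by simp
      qed
    qed (use mr r in auto)
    moreover have "0 \<le> c * (r - m)" using c mr by simp
    ultimately show False using mr neg \<kappa> by linarith
  qed
qed

lemma quotient_diff_le:
  fixes a a' d d' :: real
  assumes m: "0 < m" "m \<le> d" "m \<le> d'" and A: "\<bar>a'\<bar> \<le> A"
  shows "\<bar>a / d - a' / d'\<bar> \<le> \<bar>a - a'\<bar> / m + A * \<bar>d - d'\<bar> / m\<^sup>2"
proof -
  have pos: "0 < d" "0 < d'" using m by auto
  have "a / d - a' / d' = (a - a') / d + a' * (d' - d) / (d * d')"
    using pos by (simp add: field_simps)
  also have "\<bar>\<dots>\<bar> \<le> \<bar>(a - a') / d\<bar> + \<bar>a' * (d' - d) / (d * d')\<bar>" by (rule abs_triangle_ineq)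
  also have "\<dots> = \<bar>a - a'\<bar> / d + \<bar>a'\<bar> * \<bar>d - d'\<bar> / (d * d')"
    using pos by (simp add: abs_mult abs_minus_commute)
  also have "\<dots> \<le> \<bar>a - a'\<bar> / m + A * \<bar>d - d'\<bar> / (m * m)"
    using m pos A by (intro add_mono frac_le mult_mono mult_pos_pos) auto
  finally show ?thesis by (simp add: power2_eq_square)
qed

context fold_tube
begin

lemma on_axis_tube: "\<bar>x - xv\<bar> \<le> \<delta> \<Longrightarrow> on_axis x \<in> tube \<delta>"
  using \<sigma>_pos by (intro tubeI[of 0]) (auto simp: \<gamma>_0 on_axis_diff[symmetric])

text \<open>The slope at the fold is \<open>b\<close>, and the Lipschitz bound of \<open>DF\<close>
  keeps at least half of it nearby.\<close>

lemma F2_increasing: "\<exists>r>0. r \<le> \<delta> \<and> (\<forall>x x'. \<bar>x - xv\<bar> \<le> r \<and> \<bar>x' - xv\<bar> \<le> r \<and> x \<le> x' \<longrightarrow>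
    b / 2 * (x' - x) \<le> F (on_axis x') $ 2 - F (on_axis x) $ 2)"
proof -
  define r where "r = min \<delta> (b / (2 * L + 1))"
  have r: "0 < r" "r \<le> \<delta>" using \<delta>_pos b_pos L_nonneg by (auto simp: r_def)
  have "L * r \<le> L * (b / (2 * L + 1))" using L_nonneg by (intro mult_left_mono) (auto simp: r_def)
  also have "\<dots> \<le> b / 2" using L_nonneg b_pos by (simp add: field_simps)
  finally have Lr: "L * r \<le> b / 2" .
  have "b / 2 * (x' - x) \<le> F (on_axis x') $ 2 - F (on_axis x) $ 2"
    if x: "\<bar>x - xv\<bar> \<le> r" and x': "\<bar>x' - xv\<bar> \<le> r" and le: "x \<le> x'" for x x'
  proof -
    have in_r: "\<bar>s - xv\<bar> \<le> r" if "s \<in> {x..x'}" for s using that x x' by auto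
    have "- F (on_axis x') $ 2 - - F (on_axis x) $ 2 \<le> (- (b / 2)) * (x' - x)"
    proof (rule increment_le_of_derivative_le[OF le, where h = "\<lambda>s. - F (on_axis s) $ 2" and h' = "\<lambda>s. - DF (on_axis s) (on_axis 1) $ 2"])
      fix s assume s: "s \<in> {x..x'}"
      have st: "on_axis s \<in> tube \<delta>" using in_r[OF s] r by (intro on_axis_tube) auto
      then have sD: "on_axis s \<in> D" using tube_D by blast
      have "(on_axis has_vector_derivative on_axis 1) (at s within {x..x'})"
        using bounded_linear.has_vector_derivative[OF bounded_linear_on_axis has_vector_derivative_id] by simp
      from vector_derivative_diff_chain_within[OF this has_derivative_at_withinI[OF C2'(1)[OF sD]]]
      have "((F \<circ> on_axis) has_vector_derivative DF (on_axis s) (on_axis 1)) (at s within {x..x'})" .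
      then have "((\<lambda>s. F (on_axis s) $ 2) has_real_derivative DF (on_axis s) (on_axis 1) $ 2) (at s within {x..x'})"
        using has_vector_derivative_nth[of "F \<circ> on_axis"] by simp
      then show "((\<lambda>s. - F (on_axis s) $ 2) has_real_derivative - DF (on_axis s) (on_axis 1) $ 2) (at s within {x..x'})"
        by (rule DERIV_minus[THEN DERIV_cong]) simp
    next
      fix s assume "s \<in> {x<..<x'}"
      then have s: "s \<in> {x..x'}" by simp
      have st: "on_axis s \<in> tube \<delta>" using in_r[OF s] r by (intro on_axis_tube) auto
      have "norm (DF (on_axis s) (on_axis 1) - DF (on_axis xv) (on_axis 1)) \<le> L * norm (on_axis s - on_axis xv) * norm (on_axis 1)"
        using \<delta>_pos by (intro DF_lip st on_axis_tube) auto
      also have "\<dots> \<le> L * r"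
        using in_r[OF s] L_nonneg by (simp add: on_axis_diff[symmetric] mult_left_mono)
      finally show "- DF (on_axis s) (on_axis 1) $ 2 \<le> - (b / 2)"
        using Lr fold abs_nth_le[of "DF (on_axis s) (on_axis 1) - DF (on_axis xv) (on_axis 1)" 2] by simp
    qed
    then show ?thesis by simp
  qed
  then show ?thesis using r by blast
qed

lemma F2_linear: "\<bar>h\<bar> \<le> \<delta> \<Longrightarrow> \<bar>F (on_axis (xv + h)) $ 2 - b * h\<bar> \<le> L * h\<^sup>2"
proof -
  assume h: "\<bar>h\<bar> \<le> \<delta>"
  have D: "linear (DF (on_axis xv))" using \<gamma>_in_D[of 0] \<sigma>_pos by (intro DF_linear) (simp add: \<gamma>_0)
  have "norm (F (\<gamma> 0 + on_axis h) - F (\<gamma> 0) - DF (\<gamma> 0) (on_axis h)) \<le> L * (norm (on_axis h))\<^sup>2"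
    using h \<sigma>_pos by (intro F_taylor) auto
  moreover have "DF (on_axis xv) (on_axis h) $ 2 = b * h"
    using fold linear_scale[OF D, of h "on_axis 1"] by (simp add: on_axis_mult[symmetric] mult.commute)
  ultimately show ?thesis
    using abs_nth_le[of "F (\<gamma> 0 + on_axis h) - F (\<gamma> 0) - DF (\<gamma> 0) (on_axis h)" 2]
    by (simp add: \<gamma>_0 on_axis_add[symmetric] F_start)
qed

end

section \<open>The two fields on the switching manifold near the folds\<close>

context two_halves
begin

definition Xlow :: "real \<Rightarrow> real \<Rightarrow> real^2 \<Rightarrow> real^2" where "Xlow e t z = h1.X e t z"
text \<open>Undoes the reflection and the time reversal behind system 2, so this is the field of the
  upper half-plane.\<close>

definition Xup :: "real \<Rightarrow> real \<Rightarrow> real^2 \<Rightarrow> real^2" where "Xup e t z = - reflect (h2.X e (- t) (reflect z))"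

abbreviation "lo e t x \<equiv> Xlow e t (on_axis x)"
abbreviation "up e t x \<equiv> Xup e t (on_axis x)"

definition slide_speed :: "real \<Rightarrow> real \<Rightarrow> real \<Rightarrow> real" where
  "slide_speed e t x = (lo e t x $ 2 * up e t x $ 1 - up e t x $ 2 * lo e t x $ 1) / (lo e t x $ 2 - up e t x $ 2)"

lemma up_nth: "up e t x $ 1 = - h2.X e (- t) (on_axis x) $ 1" "up e t x $ 2 = h2.X e (- t) (on_axis x) $ 2"
  by (simp_all add: Xup_def)

lemma time_range: "t \<in> {\<theta>-1..\<theta>+1} \<Longrightarrow> t \<in> {\<theta>-2..\<theta>+\<sigma>+3}"
    "t \<in> {\<theta>-1..\<theta>+1} \<Longrightarrow> - t \<in> {-\<theta>-2..-\<theta>+\<sigma>+3}"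
  using h1.\<sigma>_pos by auto

lemma axis_lip:
  assumes e: "0 < e" "e < e0" and t: "t \<in> {\<theta>-1..\<theta>+1}" "t' \<in> {\<theta>-1..\<theta>+1}" and x: "\<bar>x - xv\<bar> \<le> \<delta>" "\<bar>x' - xv\<bar> \<le> \<delta>"
  shows "\<bar>lo e t x $ i - lo e t' x' $ i\<bar> \<le> 2 * L * (\<bar>t - t'\<bar> + \<bar>x - x'\<bar>)"
    and "\<bar>up e t x $ i - up e t' x' $ i\<bar> \<le> 2 * L * (\<bar>t - t'\<bar> + \<bar>x - x'\<bar>)"
    and "\<bar>lo e t x $ i\<bar> \<le> 2 * L" "\<bar>up e t x $ i\<bar> \<le> 2 * L"
proof -
  note tu = h1.on_axis_tube[OF x(1)] h1.on_axis_tube[OF x(2)]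
  have Le: "L * e * \<bar>t - t'\<bar> \<le> 2 * L * \<bar>t - t'\<bar>"
    using h1.L_nonneg e h1.e0_le by (intro mult_right_mono) (auto intro: order_trans[OF mult_left_mono[of e 1 L]])
  have "norm (lo e t x - lo e t' x') \<le> 2 * L * norm (on_axis x - on_axis x') + L * e * \<bar>t - t'\<bar>"
    unfolding Xlow_def by (intro h1.X_lip e tu time_range t)
  then show "\<bar>lo e t x $ i - lo e t' x' $ i\<bar> \<le> 2 * L * (\<bar>t - t'\<bar> + \<bar>x - x'\<bar>)"
    using Le abs_nth_le[of "lo e t x - lo e t' x'" i] by (simp add: on_axis_diff[symmetric] distrib_left)
  have "norm (h2.X e (- t) (on_axis x) - h2.X e (- t') (on_axis x')) \<le> 2 * L * norm (on_axis x - on_axis x') + L * e * \<bar>- t - - t'\<bar>"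
    by (intro h2.X_lip e tu time_range t)
  moreover have "up e t x - up e t' x' = - reflect (h2.X e (- t) (on_axis x) - h2.X e (- t') (on_axis x'))"
    by (simp add: Xup_def reflect_simps)
  ultimately have "norm (up e t x - up e t' x') \<le> 2 * L * \<bar>x - x'\<bar> + L * e * \<bar>t - t'\<bar>"
    by (simp add: on_axis_diff[symmetric] abs_minus_commute)
  then show "\<bar>up e t x $ i - up e t' x' $ i\<bar> \<le> 2 * L * (\<bar>t - t'\<bar> + \<bar>x - x'\<bar>)"
    using Le abs_nth_le[of "up e t x - up e t' x'" i] by (simp add: distrib_left)
  have "norm (lo e t x) \<le> 2 * L" unfolding Xlow_def by (intro h1.X_bound e tu time_range t)
  then show "\<bar>lo e t x $ i\<bar> \<le> 2 * L" using abs_nth_le[of "lo e t x" i] by linarith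
  have "norm (up e t x) \<le> 2 * L" using h2.X_bound[OF e time_range(2)[OF t(1)] tu(1)] by (simp add: Xup_def)
  then show "\<bar>up e t x $ i\<bar> \<le> 2 * L" using abs_nth_le[of "up e t x" i] by linarith
qed

lemma axis_first:
  assumes e: "0 < e" "e < e0" and t: "t \<in> {\<theta>-1..\<theta>+1}" and x: "\<bar>x - xv\<bar> \<le> \<delta>"
  shows "\<bar>lo e t x $ 1 + \<alpha>\<bar> \<le> L * e + L * \<bar>x - xv\<bar>"
    and "\<bar>up e t x $ 1 - \<alpha>\<bar> \<le> L * e + L * \<bar>x - xv\<bar>"
proof -
  note tu = h1.on_axis_tube[OF x]
  have "norm (F (on_axis x) - F (on_axis xv)) \<le> L * norm (on_axis x - on_axis xv)"
    using h1.\<delta>_pos by (intro h1.F_lip tu h1.on_axis_tube) auto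
  then have a: "\<bar>F (on_axis x) $ 1 + \<alpha>\<bar> \<le> L * \<bar>x - xv\<bar>"
    using abs_nth_le[of "F (on_axis x) - F (on_axis xv)" 1] by (simp add: on_axis_diff[symmetric] h1.F_start)
  show "\<bar>lo e t x $ 1 + \<alpha>\<bar> \<le> L * e + L * \<bar>x - xv\<bar>"
    using a h1.X_F[OF e time_range(1)[OF t] tu] abs_nth_le[of "h1.X e t (on_axis x) - F (on_axis x)" 1]
    by (simp add: Xlow_def)
  show "\<bar>up e t x $ 1 - \<alpha>\<bar> \<le> L * e + L * \<bar>x - xv\<bar>"
    using a h2.X_F[OF e time_range(2)[OF t] tu] abs_nth_le[of "h2.X e (- t) (on_axis x) - F (on_axis x)" 1]
    by (simp add: up_nth)
qed

text \<open>Growth along the axis is of order one, whereas time enters only through the perturbation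
  and is weighted by \<open>e\<close>. This comparison controls the position of the fold and the
  signs of both fields along the slide.\<close>

lemma axis_growth:
  assumes e: "0 < e" "e < e0" and t: "t \<in> {\<theta>-1..\<theta>+1}" "t' \<in> {\<theta>-1..\<theta>+1}"
    and x: "\<bar>x - xv\<bar> \<le> \<delta>" "\<bar>x' - xv\<bar> \<le> \<delta>" "x \<le> x'"
    and F2: "b / 2 * (x' - x) \<le> F (on_axis x') $ 2 - F (on_axis x) $ 2"
  shows "b / 2 * (x' - x) - e * L * (\<bar>t - t'\<bar> + (x' - x)) \<le> lo e t' x' $ 2 - lo e t x $ 2"
    and "b / 2 * (x' - x) - e * L * (\<bar>t - t'\<bar> + (x' - x)) \<le> up e t' x' $ 2 - up e t x $ 2"
proof -
  note tu = h1.on_axis_tube[OF x(1)] h1.on_axis_tube[OF x(2)]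
  have "norm (k1 e t' (on_axis x') - k1 e t (on_axis x)) \<le> L * (\<bar>t' - t\<bar> + norm (on_axis x' - on_axis x))"
    by (intro h1.k_lip e tu time_range t)
  then have "\<bar>k1 e t' (on_axis x') $ 2 - k1 e t (on_axis x) $ 2\<bar> \<le> L * (\<bar>t - t'\<bar> + (x' - x))"
    using abs_nth_le[of "k1 e t' (on_axis x') - k1 e t (on_axis x)" 2] x(3)
    by (simp add: on_axis_diff[symmetric] abs_minus_commute)
  from mult_left_mono[OF this, of e]
  have 1: "\<bar>e * (k1 e t' (on_axis x') $ 2 - k1 e t (on_axis x) $ 2)\<bar> \<le> e * L * (\<bar>t - t'\<bar> + (x' - x))"
    using e by (simp add: abs_mult mult.assoc)
  have "norm (k2 e (- t') (on_axis x') - k2 e (- t) (on_axis x)) \<le> L * (\<bar>- t' - - t\<bar> + norm (on_axis x' - on_axis x))"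
    by (intro h2.k_lip e tu time_range t)
  then have "\<bar>k2 e (- t') (on_axis x') $ 2 - k2 e (- t) (on_axis x) $ 2\<bar> \<le> L * (\<bar>t - t'\<bar> + (x' - x))"
    using abs_nth_le[of "k2 e (- t') (on_axis x') - k2 e (- t) (on_axis x)" 2] x(3)
    by (simp add: on_axis_diff[symmetric])
  from mult_left_mono[OF this, of e]
  have 2: "\<bar>e * (k2 e (- t') (on_axis x') $ 2 - k2 e (- t) (on_axis x) $ 2)\<bar> \<le> e * L * (\<bar>t - t'\<bar> + (x' - x))"
    using e by (simp add: abs_mult mult.assoc)
  have l: "lo e t' x' $ 2 - lo e t x $ 2 = (F (on_axis x') $ 2 - F (on_axis x) $ 2) + e * (k1 e t' (on_axis x') $ 2 - k1 e t (on_axis x) $ 2)"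
    by (simp add: Xlow_def h1.X_def algebra_simps)
  have u: "up e t' x' $ 2 - up e t x $ 2 = (F (on_axis x') $ 2 - F (on_axis x) $ 2) + e * (k2 e (- t') (on_axis x') $ 2 - k2 e (- t) (on_axis x) $ 2)"
    by (simp add: up_nth h2.X_def algebra_simps)
  show "b / 2 * (x' - x) - e * L * (\<bar>t - t'\<bar> + (x' - x)) \<le> lo e t' x' $ 2 - lo e t x $ 2"
    using 1 F2 unfolding l by linarith
  show "b / 2 * (x' - x) - e * L * (\<bar>t - t'\<bar> + (x' - x)) \<le> up e t' x' $ 2 - up e t x $ 2"
    using 2 F2 unfolding u by linarith
qed

text \<open>On the scale \<open>e * h\<close> both vertical components are, up to higher order,
  \<open>e\<close> times an affine function of \<open>h\<close> with the same slope
  \<open>b\<close>; the zeros of these are the scaled folds.\<close>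

lemma axis_expansion:
  assumes e: "0 < e" "e < e0" and t: "t \<in> {\<theta>-1..\<theta>+1}" and h: "\<bar>e * h\<bar> \<le> \<delta>"
  shows "\<bar>lo e t (xv + e * h) $ 2 - e * (b * h + g1 \<theta> (on_axis xv) $ 2)\<bar> \<le> e * (L * (e * h\<^sup>2 + e + \<bar>t - \<theta>\<bar> + e * \<bar>h\<bar>))"
    and "\<bar>up e t (xv + e * h) $ 2 - e * (b * h + g2 (- \<theta>) (on_axis xv) $ 2)\<bar> \<le> e * (L * (e * h\<^sup>2 + e + \<bar>t - \<theta>\<bar> + e * \<bar>h\<bar>))"
proof -
  let ?p = "on_axis xv" and ?z = "on_axis (xv + e * h)"
  have tu: "?p \<in> h1.tube \<delta>" "?z \<in> h1.tube \<delta>"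
    using h h1.\<delta>_pos h1.on_axis_tube[of xv] h1.on_axis_tube[of "xv + e * h"] by simp_all
  have zp: "norm (?z - ?p) = e * \<bar>h\<bar>" using e by (simp add: on_axis_diff[symmetric] abs_mult)
  have th: "\<theta> \<in> {\<theta>-1..\<theta>+1}" by simp
  have F2: "\<bar>F ?z $ 2 - b * (e * h)\<bar> \<le> L * (e * h)\<^sup>2" by (rule h1.F2_linear[OF h])
  have k1: "\<bar>k1 e t ?z $ 2 - g1 \<theta> ?p $ 2\<bar> \<le> L * e + L * (\<bar>t - \<theta>\<bar> + e * \<bar>h\<bar>)"
  proof -
    have "norm (g1 t ?z - g1 \<theta> ?p) \<le> L * (\<bar>t - \<theta>\<bar> + norm (?z - ?p))"
      by (intro h1.g_lip time_range t th tu)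
    then show ?thesis
      using h1.k_g[OF e time_range(1)[OF t] tu(2)] abs_nth_le[of "k1 e t ?z - g1 t ?z" 2]
        abs_nth_le[of "g1 t ?z - g1 \<theta> ?p" 2] unfolding zp by simp
  qed
  have k2: "\<bar>k2 e (- t) ?z $ 2 - g2 (- \<theta>) ?p $ 2\<bar> \<le> L * e + L * (\<bar>t - \<theta>\<bar> + e * \<bar>h\<bar>)"
  proof -
    have "norm (g2 (- t) ?z - g2 (- \<theta>) ?p) \<le> L * (\<bar>- t - - \<theta>\<bar> + norm (?z - ?p))"
      by (intro h2.g_lip time_range t th tu)
    then show ?thesis
      using h2.k_g[OF e time_range(2)[OF t] tu(2)] abs_nth_le[of "k2 e (- t) ?z - g2 (- t) ?z" 2]
        abs_nth_le[of "g2 (- t) ?z - g2 (- \<theta>) ?p" 2] unfolding zp by (simp add: abs_minus_commute)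
  qed
  have l: "lo e t (xv + e * h) $ 2 - e * (b * h + g1 \<theta> ?p $ 2) = (F ?z $ 2 - b * (e * h)) + e * (k1 e t ?z $ 2 - g1 \<theta> ?p $ 2)"
    by (simp add: Xlow_def h1.X_def algebra_simps)
  have u: "up e t (xv + e * h) $ 2 - e * (b * h + g2 (- \<theta>) ?p $ 2) = (F ?z $ 2 - b * (e * h)) + e * (k2 e (- t) ?z $ 2 - g2 (- \<theta>) ?p $ 2)"
    by (simp add: up_nth h2.X_def algebra_simps)
  have r: "e * (L * (e * h\<^sup>2 + e + \<bar>t - \<theta>\<bar> + e * \<bar>h\<bar>)) = L * (e * h)\<^sup>2 + e * (L * e + L * (\<bar>t - \<theta>\<bar> + e * \<bar>h\<bar>))"
    by (simp add: algebra_simps power2_eq_square)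
  have "\<bar>e * (k1 e t ?z $ 2 - g1 \<theta> ?p $ 2)\<bar> \<le> e * (L * e + L * (\<bar>t - \<theta>\<bar> + e * \<bar>h\<bar>))"
    using mult_left_mono[OF k1, of e] e by (simp add: abs_mult)
  then show "\<bar>lo e t (xv + e * h) $ 2 - e * (b * h + g1 \<theta> ?p $ 2)\<bar> \<le> e * (L * (e * h\<^sup>2 + e + \<bar>t - \<theta>\<bar> + e * \<bar>h\<bar>))"
    unfolding l r by (intro order_trans[OF abs_triangle_ineq] add_mono F2)
  have "\<bar>e * (k2 e (- t) ?z $ 2 - g2 (- \<theta>) ?p $ 2)\<bar> \<le> e * (L * e + L * (\<bar>t - \<theta>\<bar> + e * \<bar>h\<bar>))"
    using mult_left_mono[OF k2, of e] e by (simp add: abs_mult)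
  then show "\<bar>up e t (xv + e * h) $ 2 - e * (b * h + g2 (- \<theta>) ?p $ 2)\<bar> \<le> e * (L * (e * h\<^sup>2 + e + \<bar>t - \<theta>\<bar> + e * \<bar>h\<bar>))"
    unfolding u r by (intro order_trans[OF abs_triangle_ineq] add_mono F2)
qed

end

context two_halves
begin

text \<open>The sliding arc is followed backwards from the fold of the lower field; \<open>\<xi>0\<close> is the scaled
  position of that fold and \<open>\<zeta> t r\<close> the scaled position at time \<open>t - e * r\<close>.\<close>

definition sliding_arc :: "real \<Rightarrow> real \<Rightarrow> real set \<Rightarrow> real \<Rightarrow> real \<Rightarrow> (real \<Rightarrow> real) \<Rightarrow> (real \<Rightarrow> real \<Rightarrow> real) \<Rightarrow> bool" where
  "sliding_arc e S I B \<eta> \<xi>0 \<zeta> \<longleftrightarrow>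
    continuous_on I \<xi>0 \<and> continuous_on (I \<times> {0..S}) (\<lambda>(t, r). \<zeta> t r) \<and>
    (\<forall>t\<in>I. \<zeta> t 0 = \<xi>0 t \<and> \<bar>b * \<xi>0 t + g1 \<theta> (on_axis xv) $ 2\<bar> \<le> \<eta> \<and> lo e t (xv + e * \<xi>0 t) $ 2 = 0 \<and>
      (\<forall>r\<in>{0..S}. \<bar>\<zeta> t r\<bar> \<le> B \<and> - g1 \<theta> (on_axis xv) $ 2 - \<eta> \<le> b * \<zeta> t r
        \<and> (\<zeta> t has_real_derivative - slide_speed e (t - e * r) (xv + e * \<zeta> t r)) (at r within {0..S})
        \<and> up e (t - e * r) (xv + e * \<zeta> t r) $ 2 < 0
        \<and> (0 < r \<longrightarrow> 0 < lo e (t - e * r) (xv + e * \<zeta> t r) $ 2)))"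

text \<open>At the lower fold the sliding field equals the lower field, with horizontal part near
  \<open>- \<alpha>\<close>; backwards the arc moves right, into the sliding region. Near the upper
  fold it is close to the upper field, with horizontal part near \<open>\<alpha>\<close>, so
  backwards the arc is turned away to the left. Hence it stays between the folds for any prescribed
  scaled time \<open>S\<close> once \<open>e\<close> is small. In \<open>B\<close> the quotient
  bounds the fold and \<open>2 * \<alpha> * S\<close> the distance travelled.\<close>

lemma sliding_arc_exists:
  assumes ord: "g2 (- \<theta>) (on_axis xv) $ 2 < g1 \<theta> (on_axis xv) $ 2"
    and S: "0 < S" and \<eta>: "0 < \<eta>"
  defines "B \<equiv> (\<bar>g1 \<theta> (on_axis xv) $ 2\<bar> + \<eta>) / b + 2 * \<alpha> * S + 1"
  assumes K: "0 < K"
  shows "\<exists>e1>0. \<forall>e. 0 < e \<and> e < e1 \<longrightarrow> (\<exists>\<xi>0 \<zeta>. sliding_arc e S {\<theta> - K * e..\<theta> + K * e} B \<eta> \<xi>0 \<zeta>)"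
proof -
  note \<alpha> = h1.\<alpha>_pos and b = h1.b_pos and L = h1.L_nonneg
  define a1 where "a1 = g1 \<theta> (on_axis xv) $ 2"
  define a2 where "a2 = g2 (- \<theta>) (on_axis xv) $ 2"
  define d where "d = a1 - a2"
  have d: "0 < d" using ord by (simp add: d_def a1_def a2_def)
  have B: "(\<bar>a1\<bar> + \<eta>) / b + 2 * \<alpha> * S + 1 \<le> B" "0 < B"
    using \<alpha> b S \<eta> by (auto simp: B_def a1_def intro!: add_nonneg_pos add_nonneg_nonneg)
  obtain r0 where r0: "0 < r0" "r0 \<le> \<delta>" and F2: "\<And>x x'. \<bar>x - xv\<bar> \<le> r0 \<Longrightarrow> \<bar>x' - xv\<bar> \<le> r0 \<Longrightarrow> x \<le> x' \<Longrightarrow>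
    b / 2 * (x' - x) \<le> F (on_axis x') $ 2 - F (on_axis x) $ 2"
    using h1.F2_increasing by blast
  define H where "H = B\<^sup>2 + 1 + (K + S) + B"
  have H: "1 \<le> H" "B \<le> H" "K + S \<le> H" using B S K by (auto simp: H_def intro: add_nonneg_nonneg)
  \<comment> \<open>The least margin used below; \<open>N\<close> dominates all coefficients, so
    \<open>e < \<mu> / N\<close> yields every condition in \<open>sm\<close>.\<close>
  define \<mu> where "\<mu> = min (min (min e0 1) (min r0 \<eta>)) (min (min (d / 8) (\<alpha> / 8)) (min (b / 4) (b * \<alpha> / 16)))"
  have \<mu>: "0 < \<mu>" using e0_pos r0 \<eta> d \<alpha> b by (simp add: \<mu>_def)
  define N where "N = 1 + (L + 1) * H"
  have LH: "L * H \<le> (L + 1) * H" "H \<le> (L + 1) * H" "0 \<le> L * H" using L H by (auto simp: algebra_simps)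
  have N: "1 < N" "H \<le> N" "L * H \<le> N" "L \<le> N"
  proof -
    show "1 < N" "H \<le> N" "L * H \<le> N" using LH H unfolding N_def by linarith+
    have "L * 1 \<le> L * H" using L H by (intro mult_left_mono) auto
    then show "L \<le> N" using \<open>L * H \<le> N\<close> by simp
  qed
  have arc: "\<exists>\<xi>0 \<zeta>. sliding_arc e S {\<theta> - K * e..\<theta> + K * e} B \<eta> \<xi>0 \<zeta>" if e: "0 < e" "e < \<mu> / N" for e
  proof -
    let ?I = "{\<theta> - K * e..\<theta> + K * e}"
    have eN: "e * N < \<mu>" using e N by (simp add: pos_less_divide_eq)
    have "e * 1 < \<mu>" "e * H < \<mu>" "e * (L * H) < \<mu>" "e * L < \<mu>"
      using e(1) by (intro le_less_trans[OF mult_left_mono eN] less_imp_le[OF N(1)] N; simp)+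
    then have sm: "e < e0" "e * H < 1" "e * H < r0" "e * (L * H) < \<eta>" "e * (L * H) < d / 8" "e * (L * H) < \<alpha> / 8" "e * L < b / 4" "e * L < b * \<alpha> / 16"
      by (auto simp: \<mu>_def)
    have ee: "0 < e" "e < e0" using e sm by auto
    have eKS: "e * (K + S) \<le> e * H" "e * B \<le> e * H" using e H by (auto intro: mult_left_mono)
    let ?J = "{\<theta> - (K + S) * e..\<theta> + (K + S) * e}"
    have J: "t \<in> {\<theta>-1..\<theta>+1}" if "t \<in> ?J" for t
      using that eKS sm unfolding atLeastAtMost_iff by (auto simp: mult.commute[of e])
    have IJ: "t - e * r \<in> ?J" if "t \<in> ?I" "r \<in> {0..S}" for t r
    proof -
      have "0 \<le> e * r" "e * r \<le> e * S" using that e by (auto intro: mult_left_mono)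
      moreover have "(K + S) * e = K * e + e * S" by (simp add: algebra_simps)
      moreover have "0 \<le> e * S" using e S by simp
      ultimately show ?thesis using that(1) unfolding atLeastAtMost_iff by linarith
    qed
    have IJ0: "t \<in> ?J" if "t \<in> ?I" for t using IJ[OF that, of 0] S by simp
    have hB: "\<bar>e * h\<bar> \<le> r0" if "\<bar>h\<bar> \<le> B" for h
    proof -
      have "\<bar>e * h\<bar> = e * \<bar>h\<bar>" using e by (simp add: abs_mult)
      also have "\<dots> \<le> e * B" using that e by (intro mult_left_mono) auto
      finally show ?thesis using eKS sm by linarith
    qed
    have h\<delta>: "\<bar>(xv + e * h) - xv\<bar> \<le> \<delta>" "\<bar>e * h\<bar> \<le> \<delta>" if "\<bar>h\<bar> \<le> B" for h using hB[OF that] r0 by auto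
    have err: "L * (e * h\<^sup>2 + e + \<bar>t - \<theta>\<bar> + e * \<bar>h\<bar>) \<le> e * (L * H)" if t: "t \<in> ?J" and h: "\<bar>h\<bar> \<le> B" for t h
    proof -
      have "\<bar>t - \<theta>\<bar> \<le> (K + S) * e" using t by (auto simp: abs_le_iff)
      moreover have "h\<^sup>2 \<le> B\<^sup>2" using power_mono[OF h, of 2] by simp
      then have "e * h\<^sup>2 \<le> e * B\<^sup>2" using e by (intro mult_left_mono) auto
      moreover have "e * \<bar>h\<bar> \<le> e * B" using h e by (intro mult_left_mono) auto
      ultimately have "e * h\<^sup>2 + e + \<bar>t - \<theta>\<bar> + e * \<bar>h\<bar> \<le> e * H" by (simp add: H_def algebra_simps)
      from mult_left_mono[OF this L] show ?thesis by (simp add: mult_ac)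
    qed
    have lo_exp: "\<bar>lo e t (xv + e * h) $ 2 - e * (b * h + a1)\<bar> \<le> e * (e * (L * H))"
      and up_exp: "\<bar>up e t (xv + e * h) $ 2 - e * (b * h + a2)\<bar> \<le> e * (e * (L * H))"
      if t: "t \<in> ?J" and h: "\<bar>h\<bar> \<le> B" for t h
      using order_trans[OF axis_expansion(1)[OF ee J[OF t] h\<delta>(2)[OF h]] mult_left_mono[OF err[OF t h]]]
        order_trans[OF axis_expansion(2)[OF ee J[OF t] h\<delta>(2)[OF h]] mult_left_mono[OF err[OF t h]]] ee(1)
      unfolding a1_def[symmetric] a2_def[symmetric] by simp_all
    \<comment> \<open>The vertical components differ by nearly \<open>e * d\<close>, so the
      denominator of the sliding field, though small, is controlled from below.\<close>
    have Dn: "e * d / 2 \<le> lo e t (xv + e * h) $ 2 - up e t (xv + e * h) $ 2" if t: "t \<in> ?J" and h: "\<bar>h\<bar> \<le> B" for t h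
    proof -
      have "e * (e * (L * H)) \<le> e * (d / 8)" using sm e by (intro mult_left_mono) auto
      moreover have "e * (b * h + a1) - e * (b * h + a2) = e * d" by (simp add: d_def algebra_simps)
      moreover have "0 < e * d" using e d by simp
      ultimately show ?thesis using lo_exp[OF t h] up_exp[OF t h] by (simp add: abs_le_iff)
    qed
    have first: "\<bar>lo e t (xv + e * h) $ 1 + \<alpha>\<bar> \<le> \<alpha> / 8" "\<bar>up e t (xv + e * h) $ 1 - \<alpha>\<bar> \<le> \<alpha> / 8"
      if t: "t \<in> ?J" and h: "\<bar>h\<bar> \<le> B" for t h
    proof -
      have "e * \<bar>h\<bar> \<le> e * B" using h e by (intro mult_left_mono) auto
      moreover have "e * (1 + B) \<le> e * H" using e K S by (intro mult_left_mono) (auto simp: H_def)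
      moreover have "\<bar>e * h\<bar> = e * \<bar>h\<bar>" using e by (simp add: abs_mult)
      ultimately have "e + \<bar>e * h\<bar> \<le> e * H" unfolding distrib_left by linarith
      from mult_left_mono[OF this L] have "L * e + L * \<bar>(xv + e * h) - xv\<bar> \<le> \<alpha> / 8"
        using sm by (simp add: algebra_simps)
      then show "\<bar>lo e t (xv + e * h) $ 1 + \<alpha>\<bar> \<le> \<alpha> / 8" "\<bar>up e t (xv + e * h) $ 1 - \<alpha>\<bar> \<le> \<alpha> / 8"
        using axis_first[OF ee J[OF t] h\<delta>(1)[OF h]] by linarith+
    qed
    have grow: "b / 4 * (e * (h' - h)) - e * L * \<bar>t - t'\<bar> \<le> lo e t' (xv + e * h') $ 2 - lo e t (xv + e * h) $ 2"
      "b / 4 * (e * (h' - h)) - e * L * \<bar>t - t'\<bar> \<le> up e t' (xv + e * h') $ 2 - up e t (xv + e * h) $ 2"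
      if t: "t \<in> ?J" "t' \<in> ?J" and h: "\<bar>h\<bar> \<le> B" "\<bar>h'\<bar> \<le> B" "h \<le> h'" for t t' h h'
    proof -
      have le: "xv + e * h \<le> xv + e * h'" using h e by simp
      have "e * L * (e * (h' - h)) \<le> b / 4 * (e * (h' - h))"
        using sm h e by (intro mult_right_mono) auto
      then have "b / 4 * (e * (h' - h)) - e * L * \<bar>t - t'\<bar>
        \<le> b / 2 * ((xv + e * h') - (xv + e * h)) - e * L * (\<bar>t - t'\<bar> + ((xv + e * h') - (xv + e * h)))"
        by (simp add: algebra_simps)
      then show "b / 4 * (e * (h' - h)) - e * L * \<bar>t - t'\<bar> \<le> lo e t' (xv + e * h') $ 2 - lo e t (xv + e * h) $ 2"
        "b / 4 * (e * (h' - h)) - e * L * \<bar>t - t'\<bar> \<le> up e t' (xv + e * h') $ 2 - up e t (xv + e * h) $ 2"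
        using axis_growth[OF ee J[OF t(1)] J[OF t(2)] h\<delta>(1)[OF h(1)] h\<delta>(1)[OF h(2)] le F2[OF _ _ le]] hB[OF h(1)] hB[OF h(2)]
        by auto
    qed
    have lip: "\<bar>lo e t (xv + e * h) $ i - lo e t' (xv + e * h') $ i\<bar> \<le> 2 * L * (\<bar>t - t'\<bar> + \<bar>h - h'\<bar>)"
      "\<bar>up e t (xv + e * h) $ i - up e t' (xv + e * h') $ i\<bar> \<le> 2 * L * (\<bar>t - t'\<bar> + \<bar>h - h'\<bar>)"
      if t: "t \<in> ?J" "t' \<in> ?J" and h: "\<bar>h\<bar> \<le> B" "\<bar>h'\<bar> \<le> B" for t t' h h' i
    proof -
      have "\<bar>(xv + e * h) - (xv + e * h')\<bar> = e * \<bar>h - h'\<bar>" using e by (simp add: right_diff_distrib[symmetric] abs_mult)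
      also have "\<dots> \<le> 1 * \<bar>h - h'\<bar>" using ee h1.e0_le by (intro mult_right_mono) auto
      finally have "2 * L * (\<bar>t - t'\<bar> + \<bar>(xv + e * h) - (xv + e * h')\<bar>) \<le> 2 * L * (\<bar>t - t'\<bar> + \<bar>h - h'\<bar>)"
        using L by (intro mult_left_mono) auto
      then show "\<bar>lo e t (xv + e * h) $ i - lo e t' (xv + e * h') $ i\<bar> \<le> 2 * L * (\<bar>t - t'\<bar> + \<bar>h - h'\<bar>)"
        "\<bar>up e t (xv + e * h) $ i - up e t' (xv + e * h') $ i\<bar> \<le> 2 * L * (\<bar>t - t'\<bar> + \<bar>h - h'\<bar>)"
        using axis_lip(1,2)[OF ee J[OF t(1)] J[OF t(2)] h\<delta>(1)[OF h(1)] h\<delta>(1)[OF h(2)], of i] by linarith+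
    qed
    have bd: "\<bar>lo e t (xv + e * h) $ i\<bar> \<le> 2 * L" "\<bar>up e t (xv + e * h) $ i\<bar> \<le> 2 * L"
      if t: "t \<in> ?J" and h: "\<bar>h\<bar> \<le> B" for t h i
      using axis_lip(3,4)[OF ee J[OF t] J[OF t] h\<delta>(1)[OF h] h\<delta>(1)[OF h], of i] by simp_all

    \<comment> \<open>The perturbed fold, as a zero of the lower component between the scaled
      positions where \<open>b * h + a1\<close> equals \<open>- \<eta>\<close> and
      \<open>\<eta>\<close>.\<close>
    have "\<exists>\<xi>. \<bar>b * \<xi> + a1\<bar> \<le> \<eta> \<and> \<bar>\<xi>\<bar> \<le> (\<bar>a1\<bar> + \<eta>) / b \<and> lo e t (xv + e * \<xi>) $ 2 = 0" if t: "t \<in> ?I" for t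
    proof -
      let ?l = "(- a1 - \<eta>) / b" and ?u = "(- a1 + \<eta>) / b"
      have bnd: "\<bar>h\<bar> \<le> (\<bar>a1\<bar> + \<eta>) / b" if "h \<in> {?l..?u}" for h
      proof -
        have "- ((\<bar>a1\<bar> + \<eta>) / b) \<le> ?l" "?u \<le> (\<bar>a1\<bar> + \<eta>) / b"
          using b by (auto simp: minus_divide_left[symmetric] simp del: minus_divide_left intro!: divide_right_mono)
            (simp_all add: minus_divide_left divide_right_mono)
        then show ?thesis using that by (simp add: abs_le_iff)
      qed
      have bndB: "\<bar>h\<bar> \<le> B" if "h \<in> {?l..?u}" for h
      proof -
        have "0 \<le> 2 * \<alpha> * S" using \<alpha> S by simp
        then show ?thesis using bnd[OF that] B(1) by linarith
      qed
      have lu: "?l \<le> ?u" using b \<eta> by (intro divide_right_mono) auto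
      have e\<eta>: "e * (e * (L * H)) \<le> e * \<eta>" using sm e by (intro mult_left_mono) auto
      have "b * ?l + a1 = - \<eta>" "b * ?u + a1 = \<eta>" using b by auto
      then have sgn: "lo e t (xv + e * ?l) $ 2 \<le> 0" "0 \<le> lo e t (xv + e * ?u) $ 2"
        using lo_exp[OF IJ0[OF t] bndB[of ?l]] lo_exp[OF IJ0[OF t] bndB[of ?u]] e\<eta> lu by (auto simp: abs_le_iff)
      have "(2 * L)-lipschitz_on {?l..?u} (\<lambda>h. lo e t (xv + e * h) $ 2)"
      proof (rule lipschitz_onI)
        show "dist (lo e t (xv + e * h) $ 2) (lo e t (xv + e * h') $ 2) \<le> 2 * L * dist h h'"
          if "h \<in> {?l..?u}" "h' \<in> {?l..?u}" for h h'
          using lip(1)[OF IJ0[OF t] IJ0[OF t] bndB[OF that(1)] bndB[OF that(2)], of 2] by (simp add: dist_real_def)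
      qed (use L in simp)
      then have "continuous_on {?l..?u} (\<lambda>h. lo e t (xv + e * h) $ 2)" by (rule lipschitz_on_continuous_on)
      then obtain \<xi> where \<xi>: "?l \<le> \<xi>" "\<xi> \<le> ?u" "lo e t (xv + e * \<xi>) $ 2 = 0"
        using IVT'[of "\<lambda>h. lo e t (xv + e * h) $ 2" ?l 0 ?u] sgn lu by auto
      have "- a1 - \<eta> \<le> \<xi> * b" "\<xi> * b \<le> - a1 + \<eta>" using \<xi> b by (simp_all add: pos_divide_le_eq pos_le_divide_eq)
      then have "\<bar>b * \<xi> + a1\<bar> \<le> \<eta>" by (simp add: abs_le_iff mult.commute)
      then show ?thesis using bnd[of \<xi>] \<xi> by auto
    qed
    then obtain \<xi>0 where \<xi>0: "\<And>t. t \<in> ?I \<Longrightarrow> \<bar>b * \<xi>0 t + a1\<bar> \<le> \<eta>" "\<And>t. t \<in> ?I \<Longrightarrow> \<bar>\<xi>0 t\<bar> \<le> (\<bar>a1\<bar> + \<eta>) / b"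
      "\<And>t. t \<in> ?I \<Longrightarrow> lo e t (xv + e * \<xi>0 t) $ 2 = 0" by metis
    have \<xi>B: "\<bar>\<xi>0 t\<bar> \<le> B - 2 * \<alpha> * S" "\<bar>\<xi>0 t\<bar> \<le> B" if t: "t \<in> ?I" for t
    proof -
      show "\<bar>\<xi>0 t\<bar> \<le> B - 2 * \<alpha> * S" using \<xi>0(2)[OF t] B(1) by linarith
      moreover have "0 \<le> 2 * \<alpha> * S" using \<alpha> S by simp
      ultimately show "\<bar>\<xi>0 t\<bar> \<le> B" by linarith
    qed
    \<comment> \<open>Zeros at two times can differ only as far as the time dependence offsets the
      growth along the axis; so the zeros, chosen separately for each time, form a continuous
      function.\<close>
    have \<xi>lip: "\<bar>\<xi>0 t - \<xi>0 t'\<bar> \<le> 4 * L / b * \<bar>t - t'\<bar>" if t: "t \<in> ?I" and t': "t' \<in> ?I" for t t'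
    proof -
      have aux: "\<xi>0 t' - \<xi>0 t \<le> 4 * L / b * \<bar>t - t'\<bar>" if t: "t \<in> ?I" and t': "t' \<in> ?I" and le: "\<xi>0 t \<le> \<xi>0 t'" for t t'
      proof -
        have "b / 4 * (e * (\<xi>0 t' - \<xi>0 t)) - e * L * \<bar>t - t'\<bar> \<le> 0"
          using grow(1)[OF IJ0[OF t] IJ0[OF t'] \<xi>B(2)[OF t] \<xi>B(2)[OF t'] le] \<xi>0(3)[OF t] \<xi>0(3)[OF t'] by simp
        then have "e * (b / 4 * (\<xi>0 t' - \<xi>0 t)) \<le> e * (L * \<bar>t - t'\<bar>)" by (simp add: algebra_simps)
        then have "b / 4 * (\<xi>0 t' - \<xi>0 t) \<le> L * \<bar>t - t'\<bar>" using e by simp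
        then show ?thesis using b by (simp add: field_simps)
      qed
      show ?thesis using aux[OF t t'] aux[OF t' t] by (cases "\<xi>0 t \<le> \<xi>0 t'") (auto simp: abs_minus_commute)
    qed

    define cl where "cl h = max (- B) (min B h)" for h
    have cl: "\<bar>cl h\<bar> \<le> B" "\<bar>cl h - cl h'\<bar> \<le> \<bar>h - h'\<bar>" for h h' using B by (auto simp: cl_def)
    have clid: "\<bar>h\<bar> \<le> B \<Longrightarrow> cl h = h" for h by (auto simp: cl_def)
    define q where "q t h = lo e t (xv + e * h) $ 2 / (lo e t (xv + e * h) $ 2 - up e t (xv + e * h) $ 2)" for t h
    \<comment> \<open>Clamping the convex weight keeps \<open>V\<close> bounded and Lipschitz, so
      the arc can be constructed before it is known to stay in the sliding region, where the clamp
      has no effect.\<close>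
    define \<rho> where "\<rho> t h = max 0 (min 1 (q t h))" for t h
    have \<rho>: "0 \<le> \<rho> t h" "\<rho> t h \<le> 1" for t h by (auto simp: \<rho>_def)
    define V where "V t h = - (lo e t (xv + e * h) $ 1 + \<rho> t h * (up e t (xv + e * h) $ 1 - lo e t (xv + e * h) $ 1))" for t h
    define m where "m = e * d / 2"
    have m: "0 < m" using e d by (simp add: m_def)
    define Q where "Q = 2 * L / m + 2 * L * (4 * L) / m\<^sup>2"
    have Q: "0 \<le> Q" using L m by (simp add: Q_def)
    have \<rho>lip: "\<bar>\<rho> t h - \<rho> t' h'\<bar> \<le> Q * (\<bar>t - t'\<bar> + \<bar>h - h'\<bar>)"
      if t: "t \<in> ?J" "t' \<in> ?J" and h: "\<bar>h\<bar> \<le> B" "\<bar>h'\<bar> \<le> B" for t t' h h'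
    proof -
      let ?w = "\<bar>t - t'\<bar> + \<bar>h - h'\<bar>"
      have dd: "\<bar>(lo e t (xv + e * h) $ 2 - up e t (xv + e * h) $ 2) - (lo e t' (xv + e * h') $ 2 - up e t' (xv + e * h') $ 2)\<bar> \<le> 4 * L * ?w"
        using lip(1)[OF t h, of 2] lip(2)[OF t h, of 2] by linarith
      have "\<bar>\<rho> t h - \<rho> t' h'\<bar> \<le> \<bar>q t h - q t' h'\<bar>" by (auto simp: \<rho>_def)
      also have "\<dots> \<le> \<bar>lo e t (xv + e * h) $ 2 - lo e t' (xv + e * h') $ 2\<bar> / m + (2 * L) * \<bar>(lo e t (xv + e * h) $ 2 - up e t (xv + e * h) $ 2) - (lo e t' (xv + e * h') $ 2 - up e t' (xv + e * h') $ 2)\<bar> / m\<^sup>2"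
        unfolding q_def using Dn[OF t(1) h(1)] Dn[OF t(2) h(2)] by (intro quotient_diff_le m bd(1)[OF t(2) h(2)]) (simp_all add: m_def)
      also have "\<dots> \<le> (2 * L * ?w) / m + (2 * L) * (4 * L * ?w) / m\<^sup>2"
        using m L by (intro add_mono divide_right_mono mult_left_mono lip(1)[OF t h] dd) auto
      also have "\<dots> = Q * ?w" by (simp add: Q_def algebra_simps add_divide_distrib)
      finally show ?thesis .
    qed
    define \<Lambda> where "\<Lambda> = 2 * L + (Q * (4 * L) + 4 * L)"
    have \<Lambda>: "0 \<le> \<Lambda>" using Q L by (simp add: \<Lambda>_def)
    have Vlip: "\<bar>V t h - V t' h'\<bar> \<le> \<Lambda> * (\<bar>t - t'\<bar> + \<bar>h - h'\<bar>)"
      if t: "t \<in> ?J" "t' \<in> ?J" and h: "\<bar>h\<bar> \<le> B" "\<bar>h'\<bar> \<le> B" for t t' h h'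
    proof -
      let ?w = "\<bar>t - t'\<bar> + \<bar>h - h'\<bar>"
      let ?c = "up e t (xv + e * h) $ 1 - lo e t (xv + e * h) $ 1" and ?c' = "up e t' (xv + e * h') $ 1 - lo e t' (xv + e * h') $ 1"
      have cc: "\<bar>?c - ?c'\<bar> \<le> 4 * L * ?w" using lip(1)[OF t h, of 1] lip(2)[OF t h, of 1] by linarith
      have c: "\<bar>?c\<bar> \<le> 4 * L" using bd[OF t(1) h(1), of 1] by linarith
      have "\<bar>(\<rho> t h - \<rho> t' h') * ?c\<bar> \<le> (Q * ?w) * (4 * L)"
        unfolding abs_mult using Q by (intro mult_mono \<rho>lip[OF t h] c) auto
      moreover have "\<bar>\<rho> t' h' * (?c - ?c')\<bar> \<le> 1 * (4 * L * ?w)"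
        unfolding abs_mult using \<rho>[of t' h'] by (intro mult_mono cc) auto
      moreover have "V t h - V t' h' = - ((lo e t (xv + e * h) $ 1 - lo e t' (xv + e * h') $ 1) + ((\<rho> t h - \<rho> t' h') * ?c + \<rho> t' h' * (?c - ?c')))"
        by (simp add: V_def algebra_simps)
      ultimately have "\<bar>V t h - V t' h'\<bar> \<le> 2 * L * ?w + ((Q * ?w) * (4 * L) + 1 * (4 * L * ?w))"
        using lip(1)[OF t h, of 1] by linarith
      also have "\<dots> = \<Lambda> * ?w" by (simp add: \<Lambda>_def algebra_simps)
      finally show ?thesis .
    qed
    have Vbd: "\<bar>V t h\<bar> \<le> 2 * \<alpha>" if t: "t \<in> ?J" and h: "\<bar>h\<bar> \<le> B" for t h
    proof -
      let ?l = "lo e t (xv + e * h) $ 1" and ?u = "up e t (xv + e * h) $ 1"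
      have "\<bar>?l\<bar> \<le> 2 * \<alpha>" "\<bar>?u\<bar> \<le> 2 * \<alpha>" using first[OF t h] \<alpha> by linarith+
      then have "(1 - \<rho> t h) * \<bar>?l\<bar> + \<rho> t h * \<bar>?u\<bar> \<le> (1 - \<rho> t h) * (2 * \<alpha>) + \<rho> t h * (2 * \<alpha>)"
        using \<rho>[of t h] by (intro add_mono mult_left_mono) auto
      moreover have "\<bar>V t h\<bar> = \<bar>(1 - \<rho> t h) * ?l + \<rho> t h * ?u\<bar>" by (simp add: V_def algebra_simps abs_minus_commute)
      moreover have "\<bar>(1 - \<rho> t h) * ?l + \<rho> t h * ?u\<bar> \<le> (1 - \<rho> t h) * \<bar>?l\<bar> + \<rho> t h * \<bar>?u\<bar>"
        using \<rho>[of t h] abs_triangle_ineq[of "(1 - \<rho> t h) * ?l" "\<rho> t h * ?u"] by (simp add: abs_mult)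
      ultimately show ?thesis by (simp add: algebra_simps)
    qed
    have "\<exists>z. z 0 = \<xi>0 t \<and> (\<forall>r\<in>{0..S}. (z has_vector_derivative V (t - e * r) (cl (z r))) (at r within {0..S}))" if t: "t \<in> ?I" for t
    proof (rule global_lipschitz_ode_exists[where f = "\<lambda>r h. V (t - e * r) (cl h)" and L = \<Lambda>])
      show "0 \<le> S" using S by simp
      have "(2 * \<Lambda>)-lipschitz_on ({0..S} \<times> UNIV) (\<lambda>(r, h). V (t - e * r) (cl h))"
      proof (rule lipschitz_onI; clarify?)
        fix r h r' h' assume r: "r \<in> {0..S}" "r' \<in> {0..S}"
        have "\<bar>V (t - e * r) (cl h) - V (t - e * r') (cl h')\<bar> \<le> \<Lambda> * (\<bar>(t - e * r) - (t - e * r')\<bar> + \<bar>cl h - cl h'\<bar>)"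
          by (intro Vlip IJ t r cl)
        also have "\<bar>(t - e * r) - (t - e * r')\<bar> = e * \<bar>r - r'\<bar>"
          using e by (simp add: right_diff_distrib[symmetric] abs_mult abs_minus_commute)
        also have "\<Lambda> * (e * \<bar>r - r'\<bar> + \<bar>cl h - cl h'\<bar>) \<le> \<Lambda> * (1 * \<bar>r - r'\<bar> + \<bar>h - h'\<bar>)"
          using ee h1.e0_le \<Lambda> by (intro mult_left_mono add_mono mult_right_mono cl) auto
        also have "\<dots> \<le> \<Lambda> * (dist (r, h) (r', h') + dist (r, h) (r', h'))"
          using dist_fst_le[of "(r, h)" "(r', h')"] dist_snd_le[of "(r, h)" "(r', h')"] \<Lambda>
          by (intro mult_left_mono add_mono) (auto simp: dist_real_def)
        finally show "dist (V (t - e * r) (cl h)) (V (t - e * r') (cl h')) \<le> 2 * \<Lambda> * dist (r, h) (r', h')"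
          by (simp add: dist_real_def)
      qed (use \<Lambda> in auto)
      then show "continuous_on ({0..S} \<times> UNIV) (\<lambda>(r, h). V (t - e * r) (cl h))"
        by (rule lipschitz_on_continuous_on)
      show "norm (V (t - e * r) (cl h) - V (t - e * r) (cl h')) \<le> \<Lambda> * norm (h - h')" if "r \<in> {0..S}" for r h h'
      proof -
        have "\<bar>V (t - e * r) (cl h) - V (t - e * r) (cl h')\<bar> \<le> \<Lambda> * (\<bar>(t - e * r) - (t - e * r)\<bar> + \<bar>cl h - cl h'\<bar>)"
          by (intro Vlip IJ t that cl)
        also have "\<dots> \<le> \<Lambda> * \<bar>h - h'\<bar>" using \<Lambda> cl(2)[of h h'] by (intro mult_left_mono) auto
        finally show ?thesis by simp
      qed
    qed
    then obtain \<zeta> where \<zeta>: "\<And>t. t \<in> ?I \<Longrightarrow> \<zeta> t 0 = \<xi>0 t"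
      "\<And>t r. t \<in> ?I \<Longrightarrow> r \<in> {0..S} \<Longrightarrow> (\<zeta> t has_vector_derivative V (t - e * r) (cl (\<zeta> t r))) (at r within {0..S})"
      by metis
    have \<zeta>spd: "\<bar>\<zeta> t r' - \<zeta> t r\<bar> \<le> 2 * \<alpha> * \<bar>r' - r\<bar>" if t: "t \<in> ?I" and r: "r \<in> {0..S}" "r' \<in> {0..S}" for t r r'
    proof -
      have "norm (\<zeta> t r' - \<zeta> t r) \<le> 2 * \<alpha> * norm (r' - r)"
      proof (rule differentiable_bound[of "{0..S}" "\<zeta> t" "\<lambda>s h. h *\<^sub>R V (t - e * s) (cl (\<zeta> t s))"])
        show "(\<zeta> t has_derivative (\<lambda>h. h *\<^sub>R V (t - e * s) (cl (\<zeta> t s)))) (at s within {0..S})" if "s \<in> {0..S}" for s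
          using \<zeta>(2)[OF t that] by (simp add: has_vector_derivative_def)
        show "onorm (\<lambda>h. h *\<^sub>R V (t - e * s) (cl (\<zeta> t s))) \<le> 2 * \<alpha>" if "s \<in> {0..S}" for s
        proof (rule onorm_le)
          fix h :: real
          show "norm (h *\<^sub>R V (t - e * s) (cl (\<zeta> t s))) \<le> 2 * \<alpha> * norm h"
            using mult_left_mono[OF Vbd[OF IJ[OF t that] cl(1)], of "\<bar>h\<bar>"] by (simp add: abs_mult mult.commute)
        qed
      qed (use r in auto)
      then show ?thesis by simp
    qed
    have \<zeta>B: "\<bar>\<zeta> t r\<bar> \<le> B" if t: "t \<in> ?I" and r: "r \<in> {0..S}" for t r
    proof -
      have "\<bar>\<zeta> t r - \<zeta> t 0\<bar> \<le> 2 * \<alpha> * \<bar>r - 0\<bar>" using S r by (intro \<zeta>spd t) auto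
      also have "\<dots> \<le> 2 * \<alpha> * S" using r \<alpha> by (intro mult_left_mono) auto
      finally show ?thesis using \<xi>B(1)[OF t] \<zeta>(1)[OF t] by linarith
    qed
    have \<zeta>der: "(\<zeta> t has_real_derivative V (t - e * r) (\<zeta> t r)) (at r within {0..S})" if t: "t \<in> ?I" and r: "r \<in> {0..S}" for t r
      using \<zeta>(2)[OF t r] clid[OF \<zeta>B[OF t r]] by (simp add: has_real_derivative_iff_has_vector_derivative)
    define lo2 where "lo2 t r = lo e (t - e * r) (xv + e * \<zeta> t r) $ 2" for t r
    define up2 where "up2 t r = up e (t - e * r) (xv + e * \<zeta> t r) $ 2" for t r
    have cont2: "continuous_on {0..S} (lo2 t)" "continuous_on {0..S} (\<lambda>r. - up2 t r)" if t: "t \<in> ?I" for t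
    proof -
      have 1: "\<bar>lo2 t r - lo2 t r'\<bar> \<le> (2 * L * (1 + 2 * \<alpha>)) * \<bar>r - r'\<bar>" "\<bar>up2 t r - up2 t r'\<bar> \<le> (2 * L * (1 + 2 * \<alpha>)) * \<bar>r - r'\<bar>"
        if r: "r \<in> {0..S}" "r' \<in> {0..S}" for r r'
      proof -
        have "\<bar>(t - e * r) - (t - e * r')\<bar> = e * \<bar>r - r'\<bar>"
          using e by (simp add: right_diff_distrib[symmetric] abs_mult abs_minus_commute)
        also have "\<dots> \<le> 1 * \<bar>r - r'\<bar>" using ee h1.e0_le by (intro mult_right_mono) auto
        finally have "\<bar>(t - e * r) - (t - e * r')\<bar> + \<bar>\<zeta> t r - \<zeta> t r'\<bar> \<le> (1 + 2 * \<alpha>) * \<bar>r - r'\<bar>"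
          using \<zeta>spd[OF t r(2,1)] by (simp add: algebra_simps)
        from mult_left_mono[OF this, of "2 * L"] L
        have "2 * L * (\<bar>(t - e * r) - (t - e * r')\<bar> + \<bar>\<zeta> t r - \<zeta> t r'\<bar>) \<le> (2 * L * (1 + 2 * \<alpha>)) * \<bar>r - r'\<bar>"
          by (simp add: mult.assoc)
        then show "\<bar>lo2 t r - lo2 t r'\<bar> \<le> (2 * L * (1 + 2 * \<alpha>)) * \<bar>r - r'\<bar>" "\<bar>up2 t r - up2 t r'\<bar> \<le> (2 * L * (1 + 2 * \<alpha>)) * \<bar>r - r'\<bar>"
          using lip[OF IJ[OF t r(1)] IJ[OF t r(2)] \<zeta>B[OF t r(1)] \<zeta>B[OF t r(2)], of 2] unfolding lo2_def up2_def by linarith+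
      qed
      have "(2 * L * (1 + 2 * \<alpha>))-lipschitz_on {0..S} (lo2 t)" "(2 * L * (1 + 2 * \<alpha>))-lipschitz_on {0..S} (\<lambda>r. - up2 t r)"
        using 1 L \<alpha> by (auto intro!: lipschitz_onI simp: dist_real_def abs_minus_commute)
      then show "continuous_on {0..S} (lo2 t)" "continuous_on {0..S} (\<lambda>r. - up2 t r)"
        using lipschitz_on_continuous_on by blast+
    qed
    \<comment> \<open>Backward motion at speed \<open>\<alpha> / 2\<close> moves a vertical
      component at rate \<open>e * (b * \<alpha> / 8)\<close>; the time dependence of the field
      costs at most half of this.\<close>
    define c where "c = e * (b * \<alpha> / 16)"
    have c: "0 < c" using e b \<alpha> by (simp add: c_def)
    have c_le: "c * w \<le> b / 4 * (e * h) - e * L * (e * w)" if w: "0 \<le> w" and h: "\<alpha> / 2 * w \<le> h" for w h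
    proof -
      have "b / 4 * (\<alpha> / 2 * w) \<le> b / 4 * h" using h b by (intro mult_left_mono) auto
      moreover have "(e * L) * w \<le> (b * \<alpha> / 16) * w" using sm w by (intro mult_right_mono) auto
      moreover have "b / 4 * (\<alpha> / 2 * w) = 2 * ((b * \<alpha> / 16) * w)" by simp
      ultimately have "(b * \<alpha> / 16) * w \<le> b / 4 * h - (e * L) * w" by linarith
      from mult_left_mono[OF this, of e] e show ?thesis by (simp add: c_def algebra_simps)
    qed
    \<comment> \<open>When \<open>lo2\<close> is at most one eighth of the lower bound
      \<open>m\<close> of the denominator, the upper field has weight at most \<open>1/8\<close> and
      the lower field dominates.\<close>
    have qe: "q (t - e * s) (\<zeta> t s) \<le> 1/8" if t: "t \<in> ?I" and s: "s \<in> {0..S}" and le: "lo2 t s \<le> m / 8" for t s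
      using Dn[OF IJ[OF t s] \<zeta>B[OF t s]] m le unfolding q_def m_def[symmetric] lo2_def[symmetric]
      by (subst pos_divide_le_eq) (auto simp: m_def)
    have qe': "7/8 \<le> q (t - e * s) (\<zeta> t s)" if t: "t \<in> ?I" and s: "s \<in> {0..S}" and le: "- up2 t s \<le> m / 8" for t s
      using Dn[OF IJ[OF t s] \<zeta>B[OF t s]] m le unfolding q_def m_def[symmetric] lo2_def[symmetric] up2_def[symmetric]
      by (subst pos_le_divide_eq) (auto simp: m_def)
    have lo_pos: "0 < lo2 t r" if t: "t \<in> ?I" and r: "r \<in> {0<..S}" for t r
    proof (rule positive_by_growth[OF cont2(1)[OF t] _ c _ _ r, where \<kappa> = "m / 8"])
      show "0 \<le> lo2 t 0" using \<xi>0(3)[OF t] \<zeta>(1)[OF t] by (simp add: lo2_def)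
      show "0 < m / 8" using m by simp
      fix s s' assume s: "0 \<le> s" "s \<le> s'" "s' \<le> S" and small: "\<And>x. x \<in> {s<..<s'} \<Longrightarrow> lo2 t x \<le> m / 8"
      have "- \<zeta> t s' - - \<zeta> t s \<le> (- (\<alpha> / 2)) * (s' - s)"
      proof (rule increment_le_of_derivative_le[OF s(2), where h' = "\<lambda>x. - V (t - e * x) (\<zeta> t x)"])
        show "((\<lambda>x. - \<zeta> t x) has_real_derivative - V (t - e * x) (\<zeta> t x)) (at x within {s..s'})" if "x \<in> {s..s'}" for x
          by (rule DERIV_minus, rule DERIV_subset[OF \<zeta>der[OF t]]) (use that s in auto)
        fix x assume x: "x \<in> {s<..<s'}"
        have xS: "x \<in> {0..S}" using x s by auto
        let ?l = "lo e (t - e * x) (xv + e * \<zeta> t x) $ 1" and ?u = "up e (t - e * x) (xv + e * \<zeta> t x) $ 1"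
        have f: "- (9 * \<alpha> / 8) \<le> ?l" "?l \<le> - (7 * \<alpha> / 8)" "7 * \<alpha> / 8 \<le> ?u" "?u \<le> 9 * \<alpha> / 8"
          using first[OF IJ[OF t xS] \<zeta>B[OF t xS]] unfolding abs_le_iff by linarith+
        have "\<rho> (t - e * x) (\<zeta> t x) \<le> 1/8" using qe[OF t xS small[OF x]] by (simp add: \<rho>_def)
        then have "\<rho> (t - e * x) (\<zeta> t x) * (?u - ?l) \<le> 1/8 * (?u - ?l)"
          using f \<alpha> by (intro mult_right_mono) linarith+
        moreover have "- V (t - e * x) (\<zeta> t x) = ?l + \<rho> (t - e * x) (\<zeta> t x) * (?u - ?l)" by (simp only: V_def minus_minus)
        ultimately have "- V (t - e * x) (\<zeta> t x) \<le> 7 * ?l / 8 + ?u / 8" by simp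
        then show "- V (t - e * x) (\<zeta> t x) \<le> - (\<alpha> / 2)" using f \<alpha> by linarith
      qed
      then have inc: "\<alpha> / 2 * (s' - s) \<le> \<zeta> t s' - \<zeta> t s" by simp
      have ss: "s \<in> {0..S}" "s' \<in> {0..S}" using s by auto
      have "0 \<le> \<alpha> / 2 * (s' - s)" using \<alpha> s by simp
      then have le: "\<zeta> t s \<le> \<zeta> t s'" using inc by linarith
      have "\<bar>(t - e * s) - (t - e * s')\<bar> = e * (s' - s)"
        using e s by (simp add: right_diff_distrib[symmetric] abs_mult)
      then have "b / 4 * (e * (\<zeta> t s' - \<zeta> t s)) - e * L * (e * (s' - s)) \<le> lo2 t s' - lo2 t s"
        using grow(1)[OF IJ[OF t ss(1)] IJ[OF t ss(2)] \<zeta>B[OF t ss(1)] \<zeta>B[OF t ss(2)] le] unfolding lo2_def by simp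
      then show "c * (s' - s) \<le> lo2 t s' - lo2 t s" using c_le[OF _ inc] s by simp
    qed
    have up_neg0: "0 < - up2 t 0" if t: "t \<in> ?I" for t
      using Dn[OF IJ0[OF t] \<xi>B(2)[OF t]] \<xi>0(3)[OF t] \<zeta>(1)[OF t] m by (simp add: up2_def m_def)
    have up_neg: "0 < - up2 t r" if t: "t \<in> ?I" and r: "r \<in> {0<..S}" for t r
    proof (rule positive_by_growth[OF cont2(2)[OF t] _ c _ _ r, where \<kappa> = "m / 8"])
      show "0 \<le> - up2 t 0" using up_neg0[OF t] by simp
      show "0 < m / 8" using m by simp
      fix s s' assume s: "0 \<le> s" "s \<le> s'" "s' \<le> S" and small: "\<And>x. x \<in> {s<..<s'} \<Longrightarrow> - up2 t x \<le> m / 8"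
      have "\<zeta> t s' - \<zeta> t s \<le> (- (\<alpha> / 2)) * (s' - s)"
      proof (rule increment_le_of_derivative_le[OF s(2), where h' = "\<lambda>x. V (t - e * x) (\<zeta> t x)"])
        show "(\<zeta> t has_real_derivative V (t - e * x) (\<zeta> t x)) (at x within {s..s'})" if "x \<in> {s..s'}" for x
          by (rule DERIV_subset[OF \<zeta>der[OF t]]) (use that s in auto)
        fix x assume x: "x \<in> {s<..<s'}"
        have xS: "x \<in> {0..S}" using x s by auto
        let ?l = "lo e (t - e * x) (xv + e * \<zeta> t x) $ 1" and ?u = "up e (t - e * x) (xv + e * \<zeta> t x) $ 1"
        have f: "- (9 * \<alpha> / 8) \<le> ?l" "?l \<le> - (7 * \<alpha> / 8)" "7 * \<alpha> / 8 \<le> ?u" "?u \<le> 9 * \<alpha> / 8"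
          using first[OF IJ[OF t xS] \<zeta>B[OF t xS]] unfolding abs_le_iff by linarith+
        have "7/8 \<le> \<rho> (t - e * x) (\<zeta> t x)" using qe'[OF t xS small[OF x]] by (simp add: \<rho>_def)
        then have "7/8 * (?u - ?l) \<le> \<rho> (t - e * x) (\<zeta> t x) * (?u - ?l)"
          using f \<alpha> by (intro mult_right_mono) linarith+
        moreover have "V (t - e * x) (\<zeta> t x) = - ?l - \<rho> (t - e * x) (\<zeta> t x) * (?u - ?l)" by (simp only: V_def minus_add_distrib diff_conv_add_uminus)
        ultimately have "V (t - e * x) (\<zeta> t x) \<le> - ?l / 8 - 7 * ?u / 8" by simp
        then show "V (t - e * x) (\<zeta> t x) \<le> - (\<alpha> / 2)" using f \<alpha> by linarith
      qed
      then have inc: "\<alpha> / 2 * (s' - s) \<le> \<zeta> t s - \<zeta> t s'" by simp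
      have ss: "s \<in> {0..S}" "s' \<in> {0..S}" using s by auto
      have "0 \<le> \<alpha> / 2 * (s' - s)" using \<alpha> s by simp
      then have le: "\<zeta> t s' \<le> \<zeta> t s" using inc by linarith
      have "\<bar>(t - e * s') - (t - e * s)\<bar> = e * (s' - s)"
        using e s by (simp add: right_diff_distrib[symmetric] abs_mult)
      then have "b / 4 * (e * (\<zeta> t s - \<zeta> t s')) - e * L * (e * (s' - s)) \<le> up2 t s - up2 t s'"
        using grow(2)[OF IJ[OF t ss(2)] IJ[OF t ss(1)] \<zeta>B[OF t ss(2)] \<zeta>B[OF t ss(1)] le] unfolding up2_def by simp
      then show "c * (s' - s) \<le> - up2 t s' - - up2 t s" using c_le[OF _ inc] s by simp
    qed
    have lo_nn: "0 \<le> lo2 t r" and up_lt: "up2 t r < 0" if t: "t \<in> ?I" and r: "r \<in> {0..S}" for t r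
    proof -
      show "0 \<le> lo2 t r" using lo_pos[OF t, of r] \<xi>0(3)[OF t] \<zeta>(1)[OF t] r
        by (cases "r = 0") (auto simp: lo2_def)
      show "up2 t r < 0" using up_neg[OF t, of r] up_neg0[OF t] r by (cases "r = 0") auto
    qed
    \<comment> \<open>With both signs known the weight lies between 0 and 1, the clamp is the
      identity, and \<open>V\<close> is the reversed sliding speed.\<close>
    have Vslide: "V (t - e * r) (\<zeta> t r) = - slide_speed e (t - e * r) (xv + e * \<zeta> t r)" if t: "t \<in> ?I" and r: "r \<in> {0..S}" for t r
    proof -
      have pos: "0 < lo2 t r - up2 t r" using lo_nn[OF t r] up_lt[OF t r] by linarith
      have "0 \<le> q (t - e * r) (\<zeta> t r)" "q (t - e * r) (\<zeta> t r) \<le> 1"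
        unfolding q_def lo2_def[symmetric] up2_def[symmetric] using pos lo_nn[OF t r] up_lt[OF t r] by simp_all
      then have \<rho>q: "\<rho> (t - e * r) (\<zeta> t r) = q (t - e * r) (\<zeta> t r)" by (simp add: \<rho>_def)
      have alg: "- (l + x / (x - y) * (u - l)) = - ((x * u - y * l) / (x - y))" if "0 < x - y" for l u x y :: real
        using that by (simp add: field_simps)
      show ?thesis
        unfolding V_def slide_speed_def \<rho>q q_def lo2_def[symmetric] up2_def[symmetric] by (rule alg[OF pos])
    qed
    have cont\<xi>: "continuous_on ?I \<xi>0"
    proof (rule lipschitz_on_continuous_on)
      show "(4 * L / b)-lipschitz_on ?I \<xi>0"
        using \<xi>lip L b by (intro lipschitz_onI) (auto simp: dist_real_def)
    qed
    have cont\<zeta>: "continuous_on (?I \<times> {0..S}) (\<lambda>(t, r). \<zeta> t r)"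
    proof (rule lipschitz_on_continuous_on)
      define E where "E = exp (\<Lambda> * S)"
      define C where "C = (4 * L / b + \<Lambda> * S) * E"
      have C: "0 \<le> C" using L b \<Lambda> S by (simp add: C_def E_def)
      show "(C + 2 * \<alpha>)-lipschitz_on (?I \<times> {0..S}) (\<lambda>(t, r). \<zeta> t r)"
      proof (rule lipschitz_onI; clarify?)
        fix t r t' r' assume t: "t \<in> ?I" and r: "r \<in> {0..S}" and t': "t' \<in> ?I" and r': "r' \<in> {0..S}"
        have "norm (\<zeta> t r - \<zeta> t' r) \<le> (norm (\<zeta> t 0 - \<zeta> t' 0) + (\<Lambda> * \<bar>t - t'\<bar>) * S) * exp (\<Lambda> * S)"
        proof (rule gronwall[where e' = "\<lambda>s. V (t - e * s) (\<zeta> t s) - V (t' - e * s) (\<zeta> t' s)"])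
          fix s assume s: "s \<in> {0..S}"
          show "((\<lambda>s. \<zeta> t s - \<zeta> t' s) has_vector_derivative V (t - e * s) (\<zeta> t s) - V (t' - e * s) (\<zeta> t' s)) (at s within {0..S})"
            using \<zeta>der[OF t s] \<zeta>der[OF t' s]
            by (intro has_vector_derivative_diff) (simp_all add: has_real_derivative_iff_has_vector_derivative)
          have "\<bar>V (t - e * s) (\<zeta> t s) - V (t' - e * s) (\<zeta> t' s)\<bar> \<le> \<Lambda> * (\<bar>(t - e * s) - (t' - e * s)\<bar> + \<bar>\<zeta> t s - \<zeta> t' s\<bar>)"
            by (intro Vlip IJ \<zeta>B t t' s)
          then show "norm (V (t - e * s) (\<zeta> t s) - V (t' - e * s) (\<zeta> t' s)) \<le> \<Lambda> * norm (\<zeta> t s - \<zeta> t' s) + \<Lambda> * \<bar>t - t'\<bar>"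
            by (simp add: distrib_left)
        qed (use S \<Lambda> r in auto)
        also have "\<dots> \<le> (4 * L / b * \<bar>t - t'\<bar> + (\<Lambda> * \<bar>t - t'\<bar>) * S) * exp (\<Lambda> * S)"
          using \<xi>lip[OF t t'] unfolding \<zeta>(1)[OF t] \<zeta>(1)[OF t'] real_norm_def
          by (intro mult_right_mono[of _ _ "exp _"] add_right_mono) auto
        finally have 1: "\<bar>\<zeta> t r - \<zeta> t' r\<bar> \<le> C * \<bar>t - t'\<bar>" by (simp add: C_def E_def algebra_simps)
        have 2: "\<bar>\<zeta> t' r - \<zeta> t' r'\<bar> \<le> 2 * \<alpha> * \<bar>r - r'\<bar>" by (rule \<zeta>spd[OF t' r' r])
        have "C * \<bar>t - t'\<bar> + 2 * \<alpha> * \<bar>r - r'\<bar> \<le> C * dist (t, r) (t', r') + 2 * \<alpha> * dist (t, r) (t', r')"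
          using C \<alpha> dist_fst_le[of "(t, r)" "(t', r')"] dist_snd_le[of "(t, r)" "(t', r')"]
          by (intro add_mono mult_left_mono) (auto simp: dist_real_def)
        then show "dist (\<zeta> t r) (\<zeta> t' r') \<le> (C + 2 * \<alpha>) * dist (t, r) (t', r')"
          using 1 2 unfolding dist_real_def[of "\<zeta> t r"] by (simp add: distrib_right)
      qed (use C \<alpha> in simp)
    qed
    \<comment> \<open>Through the expansion, nonnegativity of \<open>lo2\<close> becomes a lower
      bound on the position: up to the margin \<open>\<eta>\<close> the arc never lies left of the
      limiting fold.\<close>
    have lower: "- a1 - \<eta> \<le> b * \<zeta> t r" if t: "t \<in> ?I" and r: "r \<in> {0..S}" for t r
    proof -
      have "e * (e * (L * H)) \<le> e * \<eta>" using sm e by (intro mult_left_mono) auto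
      then have "0 \<le> e * (b * \<zeta> t r + a1) + e * \<eta>"
        using lo_exp[OF IJ[OF t r] \<zeta>B[OF t r]] lo_nn[OF t r] unfolding lo2_def by linarith
      then have "0 \<le> e * (b * \<zeta> t r + a1 + \<eta>)" by (simp add: distrib_left)
      then show ?thesis using e by (simp add: zero_le_mult_iff)
    qed
    have "sliding_arc e S ?I B \<eta> \<xi>0 \<zeta>"
      unfolding sliding_arc_def a1_def[symmetric]
    proof (intro conjI ballI impI)
      fix t assume t: "t \<in> ?I"
      show "\<zeta> t 0 = \<xi>0 t" "\<bar>b * \<xi>0 t + a1\<bar> \<le> \<eta>" "lo e t (xv + e * \<xi>0 t) $ 2 = 0" using \<zeta>(1)[OF t] \<xi>0[OF t] by auto
      fix r assume r: "r \<in> {0..S}"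
      show "\<bar>\<zeta> t r\<bar> \<le> B" "- a1 - \<eta> \<le> b * \<zeta> t r" using \<zeta>B[OF t r] lower[OF t r] by auto
      show "(\<zeta> t has_real_derivative - slide_speed e (t - e * r) (xv + e * \<zeta> t r)) (at r within {0..S})"
        using \<zeta>der[OF t r] Vslide[OF t r] by simp
      show "up e (t - e * r) (xv + e * \<zeta> t r) $ 2 < 0" using up_lt[OF t r] by (simp add: up2_def)
      show "0 < lo e (t - e * r) (xv + e * \<zeta> t r) $ 2" if "0 < r" using lo_pos[OF t, of r] that r by (simp add: lo2_def)
    qed (use cont\<xi> cont\<zeta> in auto)
    then show ?thesis by blast
  qed
  have "0 < \<mu> / N" using \<mu> N by simp
  then show ?thesis using arc by blast
qed

end

section \<open>Piecewise smooth periodic solutions\<close>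

text \<open>A notion stable under gluing, periodic continuation and time reversal. The derivative is
  classical off a locally finite set \<open>E\<close>; the bound on \<open>v\<close> holds
  everywhere and yields absolute integrability.\<close>

definition piecewise_solution ::
  "(real^2) set \<Rightarrow> (real \<Rightarrow> real^2 \<Rightarrow> real^2) \<Rightarrow> (real \<Rightarrow> real^2 \<Rightarrow> real^2) \<Rightarrow> real \<Rightarrow> (real \<Rightarrow> real^2) \<Rightarrow> bool" where
  "piecewise_solution D Xp Xm P u \<longleftrightarrow>
    (\<forall>t. u t \<in> D) \<and> (\<forall>t. u (t + P) = u t) \<and> continuous_on UNIV u \<and>
    (\<exists>v E C. (\<forall>c d. finite (E \<inter> {c..d})) \<and> (\<forall>t. norm (v t) \<le> C) \<and>
      (\<forall>t. t \<notin> E \<longrightarrow> (u has_vector_derivative v t) (at t) \<and> v t \<in> filippov_set Xp Xm t (u t)))"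

text \<open>The fundamental theorem tolerates finitely many exceptional times in each interval, and
  a locally finite \<open>E\<close> is countable, hence null.\<close>

lemma piecewise_solution_periodic:
  assumes "piecewise_solution D Xp Xm P u"
  shows "periodic_solution D Xp Xm P u"
proof -
  obtain v E C where u: "\<And>t. u t \<in> D" "\<And>t. u (t + P) = u t" "continuous_on UNIV u"
    and E: "\<And>c d :: real. finite (E \<inter> {c..d})" and C: "\<And>t. norm (v t) \<le> C"
    and v: "\<And>t. t \<notin> E \<Longrightarrow> (u has_vector_derivative v t) (at t)" "\<And>t. t \<notin> E \<Longrightarrow> v t \<in> filippov_set Xp Xm t (u t)"
    using assms unfolding piecewise_solution_def by blast
  have int: "(v has_integral (u d - u c)) {c..d}" if "c \<le> d" for c d
    by (rule fundamental_theorem_of_calculus_interior_strong[OF E[of c d] that])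
      (use v in \<open>auto intro: continuous_on_subset[OF u(3)]\<close>)
  have "v absolutely_integrable_on {c..d}" if "c \<le> d" for c d
    by (rule absolutely_integrable_integrable_bound[where g = "\<lambda>_. C"])
      (use int[OF that] C in \<open>auto simp: has_integral_iff\<close>)
  moreover have "AE t in lebesgue. v t \<in> filippov_set Xp Xm t (u t)"
  proof -
    have Eeq: "E = (\<Union>n. E \<inter> {- real n..real n})"
    proof (intro equalityI subsetI)
      fix x assume "x \<in> E"
      moreover obtain n where "\<bar>x\<bar> \<le> real n" using real_arch_simple by blast
      ultimately show "x \<in> (\<Union>n. E \<inter> {- real n..real n})" by (intro UN_I[of n]) (auto simp: abs_le_iff)
    qed auto
    have "countable E" by (subst Eeq) (intro countable_UN countable_finite E countableI_type)
    then have "E \<in> null_sets lebesgue"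
      by (intro null_sets_completionI countable_imp_null_set_lborel)
    then show ?thesis by (rule AE_I') (use v(2) in blast)
  qed
  ultimately show ?thesis
    unfolding periodic_solution_def filippov_solution_def
    by (intro conjI allI exI[of _ v] impI u(1) u(2) int) auto
qed

text \<open>The transform of a field under \<open>(t, z) \<mapsto> (- t, reflect z)\<close>.
  Reflection exchanges the half-planes, so the upper field of the reversed system is
  \<open>reversed Xm\<close>.\<close>

definition reversed :: "(real \<Rightarrow> real^2 \<Rightarrow> real^2) \<Rightarrow> real \<Rightarrow> real^2 \<Rightarrow> real^2" where
  "reversed X t z = - reflect (X (- t) (reflect z))"

lemma filippov_set_reversed:
  assumes "w \<in> filippov_set Xp Xm (- t) z"
  shows "- reflect w \<in> filippov_set (reversed Xm) (reversed Xp) t (reflect z)"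
proof (cases "z $ 2 = 0")
  case True
  then obtain s where s: "0 \<le> s" "s \<le> 1" "w = (1 - s) *\<^sub>R Xm (- t) z + s *\<^sub>R Xp (- t) z"
    using assms by (auto simp: filippov_set_def in_segment)
  then have "- reflect w = (1 - (1 - s)) *\<^sub>R reversed Xp t (reflect z) + (1 - s) *\<^sub>R reversed Xm t (reflect z)"
    by (simp add: reversed_def reflect_simps)
  then have "- reflect w \<in> closed_segment (reversed Xp t (reflect z)) (reversed Xm t (reflect z))"
    unfolding in_segment using s by (intro exI[of _ "1 - s"]) simp
  then show ?thesis using True by (simp add: filippov_set_def)
qed (use assms in \<open>auto simp: filippov_set_def reversed_def split: if_splits\<close>)

lemma piecewise_solution_reversed:
  assumes u: "piecewise_solution D Xp Xm P u" and D: "reflect ` D = D"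
  shows "piecewise_solution D (reversed Xm) (reversed Xp) P (\<lambda>t. reflect (u (- t)))"
proof -
  obtain v E C where u: "\<And>t. u t \<in> D" "\<And>t. u (t + P) = u t" "continuous_on UNIV u"
    and E: "\<And>c d :: real. finite (E \<inter> {c..d})" and C: "\<And>t. norm (v t) \<le> C"
    and v: "\<And>t. t \<notin> E \<Longrightarrow> (u has_vector_derivative v t) (at t)" "\<And>t. t \<notin> E \<Longrightarrow> v t \<in> filippov_set Xp Xm t (u t)"
    using assms unfolding piecewise_solution_def by blast
  show ?thesis
    unfolding piecewise_solution_def
  proof (intro conjI allI exI[of _ "\<lambda>t. - reflect (v (- t))"] exI[of _ "uminus ` E"] exI[of _ C] impI)
    show "reflect (u (- t)) \<in> D" for t using u(1) D by blast
    show "reflect (u (- (t + P))) = reflect (u (- t))" for t using u(2)[of "- (t + P)"] by simp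
    show "continuous_on UNIV (\<lambda>t. reflect (u (- t)))"
      by (intro linear_continuous_on_compose[OF _ reflect_linear] continuous_on_compose2[OF u(3)] continuous_intros) auto
    show "finite (uminus ` E \<inter> {c..d})" for c d
      by (rule finite_subset[of _ "uminus ` (E \<inter> {- d..- c})"]) (use E in auto)
    show "norm (- reflect (v (- t))) \<le> C" for t using C by simp
    fix t assume "t \<notin> uminus ` E"
    then have t: "- t \<notin> E" by (metis image_eqI minus_minus)
    have "(uminus has_vector_derivative - 1) (at t)" by (auto intro!: derivative_eq_intros)
    from vector_diff_chain_at[OF this v(1)[OF t]]
    have "((\<lambda>t. u (- t)) has_vector_derivative - v (- t)) (at t)" by (simp add: o_def)
    from bounded_linear.has_vector_derivative[OF bounded_linear_reflect this]
    show "((\<lambda>t. reflect (u (- t))) has_vector_derivative - reflect (v (- t))) (at t)" by (simp add: reflect_simps)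
    show "- reflect (v (- t)) \<in> filippov_set (reversed Xm) (reversed Xp) t (reflect (u (- t)))"
      by (rule filippov_set_reversed[OF v(2)[OF t]])
  qed
qed

text \<open>Vertical components keep their signs while the two fields change places, which turns the
  sliding condition into the escaping one.\<close>

lemma slides_on_reversed:
  assumes "slides_on Xp Xm (sliding_region Xp Xm) u"
  shows "slides_on (reversed Xm) (reversed Xp) (escaping_region (reversed Xm) (reversed Xp)) (\<lambda>t. reflect (u (- t)))"
proof -
  obtain c d where cd: "c < d" and reg: "\<And>t. t \<in> {c..d} \<Longrightarrow> (t, u t) \<in> sliding_region Xp Xm"
    and der: "\<And>t. t \<in> {c..d} \<Longrightarrow> (u has_vector_derivative sliding_field Xp Xm t (u t)) (at t within {c..d})"
    using assms unfolding slides_on_def by blast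
  show ?thesis
    unfolding slides_on_def
  proof (rule exI[of _ "- d"], rule exI[of _ "- c"], intro conjI ballI)
    show "- d < - c" using cd by simp
    fix t assume t: "t \<in> {- d..- c}"
    then have t': "- t \<in> {c..d}" by auto
    show "(t, reflect (u (- t))) \<in> escaping_region (reversed Xm) (reversed Xp)"
      using reg[OF t'] by (auto simp: sliding_region_def escaping_region_def reversed_def)
    have "(uminus has_vector_derivative - 1) (at t within {- d..- c})" by (auto intro!: derivative_eq_intros)
    moreover have "uminus ` {- d..- c} = {c..d}" by auto
    ultimately have "((\<lambda>t. u (- t)) has_vector_derivative - sliding_field Xp Xm (- t) (u (- t))) (at t within {- d..- c})"
      using vector_diff_chain_within[of uminus "- 1" t "{- d..- c}" u] der[OF t'] by (simp add: o_def)
    from bounded_linear.has_vector_derivative[OF bounded_linear_reflect this]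
    have "((\<lambda>t. reflect (u (- t))) has_vector_derivative - reflect (sliding_field Xp Xm (- t) (u (- t)))) (at t within {- d..- c})"
      by (simp add: reflect_simps)
    moreover have "- reflect (sliding_field Xp Xm (- t) (u (- t))) = sliding_field (reversed Xm) (reversed Xp) t (reflect (u (- t)))"
    proof -
      have "x * (- p) - y * (- q) = x * - p + y * q" for x y p q :: real by simp
      have "- ((x * p - y * q) / (x - y)) = (y * (- q) - x * (- p)) / (y - x)" for x y p q :: real
        by (cases "x = y") (simp_all add: field_simps)
      then show ?thesis by (simp add: vec2_eq_iff sliding_field_def reversed_def)
    qed
    ultimately show "((\<lambda>t. reflect (u (- t))) has_vector_derivative sliding_field (reversed Xm) (reversed Xp) t (reflect (u (- t)))) (at t within {- d..- c})"
      by simp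
  qed
qed

section \<open>Periodic continuation and gluing of arcs\<close>

lemma periodic_int:
  fixes f :: "real \<Rightarrow> 'b"
  assumes "\<And>t. f (t + P) = f t"
  shows "f (t + of_int n * P) = f t"
proof (induction n arbitrary: t rule: int_induct[where k = 0])
  case (step1 i)
  then show ?case using assms[of "t + of_int i * P"] by (simp add: algebra_simps)
next
  case (step2 i)
  then show ?case using assms[of "t + of_int (i - 1) * P"] by (simp add: algebra_simps)
qed simp

text \<open>The value at \<open>t\<close> is taken in the fundamental interval, after subtracting
  the whole periods. Matching ends make the copies fit continuously; the translates of
  \<open>a\<close> join the exceptional set.\<close>

lemma periodic_extension:
  fixes u0 :: "real \<Rightarrow> real^2"
  assumes P: "0 < P" and D: "\<And>t. t \<in> {a..a+P} \<Longrightarrow> u0 t \<in> D" and cont: "continuous_on {a..a+P} u0" and close: "u0 (a + P) = u0 a"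
    and E: "finite E" and C: "\<And>t. norm (v0 t) \<le> C"
    and v: "\<And>t. t \<in> {a<..<a+P} - E \<Longrightarrow> (u0 has_vector_derivative v0 t) (at t)"
      "\<And>t. t \<in> {a<..<a+P} - E \<Longrightarrow> v0 t \<in> filippov_set Xp Xm t (u0 t)"
    and perX: "\<And>t z. z \<in> D \<Longrightarrow> Xp (t + P) z = Xp t z" "\<And>t z. z \<in> D \<Longrightarrow> Xm (t + P) z = Xm t z"
  shows "\<exists>u. piecewise_solution D Xp Xm P u \<and> (\<forall>t\<in>{a..a+P}. u t = u0 t)
    \<and> (\<forall>t. \<exists>n::int. t - of_int n * P \<in> {a..<a+P} \<and> u t = u0 (t - of_int n * P))"
proof -
  define n where "n t = \<lfloor>(t - a) / P\<rfloor>" for t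
  define \<phi> where "\<phi> t = t - of_int (n t) * P" for t
  have n_char: "n t = k" if "a + of_int k * P \<le> t" "t < a + (of_int k + 1) * P" for t k
    unfolding n_def using that P by (intro floor_unique) (auto simp: field_simps)
  have \<phi>_range: "\<phi> t \<in> {a..<a+P}" for t
  proof -
    have "of_int (n t) \<le> (t - a) / P" "(t - a) / P < of_int (n t) + 1" unfolding n_def by linarith+
    then show ?thesis using P by (simp add: \<phi>_def field_simps)
  qed
  define u where "u t = u0 (\<phi> t)" for t
  \<comment> \<open>At the right end the definition of \<open>u\<close> refers to the next period;
    there \<open>close\<close> identifies \<open>u0 (a + P)\<close> with
    \<open>u0 a\<close>.\<close>
  have u_on: "u t = u0 (t - of_int k * P)" if "t \<in> {a + of_int k * P..a + (of_int k + 1) * P}" for t k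
  proof (cases "t = a + (of_int k + 1) * P")
    case True
    then have "n t = k + 1" using P by (intro n_char) (auto simp: algebra_simps)
    then have "\<phi> t = a" "t - of_int k * P = a + P" by (auto simp: \<phi>_def True algebra_simps)
    then show ?thesis using close by (simp add: u_def)
  next
    case False
    then have "n t = k" using that by (intro n_char) auto
    then show ?thesis by (simp add: u_def \<phi>_def)
  qed
  have n_int: "t \<in> {a + of_int (n t) * P..<a + (of_int (n t) + 1) * P}" for t
    using \<phi>_range[of t] by (simp add: \<phi>_def algebra_simps)
  have piece: "continuous_on {a + of_int k * P..a + (of_int k + 1) * P} u" for k :: int
  proof (rule continuous_on_eq)
    show "continuous_on {a + of_int k * P..a + (of_int k + 1) * P} (\<lambda>t. u0 (t - of_int k * P))"
      by (rule continuous_on_compose2[OF cont]) (auto intro!: continuous_intros simp: algebra_simps)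
  qed (use u_on in auto)
  have contu: "isCont u t" for t
  proof -
    let ?l = "a + of_int (n t - 1) * P" and ?m = "a + of_int (n t) * P" and ?r = "a + (of_int (n t) + 1) * P"
    have "continuous_on ({?l..?m} \<union> {?m..?r}) u"
      using piece[of "n t - 1"] piece[of "n t"] by (intro continuous_on_closed_Un) auto
    moreover have "{?l..?m} \<union> {?m..?r} = {?l..?r}" using P by (intro ivl_disj_un_two_touch) (auto simp: algebra_simps)
    ultimately have "continuous_on {?l..?r} u" by simp
    moreover have "t \<in> interior {?l..?r}" using n_int[of t] P by (simp add: algebra_simps)
    ultimately show ?thesis by (rule continuous_on_interior)
  qed
  define v where "v t = v0 (\<phi> t)" for t
  define E' where "E' = {t. \<phi> t \<in> insert a E}"
  have perXn: "Xp (t + of_int k * P) z = Xp t z" "Xm (t + of_int k * P) z = Xm t z" if "z \<in> D" for t z k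
    using periodic_int[of "\<lambda>t. Xp t z" P t k] periodic_int[of "\<lambda>t. Xm t z" P t k] perX[OF that] by auto
  have "piecewise_solution D Xp Xm P u"
    unfolding piecewise_solution_def
  proof (intro conjI allI exI[of _ v] exI[of _ E'] exI[of _ C] impI)
    show uD: "u t \<in> D" for t unfolding u_def using \<phi>_range[of t] by (intro D) auto
    show "u (t + P) = u t" for t
    proof -
      have "n (t + P) = n t + 1" using n_int[of t] P by (intro n_char) (auto simp: algebra_simps)
      then show ?thesis by (simp add: u_def \<phi>_def algebra_simps)
    qed
    show "continuous_on UNIV u" using contu by (simp add: continuous_at_imp_continuous_on)
    show "norm (v t) \<le> C" for t by (simp add: v_def C)
    show "finite (E' \<inter> {c..d})" for c d
    proof (rule finite_subset)
      show "E' \<inter> {c..d} \<subseteq> (\<lambda>(k, x). x + of_int k * P) ` ({n c..n d} \<times> insert a E)"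
      proof
        fix t assume t: "t \<in> E' \<inter> {c..d}"
        have "n t \<in> {n c..n d}"
          unfolding n_def atLeastAtMost_iff using t P by (intro conjI floor_mono divide_right_mono) auto
        moreover have "t = \<phi> t + of_int (n t) * P" by (simp add: \<phi>_def)
        moreover have "\<phi> t \<in> insert a E" using t by (simp add: E'_def)
        ultimately show "t \<in> (\<lambda>(k, x). x + of_int k * P) ` ({n c..n d} \<times> insert a E)"
          by (intro image_eqI[of _ _ "(n t, \<phi> t)"]) auto
      qed
    qed (use E in auto)
    fix t assume "t \<notin> E'"
    then have \<phi>t: "\<phi> t \<in> {a<..<a+P} - E" using \<phi>_range[of t] by (auto simp: E'_def less_le)
    let ?S = "{a + of_int (n t) * P<..<a + (of_int (n t) + 1) * P}"
    have tS: "t \<in> ?S" using \<phi>t by (auto simp: \<phi>_def algebra_simps)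
    have "((\<lambda>t'. t' - of_int (n t) * P) has_vector_derivative 1) (at t)" by (auto intro!: derivative_eq_intros)
    from vector_diff_chain_at[OF this, of u0 "v0 (\<phi> t)"] v(1)[OF \<phi>t]
    have "((\<lambda>t'. u0 (t' - of_int (n t) * P)) has_vector_derivative v t) (at t)"
      by (simp add: o_def v_def \<phi>_def)
    then show "(u has_vector_derivative v t) (at t)"
      by (rule has_vector_derivative_transform_within_open[OF _ open_greaterThanLessThan tS])
        (rule u_on[symmetric], simp add: less_imp_le)
    have uDt: "u0 (\<phi> t) \<in> D" using uD[of t] by (simp add: u_def)
    have "filippov_set Xp Xm (\<phi> t) (u0 (\<phi> t)) = filippov_set Xp Xm t (u0 (\<phi> t))"
      using perXn[OF uDt, of "\<phi> t" "n t"] by (simp add: filippov_set_def \<phi>_def)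
    then show "v t \<in> filippov_set Xp Xm t (u t)"
      using v(2)[OF \<phi>t] by (simp add: v_def u_def)
  qed
  moreover have "u t = u0 t" if "t \<in> {a..a+P}" for t
    using u_on[of t 0] that by simp
  moreover have "\<exists>k::int. t - of_int k * P \<in> {a..<a+P} \<and> u t = u0 (t - of_int k * P)" for t
    using \<phi>_range[of t] by (intro exI[of _ "n t"]) (simp add: \<phi>_def u_def)
  ultimately show ?thesis by blast
qed

text \<open>\<open>t1 = t0\<close> is allowed: the arc on the axis then degenerates to a point, as
  for crossing orbits. The last clause reduces questions about all times to one period.\<close>

lemma closed_orbit_of_pieces:
  fixes u1 u2 :: "real \<Rightarrow> real^2" and x y :: "real \<Rightarrow> real"
  assumes ord: "t1 \<le> t0" "t0 < m" "m < t1 + P"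
    and perX: "\<And>t z. z \<in> D \<Longrightarrow> Xp (t + P) z = Xp t z" "\<And>t z. z \<in> D \<Longrightarrow> Xm (t + P) z = Xm t z"
    and slide: "\<And>t. t \<in> {t1..t0} \<Longrightarrow> on_axis (x t) \<in> D" "\<And>t. t \<in> {t1..t0} \<Longrightarrow> (x has_real_derivative y t) (at t within {t1..t0})"
      "\<And>t. t \<in> {t1<..<t0} \<Longrightarrow> on_axis (y t) \<in> closed_segment (Xm t (on_axis (x t))) (Xp t (on_axis (x t)))"
    and low: "\<And>t. t \<in> {t0..m} \<Longrightarrow> u1 t \<in> D" "\<And>t. t \<in> {t0..m} \<Longrightarrow> (u1 has_vector_derivative Xm t (u1 t)) (at t within {t0..m})"
      "\<And>t. t \<in> {t0<..<m} \<Longrightarrow> u1 t $ 2 < 0"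
    and high: "\<And>t. t \<in> {m..t1+P} \<Longrightarrow> u2 t \<in> D" "\<And>t. t \<in> {m..t1+P} \<Longrightarrow> (u2 has_vector_derivative Xp t (u2 t)) (at t within {m..t1+P})"
      "\<And>t. t \<in> {m<..<t1+P} \<Longrightarrow> u2 t $ 2 > 0"
    and joints: "u1 t0 = on_axis (x t0)" "u1 m = u2 m" "u2 (t1 + P) = on_axis (x t1)"
    and C: "\<And>t. t \<in> {t1..t0} \<Longrightarrow> \<bar>y t\<bar> \<le> C" "\<And>t. t \<in> {t0..m} \<Longrightarrow> norm (Xm t (u1 t)) \<le> C" "\<And>t. t \<in> {m..t1+P} \<Longrightarrow> norm (Xp t (u2 t)) \<le> C"
  shows "\<exists>u. piecewise_solution D Xp Xm P u \<and> (\<forall>t\<in>{t1..t0}. u t = on_axis (x t)) \<and> (\<forall>t\<in>{t0..m}. u t = u1 t) \<and> (\<forall>t\<in>{m..t1+P}. u t = u2 t)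
    \<and> (\<forall>t. \<exists>n::int. t - of_int n * P \<in> {t1..<t1+P} \<and> u t = u (t - of_int n * P))"
proof -
  define u0 where "u0 t = (if t \<le> t0 then on_axis (x t) else if t \<le> m then u1 t else u2 t)" for t
  define v0 where "v0 t = (if t \<in> {t1..t0} then on_axis (y t) else if t \<in> {t0..m} then Xm t (u1 t)
    else if t \<in> {m..t1+P} then Xp t (u2 t) else 0)" for t
  have pieces: "\<And>t. t \<in> {t1..t0} \<Longrightarrow> u0 t = on_axis (x t)" "\<And>t. t \<in> {t0..m} \<Longrightarrow> u0 t = u1 t" "\<And>t. t \<in> {m..t1+P} \<Longrightarrow> u0 t = u2 t"
    using ord joints by (auto simp: u0_def)
  have P: "0 < P" using ord by linarith
  have c1: "continuous_on {t1..t0} u0"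
  proof (rule continuous_on_eq)
    have "continuous_on {t1..t0} x" by (rule DERIV_continuous_on) (rule slide)
    then show "continuous_on {t1..t0} (\<lambda>t. on_axis (x t))"
      by (intro linear_continuous_on_compose[OF _ bounded_linear.linear[OF bounded_linear_on_axis]])
  qed (simp add: pieces)
  have c2: "continuous_on {t0..m} u0"
  proof (rule continuous_on_eq)
    show "continuous_on {t0..m} u1" by (rule continuous_on_vector_derivative) (rule low)
  qed (simp add: pieces)
  have c3: "continuous_on {m..t1+P} u0"
  proof (rule continuous_on_eq)
    show "continuous_on {m..t1+P} u2" by (rule continuous_on_vector_derivative) (rule high)
  qed (simp add: pieces)
  have "continuous_on ({t1..t0} \<union> ({t0..m} \<union> {m..t1+P})) u0"
    by (intro continuous_on_closed_Un c1 c2 c3) auto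
  moreover have "{t1..t0} \<union> ({t0..m} \<union> {m..t1+P}) = {t1..t1+P}" using ord by auto
  ultimately have cont: "continuous_on {t1..t1+P} u0" by simp
  have C0: "0 \<le> C" by (rule order_trans[OF norm_ge_zero C(2)[of t0]]) (use ord in simp)
  have "\<exists>u. piecewise_solution D Xp Xm P u \<and> (\<forall>t\<in>{t1..t1+P}. u t = u0 t)
    \<and> (\<forall>t. \<exists>n::int. t - of_int n * P \<in> {t1..<t1+P} \<and> u t = u0 (t - of_int n * P))"
  proof (rule periodic_extension[OF P _ cont, where E = "{t0, m}" and ?v0.0 = v0 and C = C])
    show "u0 t \<in> D" if "t \<in> {t1..t1+P}" for t
      using that slide(1)[of t] low(1)[of t] high(1)[of t] by (auto simp: u0_def)
    show "u0 (t1 + P) = u0 t1" using pieces(1)[of t1] pieces(3)[of "t1 + P"] ord joints by auto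
    show "norm (v0 t) \<le> C" for t using C C0 by (auto simp: v0_def)
    fix t assume t: "t \<in> {t1<..<t1+P} - {t0, m}"
    then consider "t \<in> {t1<..<t0}" | "t \<in> {t0<..<m}" | "t \<in> {m<..<t1+P}" using ord by force
    then show "(u0 has_vector_derivative v0 t) (at t)"
    proof cases
      case 1
      have "(x has_real_derivative y t) (at t)" using slide(2)[of t] 1 by (simp add: at_within_Icc_at)
      then have "((\<lambda>t. on_axis (x t)) has_vector_derivative on_axis (y t)) (at t)"
        by (intro bounded_linear.has_vector_derivative[OF bounded_linear_on_axis])
          (simp add: has_real_derivative_iff_has_vector_derivative)
      then have "(u0 has_vector_derivative on_axis (y t)) (at t)"
        by (rule has_vector_derivative_transform_within_open[OF _ open_greaterThanLessThan 1]) (use pieces(1) in auto)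
      then show ?thesis using 1 by (simp add: v0_def)
    next
      case 2
      have "(u1 has_vector_derivative Xm t (u1 t)) (at t)" using low(2)[of t] 2 by (simp add: at_within_Icc_at)
      then have "(u0 has_vector_derivative Xm t (u1 t)) (at t)"
        by (rule has_vector_derivative_transform_within_open[OF _ open_greaterThanLessThan 2]) (use pieces(2) in auto)
      then show ?thesis using 2 by (simp add: v0_def)
    next
      case 3
      have "(u2 has_vector_derivative Xp t (u2 t)) (at t)" using high(2)[of t] 3 by (simp add: at_within_Icc_at)
      then have "(u0 has_vector_derivative Xp t (u2 t)) (at t)"
        by (rule has_vector_derivative_transform_within_open[OF _ open_greaterThanLessThan 3]) (use pieces(3) in auto)
      then show ?thesis using 3 ord by (simp add: v0_def)
    qed
  next
    fix t assume t: "t \<in> {t1<..<t1+P} - {t0, m}"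
    then consider "t \<in> {t1<..<t0}" | "t \<in> {t0<..<m}" | "t \<in> {m<..<t1+P}" using ord by force
    then show "v0 t \<in> filippov_set Xp Xm t (u0 t)"
    proof cases
      case 1 then show ?thesis using slide(3)[of t] pieces(1)[of t] by (simp add: v0_def filippov_set_def)
    next
      case 2 then show ?thesis using low(3)[of t] pieces(2)[of t] by (simp add: v0_def filippov_set_def)
    next
      case 3 then show ?thesis using high(3)[of t] pieces(3)[of t] ord by (simp add: v0_def filippov_set_def)
    qed
  qed (use perX in auto)
  then obtain u where u: "piecewise_solution D Xp Xm P u" "\<And>t. t \<in> {t1..t1+P} \<Longrightarrow> u t = u0 t"
    "\<And>t. \<exists>n::int. t - of_int n * P \<in> {t1..<t1+P} \<and> u t = u0 (t - of_int n * P)" by blast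
  have "\<exists>n::int. t - of_int n * P \<in> {t1..<t1+P} \<and> u t = u (t - of_int n * P)" for t
  proof -
    obtain k :: int where k: "t - of_int k * P \<in> {t1..<t1+P}" "u t = u0 (t - of_int k * P)" using u(3) by blast
    then show ?thesis using u(2)[of "t - of_int k * P"] by (intro exI[of _ k]) simp
  qed
  moreover have "u t = on_axis (x t)" if "t \<in> {t1..t0}" for t using u(2)[of t] pieces(1)[of t] that ord by auto
  moreover have "u t = u1 t" if "t \<in> {t0..m}" for t using u(2)[of t] pieces(2)[of t] that ord by auto
  moreover have "u t = u2 t" if "t \<in> {m..t1+P}" for t using u(2)[of t] pieces(3)[of t] that ord by auto
  ultimately show ?thesis using u(1) by blast
qed

section \<open>Existence of sliding and crossing periodic solutions\<close>

text \<open>Periodicity and the symmetry of \<open>D\<close> enter when orbits are closed up;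
  matching the half orbits happens within one period.\<close>

locale periodic_halves = two_halves +
  assumes k1_periodic: "\<And>e t z. 0 < e \<Longrightarrow> e < e0 \<Longrightarrow> z \<in> D \<Longrightarrow> k1 e (t + 2 * \<sigma>) z = k1 e t z"
    and k2_periodic: "\<And>e t z. 0 < e \<Longrightarrow> e < e0 \<Longrightarrow> z \<in> D \<Longrightarrow> k2 e (t + 2 * \<sigma>) z = k2 e t z"
    and D_symmetric: "reflect ` D = D"
begin

lemma X1_periodic: "0 < e \<Longrightarrow> e < e0 \<Longrightarrow> z \<in> D \<Longrightarrow> h1.X e (t + 2 * \<sigma>) z = h1.X e t z"
  by (simp add: h1.X_def k1_periodic)

lemma X2_periodic: "0 < e \<Longrightarrow> e < e0 \<Longrightarrow> z \<in> D \<Longrightarrow> h2.X e (t + 2 * \<sigma>) z = h2.X e t z"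
  by (simp add: h2.X_def k2_periodic)

lemma Xlow_periodic: "0 < e \<Longrightarrow> e < e0 \<Longrightarrow> z \<in> D \<Longrightarrow> Xlow e (t + 2 * \<sigma>) z = Xlow e t z"
  by (simp add: Xlow_def X1_periodic)

lemma Xup_periodic:
  assumes "0 < e" "e < e0" "z \<in> D"
  shows "Xup e (t + 2 * \<sigma>) z = Xup e t z"
proof -
  have "reflect z \<in> D" using D_symmetric assms(3) by blast
  then show ?thesis using X2_periodic[OF assms(1,2), of "reflect z" "- t - 2 * \<sigma>"] by (simp add: Xup_def)
qed

text \<open>Covers both kinds of orbits: \<open>x\<close> is any curve on the axis whose velocity
  lies in Filippov's set, a single point if \<open>r = 0\<close>. Zeros of the second component off
  this arc and its translates are crossing points.\<close>

definition glues :: "real \<Rightarrow> real \<Rightarrow> bool" where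
  "glues B e1 \<longleftrightarrow> (\<forall>e t0 r \<xi>0 \<xi>1 \<tau> x y C. 0 < e \<and> e < e1 \<and> \<bar>t0 - \<theta>\<bar> \<le> 1/2 \<and> 0 \<le> r \<and> r \<le> B \<and> \<bar>\<xi>0\<bar> \<le> B \<and> \<bar>\<xi>1\<bar> \<le> B \<and> \<bar>\<tau>\<bar> \<le> B
      \<and> lo e t0 (xv + e * \<xi>0) $ 2 \<le> 0 \<and> up e (t0 - e * r) (xv + e * \<xi>1) $ 2 \<le> 0
      \<and> U e t0 \<xi>0 \<tau> = W e t0 \<xi>1 r \<tau> \<and> U e t0 \<xi>0 \<tau> $ 2 = 0
      \<and> (\<forall>t\<in>{t0 - e * r..t0}. \<bar>x t - xv\<bar> \<le> \<delta> \<and> (x has_real_derivative y t) (at t within {t0 - e * r..t0}) \<and> \<bar>y t\<bar> \<le> C)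
      \<and> (\<forall>t\<in>{t0 - e * r<..<t0}. on_axis (y t) \<in> closed_segment (lo e t (x t)) (up e t (x t)))
      \<and> x t0 = xv + e * \<xi>0 \<and> x (t0 - e * r) = xv + e * \<xi>1
    \<longrightarrow> (\<exists>u. piecewise_solution D (Xup e) (Xlow e) (2 * \<sigma>) u \<and> (\<forall>t\<in>{t0 - e * r..t0}. u t = on_axis (x t))
      \<and> (\<forall>t. u t $ 2 = 0 \<longrightarrow> crossing_point (Xup e) (Xlow e) t (u t)
          \<or> (\<exists>n::int. t - of_int n * (2 * \<sigma>) \<in> {t0 - e * r..t0} \<and> u t = u (t - of_int n * (2 * \<sigma>))))))"

lemma gluesD:
  assumes g: "glues B e1" and e: "0 < e" "e < e1" "\<bar>t0 - \<theta>\<bar> \<le> 1/2" "0 \<le> r" "r \<le> B" "\<bar>\<xi>0\<bar> \<le> B" "\<bar>\<xi>1\<bar> \<le> B" "\<bar>\<tau>\<bar> \<le> B"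
      "lo e t0 (xv + e * \<xi>0) $ 2 \<le> 0" "up e (t0 - e * r) (xv + e * \<xi>1) $ 2 \<le> 0"
      "U e t0 \<xi>0 \<tau> = W e t0 \<xi>1 r \<tau>" "U e t0 \<xi>0 \<tau> $ 2 = 0"
    and x: "\<And>t. t\<in>{t0 - e * r..t0} \<Longrightarrow> \<bar>x t - xv\<bar> \<le> \<delta>"
      "\<And>t. t\<in>{t0 - e * r..t0} \<Longrightarrow> (x has_real_derivative y t) (at t within {t0 - e * r..t0})"
      "\<And>t. t\<in>{t0 - e * r..t0} \<Longrightarrow> \<bar>y t\<bar> \<le> C"
      "\<And>t. t\<in>{t0 - e * r<..<t0} \<Longrightarrow> on_axis (y t) \<in> closed_segment (lo e t (x t)) (up e t (x t))"
      "x t0 = xv + e * \<xi>0" "x (t0 - e * r) = xv + e * \<xi>1"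
  obtains u where "piecewise_solution D (Xup e) (Xlow e) (2 * \<sigma>) u" "\<And>t. t\<in>{t0 - e * r..t0} \<Longrightarrow> u t = on_axis (x t)"
    "\<And>t. u t $ 2 = 0 \<Longrightarrow> crossing_point (Xup e) (Xlow e) t (u t)
          \<or> (\<exists>n::int. t - of_int n * (2 * \<sigma>) \<in> {t0 - e * r..t0} \<and> u t = u (t - of_int n * (2 * \<sigma>)))"
proof -
  note * = g[unfolded glues_def, THEN spec[of _ e], THEN spec[of _ t0], THEN spec[of _ r], THEN spec[of _ \<xi>0], THEN spec[of _ \<xi>1],
    THEN spec[of _ \<tau>], THEN spec[of _ x], THEN spec[of _ y], THEN spec[of _ C]]
  have "\<exists>u. piecewise_solution D (Xup e) (Xlow e) (2 * \<sigma>) u \<and> (\<forall>t\<in>{t0 - e * r..t0}. u t = on_axis (x t))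
      \<and> (\<forall>t. u t $ 2 = 0 \<longrightarrow> crossing_point (Xup e) (Xlow e) t (u t)
          \<or> (\<exists>n::int. t - of_int n * (2 * \<sigma>) \<in> {t0 - e * r..t0} \<and> u t = u (t - of_int n * (2 * \<sigma>))))"
    by (rule *[THEN mp]) (intro conjI ballI e x)
  then show ?thesis using that by (elim exE conjE) blast
qed

text \<open>The signs at departure are those that \<open>sol_below\<close> asks for. They place the
  lower arc strictly below and the upper arc strictly above the axis and make both arrivals
  transversal, so the meeting point is a crossing point.\<close>

lemma glued_orbit:
  assumes B: "0 \<le> B"
  shows "\<exists>e1>0. glues B e1"
proof -
  \<comment> \<open>Twice \<open>B\<close>, because the upper arc has the time shift
    \<open>- (r + \<tau>)\<close>.\<close>
  have B2: "0 \<le> 2 * B" using B by simp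
  obtain ea where ea: "0 < ea" and low: "\<And>e t0 \<xi> \<tau>. 0 < e \<Longrightarrow> e < ea \<Longrightarrow> e < e0 \<Longrightarrow> t0 \<in> {\<theta>-1..\<theta>+1} \<Longrightarrow> \<bar>\<xi>\<bar> \<le> 2 * B \<Longrightarrow> \<bar>\<tau>\<bar> \<le> 2 * B
     \<Longrightarrow> h1.X e t0 (on_axis (xv + e * \<xi>)) $ 2 \<le> 0 \<Longrightarrow> h1.sol e t0 (xv + e * \<xi>) (\<sigma> + e * \<tau>) $ 2 = 0 \<Longrightarrow>
    (\<forall>s\<in>{0<..<\<sigma> + e * \<tau>}. h1.sol e t0 (xv + e * \<xi>) s $ 2 < 0)
    \<and> h1.X e (t0 + (\<sigma> + e * \<tau>)) (h1.sol e t0 (xv + e * \<xi>) (\<sigma> + e * \<tau>)) $ 2 > 0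
    \<and> 0 < \<sigma> + e * \<tau> \<and> \<sigma> + e * \<tau> \<le> \<sigma> + h1.overtime \<and> h1.C1 (2 * B) * e \<le> \<delta> / 2"
    using h1.sol_below[OF B2] by blast
  obtain eb where eb: "0 < eb" and high: "\<And>e t0 \<xi> \<tau>. 0 < e \<Longrightarrow> e < eb \<Longrightarrow> e < e0 \<Longrightarrow> t0 \<in> {-\<theta>-1..-\<theta>+1} \<Longrightarrow> \<bar>\<xi>\<bar> \<le> 2 * B \<Longrightarrow> \<bar>\<tau>\<bar> \<le> 2 * B
     \<Longrightarrow> h2.X e t0 (on_axis (xv + e * \<xi>)) $ 2 \<le> 0 \<Longrightarrow> h2.sol e t0 (xv + e * \<xi>) (\<sigma> + e * \<tau>) $ 2 = 0 \<Longrightarrow>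
    (\<forall>s\<in>{0<..<\<sigma> + e * \<tau>}. h2.sol e t0 (xv + e * \<xi>) s $ 2 < 0)
    \<and> h2.X e (t0 + (\<sigma> + e * \<tau>)) (h2.sol e t0 (xv + e * \<xi>) (\<sigma> + e * \<tau>)) $ 2 > 0
    \<and> 0 < \<sigma> + e * \<tau> \<and> \<sigma> + e * \<tau> \<le> \<sigma> + h2.overtime \<and> h2.C1 (2 * B) * e \<le> \<delta> / 2"
    using h2.sol_below[OF B2] by blast
  define e1 where "e1 = min (min ea eb) (min e0 (1 / (2 * B + 1)))"
  have e1: "0 < e1" using ea eb e0_pos B by (simp add: e1_def)
  have "\<exists>u. piecewise_solution D (Xup e) (Xlow e) (2 * \<sigma>) u \<and> (\<forall>t\<in>{t0 - e * r..t0}. u t = on_axis (x t))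
      \<and> (\<forall>t. u t $ 2 = 0 \<longrightarrow> crossing_point (Xup e) (Xlow e) t (u t)
          \<or> (\<exists>n::int. t - of_int n * (2 * \<sigma>) \<in> {t0 - e * r..t0} \<and> u t = u (t - of_int n * (2 * \<sigma>))))"
    if e: "0 < e" "e < e1" and t0: "\<bar>t0 - \<theta>\<bar> \<le> 1/2" and r: "0 \<le> r" "r \<le> B" and \<xi>0: "\<bar>\<xi>0\<bar> \<le> B" and \<xi>1: "\<bar>\<xi>1\<bar> \<le> B" and \<tau>: "\<bar>\<tau>\<bar> \<le> B"
      and sgn: "lo e t0 (xv + e * \<xi>0) $ 2 \<le> 0" "up e (t0 - e * r) (xv + e * \<xi>1) $ 2 \<le> 0"
      and UW: "U e t0 \<xi>0 \<tau> = W e t0 \<xi>1 r \<tau>" and U2: "U e t0 \<xi>0 \<tau> $ 2 = 0"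
      and x: "\<And>t. t\<in>{t0 - e * r..t0} \<Longrightarrow> \<bar>x t - xv\<bar> \<le> \<delta> \<and> (x has_real_derivative y t) (at t within {t0 - e * r..t0}) \<and> \<bar>y t\<bar> \<le> C"
      and seg: "\<And>t. t\<in>{t0 - e * r<..<t0} \<Longrightarrow> on_axis (y t) \<in> closed_segment (lo e t (x t)) (up e t (x t))"
      and ends: "x t0 = xv + e * \<xi>0" "x (t0 - e * r) = xv + e * \<xi>1"
    for e t0 r \<xi>0 \<xi>1 \<tau> x y C
  proof -
    have es: "e < ea" "e < eb" "e < e0" "e * (2 * B + 1) < 1" using e B by (auto simp: e1_def pos_less_divide_eq)
    have "e * r \<le> e * B" using e r by (intro mult_left_mono) auto
    moreover have "0 \<le> e * B" "0 \<le> e * r" using e B r by auto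
    ultimately have er: "0 \<le> e * r" "e * r \<le> 1/2" using es(4) e unfolding distrib_left by linarith+
    let ?t1 = "t0 - e * r" and ?P = "2 * \<sigma>" and ?m = "t0 + (\<sigma> + e * \<tau>)"
    have tr: "t0 \<in> {\<theta>-1..\<theta>+1}" "- ?t1 \<in> {-\<theta>-1..-\<theta>+1}"
      unfolding atLeastAtMost_iff using t0 er by linarith+
    let ?a = "h1.sol e t0 (xv + e * \<xi>0)" and ?c = "h2.sol e (- ?t1) (xv + e * \<xi>1)"
    define s2 where "s2 = \<sigma> + e * (- (r + \<tau>))"
    have s2_eq: "\<sigma> - e * (r + \<tau>) = s2" by (simp add: s2_def algebra_simps)
    have W: "W e t0 \<xi>1 r \<tau> = ?c s2" by (simp only: W_def s2_eq)
    have B': "\<bar>\<xi>0\<bar> \<le> 2 * B" "\<bar>\<xi>1\<bar> \<le> 2 * B" "\<bar>\<tau>\<bar> \<le> 2 * B" "\<bar>- (r + \<tau>)\<bar> \<le> 2 * B"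
      using \<xi>0 \<xi>1 \<tau> r by linarith+
    have X20: "h2.X e (- ?t1) (on_axis (xv + e * \<xi>1)) $ 2 \<le> 0" using sgn(2) by (simp only: up_nth)
    have X10: "h1.X e t0 (on_axis (xv + e * \<xi>0)) $ 2 \<le> 0" using sgn(1) by (simp only: Xlow_def)
    have l: "(\<forall>s\<in>{0<..<\<sigma> + e * \<tau>}. ?a s $ 2 < 0)" "h1.X e (t0 + (\<sigma> + e * \<tau>)) (?a (\<sigma> + e * \<tau>)) $ 2 > 0"
        "0 < \<sigma> + e * \<tau>" "\<sigma> + e * \<tau> \<le> \<sigma> + h1.overtime" "h1.C1 (2 * B) * e \<le> \<delta> / 2"
      using low[OF e(1) es(1,3) tr(1) B'(1,3) X10] U2 by (simp_all add: U_def)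
    have c20: "?c s2 $ 2 = 0" using UW U2 W by simp
    have h: "(\<forall>s\<in>{0<..<s2}. ?c s $ 2 < 0)" "h2.X e (- ?t1 + s2) (?c s2) $ 2 > 0"
        "0 < s2" "s2 \<le> \<sigma> + h2.overtime" "h2.C1 (2 * B) * e \<le> \<delta> / 2"
      using high[OF e(1) es(2,3) tr(2) B'(2,4) X20] c20 unfolding s2_def[symmetric] by blast+
    have m_end: "?t1 + ?P - ?m = s2" by (simp add: s2_def algebra_simps)
    define u1 where "u1 t = ?a (t - t0)" for t
    \<comment> \<open>The reversed orbit is traversed backwards from the end of the period; the
      shift by \<open>2 * \<sigma>\<close> is absorbed by periodicity in
      \<open>X2per\<close>.\<close>
    define u2 where "u2 t = reflect (?c (?t1 + ?P - t))" for t
    have tube_D: "z \<in> D" if "z \<in> h1.tube \<delta>" for z using that h1.tube_D by blast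
    have refl_D: "reflect z \<in> D" if "z \<in> h1.tube \<delta>" for z using tube_D[OF that] D_symmetric by blast
    note a_sol = h1.sol_solves[OF e(1) es(3) tr(1) B'(1) l(5)]
    note c_sol = h2.sol_solves[OF e(1) es(3) tr(2) B'(2) h(5)]
    have ov: "h1.overtime \<le> 1" "h2.overtime \<le> 1" using h1.overtime h2.overtime by auto
    have X2per: "h2.X e (- ?t1 + (?t1 + ?P - t)) z = h2.X e (- t) z" if "z \<in> h1.tube \<delta>" for t z
      using X2_periodic[OF e(1) es(3) tube_D[OF that], of "- t"] by (simp add: algebra_simps)
    have Xup_u2: "Xup e t (u2 t) = - reflect (h2.X e (- ?t1 + (?t1 + ?P - t)) (?c (?t1 + ?P - t)))" if "t \<in> {?m..?t1 + ?P}" for t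
    proof -
      have "?t1 + ?P - t \<in> {0..\<sigma> + h2.overtime}" using that m_end h(4) by auto
      then show ?thesis using X2per[OF c_sol(1), of "?t1 + ?P - t" t] by (simp add: Xup_def u2_def)
    qed
    have "\<exists>u. piecewise_solution D (Xup e) (Xlow e) ?P u \<and> (\<forall>t\<in>{?t1..t0}. u t = on_axis (x t)) \<and> (\<forall>t\<in>{t0..?m}. u t = u1 t)
      \<and> (\<forall>t\<in>{?m..?t1+?P}. u t = u2 t) \<and> (\<forall>t. \<exists>n::int. t - of_int n * ?P \<in> {?t1..<?t1+?P} \<and> u t = u (t - of_int n * ?P))"
    proof (rule closed_orbit_of_pieces[where y = y and C = "max C (2 * L)"])
      show "?t1 \<le> t0" "t0 < ?m" "?m < ?t1 + ?P" using er l(3) h(3) m_end by linarith+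
      show "Xup e (t + ?P) z = Xup e t z" "Xlow e (t + ?P) z = Xlow e t z" if "z \<in> D" for t z
        using Xup_periodic[OF e(1) es(3) that] Xlow_periodic[OF e(1) es(3) that] by auto
      show "on_axis (x t) \<in> D" "(x has_real_derivative y t) (at t within {?t1..t0})" "\<bar>y t\<bar> \<le> max C (2 * L)" if "t \<in> {?t1..t0}" for t
        using x[OF that] tube_D[OF h1.on_axis_tube] by auto
      show "on_axis (y t) \<in> closed_segment (lo e t (x t)) (up e t (x t))" if "t \<in> {?t1<..<t0}" for t by (rule seg[OF that])
      show "u1 t \<in> D" "(u1 has_vector_derivative Xlow e t (u1 t)) (at t within {t0..?m})" "norm (Xlow e t (u1 t)) \<le> max C (2 * L)"
        if t: "t \<in> {t0..?m}" for t
      proof -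
        have s: "t - t0 \<in> {0..\<sigma> + h1.overtime}" using t l(4) by auto
        show "u1 t \<in> D" unfolding u1_def by (rule tube_D[OF a_sol(1)[OF s]])
        have "((\<lambda>t. t - t0) has_vector_derivative 1) (at t within {t0..?m})" by (auto intro!: derivative_eq_intros)
        moreover have "(?a has_vector_derivative h1.X e (t0 + (t - t0)) (?a (t - t0))) (at (t - t0) within (\<lambda>t. t - t0) ` {t0..?m})"
          by (rule has_vector_derivative_within_subset[OF a_sol(2)[OF s]]) (use l(4) in auto)
        ultimately have "((?a \<circ> (\<lambda>t. t - t0)) has_vector_derivative 1 *\<^sub>R h1.X e (t0 + (t - t0)) (?a (t - t0))) (at t within {t0..?m})"
          by (rule vector_diff_chain_within)
        then show "(u1 has_vector_derivative Xlow e t (u1 t)) (at t within {t0..?m})"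
          unfolding u1_def Xlow_def o_def by simp
        have "t \<in> {\<theta>-2..\<theta>+\<sigma>+3}" using tr(1) s ov by auto
        then have "norm (h1.X e t (?a (t - t0))) \<le> 2 * L" by (rule h1.X_bound[OF e(1) es(3) _ a_sol(1)[OF s]])
        then show "norm (Xlow e t (u1 t)) \<le> max C (2 * L)" by (simp add: Xlow_def u1_def)
      qed
      show "u1 t $ 2 < 0" if "t \<in> {t0<..<?m}" for t using l(1) that by (simp add: u1_def)
      show "u2 t \<in> D" "(u2 has_vector_derivative Xup e t (u2 t)) (at t within {?m..?t1+?P})" "norm (Xup e t (u2 t)) \<le> max C (2 * L)"
        if t: "t \<in> {?m..?t1+?P}" for t
      proof -
        let ?s = "?t1 + ?P - t"
        have s: "?s \<in> {0..\<sigma> + h2.overtime}" using t m_end h(4) by auto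
        show "u2 t \<in> D" unfolding u2_def by (rule refl_D[OF c_sol(1)[OF s]])
        have "((\<lambda>t. ?t1 + ?P - t) has_vector_derivative - 1) (at t within {?m..?t1+?P})" by (auto intro!: derivative_eq_intros)
        moreover have "(?c has_vector_derivative h2.X e (- ?t1 + ?s) (?c ?s)) (at ?s within (\<lambda>t. ?t1 + ?P - t) ` {?m..?t1+?P})"
          by (rule has_vector_derivative_within_subset[OF c_sol(2)[OF s]]) (use h(4) m_end in auto)
        ultimately have "((?c \<circ> (\<lambda>t. ?t1 + ?P - t)) has_vector_derivative (- 1) *\<^sub>R h2.X e (- ?t1 + ?s) (?c ?s)) (at t within {?m..?t1+?P})"
          by (rule vector_diff_chain_within)
        from bounded_linear.has_vector_derivative[OF bounded_linear_reflect this]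
        show "(u2 has_vector_derivative Xup e t (u2 t)) (at t within {?m..?t1+?P})"
          unfolding Xup_u2[OF t] unfolding u2_def o_def by (simp add: reflect_simps)
        have "- ?t1 + ?s \<in> {-\<theta>-2..-\<theta>+\<sigma>+3}"
          using tr(2) s ov unfolding atLeastAtMost_iff by linarith
        then have "norm (h2.X e (- ?t1 + ?s) (?c ?s)) \<le> 2 * L" by (rule h2.X_bound[OF e(1) es(3) _ c_sol(1)[OF s]])
        then show "norm (Xup e t (u2 t)) \<le> max C (2 * L)" unfolding Xup_u2[OF t] by simp
      qed
      show "u2 t $ 2 > 0" if "t \<in> {?m<..<?t1+?P}" for t
      proof -
        have "?t1 + ?P - t \<in> {0<..<s2}" using that m_end by auto
        then show ?thesis using h(1) by (simp add: u2_def)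
      qed
      show "u1 t0 = on_axis (x t0)" using h1.sol(1)[OF e(1) es(3) tr(1)] by (simp add: u1_def ends)
      show "u2 (?t1 + ?P) = on_axis (x ?t1)" using h2.sol(1)[OF e(1) es(3) tr(2)] by (simp add: u2_def ends)
      show "u1 ?m = u2 ?m"
      proof -
        have "reflect (?c s2) = ?c s2" using c20 by (simp add: vec2_eq_iff)
        then have "u2 ?m = ?c s2" unfolding u2_def m_end .
        moreover have "u1 ?m = U e t0 \<xi>0 \<tau>" by (simp add: u1_def U_def)
        ultimately show ?thesis using UW W by simp
      qed
    qed
    then obtain u where u: "piecewise_solution D (Xup e) (Xlow e) ?P u" "\<And>t. t \<in> {?t1..t0} \<Longrightarrow> u t = on_axis (x t)"
      "\<And>t. t \<in> {t0..?m} \<Longrightarrow> u t = u1 t" "\<And>t. t \<in> {?m..?t1+?P} \<Longrightarrow> u t = u2 t"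
      "\<And>t. \<exists>n::int. t - of_int n * ?P \<in> {?t1..<?t1+?P} \<and> u t = u (t - of_int n * ?P)"
      by blast
    have "crossing_point (Xup e) (Xlow e) t (u t) \<or> (\<exists>n::int. t - of_int n * ?P \<in> {?t1..t0} \<and> u t = u (t - of_int n * ?P))"
      if ut: "u t $ 2 = 0" for t
    proof -
      obtain n :: int where n: "t - of_int n * ?P \<in> {?t1..<?t1+?P}" "u t = u (t - of_int n * ?P)" using u(5) by blast
      let ?t = "t - of_int n * ?P"
      consider "?t \<in> {?t1..t0}" | "?t \<in> {t0<..<?m}" | "?t = ?m" | "?t \<in> {?m<..<?t1+?P}" using n(1) by force
      then show ?thesis
      proof cases
        case 1 then show ?thesis using n(2) by blast
      next
        case 2
        then have "u1 ?t $ 2 < 0" using l(1) by (simp add: u1_def)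
        moreover have "u ?t = u1 ?t" using 2 by (intro u(3)) auto
        ultimately show ?thesis using ut n(2) by simp
      next
        case 3
        have ms: "?m \<in> {t0..?m}" "?m \<in> {?m..?t1+?P}" using l(3) h(3) m_end by auto
        have uD: "u t \<in> D" using u(1) by (simp add: piecewise_solution_def)
        have "Xlow e ?m (u ?m) $ 2 > 0" unfolding u(3)[OF ms(1)] using l(2) by (simp add: Xlow_def u1_def)
        moreover have "Xup e ?m (u ?m) $ 2 > 0"
          unfolding u(4)[OF ms(2)] Xup_u2[OF ms(2)] m_end using h(2) by simp
        moreover have "t = ?m + of_int n * ?P" using 3 by simp
        then have "Xlow e t (u t) = Xlow e ?m (u t)" "Xup e t (u t) = Xup e ?m (u t)"
          using periodic_int[of "\<lambda>t'. Xlow e t' (u t)" ?P ?m n] Xlow_periodic[OF e(1) es(3) uD]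
            periodic_int[of "\<lambda>t'. Xup e t' (u t)" ?P ?m n] Xup_periodic[OF e(1) es(3) uD] by simp_all
        ultimately have "crossing_point (Xup e) (Xlow e) t (u t)"
          using ut n(2) 3 by (simp add: crossing_point_def)
        then show ?thesis ..
      next
        case 4
        then have "?t1 + ?P - ?t \<in> {0<..<s2}" using m_end by auto
        then have "u2 ?t $ 2 > 0" using h(1) unfolding u2_def by simp
        moreover have "u ?t = u2 ?t" using 4 by (intro u(4)) auto
        ultimately show ?thesis using ut n(2) by simp
      qed
    qed
    then show ?thesis using u(1,2) by blast
  qed
  note main = this
  show ?thesis
    by (rule exI[of _ e1], rule conjI, rule e1, unfold glues_def, intro allI impI, elim conjE, rule main; blast)
qed

lemma dist_start:
  "dist (t0, on_axis (xv + e * \<xi>)) (\<theta>, on_axis xv) \<le> \<bar>t0 - \<theta>\<bar> + \<bar>e * \<xi>\<bar>"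
proof -
  have "dist (on_axis (xv + e * \<xi>)) (on_axis xv) = \<bar>e * \<xi>\<bar>"
    by (simp add: dist_norm on_axis_diff[symmetric])
  then show ?thesis
    unfolding dist_Pair_Pair using sqrt_sum_squares_le_sum_abs[of "dist t0 \<theta>" "dist (on_axis (xv + e * \<xi>)) (on_axis xv)"]
    by (simp add: dist_real_def)
qed

end

context periodic_halves
begin

text \<open>With equal offsets and no slide the limit equation is linear in the offset and has the
  root \<open>\<xi>s\<close>; the hypothesis says that \<open>\<xi>s\<close> lies to the left of the
  leftmost fold \<open>- a / b\<close>.\<close>

lemma crossing_orbits_exist:
  assumes neg: "G + 2 * \<beta> / (\<alpha> * b) * max (g1 \<theta> (on_axis xv) $ 2) (g2 (- \<theta>) (on_axis xv) $ 2) < 0"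
  shows "\<exists>K e1. 0 < e1 \<and> e1 \<le> e0 \<and> (\<forall>e. 0 < e \<and> e < e1 \<longrightarrow> (\<exists>u t0.
    piecewise_solution D (Xup e) (Xlow e) (2 * \<sigma>) u \<and> (\<exists>t. u t $ 2 = 0) \<and>
    (\<forall>t. u t $ 2 = 0 \<longrightarrow> crossing_point (Xup e) (Xlow e) t (u t)) \<and> dist (t0, u t0) (\<theta>, on_axis xv) \<le> K * e))"
proof -
  note \<alpha> = h1.\<alpha>_pos and b = h1.b_pos and L = h1.L_nonneg and \<beta> = \<beta>_pos
  define a where "a = max (g1 \<theta> (on_axis xv) $ 2) (g2 (- \<theta>) (on_axis xv) $ 2)"
  define \<xi>s where "\<xi>s = \<alpha> * G / (2 * \<beta>)"
  \<comment> \<open>Half the gap between the root and the leftmost fold: within this distance of the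
    root both limiting vertical components are negative with margin
    \<open>b * \<nu>\<close>.\<close>
  define \<nu> where "\<nu> = (- a / b - \<xi>s) / 2"
  have "\<nu> = - (\<alpha> / (4 * \<beta>)) * (G + 2 * \<beta> / (\<alpha> * b) * a)"
    using \<alpha> b \<beta> by (simp add: \<nu>_def \<xi>s_def field_simps)
  moreover have "0 < \<alpha> / (4 * \<beta>)" using \<alpha> \<beta> by simp
  then have "\<alpha> / (4 * \<beta>) * (G + 2 * \<beta> / (\<alpha> * b) * a) < 0"
    using neg unfolding a_def[symmetric] by (rule mult_pos_neg)
  ultimately have \<nu>: "0 < \<nu>" by (simp only: minus_mult_left[symmetric] neg_0_less_iff_less)
  have b\<nu>: "b * h + a \<le> - (b * \<nu>)" if "h \<le> \<xi>s + \<nu>" for h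
  proof -
    have "b * h \<le> b * (\<xi>s + \<nu>)" using that b by (intro mult_left_mono) auto
    also have "b * (\<xi>s + \<nu>) = - (b * \<nu>) - a" using b by (simp add: \<nu>_def field_simps)
    finally show ?thesis by simp
  qed
  define B where "B = \<bar>\<xi>s\<bar> + \<nu> + 1"
  have B: "0 \<le> B" using \<nu> by (simp add: B_def)
  have hB: "\<bar>h\<bar> \<le> B" if "h \<in> {\<xi>s - \<nu>..\<xi>s + \<nu>}" for h using that \<nu> by (auto simp: B_def)
  define \<eta> where "\<eta> = 2 * \<beta> * \<nu> / \<alpha>"
  have \<eta>: "0 < \<eta>" using \<alpha> \<beta> \<nu> by (simp add: \<eta>_def)
  obtain K T em where K: "0 < K" and T: "0 \<le> T" and em: "0 < em" and match: "matches B \<eta> K T em"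
    using matching[OF B \<eta>] by blast
  have BT: "0 \<le> B + T" using B T by simp
  obtain eg where eg: "0 < eg" and glue: "glues (B + T) eg" using glued_orbit[OF BT] by blast
  define H where "H = B\<^sup>2 + 1 + K + B"
  define N where "N = 1 + K + B + L * H"
  have H0: "0 \<le> H" using B K by (simp add: H_def)
  have LH: "0 \<le> L * H" using H0 L by simp
  have N: "0 < N" "K \<le> N" "B \<le> N" "L * H \<le> N" using B K LH unfolding N_def by linarith+
  define \<mu> where "\<mu> = min (1/2) (min \<delta> (b * \<nu>))"
  have \<mu>: "0 < \<mu>" using h1.\<delta>_pos b \<nu> by (simp add: \<mu>_def)
  define e1 where "e1 = min (min em eg) (min e0 (\<mu> / N))"
  have e1: "0 < e1" using em eg e0_pos \<mu> N by (simp add: e1_def)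
  have "\<exists>u t0. piecewise_solution D (Xup e) (Xlow e) (2 * \<sigma>) u \<and> (\<exists>t. u t $ 2 = 0) \<and>
    (\<forall>t. u t $ 2 = 0 \<longrightarrow> crossing_point (Xup e) (Xlow e) t (u t)) \<and> dist (t0, u t0) (\<theta>, on_axis xv) \<le> (K + B) * e"
    if e: "0 < e" "e < e1" for e
  proof -
    have es: "e < em" "e < eg" "e < e0" "e * N < \<mu>" using e N by (auto simp: e1_def pos_less_divide_eq)
    have "e * K < \<mu>" "e * B < \<mu>" "e * (L * H) < \<mu>"
      using e(1) by (intro le_less_trans[OF mult_left_mono es(4)] N; simp)+
    then have sm: "e * K \<le> 1/2" "e * B \<le> \<delta>" "e * (L * H) < b * \<nu>" by (auto simp: \<mu>_def)
    let ?I = "{\<theta> - K * e..\<theta> + K * e}"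
    \<comment> \<open>The free parameter is the common offset itself, whence \<open>snd\<close> for
      both offsets.\<close>
    obtain t0 h \<tau> where t0: "t0 \<in> ?I" and h: "h \<in> {\<xi>s - \<nu><..<\<xi>s + \<nu>}" and \<tau>: "\<bar>\<tau>\<bar> \<le> T"
      and UW: "U e t0 (snd (t0, h)) \<tau> = W e t0 (snd (t0, h)) 0 \<tau>" "U e t0 (snd (t0, h)) \<tau> $ 2 = 0"
    proof (rule matchesD[OF match e(1) es(1), where r = "\<lambda>_. 0" and ?\<xi>0.0 = snd and ?\<xi>1.0 = snd and ?l0.0 = "\<xi>s - \<nu>" and ?l1.0 = "\<xi>s + \<nu>"])
      show "\<bar>snd p\<bar> \<le> B \<and> \<bar>snd p\<bar> \<le> B \<and> (0::real) \<le> 0 \<and> 0 \<le> B" if "p \<in> ?I \<times> {\<xi>s - \<nu>..\<xi>s + \<nu>}" for p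
        using hB[of "snd p"] B that by auto
      have "G = \<beta> / \<alpha> * (2 * \<xi>s)" using \<alpha> \<beta> by (simp add: \<xi>s_def)
      then have eq: "G - \<beta> / \<alpha> * (h + h) - 0 * \<beta> = \<beta> / \<alpha> * (2 * (\<xi>s - h))" for h by (simp add: algebra_simps)
      show "\<eta> \<le> G - \<beta> / \<alpha> * (snd (t, \<xi>s - \<nu>) + snd (t, \<xi>s - \<nu>)) - 0 * \<beta>" for t :: real
        unfolding snd_conv eq by (simp add: \<eta>_def mult.left_commute mult.commute)
      show "G - \<beta> / \<alpha> * (snd (t, \<xi>s + \<nu>) + snd (t, \<xi>s + \<nu>)) - 0 * \<beta> \<le> - \<eta>" for t :: real
        unfolding snd_conv eq by (simp add: \<eta>_def mult.left_commute mult.commute)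
      show "\<xi>s - \<nu> < \<xi>s + \<nu>" using \<nu> by simp
    qed ((rule that; assumption) | intro continuous_intros)+
    note UW = UW[unfolded snd_conv]
    have t0K: "\<bar>t0 - \<theta>\<bar> \<le> e * K" using t0 by (auto simp: abs_le_iff mult.commute)
    have t0h: "\<bar>t0 - \<theta>\<bar> \<le> 1/2" using t0K sm by linarith
    have t01: "t0 \<in> {\<theta>-1..\<theta>+1}" unfolding atLeastAtMost_iff using t0h by linarith
    have habs: "\<bar>h\<bar> \<le> B" using h by (intro hB) auto
    have eh: "\<bar>e * h\<bar> \<le> e * B" using habs e by (simp add: abs_mult)
    have eh\<delta>: "\<bar>e * h\<bar> \<le> \<delta>" using eh sm by linarith
    have "h\<^sup>2 \<le> B\<^sup>2" using power_mono[OF habs, of 2] by simp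
    then have "e * h\<^sup>2 \<le> e * B\<^sup>2" using e by (intro mult_left_mono) auto
    moreover have "\<bar>e * h\<bar> = e * \<bar>h\<bar>" using e by (simp add: abs_mult)
    ultimately have "e * h\<^sup>2 + e + \<bar>t0 - \<theta>\<bar> + e * \<bar>h\<bar> \<le> e * H" using t0K eh unfolding H_def distrib_left mult_1_right by linarith
    from mult_left_mono[OF this L] have "L * (e * h\<^sup>2 + e + \<bar>t0 - \<theta>\<bar> + e * \<bar>h\<bar>) < b * \<nu>"
      using sm(3) by (simp add: mult_ac)
    then have er: "e * (L * (e * h\<^sup>2 + e + \<bar>t0 - \<theta>\<bar> + e * \<bar>h\<bar>)) < e * (b * \<nu>)" using e by simp
    have neg12: "e * (b * h + g1 \<theta> (on_axis xv) $ 2) \<le> - (e * (b * \<nu>))" "e * (b * h + g2 (- \<theta>) (on_axis xv) $ 2) \<le> - (e * (b * \<nu>))"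
    proof -
      have "b * h + a \<le> - (b * \<nu>)" using h by (intro b\<nu>) auto
      then have "b * h + g1 \<theta> (on_axis xv) $ 2 \<le> - (b * \<nu>)" "b * h + g2 (- \<theta>) (on_axis xv) $ 2 \<le> - (b * \<nu>)"
        unfolding a_def by linarith+
      from this[THEN mult_left_mono, of e] e
      show "e * (b * h + g1 \<theta> (on_axis xv) $ 2) \<le> - (e * (b * \<nu>))" "e * (b * h + g2 (- \<theta>) (on_axis xv) $ 2) \<le> - (e * (b * \<nu>))"
        by simp_all
    qed
    have sgn: "lo e t0 (xv + e * h) $ 2 < 0" "up e t0 (xv + e * h) $ 2 < 0"
      using axis_expansion[OF e(1) es(3) t01 eh\<delta>] er neg12 by linarith+
    obtain u where u: "piecewise_solution D (Xup e) (Xlow e) (2 * \<sigma>) u" "\<And>t. t \<in> {t0 - e * 0..t0} \<Longrightarrow> u t = on_axis (xv + e * h)"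
      "\<And>t. u t $ 2 = 0 \<Longrightarrow> crossing_point (Xup e) (Xlow e) t (u t)
          \<or> (\<exists>n::int. t - of_int n * (2 * \<sigma>) \<in> {t0 - e * 0..t0} \<and> u t = u (t - of_int n * (2 * \<sigma>)))"
    \<comment> \<open>A constant curve on a one-point interval serves as the arc on the
      axis.\<close>
    proof (rule gluesD[OF glue e(1) es(2) t0h _ _ _ _ _ _ _ UW, where x = "\<lambda>_. xv + e * h" and y = "\<lambda>_. 0" and C = 0])
    qed ((rule that; assumption) | (use sgn eh\<delta> habs T \<tau> B in auto))+
    have ut0: "u t0 = on_axis (xv + e * h)" by (rule u(2)) simp
    have "crossing_point (Xup e) (Xlow e) t (u t)" if ut: "u t $ 2 = 0" for t
      using u(3)[OF ut]
    proof
      \<comment> \<open>The other zeros are translates of \<open>t0\<close> by whole periods, where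
        both vertical components are negative.\<close>
      assume *: "\<exists>n::int. t - of_int n * (2 * \<sigma>) \<in> {t0 - e * 0..t0} \<and> u t = u (t - of_int n * (2 * \<sigma>))"
      then obtain n :: int where n: "t = t0 + of_int n * (2 * \<sigma>)" "u t = on_axis (xv + e * h)"
      proof -
        obtain n :: int where n: "t - of_int n * (2 * \<sigma>) \<in> {t0 - e * 0..t0}" "u t = u (t - of_int n * (2 * \<sigma>))"
          using * by blast
        have "t - of_int n * (2 * \<sigma>) = t0" using n(1) by simp
        then show ?thesis using that[of n] n(2) ut0 by (simp add: diff_eq_eq)
      qed
      have uD: "u t \<in> D" using u(1) by (simp add: piecewise_solution_def)
      have "Xlow e t (u t) = Xlow e t0 (u t)" "Xup e t (u t) = Xup e t0 (u t)"
        unfolding n(1) using periodic_int[of "\<lambda>t'. Xlow e t' (u t)" "2 * \<sigma>" t0 n] Xlow_periodic[OF e(1) es(3) uD]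
          periodic_int[of "\<lambda>t'. Xup e t' (u t)" "2 * \<sigma>" t0 n] Xup_periodic[OF e(1) es(3) uD] n(1) by simp_all
      then show ?thesis
        using sgn n(2) by (simp add: crossing_point_def mult_neg_neg)
    qed
    moreover have "u t0 $ 2 = 0" by (simp add: ut0)
    moreover have "dist (t0, u t0) (\<theta>, on_axis xv) \<le> (K + B) * e"
      unfolding ut0 using dist_start[of t0 e h] t0K eh by (simp add: algebra_simps)
    ultimately show ?thesis using u(1) by blast
  qed
  moreover have "e1 \<le> e0" by (simp add: e1_def)
  ultimately show ?thesis using e1 by blast
qed

text \<open>The free parameter is the scaled duration of the slide. At duration 0 both offsets are
  the fold and the residual is close to \<open>\<Delta>\<close>; at duration \<open>S\<close> the
  offset \<open>\<zeta>\<close> is, up to \<open>\<eta>\<close>, still not left of the fold, so the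
  term \<open>S * \<beta>\<close> makes the residual negative.\<close>

lemma sliding_orbits_exist:
  assumes ord: "g2 (- \<theta>) (on_axis xv) $ 2 < g1 \<theta> (on_axis xv) $ 2"
    and pos: "0 < G + 2 * \<beta> / (\<alpha> * b) * g1 \<theta> (on_axis xv) $ 2"
  shows "\<exists>K e1. 0 < e1 \<and> e1 \<le> e0 \<and> (\<forall>e. 0 < e \<and> e < e1 \<longrightarrow> (\<exists>u t0.
    piecewise_solution D (Xup e) (Xlow e) (2 * \<sigma>) u \<and>
    slides_on (Xup e) (Xlow e) (sliding_region (Xup e) (Xlow e)) u \<and> dist (t0, u t0) (\<theta>, on_axis xv) \<le> K * e))"
proof -
  note \<alpha> = h1.\<alpha>_pos and b = h1.b_pos and L = h1.L_nonneg and \<beta> = \<beta>_pos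
  define a1 where "a1 = g1 \<theta> (on_axis xv) $ 2"
  define \<Delta> where "\<Delta> = G + 2 * \<beta> / (\<alpha> * b) * a1"
  have \<Delta>: "0 < \<Delta>" using pos by (simp add: \<Delta>_def a1_def)
  \<comment> \<open>The uncertainty \<open>\<eta>\<close> in the two positions then changes the
    residual by at most \<open>\<Delta> / 2\<close>.\<close>
  define \<eta> where "\<eta> = \<Delta> * (\<alpha> * b) / (4 * \<beta>)"
  have \<eta>: "0 < \<eta>" using \<Delta> \<alpha> b \<beta> by (simp add: \<eta>_def)
  \<comment> \<open>Makes \<open>S * \<beta>\<close> equal to \<open>2 * \<Delta>\<close>, which
    turns the largest possible residual \<open>3 * \<Delta> / 2\<close> into
    \<open>- \<Delta> / 2\<close>.\<close>
  define S where "S = 2 * \<Delta> / \<beta>"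
  have S: "0 < S" using \<Delta> \<beta> by (simp add: S_def)
  define A where "A = (\<bar>g1 \<theta> (on_axis xv) $ 2\<bar> + \<eta>) / b + 2 * \<alpha> * S + 1"
  have A: "0 \<le> A" using \<alpha> b S \<eta> by (simp add: A_def)
  define B where "B = A + S"
  have B: "0 \<le> B" "A \<le> B" "S \<le> B" using A S by (auto simp: B_def)
  have \<Delta>2: "0 < \<Delta> / 2" using \<Delta> by simp
  obtain K T em where K: "0 < K" and T: "0 \<le> T" and em: "0 < em" and match: "matches B (\<Delta> / 2) K T em"
    using matching[OF B(1) \<Delta>2] by blast
  obtain ea where ea: "0 < ea" and arc: "\<And>e. 0 < e \<Longrightarrow> e < ea \<Longrightarrow> \<exists>\<xi>0 \<zeta>. sliding_arc e S {\<theta> - K * e..\<theta> + K * e} A \<eta> \<xi>0 \<zeta>"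
    using sliding_arc_exists[OF ord S \<eta> K] unfolding A_def by blast
  have BT: "0 \<le> B + T" using B T by simp
  obtain eg where eg: "0 < eg" and glue: "glues (B + T) eg" using glued_orbit[OF BT] by blast
  define N where "N = 1 + K + B"
  have N: "0 < N" "K \<le> N" "B \<le> N" "K + B \<le> N" using B K unfolding N_def by linarith+
  define \<mu> where "\<mu> = min (1/2) \<delta>"
  have \<mu>: "0 < \<mu>" using h1.\<delta>_pos by (simp add: \<mu>_def)
  define e1 where "e1 = min (min em eg) (min (min e0 ea) (\<mu> / N))"
  have e1: "0 < e1" using em eg e0_pos ea \<mu> N by (simp add: e1_def)
  have "\<exists>u t0. piecewise_solution D (Xup e) (Xlow e) (2 * \<sigma>) u \<and>
    slides_on (Xup e) (Xlow e) (sliding_region (Xup e) (Xlow e)) u \<and> dist (t0, u t0) (\<theta>, on_axis xv) \<le> (K + B) * e"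
    if e: "0 < e" "e < e1" for e
  proof -
    have es: "e < em" "e < eg" "e < e0" "e < ea" "e * N < \<mu>" using e N by (auto simp: e1_def pos_less_divide_eq)
    have "e * K < \<mu>" "e * B < \<mu>" "e * (K + B) < \<mu>"
      using e(1) by (intro le_less_trans[OF mult_left_mono es(5)] N; simp)+
    then have sm: "e * K \<le> 1/2" "e * B \<le> \<delta>" "e * (K + B) \<le> 1/2" by (auto simp: \<mu>_def)
    let ?I = "{\<theta> - K * e..\<theta> + K * e}"
    obtain \<xi>0 \<zeta> where sa: "sliding_arc e S ?I A \<eta> \<xi>0 \<zeta>" using arc[OF e(1) es(4)] by blast
    have cont: "continuous_on ?I \<xi>0" "continuous_on (?I \<times> {0..S}) (\<lambda>(t, r). \<zeta> t r)"
      and \<xi>: "\<And>t. t \<in> ?I \<Longrightarrow> \<zeta> t 0 = \<xi>0 t \<and> \<bar>b * \<xi>0 t + a1\<bar> \<le> \<eta> \<and> lo e t (xv + e * \<xi>0 t) $ 2 = 0"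
      and \<zeta>: "\<And>t r. t \<in> ?I \<Longrightarrow> r \<in> {0..S} \<Longrightarrow> \<bar>\<zeta> t r\<bar> \<le> A \<and> - a1 - \<eta> \<le> b * \<zeta> t r
        \<and> (\<zeta> t has_real_derivative - slide_speed e (t - e * r) (xv + e * \<zeta> t r)) (at r within {0..S})
        \<and> up e (t - e * r) (xv + e * \<zeta> t r) $ 2 < 0
        \<and> (0 < r \<longrightarrow> 0 < lo e (t - e * r) (xv + e * \<zeta> t r) $ 2)"
      using sa unfolding sliding_arc_def a1_def by blast+
    have S0: "0 \<in> {0..S}" "S \<in> {0..S}" using S by auto
    have \<xi>A: "\<bar>\<xi>0 t\<bar> \<le> A" if "t \<in> ?I" for t using \<xi>[OF that] \<zeta>[OF that S0(1)] by auto
    obtain t0 r \<tau> where t0: "t0 \<in> ?I" and r: "r \<in> {0<..<S}" and \<tau>: "\<bar>\<tau>\<bar> \<le> T"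
      and UW: "U e t0 (\<xi>0 (fst (t0, r))) \<tau> = W e t0 ((\<lambda>(t, r). \<zeta> t r) (t0, r)) (snd (t0, r)) \<tau>" "U e t0 (\<xi>0 (fst (t0, r))) \<tau> $ 2 = 0"
    proof (rule matchesD[OF match e(1) es(1) S _ cont(2), where ?\<xi>0.0 = "\<lambda>p. \<xi>0 (fst p)" and r = snd])
      show "continuous_on (?I \<times> {0..S}) (\<lambda>p. \<xi>0 (fst p))"
        by (rule continuous_on_compose2[OF cont(1)]) (auto intro!: continuous_intros)
      show "continuous_on (?I \<times> {0..S}) snd" by (intro continuous_intros)
      show "\<bar>\<xi>0 (fst p)\<bar> \<le> B \<and> \<bar>(\<lambda>(t, r). \<zeta> t r) p\<bar> \<le> B \<and> 0 \<le> snd p \<and> snd p \<le> B" if p: "p \<in> ?I \<times> {0..S}" for p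
      proof -
        have "fst p \<in> ?I" "snd p \<in> {0..S}" using p by auto
        then show ?thesis
          using \<xi>A[of "fst p"] \<zeta>[of "fst p" "snd p"] B unfolding case_prod_beta by auto
      qed
      have \<beta>\<alpha>: "\<beta> / \<alpha> * (h + h') = \<beta> / (\<alpha> * b) * (b * h + b * h')" for h h'
        using b \<alpha> unfolding distrib_left[symmetric, of b] by simp
      have \<beta>p: "0 < \<beta> / (\<alpha> * b)" using \<alpha> b \<beta> by simp
      have \<eta>\<Delta>: "\<beta> / (\<alpha> * b) * (2 * \<eta>) = \<Delta> / 2" using \<alpha> b \<beta> by (simp add: \<eta>_def)
      have \<Delta>e: "G = \<Delta> - \<beta> / (\<alpha> * b) * (2 * a1)" by (simp add: \<Delta>_def)
      show "\<Delta> / 2 \<le> G - \<beta> / \<alpha> * (\<xi>0 (fst (t, 0::real)) + (\<lambda>(t, r). \<zeta> t r) (t, 0)) - snd (t, 0) * \<beta>" if t: "t \<in> ?I" for t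
      proof -
        have "b * \<xi>0 t + b * \<xi>0 t \<le> 2 * \<eta> - 2 * a1" using \<xi>[OF t] by (simp add: abs_le_iff)
        from mult_left_mono[OF this, of "\<beta> / (\<alpha> * b)"] \<beta>p
        have "\<beta> / \<alpha> * (\<xi>0 t + \<xi>0 t) \<le> \<Delta> / 2 - \<beta> / (\<alpha> * b) * (2 * a1)"
          unfolding \<beta>\<alpha> by (simp only: right_diff_distrib \<eta>\<Delta> less_imp_le)
        then show ?thesis
          using \<xi>[OF t] \<Delta>e by simp
      qed
      show "G - \<beta> / \<alpha> * (\<xi>0 (fst (t, S)) + (\<lambda>(t, r). \<zeta> t r) (t, S)) - snd (t, S) * \<beta> \<le> - (\<Delta> / 2)" if t: "t \<in> ?I" for t
      proof -
        have "- 2 * \<eta> - 2 * a1 \<le> b * \<xi>0 t + b * \<zeta> t S" using \<xi>[OF t] \<zeta>[OF t S0(2)] by (simp add: abs_le_iff)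
        from mult_left_mono[OF this, of "\<beta> / (\<alpha> * b)"] \<beta>p
        have "- (\<beta> / (\<alpha> * b) * (2 * \<eta>)) - \<beta> / (\<alpha> * b) * (2 * a1) \<le> \<beta> / \<alpha> * (\<xi>0 t + \<zeta> t S)"
          unfolding \<beta>\<alpha> by (simp add: right_diff_distrib)
        moreover have "S * \<beta> = 2 * \<Delta>" using \<beta> by (simp add: S_def)
        moreover have arith: "- (d / 2) - q \<le> p \<Longrightarrow> x = 2 * d \<Longrightarrow> g = d - q \<Longrightarrow> g - p - x \<le> - (d / 2)"
          for d q p x g :: real by linarith
        ultimately show ?thesis
          using \<Delta>e arith unfolding \<eta>\<Delta> fst_conv snd_conv case_prod_conv by blast
      qed
    qed (rule that; assumption)
    note UW = UW[unfolded fst_conv snd_conv case_prod_conv]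
    have rS: "r \<in> {0..S}" using r by auto
    have t0K: "\<bar>t0 - \<theta>\<bar> \<le> e * K" using t0 by (auto simp: abs_le_iff mult.commute)
    have t0h: "\<bar>t0 - \<theta>\<bar> \<le> 1/2" using t0K sm by linarith
    have er: "0 < e * r" "e * r \<le> e * B"
    proof -
      show "0 < e * r" using e r by simp
      show "e * r \<le> e * B" using e r B by (intro mult_left_mono) auto
    qed
    \<comment> \<open>Converts forward time into the scaled backward time of the sliding
      arc.\<close>
    define q where "q t = (t0 - t) / e" for t
    have q: "q t \<in> {0..S}" "t0 - e * q t = t" if "t \<in> {t0 - e * r..t0}" for t
    proof -
      have "q t \<le> r" using that e by (simp add: q_def pos_divide_le_eq mult.commute)
      moreover have "0 \<le> q t" using that e by (simp add: q_def)
      ultimately show "q t \<in> {0..S}" using r by auto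
      show "t0 - e * q t = t" using e by (simp add: q_def)
    qed
    define x where "x t = xv + e * \<zeta> t0 (q t)" for t
    have x_range: "\<bar>x t - xv\<bar> \<le> \<delta>" if t: "t \<in> {t0 - e * r..t0}" for t
    proof -
      have "\<bar>x t - xv\<bar> = e * \<bar>\<zeta> t0 (q t)\<bar>" using e by (simp add: x_def abs_mult)
      also have "\<dots> \<le> e * B" using \<zeta>[OF t0 q(1)[OF t]] B e by (intro mult_left_mono) auto
      finally show ?thesis using sm by linarith
    qed
    have x_deriv: "(x has_real_derivative slide_speed e t (x t)) (at t within {t0 - e * r..t0})" if t: "t \<in> {t0 - e * r..t0}" for t
    proof -
      have "(q has_real_derivative - 1 / e) (at t within {t0 - e * r..t0})"
        unfolding q_def using e by (auto intro!: derivative_eq_intros)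
      moreover have "(\<zeta> t0 has_real_derivative - slide_speed e t (x t)) (at (q t) within q ` {t0 - e * r..t0})"
      proof (rule DERIV_subset)
        show "(\<zeta> t0 has_real_derivative - slide_speed e t (x t)) (at (q t) within {0..S})"
          using \<zeta>[OF t0 q(1)[OF t]] unfolding q(2)[OF t] x_def by blast
        show "q ` {t0 - e * r..t0} \<subseteq> {0..S}" using q(1) by blast
      qed
      ultimately have "((\<zeta> t0 \<circ> q) has_real_derivative - slide_speed e t (x t) * (- 1 / e)) (at t within {t0 - e * r..t0})"
        by (intro DERIV_image_chain)
      from DERIV_add[OF DERIV_const[of xv] DERIV_cmult[OF this, of e]]
      show ?thesis using e unfolding x_def o_def by simp
    qed
    have lo_up: "up e t (x t) $ 2 < 0" "t < t0 \<Longrightarrow> 0 < lo e t (x t) $ 2" if t: "t \<in> {t0 - e * r..t0}" for t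
    proof -
      show "up e t (x t) $ 2 < 0" using \<zeta>[OF t0 q(1)[OF t]] unfolding q(2)[OF t] x_def by blast
      show "0 < lo e t (x t) $ 2" if "t < t0"
      proof -
        have "0 < q t" using that e by (simp add: q_def)
        then show ?thesis using \<zeta>[OF t0 q(1)[OF t]] unfolding q(2)[OF t] x_def by blast
      qed
    qed
    have x_seg: "on_axis (slide_speed e t (x t)) \<in> closed_segment (lo e t (x t)) (up e t (x t))" if t: "t \<in> {t0 - e * r<..<t0}" for t
    proof -
      let ?l = "lo e t (x t)" and ?u = "up e t (x t)"
      have s: "?u $ 2 < 0" "0 < ?l $ 2" using lo_up[of t] t by auto
      let ?s = "?l $ 2 / (?l $ 2 - ?u $ 2)"
      have d: "0 < ?l $ 2 - ?u $ 2" using s by linarith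
      have "on_axis (slide_speed e t (x t)) = (1 - ?s) *\<^sub>R ?l + ?s *\<^sub>R ?u"
      proof -
        have "1 - ?s = - ?u $ 2 / (?l $ 2 - ?u $ 2)" using d by (simp add: field_simps)
        then show ?thesis by (simp add: vec2_eq_iff slide_speed_def diff_divide_distrib)
      qed
      moreover have "0 \<le> ?s" "?s \<le> 1" using s d by simp_all
      ultimately show ?thesis unfolding in_segment by blast
    qed
    \<comment> \<open>Continuity up to and including the fold supplies the velocity bound that
      gluing asks for; at the fold the denominator is nonzero because the upper component is
      negative.\<close>
    have "continuous_on {t0 - e * r..t0} (\<lambda>t. slide_speed e t (x t))"
    proof -
      let ?J = "{t0 - e * r..t0}"
      have tJ: "t \<in> {\<theta>-1..\<theta>+1}" if "t \<in> ?J" for t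
        using that t0K er sm(3) unfolding atLeastAtMost_iff distrib_left by (auto simp: abs_le_iff)
      have cx: "continuous_on ?J x" by (rule DERIV_continuous_on) (rule x_deriv)
      have c: "continuous_on ({\<theta>-1..\<theta>+1} \<times> {xv - \<delta>..xv + \<delta>}) (\<lambda>p. lo e (fst p) (snd p) $ i)"
          "continuous_on ({\<theta>-1..\<theta>+1} \<times> {xv - \<delta>..xv + \<delta>}) (\<lambda>p. up e (fst p) (snd p) $ i)" for i
      proof -
        have le: "2 * L * (\<bar>fst p - fst p'\<bar> + \<bar>snd p - snd p'\<bar>) \<le> 4 * L * dist p p'" for p p' :: "real \<times> real"
        proof -
          have "\<bar>fst p - fst p'\<bar> + \<bar>snd p - snd p'\<bar> \<le> 2 * dist p p'"
            using dist_fst_le[of p p'] dist_snd_le[of p p'] by (simp add: dist_real_def)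
          from mult_left_mono[OF this, of "2 * L"] L show ?thesis by simp
        qed
        have "(4 * L)-lipschitz_on ({\<theta>-1..\<theta>+1} \<times> {xv - \<delta>..xv + \<delta>}) (\<lambda>p. lo e (fst p) (snd p) $ i)"
          and "(4 * L)-lipschitz_on ({\<theta>-1..\<theta>+1} \<times> {xv - \<delta>..xv + \<delta>}) (\<lambda>p. up e (fst p) (snd p) $ i)"
        proof -
          have range: "fst p \<in> {\<theta>-1..\<theta>+1}" "\<bar>snd p - xv\<bar> \<le> \<delta>" if "p \<in> {\<theta>-1..\<theta>+1} \<times> {xv - \<delta>..xv + \<delta>}" for p
            using that by (auto simp: abs_le_iff)
          show "(4 * L)-lipschitz_on ({\<theta>-1..\<theta>+1} \<times> {xv - \<delta>..xv + \<delta>}) (\<lambda>p. lo e (fst p) (snd p) $ i)"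
            by (rule lipschitz_onI, unfold dist_real_def[of "_ $ _"])
              (rule order_trans[OF axis_lip(1)[OF e(1) es(3)] le]; (rule range; assumption) | use L in simp)+
          show "(4 * L)-lipschitz_on ({\<theta>-1..\<theta>+1} \<times> {xv - \<delta>..xv + \<delta>}) (\<lambda>p. up e (fst p) (snd p) $ i)"
            by (rule lipschitz_onI, unfold dist_real_def[of "_ $ _"])
              (rule order_trans[OF axis_lip(2)[OF e(1) es(3)] le]; (rule range; assumption) | use L in simp)+
        qed
        then show "continuous_on ({\<theta>-1..\<theta>+1} \<times> {xv - \<delta>..xv + \<delta>}) (\<lambda>p. lo e (fst p) (snd p) $ i)"
          "continuous_on ({\<theta>-1..\<theta>+1} \<times> {xv - \<delta>..xv + \<delta>}) (\<lambda>p. up e (fst p) (snd p) $ i)"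
          using lipschitz_on_continuous_on by blast+
      qed
      have sub: "(\<lambda>t. (t, x t)) ` ?J \<subseteq> {\<theta>-1..\<theta>+1} \<times> {xv - \<delta>..xv + \<delta>}"
      proof (rule image_subsetI)
        fix t assume t: "t \<in> ?J"
        show "(t, x t) \<in> {\<theta>-1..\<theta>+1} \<times> {xv - \<delta>..xv + \<delta>}"
          using tJ[OF t] x_range[OF t] by (simp add: abs_le_iff)
      qed
      have cp: "continuous_on ?J (\<lambda>t. (t, x t))" by (intro continuous_intros cx)
      note cc = continuous_on_compose2[OF c(1) cp sub, unfolded fst_conv snd_conv] continuous_on_compose2[OF c(2) cp sub, unfolded fst_conv snd_conv]
      have "lo e t (x t) $ 2 - up e t (x t) $ 2 \<noteq> 0" if t: "t \<in> ?J" for t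
      proof (cases "t = t0")
        case True
        have "lo e t0 (x t0) $ 2 = 0" using \<xi>[OF t0] by (simp add: x_def q_def)
        then show ?thesis using lo_up(1)[OF t] True by simp
      next
        case False
        then show ?thesis using lo_up[OF t] t by auto
      qed
      then show ?thesis unfolding slide_speed_def by (intro continuous_intros cc) auto
    qed
    then have "bounded ((\<lambda>t. slide_speed e t (x t)) ` {t0 - e * r..t0})"
      by (intro compact_imp_bounded compact_continuous_image) auto
    then obtain C where C: "\<And>t. t \<in> {t0 - e * r..t0} \<Longrightarrow> \<bar>slide_speed e t (x t)\<bar> \<le> C"
      unfolding bounded_iff real_norm_def by blast
    obtain u where u: "piecewise_solution D (Xup e) (Xlow e) (2 * \<sigma>) u" "\<And>t. t \<in> {t0 - e * r..t0} \<Longrightarrow> u t = on_axis (x t)"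
    proof (rule gluesD[OF glue e(1) es(2) t0h _ _ _ _ _ _ _ UW x_range x_deriv C x_seg])
      show "0 \<le> r" "r \<le> B + T" using r B T by auto
      show "\<bar>\<xi>0 t0\<bar> \<le> B + T" "\<bar>\<zeta> t0 r\<bar> \<le> B + T" "\<bar>\<tau>\<bar> \<le> B + T"
        using \<xi>A[OF t0] \<zeta>[OF t0 rS] \<tau> B T by auto
      show "lo e t0 (xv + e * \<xi>0 t0) $ 2 \<le> 0" "up e (t0 - e * r) (xv + e * \<zeta> t0 r) $ 2 \<le> 0"
        using \<xi>[OF t0] \<zeta>[OF t0 rS] by auto
      show "x t0 = xv + e * \<xi>0 t0" "x (t0 - e * r) = xv + e * \<zeta> t0 r" using \<xi>[OF t0] e by (auto simp: x_def q_def)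
    qed ((rule that; assumption) | assumption)+
    have "slides_on (Xup e) (Xlow e) (sliding_region (Xup e) (Xlow e)) u"
      unfolding slides_on_def
    \<comment> \<open>The final half of the slide is left out: at \<open>t0\<close> the lower
      component vanishes, so the fold is not a point of the sliding region.\<close>
    proof (rule exI[of _ "t0 - e * r"], rule exI[of _ "t0 - e * r / 2"], intro conjI ballI)
      show "t0 - e * r < t0 - e * r / 2" using er by simp
      fix t assume t: "t \<in> {t0 - e * r..t0 - e * r / 2}"
      have t': "t \<in> {t0 - e * r..t0}" "t < t0" using t er by auto
      show "(t, u t) \<in> sliding_region (Xup e) (Xlow e)"
        using lo_up[OF t'(1)] t'(2) by (simp add: sliding_region_def u(2)[OF t'(1)])
      have "(x has_real_derivative slide_speed e t (x t)) (at t within {t0 - e * r..t0 - e * r / 2})"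
        by (rule DERIV_subset[OF x_deriv[OF t'(1)]]) (use er in auto)
      then have "((\<lambda>t. on_axis (x t)) has_vector_derivative on_axis (slide_speed e t (x t))) (at t within {t0 - e * r..t0 - e * r / 2})"
        by (intro bounded_linear.has_vector_derivative[OF bounded_linear_on_axis])
          (simp add: has_real_derivative_iff_has_vector_derivative)
      moreover have "on_axis (slide_speed e t (x t)) = sliding_field (Xup e) (Xlow e) t (u t)"
        by (simp add: sliding_field_def slide_speed_def u(2)[OF t'(1)])
      moreover have "u s = on_axis (x s)" if "s \<in> {t0 - e * r..t0 - e * r / 2}" for s
        by (rule u(2)) (use that er in auto)
      ultimately show "(u has_vector_derivative sliding_field (Xup e) (Xlow e) t (u t)) (at t within {t0 - e * r..t0 - e * r / 2})"
        by (simp only: has_vector_derivative_transform[OF t])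
    qed
    moreover have "dist (t0, u t0) (\<theta>, on_axis xv) \<le> (K + B) * e"
    proof -
      have ut0: "u t0 = on_axis (xv + e * \<xi>0 t0)" using u(2)[of t0] er \<xi>[OF t0] by (simp add: x_def q_def)
      have "\<bar>e * \<xi>0 t0\<bar> \<le> e * B" using \<xi>A[OF t0] B e by (simp add: abs_mult)
      then show ?thesis unfolding ut0 using dist_start[of t0 e "\<xi>0 t0"] t0K by (simp add: algebra_simps)
    qed
    ultimately show ?thesis using u(1) by blast
  qed
  moreover have "e1 \<le> e0" by (simp add: e1_def)
  ultimately show ?thesis using e1 by blast
qed

end

section \<open>Exchanging the two systems by time reversal\<close>

text \<open>Exchanging the systems turns \<open>M t\<close> into \<open>- M (- t)\<close>, whose
  derivative at \<open>- \<theta>\<close> is again \<open>M'\<close>.\<close>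

lemma (in two_halves) exchanged: "two_halves F D \<gamma> \<sigma> xv \<alpha> b \<delta> L g2 k2 g1 k1 (- \<theta>) e0 M'"
proof -
  have 1: "half F D \<gamma> \<sigma> xv \<alpha> b \<delta> L g2 k2 (- \<theta>) e0" by (rule h2.half_axioms)
  have 2: "half F D \<gamma> \<sigma> xv \<alpha> b \<delta> L g1 k1 (- (- \<theta>)) e0" using h1.half_axioms by simp
  have eq: "wedge (F (\<gamma> \<sigma>)) (h1.Y \<sigma> (h2.J t - h1.J (- t))) = - M (- t)" for t
  proof -
    have "h2.J t - h1.J (- t) = - (h1.J (- t) - h2.J (- (- t)))" by simp
    then show ?thesis
      by (simp only: M_def linear_neg[OF h1.linear_Y]) (simp add: wedge_def)
  qed
  have "(M has_real_derivative M') (at (- (- \<theta>)))" using M_deriv by (simp add: M_def[symmetric])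
  from DERIV_minus[OF DERIV_chain2[OF this DERIV_minus[OF DERIV_ident]]]
  have "((\<lambda>t. - M (- t)) has_real_derivative M') (at (- \<theta>))" by simp
  then have 3: "((\<lambda>t. wedge (F (\<gamma> \<sigma>)) (h1.Y \<sigma> (h2.J t - h1.J (- t)))) has_real_derivative M') (at (- \<theta>))"
    unfolding eq .
  have 4: "wedge (F (\<gamma> \<sigma>)) (h1.Y \<sigma> (h2.J (- \<theta>) - h1.J (- (- \<theta>)))) = 0"
    unfolding eq using M_zero by (simp add: M_def)
  show ?thesis
    by (intro two_halves.intro two_halves_axioms.intro 1 2 3 4 e0_pos M'_nonzero)
qed

context periodic_halves
begin

lemma escaping_orbits_exist:
  assumes ord: "g1 \<theta> (on_axis xv) $ 2 < g2 (- \<theta>) (on_axis xv) $ 2"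
    and pos: "0 < G + 2 * \<beta> / (\<alpha> * b) * g2 (- \<theta>) (on_axis xv) $ 2"
  shows "\<exists>K e1. 0 < e1 \<and> e1 \<le> e0 \<and> (\<forall>e. 0 < e \<and> e < e1 \<longrightarrow> (\<exists>u t0.
    piecewise_solution D (Xup e) (Xlow e) (2 * \<sigma>) u \<and>
    slides_on (Xup e) (Xlow e) (escaping_region (Xup e) (Xlow e)) u \<and> dist (t0, u t0) (\<theta>, on_axis xv) \<le> K * e))"
proof -
  interpret s: periodic_halves F D \<gamma> \<sigma> xv \<alpha> b \<delta> L g2 k2 g1 k1 "- \<theta>" e0 M'
    by (intro periodic_halves.intro exchanged periodic_halves_axioms.intro k1_periodic k2_periodic D_symmetric)
  \<comment> \<open>\<open>G\<close> is symmetric in the two systems, so the inequality carries over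
    unchanged.\<close>
  have sG: "s.G = G" by (simp add: s.G_def G_def add.commute)
  have rev: "reversed (s.Xlow e) = Xup e" "reversed (s.Xup e) = Xlow e" for e
    unfolding reversed_def Xup_def[abs_def] Xlow_def[abs_def] s.Xup_def[abs_def] s.Xlow_def[abs_def]
    by (intro ext, simp only: minus_minus reflect_reflect linear_neg[OF reflect_linear])+
  have "\<exists>K e1. 0 < e1 \<and> e1 \<le> e0 \<and> (\<forall>e. 0 < e \<and> e < e1 \<longrightarrow> (\<exists>u t0.
    piecewise_solution D (s.Xup e) (s.Xlow e) (2 * \<sigma>) u \<and>
    slides_on (s.Xup e) (s.Xlow e) (sliding_region (s.Xup e) (s.Xlow e)) u \<and> dist (t0, u t0) (- \<theta>, on_axis xv) \<le> K * e))"
    by (rule s.sliding_orbits_exist[unfolded sG minus_minus, OF ord pos])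
  then obtain K e1 where K: "0 < e1 \<and> e1 \<le> e0 \<and> (\<forall>e. 0 < e \<and> e < e1 \<longrightarrow> (\<exists>u t0.
    piecewise_solution D (s.Xup e) (s.Xlow e) (2 * \<sigma>) u \<and>
    slides_on (s.Xup e) (s.Xlow e) (sliding_region (s.Xup e) (s.Xlow e)) u \<and> dist (t0, u t0) (- \<theta>, on_axis xv) \<le> K * e))"
    by (elim exE)
  then have e1: "0 < e1" "e1 \<le> e0" by blast+
  have "\<exists>u t0. piecewise_solution D (Xup e) (Xlow e) (2 * \<sigma>) u \<and>
    slides_on (Xup e) (Xlow e) (escaping_region (Xup e) (Xlow e)) u \<and> dist (t0, u t0) (\<theta>, on_axis xv) \<le> K * e"
    if e: "0 < e" "e < e1" for e
  proof -
    obtain u t0 where u: "piecewise_solution D (s.Xup e) (s.Xlow e) (2 * \<sigma>) u"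
      "slides_on (s.Xup e) (s.Xlow e) (sliding_region (s.Xup e) (s.Xlow e)) u" "dist (t0, u t0) (- \<theta>, on_axis xv) \<le> K * e"
      using K[THEN conjunct2, THEN conjunct2, rule_format, OF conjI[OF e]] by blast
    have "dist (- t0, reflect (u (- (- t0)))) (\<theta>, on_axis xv) = dist (t0, u t0) (- \<theta>, on_axis xv)"
    proof -
      have "reflect (u t0) - on_axis xv = reflect (u t0 - on_axis xv)" by (simp add: reflect_simps)
      then have "dist (reflect (u t0)) (on_axis xv) = dist (u t0) (on_axis xv)" by (simp add: dist_norm)
      moreover have "dist (- t0) \<theta> = dist t0 (- \<theta>)" by (simp add: dist_real_def abs_if)
      ultimately show ?thesis by (simp only: dist_Pair_Pair minus_minus)
    qed
    then show ?thesis
      using piecewise_solution_reversed[OF u(1) D_symmetric] slides_on_reversed[OF u(2)] u(3)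
      unfolding rev by (intro exI[of _ "\<lambda>t. reflect (u (- t))"] exI[of _ "- t0"]) simp
  qed
  then show ?thesis using e1 by blast
qed

end

section \<open>The flow and its derivative\<close>

lemma Ck_on_2_imp_Suc_0: "Ck_on 2 D F \<Longrightarrow> Ck_on (Suc 0) D F"
  by (auto simp: numeral_2_eq_2 intro!: differentiable_imp_continuous_on differentiable_at_imp_differentiable_on)

text \<open>The images of both curves form one compact subset of \<open>D\<close>, on which
  \<open>F\<close> is Lipschitz; Gronwall without forcing does the rest.\<close>

lemma ode_unique:
  assumes D: "open D" and F: "Ck_on (Suc 0) D F" and u: "ode_solution F D {0..t} u" and v: "ode_solution F D {0..t} v"
    and eq: "u 0 = v 0" and t: "0 \<le> t"
  shows "u t = v t"
proof -
  have du: "\<And>s. s \<in> {0..t} \<Longrightarrow> u s \<in> D \<and> (u has_vector_derivative F (u s)) (at s within {0..t})"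
    and dv: "\<And>s. s \<in> {0..t} \<Longrightarrow> v s \<in> D \<and> (v has_vector_derivative F (v s)) (at s within {0..t})"
    using u v unfolding ode_solution_def by blast+
  have "continuous_on {0..t} u" "continuous_on {0..t} v"
    using du dv by (meson continuous_on_vector_derivative)+
  then have "compact (u ` {0..t} \<union> v ` {0..t})" by (intro compact_Un compact_continuous_image) auto
  moreover have "u ` {0..t} \<union> v ` {0..t} \<subseteq> D" using du dv by blast
  ultimately obtain L where L: "L-lipschitz_on (u ` {0..t} \<union> v ` {0..t}) F"
    using Ck_on_Suc_0_compactly_lipschitz[OF D F] unfolding compactly_lipschitz_def by blast
  have "norm (u t - v t) \<le> (norm (u 0 - v 0) + 0 * t) * exp (L * t)"
  proof (rule gronwall[where e' = "\<lambda>s. F (u s) - F (v s)"])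
    show "0 \<le> t" "0 \<le> L" "(0::real) \<le> 0" "t \<in> {0..t}" using t lipschitz_on_nonneg[OF L] by auto
    fix s assume s: "s \<in> {0..t}"
    show "((\<lambda>s. u s - v s) has_vector_derivative F (u s) - F (v s)) (at s within {0..t})"
      using du[OF s] dv[OF s] by (intro has_vector_derivative_diff) auto
    show "norm (F (u s) - F (v s)) \<le> L * norm (u s - v s) + 0"
      using lipschitz_onD[OF L, of "u s" "v s"] s by (simp add: dist_norm)
  qed
  then show ?thesis using eq by simp
qed

text \<open>\<open>flow\<close> is a definite description; uniqueness lets any solution at hand
  compute it.\<close>

lemma flow_eq:
  assumes "open D" "Ck_on (Suc 0) D F" "ode_solution F D {0..t} u" "u 0 = z" "0 \<le> t"
  shows "flow F D t z = u t"
  unfolding flow_def closed_segment_eq_real_ivl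
proof (rule the_equality)
  show "\<exists>v. ode_solution F D (if 0 \<le> t then {0..t} else {t..0}) v \<and> v 0 = z \<and> v t = u t"
    using assms(3-5) by (intro exI[of _ u]) simp
  fix w assume "\<exists>v. ode_solution F D (if 0 \<le> t then {0..t} else {t..0}) v \<and> v 0 = z \<and> v t = w"
  then obtain v where "ode_solution F D {0..t} v" "v 0 = u 0" "v t = w" using assms(4,5) by auto
  then show "w = u t" using ode_unique[OF assms(1,2) _ assms(3) _ assms(5)] by blast
qed

context fold_tube
begin

lemmas F_C1 = Ck_on_2_imp_Suc_0[OF C2]

lemma flow_\<gamma>:
  assumes t: "t \<in> {0..\<sigma>}" shows "flow F D t (on_axis xv) = \<gamma> t"
proof (rule flow_eq[OF open_D F_C1])
  show "ode_solution F D {0..t} \<gamma>"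
    unfolding ode_solution_def
  proof
    fix s assume s: "s \<in> {0..t}"
    show "\<gamma> s \<in> D \<and> (\<gamma> has_vector_derivative F (\<gamma> s)) (at s within {0..t})"
      using s t by (intro conjI \<gamma>_in_D has_vector_derivative_within_subset[OF \<gamma>_deriv]) auto
  qed
qed (use \<gamma>_0 t in auto)

text \<open>From \<open>w\<close> close to the fold, the solution of the truncated field stays in
  the tube and so computes the flow; Gronwall then compares it with
  \<open>\<gamma> t + Y t (w - on_axis xv)\<close>.\<close>

lemma flow_expansion:
  assumes w: "norm (w - on_axis xv) * exp (L * \<sigma>) \<le> \<delta>" and t: "t \<in> {0..\<sigma>}"
  shows "norm (flow F D t w - \<gamma> t - Y t (w - on_axis xv)) \<le> (L * (exp (L * \<sigma>))\<^sup>2 * \<sigma> * exp (L * \<sigma>)) * (norm (w - on_axis xv))\<^sup>2"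
proof -
  let ?n = "norm (w - on_axis xv)" and ?E = "exp (L * \<sigma>)"
  have "\<exists>V. V 0 = w \<and> (\<forall>s\<in>{0..\<sigma>}. (V has_vector_derivative F (proj s (V s))) (at s within {0..\<sigma>}))"
  proof (rule global_lipschitz_ode_exists[where f = "\<lambda>s u. F (proj s u)" and L = L])
    show "continuous_on ({0..\<sigma>} \<times> UNIV) (\<lambda>(s, u). F (proj s u))"
    proof -
      have "continuous_on ({0..\<sigma>} \<times> UNIV) (\<lambda>p. F ((\<lambda>(s, u). proj s u) p))"
        by (rule continuous_on_compose2[OF F_continuous proj_continuous]) (use proj_tube tube_D in force)
      then show ?thesis by (simp add: case_prod_beta)
    qed
    show "norm (F (proj s x) - F (proj s y)) \<le> L * norm (x - y)" if "s \<in> {0..\<sigma>}" for s x y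
      using that order_trans[OF F_lip[OF proj_tube proj_tube] mult_left_mono[OF proj_lip L_nonneg]] by simp
  qed (use \<sigma>_pos in simp)
  then obtain V where V: "V 0 = w" "\<And>s. s \<in> {0..\<sigma>} \<Longrightarrow> (V has_vector_derivative F (proj s (V s))) (at s within {0..\<sigma>})"
    by blast
  have near: "norm (V s - \<gamma> s) \<le> ?n * ?E" if s: "s \<in> {0..\<sigma>}" for s
  proof -
    have "norm (V s - \<gamma> s) \<le> (norm (V 0 - \<gamma> 0) + 0 * \<sigma>) * exp (L * \<sigma>)"
    proof (rule gronwall[where e' = "\<lambda>s. F (proj s (V s)) - F (\<gamma> s)"])
      fix r assume r: "r \<in> {0..\<sigma>}"
      show "((\<lambda>s. V s - \<gamma> s) has_vector_derivative F (proj r (V r)) - F (\<gamma> r)) (at r within {0..\<sigma>})"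
        by (intro has_vector_derivative_diff V(2) \<gamma>_deriv r)
      have "proj r (\<gamma> r) = \<gamma> r" using center_eq[OF r] \<delta>_pos by (intro proj_id) simp
      then have "norm (proj r (V r) - \<gamma> r) \<le> norm (V r - \<gamma> r)" using proj_lip[of r "V r" "\<gamma> r"] by simp
      from mult_left_mono[OF this L_nonneg]
      show "norm (F (proj r (V r)) - F (\<gamma> r)) \<le> L * norm (V r - \<gamma> r) + 0"
        using F_lip[OF proj_tube \<gamma>_tube[OF r], of r "V r"] r by simp
    qed (use \<sigma>_pos L_nonneg s in auto)
    then show ?thesis by (simp add: V(1) \<gamma>_0)
  qed
  have V\<delta>: "norm (V s - \<gamma> s) \<le> \<delta>" if "s \<in> {0..\<sigma>}" for s using near[OF that] w by linarith
  have Vtube: "V s \<in> tube \<delta>" if "s \<in> {0..\<sigma>}" for s by (rule tubeI[OF that V\<delta>[OF that]])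
  have Vder: "(V has_vector_derivative F (V s)) (at s within {0..\<sigma>})" if s: "s \<in> {0..\<sigma>}" for s
  proof -
    have "proj s (V s) = V s" using V\<delta>[OF s] center_eq[OF s] by (intro proj_id) simp
    then show ?thesis using V(2)[OF s] by simp
  qed
  have "flow F D t w = V t"
  proof (rule flow_eq[OF open_D F_C1])
    show "ode_solution F D {0..t} V"
      unfolding ode_solution_def
    proof
      fix s assume "s \<in> {0..t}"
      then have s: "s \<in> {0..\<sigma>}" using t by auto
      have "(V has_vector_derivative F (V s)) (at s within {0..t})"
        by (rule has_vector_derivative_within_subset[OF Vder[OF s]]) (use t in auto)
      then show "V s \<in> D \<and> (V has_vector_derivative F (V s)) (at s within {0..t})"
        using Vtube[OF s] tube_D by blast
    qed
  qed (use V t in auto)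
  moreover have "norm (V t - \<gamma> t - Y t (w - on_axis xv)) \<le>
    (norm (V 0 - \<gamma> 0 - Y 0 (w - on_axis xv)) + (L * (?n * ?E)\<^sup>2) * \<sigma>) * exp (L * \<sigma>)"
  proof (rule gronwall[where e' = "\<lambda>s. F (V s) - F (\<gamma> s) - DF (\<gamma> s) (Y s (w - on_axis xv))"])
    fix r assume r: "r \<in> {0..\<sigma>}"
    show "((\<lambda>s. V s - \<gamma> s - Y s (w - on_axis xv)) has_vector_derivative F (V r) - F (\<gamma> r) - DF (\<gamma> r) (Y r (w - on_axis xv))) (at r within {0..\<sigma>})"
      by (intro has_vector_derivative_diff Vder \<gamma>_deriv Y_deriv r)
    define v where "v = V r - \<gamma> r"
    have Vr: "V r = \<gamma> r + v" by (simp add: v_def)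
    have "norm (F (\<gamma> r + v) - F (\<gamma> r) - DF (\<gamma> r) v) \<le> L * (norm v)\<^sup>2"
      using V\<delta>[OF r] unfolding v_def[symmetric] by (rule F_taylor[OF r])
    also have "\<dots> \<le> L * (?n * ?E)\<^sup>2"
      using near[OF r] L_nonneg unfolding v_def[symmetric] by (intro mult_left_mono power_mono) auto
    finally have 1: "norm (F (\<gamma> r + v) - F (\<gamma> r) - DF (\<gamma> r) v) \<le> L * (?n * ?E)\<^sup>2" .
    have 2: "norm (DF (\<gamma> r) (v - Y r (w - on_axis xv))) \<le> L * norm (v - Y r (w - on_axis xv))"
      by (intro DF_bound \<gamma>_tube r)
    have eq: "F (V r) - F (\<gamma> r) - DF (\<gamma> r) (Y r (w - on_axis xv))
      = DF (\<gamma> r) (v - Y r (w - on_axis xv)) + (F (\<gamma> r + v) - F (\<gamma> r) - DF (\<gamma> r) v)"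
      unfolding Vr by (simp add: linear_diff[OF DF_linear[OF \<gamma>_in_D[OF r]]])
    show "norm (F (V r) - F (\<gamma> r) - DF (\<gamma> r) (Y r (w - on_axis xv))) \<le> L * norm (V r - \<gamma> r - Y r (w - on_axis xv)) + L * (?n * ?E)\<^sup>2"
      unfolding eq v_def[symmetric] by (intro order_trans[OF norm_triangle_ineq] add_mono 1 2)
  qed (use \<sigma>_pos L_nonneg t in auto)
  ultimately show ?thesis
    by (simp add: V(1) \<gamma>_0 Y_0 power_mult_distrib mult_ac)
qed

lemma flow_has_derivative:
  assumes t: "t \<in> {0..\<sigma>}"
  shows "((\<lambda>w. flow F D t w) has_derivative Y t) (at (on_axis xv))"
  unfolding has_derivative_at_alt
proof (intro conjI allI impI)
  show "bounded_linear (Y t)" using linear_Y linear_conv_bounded_linear by blast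
  fix \<epsilon> :: real assume \<epsilon>: "0 < \<epsilon>"
  define C where "C = L * (exp (L * \<sigma>))\<^sup>2 * \<sigma> * exp (L * \<sigma>)"
  have C: "0 \<le> C" using L_nonneg \<sigma>_pos by (simp add: C_def)
  \<comment> \<open>The first bound keeps \<open>w\<close> within reach of the expansion, the second
    turns its quadratic error into \<open>\<epsilon>\<close> times the distance.\<close>
  define d where "d = min (\<delta> / exp (L * \<sigma>)) (\<epsilon> / (C + 1))"
  have "norm (flow F D t w - flow F D t (on_axis xv) - Y t (w - on_axis xv)) \<le> \<epsilon> * norm (w - on_axis xv)"
    if w: "norm (w - on_axis xv) < d" for w
  proof -
    have "norm (w - on_axis xv) < \<delta> / exp (L * \<sigma>)" "norm (w - on_axis xv) < \<epsilon> / (C + 1)" using w by (auto simp: d_def)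
    then have a: "norm (w - on_axis xv) * exp (L * \<sigma>) \<le> \<delta>" and b: "norm (w - on_axis xv) * (C + 1) \<le> \<epsilon>"
      using C by (simp_all add: pos_less_divide_eq less_imp_le)
    have "norm (flow F D t w - \<gamma> t - Y t (w - on_axis xv)) \<le> C * (norm (w - on_axis xv))\<^sup>2"
      using flow_expansion[OF a t] unfolding C_def .
    also have "\<dots> \<le> (C + 1) * (norm (w - on_axis xv))\<^sup>2" by (intro mult_right_mono) auto
    also have "\<dots> = (norm (w - on_axis xv) * (C + 1)) * norm (w - on_axis xv)" by (simp add: power2_eq_square mult_ac)
    also have "\<dots> \<le> \<epsilon> * norm (w - on_axis xv)" by (intro mult_right_mono b) auto
    finally show ?thesis by (simp add: flow_\<gamma>[OF t])
  qed
  moreover have "0 < d" using \<delta>_pos \<epsilon> C by (simp add: d_def)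
  ultimately show "\<exists>d>0. \<forall>y. norm (y - on_axis xv) < d \<longrightarrow>
      norm (flow F D t y - flow F D t (on_axis xv) - Y t (y - on_axis xv)) \<le> \<epsilon> * norm (y - on_axis xv)"
    by blast
qed

lemma flow_deriv_eq:
  assumes t: "t \<in> {0..\<sigma>}" shows "flow_deriv F D t (on_axis xv) = matrix (Y t)"
  unfolding flow_deriv_def using frechet_derivative_at[OF flow_has_derivative[OF t]] by simp

lemma flow_deriv_mult: "t \<in> {0..\<sigma>} \<Longrightarrow> flow_deriv F D t (on_axis xv) *v v = Y t v"
  by (simp add: flow_deriv_eq matrix_works linear_Y)

text \<open>\<open>matrix_inv\<close> is defined by choice, so it is identified through the
  two-sided inverse \<open>Z t\<close>.\<close>

lemma flow_deriv_inv_mult: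
  assumes t: "t \<in> {0..\<sigma>}" shows "matrix_inv (flow_deriv F D t (on_axis xv)) *v v = Z t v"
proof -
  have "Z t \<circ> Y t = id" "Y t \<circ> Z t = id" using Z_Y[OF t] Y_Z[OF t] by auto
  then have inv: "matrix (Z t) ** matrix (Y t) = mat 1" "matrix (Y t) ** matrix (Z t) = mat 1"
    using matrix_compose[OF linear_Y linear_Z, of t t] matrix_compose[OF linear_Z linear_Y, of t t] by (simp_all add: matrix_id_mat_1)
  have "\<exists>B. matrix (Y t) ** B = mat 1 \<and> B ** matrix (Y t) = mat 1" using inv by blast
  then have "matrix_inv (matrix (Y t)) ** matrix (Y t) = mat 1"
    unfolding matrix_inv_def by (rule someI2_ex) blast
  then have "matrix_inv (matrix (Y t)) = matrix (Z t)"
    by (metis inv(2) matrix_mul_assoc matrix_mul_lid matrix_mul_rid)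
  then show ?thesis by (simp add: flow_deriv_eq[OF t] matrix_works linear_Z)
qed

end

section \<open>Consequences of the smoothness hypotheses\<close>

text \<open>\<open>H\<close> is smooth on an open range of \<epsilon>, so uniform bounds come from
  the compact part \<open>{0..\<epsilon>0 / 2}\<close>; the cutoff at 1 lets factors
  \<open>e\<close> be dropped. Stating the bound for all \<open>L \<ge> L0\<close> allows merging it
  with other constants.\<close>

lemma perturbation_bounds:
  fixes Gf :: "real \<Rightarrow> real^2 \<Rightarrow> real^2" and Hf :: "real \<Rightarrow> real^2 \<Rightarrow> real \<Rightarrow> real^2"
  assumes G: "compactly_lipschitz (UNIV \<times> D) (\<lambda>(t, z). Gf t z)"
    and H: "compactly_lipschitz (UNIV \<times> D \<times> {-\<epsilon>0<..<\<epsilon>0}) (\<lambda>(t, z, \<epsilon>). Hf t z \<epsilon>)"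
    and \<epsilon>0: "0 < \<epsilon>0" and K: "compact K" "K \<subseteq> D"
  shows "\<exists>L0\<ge>0. \<forall>L e t t' z z'. L0 \<le> L \<and> 0 < e \<and> e < min 1 (\<epsilon>0 / 2) \<and> t \<in> {a..c} \<and> t' \<in> {a..c} \<and> z \<in> K \<and> z' \<in> K \<longrightarrow>
    norm ((Gf t z + e *\<^sub>R Hf t z e) - (Gf t' z' + e *\<^sub>R Hf t' z' e)) \<le> L * (\<bar>t - t'\<bar> + norm (z - z'))
    \<and> norm (Gf t z + e *\<^sub>R Hf t z e) \<le> L \<and> norm ((Gf t z + e *\<^sub>R Hf t z e) - Gf t z) \<le> L * e
    \<and> norm (Gf t z - Gf t' z') \<le> L * (\<bar>t - t'\<bar> + norm (z - z')) \<and> norm (Gf t z) \<le> L"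
proof -
  let ?KG = "{a..c} \<times> K" and ?KH = "{a..c} \<times> K \<times> {0..\<epsilon>0 / 2}"
  have cG: "compact ?KG" "?KG \<subseteq> UNIV \<times> D" using K by (auto intro: compact_Times)
  have cH: "compact ?KH" using K by (intro compact_Times) auto
  have sH: "?KH \<subseteq> UNIV \<times> D \<times> {-\<epsilon>0<..<\<epsilon>0}" using K \<epsilon>0 by auto
  obtain LG where LG: "LG-lipschitz_on ?KG (\<lambda>(t, z). Gf t z)" using G cG unfolding compactly_lipschitz_def by blast
  obtain LH where LH: "LH-lipschitz_on ?KH (\<lambda>(t, z, \<epsilon>). Hf t z \<epsilon>)" using H cH sH unfolding compactly_lipschitz_def by blast
  obtain BG where BG: "\<And>p. p \<in> ?KG \<Longrightarrow> norm ((\<lambda>(t, z). Gf t z) p) \<le> BG"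
    using compact_imp_bounded[OF compact_continuous_image[OF lipschitz_on_continuous_on[OF LG] cG(1)]] by (auto simp: bounded_iff)
  obtain BH where BH: "\<And>p. p \<in> ?KH \<Longrightarrow> norm ((\<lambda>(t, z, \<epsilon>). Hf t z \<epsilon>) p) \<le> BH"
    using compact_imp_bounded[OF compact_continuous_image[OF lipschitz_on_continuous_on[OF LH] cH]] by (auto simp: bounded_iff)
  define L0 where "L0 = LG + LH + \<bar>BG\<bar> + \<bar>BH\<bar>"
  have nn: "0 \<le> LG" "0 \<le> LH" using lipschitz_on_nonneg[OF LG] lipschitz_on_nonneg[OF LH] by auto
  have "norm ((Gf t z + e *\<^sub>R Hf t z e) - (Gf t' z' + e *\<^sub>R Hf t' z' e)) \<le> L * (\<bar>t - t'\<bar> + norm (z - z'))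
    \<and> norm (Gf t z + e *\<^sub>R Hf t z e) \<le> L \<and> norm ((Gf t z + e *\<^sub>R Hf t z e) - Gf t z) \<le> L * e
    \<and> norm (Gf t z - Gf t' z') \<le> L * (\<bar>t - t'\<bar> + norm (z - z')) \<and> norm (Gf t z) \<le> L"
    if L: "L0 \<le> L" and e: "0 < e" "e < min 1 (\<epsilon>0 / 2)" and t: "t \<in> {a..c}" "t' \<in> {a..c}" and z: "z \<in> K" "z' \<in> K" for L e t t' z z'
  proof -
    let ?d = "\<bar>t - t'\<bar> + norm (z - z')"
    have d0: "0 \<le> ?d" by simp
    have pairs: "(t, z) \<in> ?KG" "(t', z') \<in> ?KG" "(t, z, e) \<in> ?KH" "(t', z', e) \<in> ?KH" using e t z by auto
    have dG: "dist (t, z) (t', z') \<le> ?d"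
      unfolding dist_Pair_Pair using sqrt_sum_squares_le_sum[of "dist t t'" "dist z z'"] by (simp add: dist_real_def dist_norm)
    have dH: "dist (t, z, e) (t', z', e) \<le> ?d"
      unfolding dist_Pair_Pair using sqrt_sum_squares_le_sum[of "dist t t'" "dist z z'"] by (simp add: dist_real_def dist_norm)
    have gl: "norm (Gf t z - Gf t' z') \<le> LG * ?d"
      using order_trans[OF lipschitz_onD[OF LG pairs(1,2)] mult_left_mono[OF dG nn(1)]] by (simp add: dist_norm)
    have hl: "norm (Hf t z e - Hf t' z' e) \<le> LH * ?d"
      using order_trans[OF lipschitz_onD[OF LH pairs(3,4)] mult_left_mono[OF dH nn(2)]] by (simp add: dist_norm)
    have gb: "norm (Gf t z) \<le> \<bar>BG\<bar>" using BG[OF pairs(1)] by simp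
    have hb: "norm (Hf t z e) \<le> \<bar>BH\<bar>" using BH[OF pairs(3)] by simp
    have e1: "e \<le> 1" using e by simp
    have "e * norm (Hf t z e - Hf t' z' e) \<le> 1 * (LH * ?d)" using e e1 hl by (intro mult_mono) auto
    then have "norm (e *\<^sub>R (Hf t z e - Hf t' z' e)) \<le> LH * ?d" using e by simp
    moreover have eq: "(Gf t z + e *\<^sub>R Hf t z e) - (Gf t' z' + e *\<^sub>R Hf t' z' e) = (Gf t z - Gf t' z') + e *\<^sub>R (Hf t z e - Hf t' z' e)"
      by (simp add: algebra_simps)
    ultimately have "norm ((Gf t z + e *\<^sub>R Hf t z e) - (Gf t' z' + e *\<^sub>R Hf t' z' e)) \<le> LG * ?d + LH * ?d"
      unfolding eq using gl norm_triangle_ineq[of "Gf t z - Gf t' z'" "e *\<^sub>R (Hf t z e - Hf t' z' e)"] by linarith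
    also have "\<dots> = (LG + LH) * ?d" by (simp add: distrib_right)
    also have "\<dots> \<le> L * ?d" using L unfolding L0_def by (intro mult_right_mono d0) linarith
    finally have 1: "norm ((Gf t z + e *\<^sub>R Hf t z e) - (Gf t' z' + e *\<^sub>R Hf t' z' e)) \<le> L * ?d" .
    have "norm (e *\<^sub>R Hf t z e) \<le> 1 * \<bar>BH\<bar>" unfolding norm_scaleR using e e1 hb by (intro mult_mono) auto
    then have 2: "norm (Gf t z + e *\<^sub>R Hf t z e) \<le> L"
      using norm_triangle_ineq[of "Gf t z" "e *\<^sub>R Hf t z e"] gb L nn unfolding L0_def by linarith
    have "norm (Hf t z e) \<le> L" using hb L nn unfolding L0_def by linarith
    then have 3: "norm ((Gf t z + e *\<^sub>R Hf t z e) - Gf t z) \<le> L * e" using e by (simp add: mult.commute)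
    have "LG * ?d \<le> L * ?d" using L nn unfolding L0_def by (intro mult_right_mono d0) linarith
    then have 4: "norm (Gf t z - Gf t' z') \<le> L * ?d" using gl by linarith
    have 5: "norm (Gf t z) \<le> L" using gb L nn unfolding L0_def by linarith
    from 1 2 3 4 5 show ?thesis by blast
  qed
  note main = this
  have "0 \<le> L0" using nn by (simp add: L0_def)
  then show ?thesis by (intro exI[of _ L0] conjI allI impI) (assumption, (elim conjE, rule main[THEN conjunct1]; assumption)
    , (elim conjE, rule main[THEN conjunct2, THEN conjunct1]; assumption)
    , (elim conjE, rule main[THEN conjunct2, THEN conjunct2, THEN conjunct1]; assumption)
    , (elim conjE, rule main[THEN conjunct2, THEN conjunct2, THEN conjunct2, THEN conjunct1]; assumption)
    , (elim conjE, rule main[THEN conjunct2, THEN conjunct2, THEN conjunct2, THEN conjunct2]; assumption))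
qed

lemma smooth_compactly_lipschitz: "open S \<Longrightarrow> smooth_on S f \<Longrightarrow> compactly_lipschitz S f"
  by (rule Ck_on_Suc_0_compactly_lipschitz) (auto simp only: smooth_on_def)

lemma smooth_time_derivative:
  fixes Gf :: "real \<Rightarrow> real^2 \<Rightarrow> real^2"
  assumes "smooth_on (UNIV \<times> D) (\<lambda>(t, z). Gf t z)"
  obtains G' where "continuous_on (UNIV \<times> D) (\<lambda>(t, z). G' t z)"
    "\<And>t z. z \<in> D \<Longrightarrow> ((\<lambda>t. Gf t z) has_vector_derivative G' t z) (at t)"
proof -
  let ?f = "\<lambda>(t, z). Gf t z"
  have "Ck_on (Suc 0) (UNIV \<times> D) ?f" using assms by (simp only: smooth_on_def)
  then have diff: "\<And>p. p \<in> UNIV \<times> D \<Longrightarrow> ?f differentiable (at p)"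
    and cont: "continuous_on (UNIV \<times> D) (\<lambda>p. frechet_derivative ?f (at p) (1, 0))" by auto
  define G' where "G' t z = frechet_derivative ?f (at (t, z)) (1, 0)" for t z
  have "((\<lambda>t. Gf t z) has_vector_derivative G' t z) (at t)" if z: "z \<in> D" for t z
  proof -
    have "(?f has_derivative frechet_derivative ?f (at (t, z))) (at (t, z))"
      using diff[of "(t, z)"] z frechet_derivative_works by blast
    moreover have "((\<lambda>t. (t, z)) has_vector_derivative (1, 0)) (at t)"
      by (auto intro!: derivative_eq_intros simp: has_vector_derivative_def)
    ultimately have "((?f \<circ> (\<lambda>t. (t, z))) has_vector_derivative frechet_derivative ?f (at (t, z)) (1, 0)) (at t)"
      by (intro vector_derivative_diff_chain_within) (auto intro: has_derivative_at_withinI)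
    then show ?thesis by (simp add: o_def G'_def)
  qed
  moreover have "continuous_on (UNIV \<times> D) (\<lambda>(t, z). G' t z)" using cont by (simp add: G'_def case_prod_beta)
  ultimately show ?thesis using that by blast
qed

lemma (in fold_orbit) fold_tube_exists: "\<exists>\<delta> L0. \<forall>L\<ge>L0. fold_tube F D \<gamma> \<sigma> xv \<alpha> b \<delta> L"
proof -
  obtain \<delta> L0 where \<delta>: "0 < \<delta>" "0 \<le> L0" "compact (tube \<delta>)" "tube \<delta> \<subseteq> D"
    and a: "\<forall>x\<in>tube \<delta>. \<forall>y\<in>tube \<delta>. norm (F x - F y) \<le> L0 * norm (x - y)"
    and c: "\<forall>x\<in>tube \<delta>. norm (F x) \<le> L0"
    and d: "\<forall>x\<in>tube \<delta>. \<forall>v. norm (DF x v) \<le> L0 * norm v"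
    and f: "\<forall>x\<in>tube \<delta>. \<forall>y\<in>tube \<delta>. \<forall>v. norm (DF x v - DF y v) \<le> L0 * norm (x - y) * norm v"
    using tube_constants_exist by blast
  have "fold_tube F D \<gamma> \<sigma> xv \<alpha> b \<delta> L" if L: "L0 \<le> L" for L
  proof (intro fold_tube.intro fold_tube_axioms.intro fold_orbit_axioms \<delta>(1,3,4))
    show "0 \<le> L" using L \<delta> by simp
    fix x y v assume x: "x \<in> tube \<delta>"
    show "norm (F x) \<le> L" using c x L by force
    show "norm (DF x v) \<le> L * norm v" by (rule order_trans[OF d[rule_format, OF x] mult_right_mono[OF L norm_ge_zero]])
    assume y: "y \<in> tube \<delta>"
    show "norm (F x - F y) \<le> L * norm (x - y)" by (rule order_trans[OF a[rule_format, OF x y] mult_right_mono[OF L norm_ge_zero]])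
    have "norm (DF x v - DF y v) \<le> L0 * (norm (x - y) * norm v)" using f x y by (simp add: mult.assoc)
    also have "\<dots> \<le> L * (norm (x - y) * norm v)" using L by (intro mult_right_mono) auto
    finally show "norm (DF x v - DF y v) \<le> L * norm (x - y) * norm v" by (simp add: mult.assoc)
  qed
  then show ?thesis by blast
qed

text \<open>Differentiation under the integral sign; through it the Melnikov function is seen to be
  differentiable at \<open>\<theta>\<close>.\<close>

lemma (in half) J_has_derivative:
  assumes g': "\<And>t z. z \<in> D \<Longrightarrow> ((\<lambda>t. g t z) has_vector_derivative g' t z) (at t)"
    and cont: "continuous_on (UNIV \<times> D) (\<lambda>(t, z). g' t z)"
  shows "(J has_vector_derivative integral {0..\<sigma>} (\<lambda>s. Z s (g' (\<theta> + s) (\<gamma> s)))) (at \<theta>)"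
proof -
  let ?U = "{\<theta>-1..\<theta>+1}"
  have "((\<lambda>t. integral (cbox 0 \<sigma>) (\<lambda>s. Z s (g (t + s) (\<gamma> s)))) has_vector_derivative
      integral (cbox 0 \<sigma>) (\<lambda>s. Z s (g' (\<theta> + s) (\<gamma> s)))) (at \<theta> within ?U)"
  proof (rule leibniz_rule_vector_derivative[where fx = "\<lambda>t s. Z s (g' (t + s) (\<gamma> s))"])
    show "((\<lambda>t. Z s (g (t + s) (\<gamma> s))) has_vector_derivative Z s (g' (t + s) (\<gamma> s))) (at t within ?U)"
      if "t \<in> ?U" "s \<in> cbox 0 \<sigma>" for t s
    proof -
      have s: "s \<in> {0..\<sigma>}" using that by simp
      have "((\<lambda>t. t + s) has_vector_derivative 1) (at t)" by (auto intro!: derivative_eq_intros)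
      from vector_diff_chain_at[OF this g'[OF \<gamma>_in_D[OF s]]]
      have "((\<lambda>t. g (t + s) (\<gamma> s)) has_vector_derivative g' (t + s) (\<gamma> s)) (at t)" by (simp add: o_def)
      moreover have "bounded_linear (Z s)" using linear_Z linear_conv_bounded_linear by blast
      ultimately show ?thesis
        by (metis bounded_linear.has_vector_derivative has_vector_derivative_at_within)
    qed
    show "(\<lambda>s. Z s (g (t + s) (\<gamma> s))) integrable_on cbox 0 \<sigma>" if "t \<in> ?U" for t
      unfolding cbox_interval by (intro integrable_continuous_real Z_continuous g_\<gamma>_continuous that)
    show "continuous_on (?U \<times> cbox 0 \<sigma>) (\<lambda>(t, s). Z s (g' (t + s) (\<gamma> s)))"
    proof -
      have 1: "continuous_on (?U \<times> {0..\<sigma>}) (\<lambda>p. \<gamma> (snd p))"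
        by (rule continuous_on_compose2[OF \<gamma>_continuous]) (auto intro!: continuous_intros)
      have "continuous_on (?U \<times> {0..\<sigma>}) (\<lambda>p. (\<lambda>(t, z). g' t z) (fst p + snd p, \<gamma> (snd p)))"
        by (rule continuous_on_compose2[OF cont]) (use \<gamma>_in_D in \<open>auto intro!: continuous_intros 1\<close>)
      moreover have "continuous_on (?U \<times> {0..\<sigma>}) (\<lambda>p. adj h (snd p))" for h
        by (rule continuous_on_compose2[OF adj_continuous]) (auto intro!: continuous_intros)
      ultimately show ?thesis unfolding Z_eq case_prod_beta cbox_interval by (intro continuous_intros) simp_all
    qed
  qed auto
  then show ?thesis by (simp add: J_def[abs_def] at_within_Icc_at)
qed

lemma dF2_dx_eq:
  assumes "(F has_derivative F') (at (on_axis x))"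
  shows "((\<lambda>s. F (on_axis s) $ 2) has_real_derivative F' (on_axis 1) $ 2) (at x)"
    and "dF2_dx F (on_axis x) = F' (on_axis 1) $ 2"
proof -
  have "(on_axis has_vector_derivative on_axis 1) (at x)"
    using bounded_linear.has_vector_derivative[OF bounded_linear_on_axis has_vector_derivative_id] by simp
  from vector_derivative_diff_chain_within[OF this has_derivative_at_withinI[OF assms]]
  have "((F \<circ> on_axis) has_vector_derivative F' (on_axis 1)) (at x)" .
  then show d: "((\<lambda>s. F (on_axis s) $ 2) has_real_derivative F' (on_axis 1) $ 2) (at x)"
    using has_vector_derivative_nth[of "F \<circ> on_axis"] by simp
  then show "dF2_dx F (on_axis x) = F' (on_axis 1) $ 2"
    unfolding dF2_dx_def on_axis_def[symmetric] on_axis_nth by (rule DERIV_imp_deriv)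
qed

section \<open>Consequences of the fold and return hypotheses\<close>

text \<open>For the last clause: an upward start would lift the orbit above the axis at once,
  against the return hypothesis.\<close>

lemma return_orbit:
  assumes D: "open D" and F: "Ck_on 2 D F" and ret: "return_hyp F D xi xv \<sigma>" and x: "x \<in> {xi<..xv}"
  obtains \<gamma> where "0 < \<sigma> x" "ode_solution F D {0..\<sigma> x} \<gamma>" "\<gamma> 0 = on_axis x"
    "\<And>t. t \<in> {0<..<\<sigma> x} \<Longrightarrow> \<gamma> t $ 2 < 0" "\<gamma> (\<sigma> x) $ 2 = 0" "F (\<gamma> (\<sigma> x)) $ 2 \<noteq> 0"
    "F (on_axis x) $ 2 \<le> 0"
proof -
  have pos: "0 < \<sigma> x" and ex: "flow_exists F D (\<sigma> x) (on_axis x)"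
    and neg: "\<forall>t\<in>{0<..<\<sigma> x}. flow F D t (on_axis x) $ 2 < 0"
    and zero: "flow F D (\<sigma> x) (on_axis x) $ 2 = 0" "F (flow F D (\<sigma> x) (on_axis x)) $ 2 \<noteq> 0"
    using ret x unfolding return_hyp_def by blast+
  obtain \<gamma> where \<gamma>: "ode_solution F D {0..\<sigma> x} \<gamma>" "\<gamma> 0 = on_axis x"
    using ex pos unfolding flow_exists_def closed_segment_eq_real_ivl by auto
  have flow: "flow F D t (on_axis x) = \<gamma> t" if t: "t \<in> {0..\<sigma> x}" for t
  proof (rule flow_eq[OF D Ck_on_2_imp_Suc_0[OF F]])
    show "ode_solution F D {0..t} \<gamma>"
      unfolding ode_solution_def
    proof
      fix s assume s: "s \<in> {0..t}"
      then have "\<gamma> s \<in> D" "(\<gamma> has_vector_derivative F (\<gamma> s)) (at s within {0..\<sigma> x})"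
        using \<gamma>(1) t unfolding ode_solution_def by auto
      then show "\<gamma> s \<in> D \<and> (\<gamma> has_vector_derivative F (\<gamma> s)) (at s within {0..t})"
        using t by (auto intro: has_vector_derivative_within_subset)
    qed
  qed (use \<gamma> t in auto)
  have below: "\<gamma> t $ 2 < 0" if "t \<in> {0<..<\<sigma> x}" for t using neg flow[of t] that by force
  have "F (on_axis x) $ 2 \<le> 0"
  proof (rule ccontr)
    assume "\<not> ?thesis"
    then have up: "0 < F (\<gamma> 0) $ 2" by (simp add: \<gamma>)
    have "(\<gamma> has_vector_derivative F (\<gamma> 0)) (at 0 within {0..\<sigma> x})" using \<gamma>(1) pos unfolding ode_solution_def by force
    then have "((\<lambda>t. \<gamma> t $ 2) has_real_derivative F (\<gamma> 0) $ 2) (at 0 within {0..\<sigma> x})"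
      by (rule has_vector_derivative_nth)
    from has_real_derivative_pos_inc_right[OF this up]
    obtain d where d: "0 < d" "\<And>h. 0 < h \<Longrightarrow> 0 + h \<in> {0..\<sigma> x} \<Longrightarrow> h < d \<Longrightarrow> \<gamma> 0 $ 2 < \<gamma> (0 + h) $ 2" by blast
    define h where "h = min d (\<sigma> x) / 2"
    have h: "0 < h" "h < d" "h < \<sigma> x" using d pos by (auto simp: h_def min_def)
    show False using d(2)[of h] below[of h] h \<gamma>(2) by simp
  qed
  with that \<gamma> pos below zero flow[of "\<sigma> x"] show ?thesis by force
qed

text \<open>A negative slope at the fold would make \<open>F (on_axis x) $ 2\<close> positive just
  left of \<open>xv\<close>, where orbits leave downwards. So the slope is positive and
  \<open>F (on_axis xv) $ 1\<close> is negative. Arrival from below together with transversality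
  fixes the sign at the end.\<close>

lemma fold_orbit_exists:
  assumes D: "open D" and F: "Ck_on 2 D F" and folds: "fold_hyp F D xi xv" and ret: "return_hyp F D xi xv \<sigma>"
  shows "\<exists>\<gamma>. fold_orbit F D \<gamma> (\<sigma> xv) xv (- (F (on_axis xv) $ 1)) (dF2_dx F (on_axis xv))"
proof -
  have xs: "xi < xv" "on_axis xv \<in> D" and F0: "F (on_axis xv) $ 2 = 0"
    and prod: "dF2_dx F (on_axis xv) * F (on_axis xv) $ 1 < 0"
    using folds unfolding fold_hyp_def by auto
  have "F differentiable (at (on_axis xv))" using F xs by (simp add: numeral_2_eq_2)
  then have F': "(F has_derivative frechet_derivative F (at (on_axis xv))) (at (on_axis xv))"
    by (simp only: frechet_derivative_works)
  note dF = dF2_dx_eq[OF F']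
  have "0 \<le> dF2_dx F (on_axis xv)"
  proof (rule ccontr)
    assume "\<not> ?thesis"
    then have "frechet_derivative F (at (on_axis xv)) (on_axis 1) $ 2 < 0" using dF(2) by simp
    from has_real_derivative_neg_dec_left[OF dF(1) this]
    obtain d where d: "0 < d" "\<And>h. 0 < h \<Longrightarrow> h < d \<Longrightarrow> F (on_axis xv) $ 2 < F (on_axis (xv - h)) $ 2" by auto
    define h where "h = min d (xv - xi) / 2"
    have h: "0 < h" "h < d" "h < xv - xi" using d xs by (auto simp: h_def min_def)
    have "F (on_axis (xv - h)) $ 2 \<le> 0"
      by (rule return_orbit[OF D F ret, of "xv - h"]) (use h in auto)
    moreover have "0 < F (on_axis (xv - h)) $ 2" using d(2)[of h] h F0 by simp
    ultimately show False by simp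
  qed
  then have b: "0 < dF2_dx F (on_axis xv)" and F1: "F (on_axis xv) $ 1 < 0"
    using prod by (auto simp: mult_less_0_iff)
  obtain \<gamma> where pos: "0 < \<sigma> xv" and \<gamma>: "ode_solution F D {0..\<sigma> xv} \<gamma>" "\<gamma> 0 = on_axis xv"
    and below: "\<And>t. t \<in> {0<..<\<sigma> xv} \<Longrightarrow> \<gamma> t $ 2 < 0" and "end": "\<gamma> (\<sigma> xv) $ 2 = 0" "F (\<gamma> (\<sigma> xv)) $ 2 \<noteq> 0"
    using return_orbit[OF D F ret, of xv] xs by auto
  have der: "\<gamma> t \<in> D" "(\<gamma> has_vector_derivative F (\<gamma> t)) (at t within {0..\<sigma> xv})" if "t \<in> {0..\<sigma> xv}" for t
    using \<gamma>(1) that unfolding ode_solution_def by auto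
  have "\<not> F (\<gamma> (\<sigma> xv)) $ 2 < 0"
  proof
    assume down: "F (\<gamma> (\<sigma> xv)) $ 2 < 0"
    have "((\<lambda>t. \<gamma> t $ 2) has_real_derivative F (\<gamma> (\<sigma> xv)) $ 2) (at (\<sigma> xv) within {0..\<sigma> xv})"
      by (intro has_vector_derivative_nth der) (use pos in simp)
    from has_real_derivative_neg_dec_left[OF this down]
    obtain d where d: "0 < d" "\<And>h. 0 < h \<Longrightarrow> \<sigma> xv - h \<in> {0..\<sigma> xv} \<Longrightarrow> h < d \<Longrightarrow> \<gamma> (\<sigma> xv) $ 2 < \<gamma> (\<sigma> xv - h) $ 2" by blast
    define h where "h = min d (\<sigma> xv) / 2"
    have h: "0 < h" "h < d" "h < \<sigma> xv" using d pos by (auto simp: h_def min_def)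
    show False using d(2)[of h] below[of "\<sigma> xv - h"] h "end" by simp
  qed
  then have "0 < F (\<gamma> (\<sigma> xv)) $ 2" using "end" by linarith
  moreover have "F (on_axis xv) = on_axis (- (- (F (on_axis xv) $ 1)))" using F0 by (simp add: vec2_eq_iff)
  ultimately have "fold_orbit F D \<gamma> (\<sigma> xv) xv (- (F (on_axis xv) $ 1)) (dF2_dx F (on_axis xv))"
    using D F pos der \<gamma>(2) below "end" F1 b dF(2) by unfold_locales auto
  then show ?thesis by blast
qed

text \<open>Both systems must share \<open>\<delta>\<close> and \<open>L\<close>, since
  \<open>two_halves\<close> treats them as perturbations over one tube. For the upper field the
  bounds are taken on the reflected tube and the reflected time window.\<close>

lemma (in fold_orbit) halves_exist:
  fixes Gp Gm :: "real \<Rightarrow> real^2 \<Rightarrow> real^2" and Hp Hm :: "real \<Rightarrow> real^2 \<Rightarrow> real \<Rightarrow> real^2"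
  assumes sym: "reflect ` D = D" and \<epsilon>0: "0 < \<epsilon>0"
    and G: "smooth_on (UNIV \<times> D) (\<lambda>(t, z). Gp t z)" "smooth_on (UNIV \<times> D) (\<lambda>(t, z). Gm t z)"
    and H: "smooth_on (UNIV \<times> D \<times> {-\<epsilon>0<..<\<epsilon>0}) (\<lambda>(t, z, \<epsilon>). Hp t z \<epsilon>)"
      "smooth_on (UNIV \<times> D \<times> {-\<epsilon>0<..<\<epsilon>0}) (\<lambda>(t, z, \<epsilon>). Hm t z \<epsilon>)"
  shows "\<exists>\<delta> L. half F D \<gamma> \<sigma> xv \<alpha> b \<delta> L Gm (\<lambda>e t z. Gm t z + e *\<^sub>R Hm t z e) \<theta> (min 1 (\<epsilon>0 / 2))
    \<and> half F D \<gamma> \<sigma> xv \<alpha> b \<delta> L (\<lambda>t z. - reflect (Gp (- t) (reflect z)))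
        (\<lambda>e t z. - reflect (Gp (- t) (reflect z) + e *\<^sub>R Hp (- t) (reflect z) e)) (- \<theta>) (min 1 (\<epsilon>0 / 2))"
proof -
  obtain \<delta> L0 where tube: "\<And>L. L0 \<le> L \<Longrightarrow> fold_tube F D \<gamma> \<sigma> xv \<alpha> b \<delta> L" using fold_tube_exists by blast
  interpret t: fold_tube F D \<gamma> \<sigma> xv \<alpha> b \<delta> L0 by (rule tube) simp
  have K: "compact (tube \<delta>)" "tube \<delta> \<subseteq> D" by (rule t.tube_compact t.tube_D)+
  have K': "compact (reflect ` tube \<delta>)" "reflect ` tube \<delta> \<subseteq> D"
    using K sym by (auto intro!: compact_continuous_image linear_continuous_on bounded_linear_reflect)
  have oD: "open ((UNIV :: real set) \<times> D)" "open ((UNIV :: real set) \<times> D \<times> {-\<epsilon>0<..<\<epsilon>0})"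
    by (intro open_Times open_D open_UNIV open_greaterThanLessThan)+
  note lip = smooth_compactly_lipschitz[OF oD(1) G(1)] smooth_compactly_lipschitz[OF oD(1) G(2)]
    smooth_compactly_lipschitz[OF oD(2) H(1)] smooth_compactly_lipschitz[OF oD(2) H(2)]
  obtain Lm where Lm: "\<forall>L e t t' z z'. Lm \<le> L \<and> 0 < e \<and> e < min 1 (\<epsilon>0 / 2) \<and> t \<in> {\<theta>-2..\<theta>+\<sigma>+3} \<and> t' \<in> {\<theta>-2..\<theta>+\<sigma>+3}
      \<and> z \<in> tube \<delta> \<and> z' \<in> tube \<delta> \<longrightarrow>
    norm ((Gm t z + e *\<^sub>R Hm t z e) - (Gm t' z' + e *\<^sub>R Hm t' z' e)) \<le> L * (\<bar>t - t'\<bar> + norm (z - z'))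
    \<and> norm (Gm t z + e *\<^sub>R Hm t z e) \<le> L \<and> norm ((Gm t z + e *\<^sub>R Hm t z e) - Gm t z) \<le> L * e
    \<and> norm (Gm t z - Gm t' z') \<le> L * (\<bar>t - t'\<bar> + norm (z - z')) \<and> norm (Gm t z) \<le> L"
    using perturbation_bounds[OF lip(2,4) \<epsilon>0 K] by blast
  obtain Lp where Lp: "\<forall>L e t t' z z'. Lp \<le> L \<and> 0 < e \<and> e < min 1 (\<epsilon>0 / 2) \<and> t \<in> {\<theta>-\<sigma>-3..\<theta>+2} \<and> t' \<in> {\<theta>-\<sigma>-3..\<theta>+2}
      \<and> z \<in> reflect ` tube \<delta> \<and> z' \<in> reflect ` tube \<delta> \<longrightarrow>
    norm ((Gp t z + e *\<^sub>R Hp t z e) - (Gp t' z' + e *\<^sub>R Hp t' z' e)) \<le> L * (\<bar>t - t'\<bar> + norm (z - z'))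
    \<and> norm (Gp t z + e *\<^sub>R Hp t z e) \<le> L \<and> norm ((Gp t z + e *\<^sub>R Hp t z e) - Gp t z) \<le> L * e
    \<and> norm (Gp t z - Gp t' z') \<le> L * (\<bar>t - t'\<bar> + norm (z - z')) \<and> norm (Gp t z) \<le> L"
    using perturbation_bounds[OF lip(1,3) \<epsilon>0 K'] by blast
  define L where "L = max L0 (max Lm Lp)"
  have LL: "L0 \<le> L" "Lm \<le> L" "Lp \<le> L" by (auto simp: L_def)
  interpret t': fold_tube F D \<gamma> \<sigma> xv \<alpha> b \<delta> L by (rule tube) (rule LL)
  let ?e0 = "min 1 (\<epsilon>0 / 2)"
  \<comment> \<open>Bounds that concern \<open>Gm\<close> or \<open>Gp\<close> alone are read off
    from the joint statement at this admissible value of \<open>e\<close>.\<close>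
  have mid: "0 < ?e0 / 2" "?e0 / 2 < ?e0" using \<epsilon>0 by auto
  have hm: "half F D \<gamma> \<sigma> xv \<alpha> b \<delta> L Gm (\<lambda>e t z. Gm t z + e *\<^sub>R Hm t z e) \<theta> ?e0"
  proof (intro half.intro half_axioms.intro t'.fold_tube_axioms)
    show "?e0 \<le> 1" by simp
  next
    fix e t t' z z' assume a: "0 < e" "e < ?e0" "t \<in> {\<theta>-2..\<theta>+\<sigma>+3}" "t' \<in> {\<theta>-2..\<theta>+\<sigma>+3}" "z \<in> tube \<delta>" "z' \<in> tube \<delta>"
    show "norm ((Gm t z + e *\<^sub>R Hm t z e) - (Gm t' z' + e *\<^sub>R Hm t' z' e)) \<le> L * (\<bar>t - t'\<bar> + norm (z - z'))"
      using Lm LL(2) a by blast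
  next
    fix e t z assume a: "0 < e" "e < ?e0" "t \<in> {\<theta>-2..\<theta>+\<sigma>+3}" "z \<in> tube \<delta>"
    show "norm (Gm t z + e *\<^sub>R Hm t z e) \<le> L" "norm ((Gm t z + e *\<^sub>R Hm t z e) - Gm t z) \<le> L * e"
      using Lm LL(2) a by blast+
  next
    fix t t' z z' assume a: "t \<in> {\<theta>-2..\<theta>+\<sigma>+3}" "t' \<in> {\<theta>-2..\<theta>+\<sigma>+3}" "z \<in> tube \<delta>" "z' \<in> tube \<delta>"
    show "norm (Gm t z - Gm t' z') \<le> L * (\<bar>t - t'\<bar> + norm (z - z'))"
      using Lm LL(2) a mid by blast
  next
    fix t z assume a: "t \<in> {\<theta>-2..\<theta>+\<sigma>+3}" "z \<in> tube \<delta>"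
    show "norm (Gm t z) \<le> L" using Lm LL(2) a mid by blast
  qed
  have refl: "norm (- reflect a - - reflect c) = norm (a - c)" for a c
  proof -
    have "- reflect a - - reflect c = - reflect (a - c)" by (simp add: reflect_simps)
    then show ?thesis by simp
  qed
  have dist: "\<bar>- t - - t'\<bar> + norm (reflect z - reflect z') = \<bar>t - t'\<bar> + norm (z - z')" for t t' :: real and z z'
    using norm_reflect[of "z - z'"] by (simp add: reflect_simps abs_minus_commute del: norm_reflect)
  have range: "- t \<in> {\<theta>-\<sigma>-3..\<theta>+2}" if "t \<in> {- \<theta> - 2..- \<theta> + \<sigma> + 3}" for t using that by auto
  have hp: "half F D \<gamma> \<sigma> xv \<alpha> b \<delta> L (\<lambda>t z. - reflect (Gp (- t) (reflect z)))
        (\<lambda>e t z. - reflect (Gp (- t) (reflect z) + e *\<^sub>R Hp (- t) (reflect z) e)) (- \<theta>) ?e0"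
  proof (intro half.intro half_axioms.intro t'.fold_tube_axioms, unfold refl norm_minus_cancel norm_reflect)
    show "?e0 \<le> 1" by simp
  next
    fix e t t' z z' assume a: "0 < e" "e < ?e0" and t: "t \<in> {- \<theta> - 2..- \<theta> + \<sigma> + 3}" "t' \<in> {- \<theta> - 2..- \<theta> + \<sigma> + 3}" and z: "z \<in> tube \<delta>" "z' \<in> tube \<delta>"
    show "norm ((Gp (- t) (reflect z) + e *\<^sub>R Hp (- t) (reflect z) e) - (Gp (- t') (reflect z') + e *\<^sub>R Hp (- t') (reflect z') e)) \<le> L * (\<bar>t - t'\<bar> + norm (z - z'))"
      using Lp LL(3) a range[OF t(1)] range[OF t(2)] imageI[OF z(1), of reflect] imageI[OF z(2), of reflect] unfolding dist[of t t' z z', symmetric] by blast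
  next
    fix e t z assume a: "0 < e" "e < ?e0" and t: "t \<in> {- \<theta> - 2..- \<theta> + \<sigma> + 3}" and z: "z \<in> tube \<delta>"
    show "norm (Gp (- t) (reflect z) + e *\<^sub>R Hp (- t) (reflect z) e) \<le> L" "norm ((Gp (- t) (reflect z) + e *\<^sub>R Hp (- t) (reflect z) e) - Gp (- t) (reflect z)) \<le> L * e"
      using Lp LL(3) a range[OF t] imageI[OF z, of reflect] by blast+
  next
    fix t t' z z' assume t: "t \<in> {- \<theta> - 2..- \<theta> + \<sigma> + 3}" "t' \<in> {- \<theta> - 2..- \<theta> + \<sigma> + 3}" and z: "z \<in> tube \<delta>" "z' \<in> tube \<delta>"
    show "norm (Gp (- t) (reflect z) - Gp (- t') (reflect z')) \<le> L * (\<bar>t - t'\<bar> + norm (z - z'))"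
      using Lp LL(3) mid range[OF t(1)] range[OF t(2)] imageI[OF z(1), of reflect] imageI[OF z(2), of reflect] unfolding dist[of t t' z z', symmetric] by blast
  next
    fix t z assume t: "t \<in> {- \<theta> - 2..- \<theta> + \<sigma> + 3}" and z: "z \<in> tube \<delta>"
    show "norm (Gp (- t) (reflect z)) \<le> L" using Lp LL(3) mid range[OF t] imageI[OF z, of reflect] by blast
  qed
  from hm hp show ?thesis by blast
qed

section \<open>The Melnikov integrals in terms of the fundamental solution\<close>

context fold_tube
begin

lemma flow_deriv_integral:
  assumes f: "continuous_on {0..\<sigma>} f"
  shows "flow_deriv F D \<sigma> (on_axis xv) *v integral {0..\<sigma>} (\<lambda>t. matrix_inv (flow_deriv F D t (on_axis xv)) *v f t)
    = Y \<sigma> (integral {0..\<sigma>} (\<lambda>t. Z t (f t)))"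
proof -
  have "integral {0..\<sigma>} (\<lambda>t. matrix_inv (flow_deriv F D t (on_axis xv)) *v f t) = integral {0..\<sigma>} (\<lambda>t. Z t (f t))"
    by (intro integral_cong flow_deriv_inv_mult)
  then show ?thesis using \<sigma>_pos by (simp add: flow_deriv_mult)
qed

lemma integral_Z_add:
  assumes "continuous_on {0..\<sigma>} f" "continuous_on {0..\<sigma>} g"
  shows "integral {0..\<sigma>} (\<lambda>t. Z t (f t + g t)) = integral {0..\<sigma>} (\<lambda>t. Z t (f t)) + integral {0..\<sigma>} (\<lambda>t. Z t (g t))"
  unfolding linear_add[OF linear_Z]
  by (intro integral_add integrable_continuous_real Z_continuous assms)

lemma integral_Z_diff:
  assumes "continuous_on {0..\<sigma>} f" "continuous_on {0..\<sigma>} g"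
  shows "integral {0..\<sigma>} (\<lambda>t. Z t (f t - g t)) = integral {0..\<sigma>} (\<lambda>t. Z t (f t)) - integral {0..\<sigma>} (\<lambda>t. Z t (g t))"
  unfolding linear_diff[OF linear_Z]
  by (intro integral_diff integrable_continuous_real Z_continuous assms)

end

theorem theoremB:
  fixes F :: "real^2 \<Rightarrow> real^2" and D :: "(real^2) set"
    and xi xv :: real and \<sigma> :: "real \<Rightarrow> real"
    and Gp Gm :: "real \<Rightarrow> real^2 \<Rightarrow> real^2"
    and Hp Hm :: "real \<Rightarrow> real^2 \<Rightarrow> real \<Rightarrow> real^2"
    and \<epsilon>0 \<sigma>v \<theta> C :: real
    and pv qv :: "real^2"
    and Xp Xm :: "real \<Rightarrow> real \<Rightarrow> real^2 \<Rightarrow> real^2"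
  defines "pv \<equiv> on_axis xv" and "\<sigma>v \<equiv> \<sigma> xv" and "qv \<equiv> flow F D \<sigma>v pv"
    and "Xp \<equiv> perturbed_field (upper_field F) Gp Hp"
    and "Xm \<equiv> perturbed_field F Gm Hm"
    and "C \<equiv> 2 * F qv $ 2 / (F pv $ 1 * dF2_dx F pv) * max (Gp \<theta> pv $ 2) (Gm \<theta> pv $ 2)"
  assumes D: "open D" "bounded D" "reflect ` D = D"
    and F: "Ck_on 2 D F"
    and folds: "fold_hyp F D xi xv"
    and returns: "return_hyp F D xi xv \<sigma>"
    and eps0: "\<epsilon>0 > 0"
    and smooth_G: "smooth_on (UNIV \<times> D) (\<lambda>(t, z). Gp t z)"
      "smooth_on (UNIV \<times> D) (\<lambda>(t, z). Gm t z)"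
    and smooth_H: "smooth_on (UNIV \<times> D \<times> {-\<epsilon>0<..<\<epsilon>0}) (\<lambda>(t, z, \<epsilon>). Hp t z \<epsilon>)"
      "smooth_on (UNIV \<times> D \<times> {-\<epsilon>0<..<\<epsilon>0}) (\<lambda>(t, z, \<epsilon>). Hm t z \<epsilon>)"
    and periodic_G: "\<And>t z. z \<in> D \<Longrightarrow> Gp (t + 2 * \<sigma>v) z = Gp t z"
      "\<And>t z. z \<in> D \<Longrightarrow> Gm (t + 2 * \<sigma>v) z = Gm t z"
    and periodic_H:
      "\<And>t z \<epsilon>. z \<in> D \<Longrightarrow> \<epsilon> \<in> {-\<epsilon>0<..<\<epsilon>0} \<Longrightarrow> Hp (t + 2 * \<sigma>v) z \<epsilon> = Hp t z \<epsilon>"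
      "\<And>t z \<epsilon>. z \<in> D \<Longrightarrow> \<epsilon> \<in> {-\<epsilon>0<..<\<epsilon>0} \<Longrightarrow> Hm (t + 2 * \<sigma>v) z \<epsilon> = Hm t z \<epsilon>"
    and zero: "melnikov F D \<sigma> Gm Gp \<theta> xv = 0"
    and simple: "deriv (\<lambda>s. melnikov F D \<sigma> Gm Gp s xv) \<theta> \<noteq> 0"
  shows "(Gp \<theta> pv $ 2 \<noteq> Gm \<theta> pv $ 2 \<and> g_number F D \<sigma> xv Gm Gp \<theta> > C \<longrightarrow>
           (\<exists>K \<epsilon>1. 0 < \<epsilon>1 \<and> \<epsilon>1 \<le> \<epsilon>0 \<and>
             (\<forall>\<epsilon>. 0 < \<epsilon> \<and> \<epsilon> < \<epsilon>1 \<longrightarrow>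
               (\<exists>u t0. sliding_periodic_solution D (Xp \<epsilon>) (Xm \<epsilon>) (2 * \<sigma>v) u \<and>
                  dist (t0, u t0) (\<theta>, pv) \<le> K * \<epsilon> \<and>
                  (Gp \<theta> pv $ 2 < Gm \<theta> pv $ 2 \<longrightarrow>
                     slides_on (Xp \<epsilon>) (Xm \<epsilon>) (sliding_region (Xp \<epsilon>) (Xm \<epsilon>)) u) \<and>
                  (Gp \<theta> pv $ 2 > Gm \<theta> pv $ 2 \<longrightarrow>
                     slides_on (Xp \<epsilon>) (Xm \<epsilon>) (escaping_region (Xp \<epsilon>) (Xm \<epsilon>)) u)))))
       \<and> (g_number F D \<sigma> xv Gm Gp \<theta> < C \<longrightarrow>
           (\<exists>K \<epsilon>1. 0 < \<epsilon>1 \<and> \<epsilon>1 \<le> \<epsilon>0 \<and>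
             (\<forall>\<epsilon>. 0 < \<epsilon> \<and> \<epsilon> < \<epsilon>1 \<longrightarrow>
               (\<exists>u t0. crossing_periodic_solution D (Xp \<epsilon>) (Xm \<epsilon>) (2 * \<sigma>v) u \<and>
                  dist (t0, u t0) (\<theta>, pv) \<le> K * \<epsilon>))))"
proof -
  obtain \<gamma> where "fold_orbit F D \<gamma> \<sigma>v xv (- (F pv $ 1)) (dF2_dx F pv)"
    using fold_orbit_exists[OF D(1) F folds returns] unfolding pv_def \<sigma>v_def by blast
  define \<alpha> where "\<alpha> = - (F pv $ 1)"
  define b where "b = dF2_dx F pv"
  define e0 where "e0 = min 1 (\<epsilon>0 / 2)"
  define g2 where "g2 t z = - reflect (Gp (- t) (reflect z))" for t z
  define k1 where "k1 e t z = Gm t z + e *\<^sub>R Hm t z e" for e t z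
  define k2 where "k2 e t z = - reflect (Gp (- t) (reflect z) + e *\<^sub>R Hp (- t) (reflect z) e)" for e t z
  have "fold_orbit F D \<gamma> \<sigma>v xv \<alpha> b" unfolding \<alpha>_def b_def by fact
  from fold_orbit.halves_exist[OF this D(3) eps0 smooth_G smooth_H, of \<theta>]
  obtain \<delta> L where "half F D \<gamma> \<sigma>v xv \<alpha> b \<delta> L Gm k1 \<theta> e0" "half F D \<gamma> \<sigma>v xv \<alpha> b \<delta> L g2 k2 (- \<theta>) e0"
    unfolding e0_def[symmetric] g2_def[abs_def] k1_def[abs_def] k2_def[abs_def] by blast
  interpret h1: half F D \<gamma> \<sigma>v xv \<alpha> b \<delta> L Gm k1 \<theta> e0 by fact
  interpret h2: half F D \<gamma> \<sigma>v xv \<alpha> b \<delta> L g2 k2 "- \<theta>" e0 by fact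
  have \<sigma>: "0 \<le> \<sigma>v" "\<sigma>v \<in> {0..\<sigma>v}" using h1.\<sigma>_pos by auto
  have qv: "qv = \<gamma> \<sigma>v" unfolding qv_def pv_def by (rule h1.flow_\<gamma>[OF \<sigma>(2)])
  have symD: "reflect z \<in> D" if "z \<in> D" for z using D(3) that by blast
  have cont: "continuous_on {0..\<sigma>v} (\<lambda>t. Gm (s + t) (\<gamma> t))" "continuous_on {0..\<sigma>v} (\<lambda>t. g2 (- s + t) (\<gamma> t))"
    if "s \<in> {\<theta>-1..\<theta>+1}" for s
    by (rule h1.g_\<gamma>_continuous, use that in simp) (rule h2.g_\<gamma>_continuous, use that in simp)

  define \<Phi> where "\<Phi> v = wedge (F qv) (h1.Y \<sigma>v v)" for v
  have \<Phi>: "bounded_linear \<Phi>"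
    unfolding linear_conv_bounded_linear[symmetric] \<Phi>_def[abs_def] wedge_def
    by (rule linearI) (simp_all add: linear_add[OF h1.linear_Y] linear_scale[OF h1.linear_Y] algebra_simps)
  \<comment> \<open>\<open>g2\<close> carries a minus sign, so the sum in \<open>bracket\<close>
    becomes a difference of the two fields here, and the difference in \<open>g_number\<close> a
    sum.\<close>
  have mel: "melnikov F D \<sigma> Gm Gp s xv = \<Phi> (h1.J s - h2.J (- s))" if s: "s \<in> {\<theta>-1..\<theta>+1}" for s
  proof -
    have "flow_deriv F D \<sigma>v pv *v integral {0..\<sigma>v} (\<lambda>t. matrix_inv (flow_deriv F D t pv) *v bracket Gm Gp s t (periodic_orbit F D t xv))
      = flow_deriv F D \<sigma>v pv *v integral {0..\<sigma>v} (\<lambda>t. matrix_inv (flow_deriv F D t pv) *v (Gm (s + t) (\<gamma> t) - g2 (- s + t) (\<gamma> t)))"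
      by (intro arg_cong[where f = "\<lambda>v. _ *v v"] integral_cong)
        (simp add: bracket_def periodic_orbit_def h1.flow_\<gamma> g2_def add.commute)
    also have "\<dots> = h1.Y \<sigma>v (h1.J s - h2.J (- s))"
      unfolding pv_def h1.flow_deriv_integral[OF continuous_on_diff[OF cont[OF s]]] h1.integral_Z_diff[OF cont[OF s]]
      by (simp add: h1.J_def h2.J_def)
    finally show ?thesis
      unfolding melnikov_def \<Phi>_def \<sigma>v_def[symmetric] pv_def[symmetric]
      using \<sigma>(1) by (simp add: periodic_orbit_def qv_def pv_def)
  qed
  have g_num: "g_number F D \<sigma> xv Gm Gp \<theta> = h1.Y \<sigma>v (h1.J \<theta> + h2.J (- \<theta>)) $ 2"
  proof -
    have \<theta>: "\<theta> \<in> {\<theta>-1..\<theta>+1}" by simp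
    have row: "row 2 A \<bullet> v = (A *v v) $ 2" for A :: "real^2^2" and v
      by (simp add: row_def matrix_vector_mul_component)
    have "flow_deriv F D \<sigma>v pv *v integral {0..\<sigma>v} (\<lambda>t. matrix_inv (flow_deriv F D t pv) *v
        (Gm (t + \<theta>) (flow F D t pv) - reflect (Gp (- t + \<theta>) (reflect (flow F D t pv)))))
      = flow_deriv F D \<sigma>v pv *v integral {0..\<sigma>v} (\<lambda>t. matrix_inv (flow_deriv F D t pv) *v (Gm (\<theta> + t) (\<gamma> t) + g2 (- \<theta> + t) (\<gamma> t)))"
      by (intro arg_cong[where f = "\<lambda>v. _ *v v"] integral_cong)
        (simp add: pv_def h1.flow_\<gamma> g2_def add.commute)
    also have "\<dots> = h1.Y \<sigma>v (h1.J \<theta> + h2.J (- \<theta>))"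
      unfolding pv_def h1.flow_deriv_integral[OF continuous_on_add[OF cont[OF \<theta>]]] h1.integral_Z_add[OF cont[OF \<theta>]]
      by (simp add: h1.J_def h2.J_def)
    finally show ?thesis unfolding g_number_def \<sigma>v_def[symmetric] pv_def[symmetric] row by simp
  qed

  obtain Gm' where Gm': "continuous_on (UNIV \<times> D) (\<lambda>(t, z). Gm' t z)"
    "\<And>t z. z \<in> D \<Longrightarrow> ((\<lambda>t. Gm t z) has_vector_derivative Gm' t z) (at t)"
    using smooth_time_derivative[OF smooth_G(2)] by blast
  obtain Gp' where Gp': "continuous_on (UNIV \<times> D) (\<lambda>(t, z). Gp' t z)"
    "\<And>t z. z \<in> D \<Longrightarrow> ((\<lambda>t. Gp t z) has_vector_derivative Gp' t z) (at t)"
    using smooth_time_derivative[OF smooth_G(1)] by blast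
  define A where "A = integral {0..\<sigma>v} (\<lambda>s. h1.Z s (Gm' (\<theta> + s) (\<gamma> s)))"
  define B where "B = integral {0..\<sigma>v} (\<lambda>s. h1.Z s (reflect (Gp' (- (- \<theta> + s)) (reflect (\<gamma> s)))))"
  have J1: "(h1.J has_vector_derivative A) (at \<theta>)"
    unfolding A_def by (rule h1.J_has_derivative[OF Gm'(2,1)])
  have neg: "((\<lambda>t. - t) has_vector_derivative - 1) (at t)" for t :: real
    by (auto intro!: derivative_eq_intros)
  have J2: "(h2.J has_vector_derivative B) (at (- \<theta>))"
    unfolding B_def
  proof (rule h2.J_has_derivative)
    fix t z assume z: "z \<in> D"
    from vector_diff_chain_at[OF neg Gp'(2)[OF symD[OF z]]]
    have "((\<lambda>t. Gp (- t) (reflect z)) has_vector_derivative - Gp' (- t) (reflect z)) (at t)" by (simp add: o_def)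
    from has_vector_derivative_minus[OF bounded_linear.has_vector_derivative[OF bounded_linear_reflect this]]
    show "((\<lambda>t. g2 t z) has_vector_derivative reflect (Gp' (- t) (reflect z))) (at t)"
      by (simp add: g2_def reflect_simps)
  next
    have "continuous_on (UNIV \<times> D) (\<lambda>p. reflect ((\<lambda>(t, z). Gp' t z) (- fst p, reflect (snd p))))"
      using symD
      by (intro bounded_linear.continuous_on[OF bounded_linear_reflect] continuous_on_compose2[OF Gp'(1)] continuous_intros) auto
    then show "continuous_on (UNIV \<times> D) (\<lambda>(t, z). reflect (Gp' (- t) (reflect z)))" by (simp add: case_prod_beta)
  qed
  have "((\<lambda>s. h2.J (- s)) has_vector_derivative - B) (at \<theta>)"
    using vector_diff_chain_at[OF neg J2] by (simp add: o_def)
  from bounded_linear.has_vector_derivative[OF \<Phi> has_vector_derivative_diff[OF J1 this]]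
  have \<Phi>': "((\<lambda>s. \<Phi> (h1.J s - h2.J (- s))) has_real_derivative \<Phi> (A + B)) (at \<theta>)"
    by (simp add: has_real_derivative_iff_has_vector_derivative)
  have "((\<lambda>s. melnikov F D \<sigma> Gm Gp s xv) has_real_derivative \<Phi> (A + B)) (at \<theta>)"
  proof (rule has_field_derivative_transform_within_open[OF \<Phi>'])
    show "open {\<theta> - 1<..<\<theta> + 1}" "\<theta> \<in> {\<theta> - 1<..<\<theta> + 1}" by auto
    show "\<Phi> (h1.J s - h2.J (- s)) = melnikov F D \<sigma> Gm Gp s xv" if "s \<in> {\<theta> - 1<..<\<theta> + 1}" for s
      using mel[of s] that by simp
  qed
  \<comment> \<open>\<open>deriv\<close> says nothing where no derivative exists;
    \<open>simple\<close> becomes usable only now that differentiability is established.\<close>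
  then have nonzero: "\<Phi> (A + B) \<noteq> 0" using simple by (simp add: DERIV_imp_deriv)

  interpret p: periodic_halves F D \<gamma> \<sigma>v xv \<alpha> b \<delta> L Gm k1 g2 k2 \<theta> e0 "\<Phi> (A + B)"
  proof
    show "0 < e0" using eps0 by (simp add: e0_def)
    show "wedge (F (\<gamma> \<sigma>v)) (h1.Y \<sigma>v (h1.J \<theta> - h2.J (- \<theta>))) = 0"
      using zero mel[of \<theta>] by (simp add: \<Phi>_def qv)
    show "((\<lambda>t. wedge (F (\<gamma> \<sigma>v)) (h1.Y \<sigma>v (h1.J t - h2.J (- t)))) has_real_derivative \<Phi> (A + B)) (at \<theta>)"
      using \<Phi>' unfolding \<Phi>_def[abs_def] qv .
    fix e t z assume e: "0 < e" "e < e0" and z: "(z :: real^2) \<in> D"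
    have e': "e \<in> {-\<epsilon>0<..<\<epsilon>0}" using e eps0 by (auto simp: e0_def)
    show "k1 e (t + 2 * \<sigma>v) z = k1 e t z" unfolding k1_def by (simp only: periodic_G(2)[OF z] periodic_H(2)[OF z e'])
    \<comment> \<open>System 2 runs in reversed time, so its shift by a period is a shift of
      \<open>Gp\<close> and \<open>Hp\<close> in the opposite direction.\<close>
    have "- t = - (t + 2 * \<sigma>v) + 2 * \<sigma>v" by simp
    then show "k2 e (t + 2 * \<sigma>v) z = k2 e t z"
      unfolding k2_def by (metis periodic_G(1)[OF symD[OF z]] periodic_H(1)[OF symD[OF z] e'])
  qed (fact nonzero D(3))+
  have G: "p.G = g_number F D \<sigma> xv Gm Gp \<theta>" unfolding p.G_def g_num ..
  have low: "p.Xlow e = Xm e" for e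
    by (intro ext) (simp add: Xm_def perturbed_field_def p.Xlow_def h1.X_def k1_def scaleR_add_right power2_eq_square)
  have up: "p.Xup e = Xp e" for e
    by (intro ext)
      (simp add: Xp_def perturbed_field_def upper_field_def p.Xup_def h2.X_def k2_def scaleR_add_right scaleR_diff_right
        power2_eq_square reflect_simps)
  have g: "g2 (- \<theta>) pv $ 2 = Gp \<theta> pv $ 2" by (simp add: g2_def pv_def)
  \<comment> \<open>\<open>F pv $ 1\<close> is \<open>- \<alpha>\<close>, hence the sign.
    \<open>C\<close> is the value of \<open>G\<close> at which the limit equation with equal offsets
    has its root at the leftmost fold.\<close>
  have C: "C = - (2 * p.\<beta> / (\<alpha> * b) * max (Gm \<theta> pv $ 2) (g2 (- \<theta>) pv $ 2))"
    unfolding C_def g p.\<beta>_def qv[symmetric] \<alpha>_def b_def by (simp add: max.commute)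
  have e0: "e \<le> \<epsilon>0" if "e \<le> e0" for e using that eps0 by (simp add: e0_def)
  show ?thesis
  proof (intro conjI impI; (elim conjE)?)
    assume "g_number F D \<sigma> xv Gm Gp \<theta> < C"
    then have "p.G + 2 * p.\<beta> / (\<alpha> * b) * max (Gm \<theta> (on_axis xv) $ 2) (g2 (- \<theta>) (on_axis xv) $ 2) < 0"
      unfolding C G pv_def by linarith
    from p.crossing_orbits_exist[OF this, unfolded low up, folded pv_def]
    obtain K e1 where "0 < e1 \<and> e1 \<le> e0 \<and> (\<forall>e. 0 < e \<and> e < e1 \<longrightarrow> (\<exists>u t0.
      piecewise_solution D (Xp e) (Xm e) (2 * \<sigma>v) u \<and> (\<exists>t. u t $ 2 = 0) \<and>
      (\<forall>t. u t $ 2 = 0 \<longrightarrow> crossing_point (Xp e) (Xm e) t (u t)) \<and> dist (t0, u t0) (\<theta>, pv) \<le> K * e))"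
      by (elim exE)
    then show "\<exists>K \<epsilon>1. 0 < \<epsilon>1 \<and> \<epsilon>1 \<le> \<epsilon>0 \<and> (\<forall>\<epsilon>. 0 < \<epsilon> \<and> \<epsilon> < \<epsilon>1 \<longrightarrow>
      (\<exists>u t0. crossing_periodic_solution D (Xp \<epsilon>) (Xm \<epsilon>) (2 * \<sigma>v) u \<and> dist (t0, u t0) (\<theta>, pv) \<le> K * \<epsilon>))"
      unfolding crossing_periodic_solution_def using e0 piecewise_solution_periodic by metis
  next
    assume ne: "Gp \<theta> pv $ 2 \<noteq> Gm \<theta> pv $ 2" and gt: "g_number F D \<sigma> xv Gm Gp \<theta> > C"
    then have pos: "0 < p.G + 2 * p.\<beta> / (\<alpha> * b) * max (Gm \<theta> (on_axis xv) $ 2) (g2 (- \<theta>) (on_axis xv) $ 2)"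
      unfolding C G pv_def by linarith
    show "\<exists>K \<epsilon>1. 0 < \<epsilon>1 \<and> \<epsilon>1 \<le> \<epsilon>0 \<and> (\<forall>\<epsilon>. 0 < \<epsilon> \<and> \<epsilon> < \<epsilon>1 \<longrightarrow>
      (\<exists>u t0. sliding_periodic_solution D (Xp \<epsilon>) (Xm \<epsilon>) (2 * \<sigma>v) u \<and> dist (t0, u t0) (\<theta>, pv) \<le> K * \<epsilon> \<and>
        (Gp \<theta> pv $ 2 < Gm \<theta> pv $ 2 \<longrightarrow> slides_on (Xp \<epsilon>) (Xm \<epsilon>) (sliding_region (Xp \<epsilon>) (Xm \<epsilon>)) u) \<and>
        (Gp \<theta> pv $ 2 > Gm \<theta> pv $ 2 \<longrightarrow> slides_on (Xp \<epsilon>) (Xm \<epsilon>) (escaping_region (Xp \<epsilon>) (Xm \<epsilon>)) u)))"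
    proof (cases "Gp \<theta> pv $ 2 < Gm \<theta> pv $ 2")
      case True
      then have ord: "g2 (- \<theta>) (on_axis xv) $ 2 < Gm \<theta> (on_axis xv) $ 2" using g by (simp add: pv_def)
      with pos have "0 < p.G + 2 * p.\<beta> / (\<alpha> * b) * Gm \<theta> (on_axis xv) $ 2" by (simp add: max_def)
      from p.sliding_orbits_exist[OF ord this, unfolded low up, folded pv_def]
      obtain K e1 where "0 < e1 \<and> e1 \<le> e0 \<and> (\<forall>e. 0 < e \<and> e < e1 \<longrightarrow> (\<exists>u t0.
        piecewise_solution D (Xp e) (Xm e) (2 * \<sigma>v) u \<and> slides_on (Xp e) (Xm e) (sliding_region (Xp e) (Xm e)) u
        \<and> dist (t0, u t0) (\<theta>, pv) \<le> K * e))"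
        by (elim exE)
      moreover have "\<not> Gp \<theta> pv $ 2 > Gm \<theta> pv $ 2" using True by simp
      ultimately show ?thesis
        unfolding sliding_periodic_solution_def using e0 piecewise_solution_periodic by metis
    next
      case False
      then have ord: "Gm \<theta> (on_axis xv) $ 2 < g2 (- \<theta>) (on_axis xv) $ 2" using g ne by (simp add: pv_def)
      with pos have "0 < p.G + 2 * p.\<beta> / (\<alpha> * b) * g2 (- \<theta>) (on_axis xv) $ 2" by (simp add: max_def)
      from p.escaping_orbits_exist[OF ord this, unfolded low up, folded pv_def]
      obtain K e1 where "0 < e1 \<and> e1 \<le> e0 \<and> (\<forall>e. 0 < e \<and> e < e1 \<longrightarrow> (\<exists>u t0.
        piecewise_solution D (Xp e) (Xm e) (2 * \<sigma>v) u \<and> slides_on (Xp e) (Xm e) (escaping_region (Xp e) (Xm e)) u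
        \<and> dist (t0, u t0) (\<theta>, pv) \<le> K * e))"
        by (elim exE)
      with False show ?thesis
        unfolding sliding_periodic_solution_def using e0 piecewise_solution_periodic by metis
    qed
  qed
qed

end
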